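(* All of the following stable limits of Hilbert series exist, and $$\lim \mathrm{HS}(GL(n,\mathbb R))=\lim \mathrm{HS}(Sp(m,\mathbb R))=\lim \mathrm{HS}(GL(n,\mathbb H))=\lim \mathrm{HS}(SO^*(2m)),$$ $$\lim \mathrm{HS}(O(n,\mathbb C))=\lim \mathrm{HS}(Sp(p,q))=\lim \mathrm{HS}(Sp(m,\mathbb C))=\lim \mathrm{HS}(O(p,q)),$$ $$\lim \mathrm{HS}(GL(n,\mathbb C))=\lim \mathrm{HS}(U(p,q)).$$
   Context: For each real form $G_0$ let $(G,K)$ be the symmetric pair of complex linear algebraic groups listed below, $\mathfrak g=\mathrm{Lie}(G)$. $K$ acts on $\mathfrak g$ by restriction of the adjoint representation of $G$, hence on the symmetric power $\mathcal S^d(\mathfrak g)$; set $h_d(G_0):=\dim[\mathcal S^d(\mathfrak g)]^K$ (dimension over $\mathbb C$ of the $K$-invariants) and $\mathrm{HS}(G_0)=\mathrm{HS}(G_0;t):=\sum_{d\ge0}h_d(G_0)t^d$. The stable limit is the term-by-term limit: for a family indexed by one parameter, e.g. $GL(n,\mathbb C)$, $\lim \mathrm{HS}(GL(n,\mathbb C)):=\sum_{d\ge0}\left[\lim_{n\to\infty}h_d(GL(n,\mathbb C))\right]t^d$, and similarly with $m\to\infty$ for families indexed by $m$; for the families $U(p,q)$, $O(p,q)$, $Sp(p,q)$ the limit of each coefficient is taken as $\min(p,q)\to\infty$. Let $J_m=\begin{pmatrix}0&I_m\\ -I_m&0\end{pmatrix}$, $D_m=\begin{pmatrix}0&I_m\\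 I_m&0\end{pmatrix}$. The group $Sp_{2m}(\mathbb C)$ has defining representation of dimension $2m$. - $U(p,q)$: $G=GL_{p+q}(\mathbb C)$, $K=GL_p(\mathbb C)\times GL_q(\mathbb C)$ embedded block diagonally. - $GL(n,\mathbb R)$: $G=GL_n(\mathbb C)$, $K=O_n(\mathbb C)=\{g: g^{-1}=g^t\}$. - $GL(n,\mathbb H)$: $G=GL_{2n}(\mathbb C)$, $K=Sp_{2n}(\mathbb C)$, the fixed points of $g\mapsto -J_n(g^{-1})^tJ_n$. - $SO^*(2m)$: $G=SO_{2m}(\mathbb C)$ for the symmetric form $(x,y)=xD_my^t$, $K=\{\mathrm{diag}(g,(g^{-1})^t): g\in GL_m(\mathbb C)\}\cong GL_m(\mathbb C)$. - $Sp(m,\mathbb R)$: $G=Sp_{2m}(\mathbb C)$ for the form $(x,y)=xJ_my^t$, $K=\{\mathrm{diag}(g,(g^{-1})^t): g\in GL_m(\mathbb C)\}\cong GL_m(\mathbb C)$. - $O(p,q)$: $G=O_{p+q}(\mathbb C)$ for the form $(x,y)=xy^t$, $K=O_p(\mathbb C)\times O_q(\mathbb C)$ embedded block diagonally. - $Sp(p,q)$: $G=Sp_{2(p+q)}(\mathbb C)$ for the form $(x,y)=xC_{p+q}y^t$, where $C_{p+q}$ is block diagonal with $p+q$ copies of $J_1=\begin{pmatrix}0&1\\-1&0\end{pmatrix}$, and $K=Sp_{2p}(\mathbb C)\times Sp_{2q}(\mathbb C)$ embedded block diagonally (the factors preserving the forms $C_p$ and $C_q$). - $GL(n,\mathbb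 C)$, $O(n,\mathbb C)$, $Sp(m,\mathbb C)$: $G=K\times K$ with $K=GL_n(\mathbb C)$, $O_n(\mathbb C)$, $Sp_{2m}(\mathbb C)$ respectively, $K$ embedded diagonally in $G$. *)

theory Defs
  imports
    "HOL-Analysis.Analysis"
    "HOL-Library.Poly_Mapping"
    "HOL-Computational_Algebra.Formal_Power_Series"
    "Jordan_Normal_Form.Gauss_Jordan_Elimination"
    "Jordan_Normal_Form.Determinant"
begin

section \<open>Symmetric powers of spaces of matrices\<close>

text \<open>
  The symmetric algebra of the space of complex matrices is the polynomial ring on the matrix units,
  the variable indexed by \<open>(i, j)\<close> standing for the matrix unit with its entry 1 in position
  \<open>(i, j)\<close>. For a linear subspace \<open>V\<close> of a vector space \<open>W\<close>, the natural map from the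
  \<open>d\<close>-th symmetric power of \<open>V\<close> to that of \<open>W\<close> is injective, and its image is spanned by the
  \<open>d\<close>-fold products of elements of \<open>V\<close>; this image is what \<open>sym_power d V\<close> denotes.
\<close>

type_synonym mat_poly = "((nat \<times> nat) \<Rightarrow>\<^sub>0 nat) \<Rightarrow>\<^sub>0 complex"

definition poly_scale :: "complex \<Rightarrow> mat_poly \<Rightarrow> mat_poly" where
  "poly_scale c p = Poly_Mapping.single 0 c * p"

global_interpretation mat_poly: vector_space poly_scale
  by unfold_locales
    (simp_all add: poly_scale_def algebra_simps Poly_Mapping.single_add Poly_Mapping.mult_single
      flip: mult.assoc)

definition matrix_var :: "nat \<times> nat \<Rightarrow> mat_poly" where
  "matrix_var ij = Poly_Mapping.single (Poly_Mapping.single ij 1) 1"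

definition of_matrix :: "complex mat \<Rightarrow> mat_poly" where
  "of_matrix X = (\<Sum>i<dim_row X. \<Sum>j<dim_col X. poly_scale (X $$ (i, j)) (matrix_var (i, j)))"

definition sym_power :: "nat \<Rightarrow> complex mat set \<Rightarrow> mat_poly set" where
  "sym_power d V =
     mat_poly.span {prod_list (map of_matrix Xs) | Xs. length Xs = d \<and> set Xs \<subseteq> V}"

section \<open>The action by conjugation\<close>

definition mat_inv :: "complex mat \<Rightarrow> complex mat" where
  "mat_inv g = the (mat_inverse g)"

definition Ad :: "complex mat \<Rightarrow> complex mat \<Rightarrow> complex mat" where
  "Ad g X = g * X * mat_inv g"

definition matrix_unit :: "nat \<Rightarrow> nat \<times> nat \<Rightarrow> complex mat" where
  "matrix_unit N ij = mat N N (\<lambda>kl. if kl = ij then 1 else 0)"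

definition poly_subst :: "(nat \<times> nat \<Rightarrow> mat_poly) \<Rightarrow> mat_poly \<Rightarrow> mat_poly" where
  "poly_subst f p = (\<Sum>m\<in>Poly_Mapping.keys p. poly_scale (Poly_Mapping.lookup p m)
     (\<Prod>v\<in>Poly_Mapping.keys m. f v ^ Poly_Mapping.lookup m v))"

text \<open>
  The algebra endomorphism extending \<open>Ad g\<close>; lemma \<open>sym_Ad_prod_list\<close> below is its
  characterisation on products of matrices.
\<close>

definition sym_Ad :: "complex mat \<Rightarrow> mat_poly \<Rightarrow> mat_poly" where
  "sym_Ad g = poly_subst (\<lambda>ij. of_matrix (Ad g (matrix_unit (dim_row g) ij)))"

lemma poly_subst_superset:
  assumes "finite A" "Poly_Mapping.keys p \<subseteq> A"
  shows "poly_subst f p = (\<Sum>m\<in>A. poly_scale (Poly_Mapping.lookup p m)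
     (\<Prod>v\<in>Poly_Mapping.keys m. f v ^ Poly_Mapping.lookup m v))"
  unfolding poly_subst_def
  by (rule sum.mono_neutral_left) (use assms in \<open>auto simp: in_keys_iff\<close>)

lemma poly_subst_zero [simp]: "poly_subst f 0 = 0"
  by (simp add: poly_subst_def)

lemma poly_subst_add: "poly_subst f (p + q) = poly_subst f p + poly_subst f q"
proof -
  let ?A = "Poly_Mapping.keys p \<union> Poly_Mapping.keys q"
  have "Poly_Mapping.keys (p + q) \<subseteq> ?A" by (rule Poly_Mapping.keys_add)
  then show ?thesis
    by (simp add: poly_subst_superset[of ?A] Poly_Mapping.lookup_add
        mat_poly.scale_left_distrib sum.distrib)
qed

lemma poly_subst_sum: "poly_subst f (\<Sum>i\<in>I. g i) = (\<Sum>i\<in>I. poly_subst f (g i))"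
  by (induction I rule: infinite_finite_induct) (simp_all add: poly_subst_add)

lemma poly_subst_single:
  "poly_subst f (Poly_Mapping.single m c) =
     poly_scale c (\<Prod>v\<in>Poly_Mapping.keys m. f v ^ Poly_Mapping.lookup m v)"
  by (subst poly_subst_superset[of "{m}"]) auto

lemma poly_subst_one: "poly_subst f 1 = 1"
  using poly_subst_single[of f 0 1] by (simp add: poly_scale_def)

lemma monomial_eval_add:
  fixes f :: "nat \<times> nat \<Rightarrow> mat_poly"
  shows "(\<Prod>v\<in>Poly_Mapping.keys (m + n). f v ^ Poly_Mapping.lookup (m + n) v) =
    (\<Prod>v\<in>Poly_Mapping.keys m. f v ^ Poly_Mapping.lookup m v) *
    (\<Prod>v\<in>Poly_Mapping.keys n. f v ^ Poly_Mapping.lookup n v)"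
proof -
  let ?A = "Poly_Mapping.keys m \<union> Poly_Mapping.keys n"
  have *: "(\<Prod>v\<in>Poly_Mapping.keys k. f v ^ Poly_Mapping.lookup k v) =
      (\<Prod>v\<in>?A. f v ^ Poly_Mapping.lookup k v)" if "Poly_Mapping.keys k \<subseteq> ?A"
    for k :: "(nat \<times> nat) \<Rightarrow>\<^sub>0 nat"
    by (rule prod.mono_neutral_left) (use that in \<open>auto simp: in_keys_iff\<close>)
  show ?thesis
    unfolding *[OF Poly_Mapping.keys_add] *[of m, OF Un_upper1] *[of n, OF Un_upper2]
    by (simp add: Poly_Mapping.lookup_add power_add prod.distrib)
qed

lemma poly_eq_sum_single:
  fixes p :: mat_poly
  shows "p = (\<Sum>m\<in>Poly_Mapping.keys p. Poly_Mapping.single m (Poly_Mapping.lookup p m))"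
proof (rule poly_mapping_eqI)
  fix m
  show "Poly_Mapping.lookup p m =
    Poly_Mapping.lookup (\<Sum>m\<in>Poly_Mapping.keys p. Poly_Mapping.single m (Poly_Mapping.lookup p m)) m"
    by (simp add: Poly_Mapping.lookup_sum Poly_Mapping.lookup_single when_def in_keys_iff)
qed

lemma poly_subst_mult: "poly_subst f (p * q) = poly_subst f p * poly_subst f q"
proof -
  have *: "poly_subst f (Poly_Mapping.single m a * Poly_Mapping.single n b) =
      poly_subst f (Poly_Mapping.single m a) * poly_subst f (Poly_Mapping.single n b)" for m n a b
  proof -
    have "Poly_Mapping.single (0 :: (nat \<times> nat) \<Rightarrow>\<^sub>0 nat) (a * b) =
        Poly_Mapping.single 0 a * Poly_Mapping.single 0 b"
      by (simp add: Poly_Mapping.mult_single)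
    then show ?thesis
      unfolding Poly_Mapping.mult_single[of m] poly_subst_single monomial_eval_add poly_scale_def
      by (simp only: mult_ac)
  qed
  have "poly_subst f ((\<Sum>m\<in>A. Poly_Mapping.single m (a m)) * (\<Sum>n\<in>B. Poly_Mapping.single n (b n))) =
      poly_subst f (\<Sum>m\<in>A. Poly_Mapping.single m (a m)) *
      poly_subst f (\<Sum>n\<in>B. Poly_Mapping.single n (b n))" for A B a b
    by (simp only: sum_product poly_subst_sum *)
  from this[of "Poly_Mapping.lookup p" "Poly_Mapping.keys p" "Poly_Mapping.lookup q" "Poly_Mapping.keys q"]
  show ?thesis
    by (simp only: poly_eq_sum_single[symmetric])
qed

lemma poly_subst_scale: "poly_subst f (poly_scale c p) = poly_scale c (poly_subst f p)"
  by (simp add: poly_scale_def poly_subst_mult) (simp add: poly_subst_single poly_scale_def)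

lemma poly_subst_var: "poly_subst f (matrix_var ij) = f ij"
  by (simp add: matrix_var_def poly_subst_single)

lemma Ad_entry:
  assumes "g \<in> carrier_mat N N" "mat_inv g \<in> carrier_mat N N" "X \<in> carrier_mat N N" "a < N" "b < N"
  shows "Ad g X $$ (a, b) = (\<Sum>i<N. \<Sum>j<N. X $$ (i, j) * (g $$ (a, i) * mat_inv g $$ (j, b)))"
  using assms by (simp add: Ad_def scalar_prod_def sum_distrib_right sum_distrib_left atLeast0LessThan mult_ac)

lemma Ad_unit_entry:
  assumes "g \<in> carrier_mat N N" "mat_inv g \<in> carrier_mat N N" "i < N" "j < N" "a < N" "b < N"
  shows "Ad g (matrix_unit N (i, j)) $$ (a, b) = g $$ (a, i) * mat_inv g $$ (j, b)"
proof -
  have "(\<Sum>k<N. \<Sum>l<N. matrix_unit N (i, j) $$ (k, l) * (g $$ (a, k) * mat_inv g $$ (l, b))) =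
    (\<Sum>k<N. \<Sum>l<N. if l = j then if k = i then g $$ (a, i) * mat_inv g $$ (j, b) else 0 else 0)"
    by (intro sum.cong refl) (auto simp: matrix_unit_def)
  then show ?thesis
    using assms by (subst Ad_entry[of g N]) (auto simp: matrix_unit_def)
qed

lemma sym_Ad_of_matrix:
  assumes "g \<in> carrier_mat N N" "mat_inv g \<in> carrier_mat N N" "X \<in> carrier_mat N N"
  shows "sym_Ad g (of_matrix X) = of_matrix (Ad g X)"
proof -
  have "sym_Ad g (of_matrix X) = (\<Sum>i<N. \<Sum>j<N. \<Sum>a<N. \<Sum>b<N.
      poly_scale (X $$ (i, j) * (g $$ (a, i) * mat_inv g $$ (j, b))) (matrix_var (a, b)))"
    using assms Ad_unit_entry[OF assms(1,2)]
    by (simp add: sym_Ad_def of_matrix_def poly_subst_sum poly_subst_scale poly_subst_var Ad_def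
        mat_poly.scale_sum_right)
  also have "\<dots> = (\<Sum>i<N. \<Sum>a<N. \<Sum>j<N. \<Sum>b<N.
      poly_scale (X $$ (i, j) * (g $$ (a, i) * mat_inv g $$ (j, b))) (matrix_var (a, b)))"
    by (intro sum.cong refl sum.swap)
  also have "\<dots> = (\<Sum>a<N. \<Sum>i<N. \<Sum>j<N. \<Sum>b<N.
      poly_scale (X $$ (i, j) * (g $$ (a, i) * mat_inv g $$ (j, b))) (matrix_var (a, b)))"
    by (rule sum.swap)
  also have "\<dots> = (\<Sum>a<N. \<Sum>i<N. \<Sum>b<N. \<Sum>j<N.
      poly_scale (X $$ (i, j) * (g $$ (a, i) * mat_inv g $$ (j, b))) (matrix_var (a, b)))"
    by (intro sum.cong refl sum.swap)
  also have "\<dots> = (\<Sum>a<N. \<Sum>b<N. \<Sum>i<N. \<Sum>j<N.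
      poly_scale (X $$ (i, j) * (g $$ (a, i) * mat_inv g $$ (j, b))) (matrix_var (a, b)))"
    by (intro sum.cong refl sum.swap)
  also have "\<dots> = (\<Sum>a<N. \<Sum>b<N. poly_scale (Ad g X $$ (a, b)) (matrix_var (a, b)))"
    by (intro sum.cong refl) (simp add: Ad_entry[OF assms] mat_poly.scale_sum_left)
  also have "\<dots> = of_matrix (Ad g X)"
    using assms by (simp add: of_matrix_def Ad_def)
  finally show ?thesis .
qed

lemma mat_inv:
  assumes "g \<in> carrier_mat N N" "invertible_mat g"
  shows "mat_inv g \<in> carrier_mat N N" "g * mat_inv g = 1\<^sub>m N" "mat_inv g * g = 1\<^sub>m N"
proof -
  obtain B where B: "g * B = 1\<^sub>m N" "B * g = 1\<^sub>m (dim_row B)"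
    using assms by (auto simp: invertible_mat_def inverts_mat_def)
  have "dim_col B = N" using arg_cong[OF B(1), of dim_col] by simp
  moreover have "dim_row B = N" using arg_cong[OF B(2), of dim_col] assms by simp
  ultimately have "B \<in> carrier_mat N N" by auto
  with B assms have "g \<in> Units (ring_mat TYPE(complex) N ())"
    by (auto simp: Units_def ring_mat_def)
  then obtain C where "mat_inverse g = Some C"
    using mat_inverse(1)[OF assms(1), of "()"] by (cases "mat_inverse g") auto
  with mat_inverse(2)[OF assms(1)] show "mat_inv g \<in> carrier_mat N N" "g * mat_inv g = 1\<^sub>m N"
    "mat_inv g * g = 1\<^sub>m N"
    by (auto simp: mat_inv_def)
qed

lemma sym_Ad_prod_list:
  assumes "g \<in> carrier_mat N N" "invertible_mat g" "set Xs \<subseteq> carrier_mat N N"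
  shows "sym_Ad g (prod_list (map of_matrix Xs)) = prod_list (map (\<lambda>X. of_matrix (Ad g X)) Xs)"
  using assms(3)
proof (induction Xs)
  case Nil
  then show ?case by (simp add: sym_Ad_def poly_subst_one)
next
  case (Cons X Xs)
  then show ?case
    using sym_Ad_of_matrix[OF assms(1) mat_inv(1)[OF assms(1,2)], of X]
    by (simp add: sym_Ad_def poly_subst_mult)
qed

section \<open>Invariants and Hilbert series\<close>

text \<open>
  The Lie algebra of a closed complex subgroup \<open>G\<close> of the \<open>N\<close> by \<open>N\<close> invertible matrices, as the
  tangent space at the identity: the velocities at 0 of holomorphic curves in \<open>G\<close> through 1.
\<close>

definition Lie :: "nat \<Rightarrow> complex mat set \<Rightarrow> complex mat set" where
  "Lie N G = {X \<in> carrier_mat N N. \<exists>r>0. \<exists>c :: complex \<Rightarrow> complex mat.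
     c 0 = 1\<^sub>m N \<and> (\<forall>z\<in>ball 0 r. c z \<in> G) \<and>
     (\<forall>i<N. \<forall>j<N. (\<lambda>z. c z $$ (i, j)) holomorphic_on ball 0 r \<and>
        deriv (\<lambda>z. c z $$ (i, j)) 0 = X $$ (i, j))}"

definition invariants :: "nat \<Rightarrow> complex mat set \<Rightarrow> complex mat set \<Rightarrow> nat \<Rightarrow> mat_poly set" where
  "invariants N G K d = {p \<in> sym_power d (Lie N G). \<forall>k\<in>K. sym_Ad k p = p}"

definition hilbert_series :: "nat \<Rightarrow> complex mat set \<Rightarrow> complex mat set \<Rightarrow> real fps" where
  "hilbert_series N G K = Abs_fps (\<lambda>d. real (mat_poly.dim (invariants N G K d)))"

definition stable_limit_exists :: "'i filter \<Rightarrow> ('i \<Rightarrow> real fps) \<Rightarrow> bool" where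
  "stable_limit_exists F H \<longleftrightarrow> (\<forall>d. \<exists>l. ((\<lambda>i. fps_nth (H i) d) \<longlongrightarrow> l) F)"

definition stable_limit :: "'i filter \<Rightarrow> ('i \<Rightarrow> real fps) \<Rightarrow> real fps" where
  "stable_limit F H = Abs_fps (\<lambda>d. Lim F (\<lambda>i. fps_nth (H i) d))"

definition min_at_top :: "(nat \<times> nat) filter" where
  "min_at_top = filtercomap (\<lambda>(p, q). min p q) at_top"

section \<open>The groups\<close>

definition GL :: "nat \<Rightarrow> complex mat set" where
  "GL n = {g \<in> carrier_mat n n. invertible_mat g}"

text \<open>The isometry group of the bilinear form with Gram matrix \<open>B\<close>.\<close>

definition isometries :: "nat \<Rightarrow> complex mat \<Rightarrow> complex mat set" where
  "isometries n B = {g \<in> GL n. \<forall>x\<in>carrier_vec n. \<forall>y\<in>carrier_vec n.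
     scalar_prod (g *\<^sub>v x) (B *\<^sub>v (g *\<^sub>v y)) = scalar_prod x (B *\<^sub>v y)}"

definition J_mat :: "nat \<Rightarrow> complex mat" where
  "J_mat m = four_block_mat (0\<^sub>m m m) (1\<^sub>m m) (- 1\<^sub>m m) (0\<^sub>m m m)"

definition D_mat :: "nat \<Rightarrow> complex mat" where
  "D_mat m = four_block_mat (0\<^sub>m m m) (1\<^sub>m m) (1\<^sub>m m) (0\<^sub>m m m)"

definition C_mat :: "nat \<Rightarrow> complex mat" where
  "C_mat k = diag_block_mat (replicate k (J_mat 1))"

definition O_grp :: "nat \<Rightarrow> complex mat set" where
  "O_grp n = {g \<in> GL n. mat_inv g = transpose_mat g}"

definition Sp_grp :: "nat \<Rightarrow> complex mat set" where
  "Sp_grp m = isometries (2 * m) (J_mat m)"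

definition block_prod :: "complex mat set \<Rightarrow> complex mat set \<Rightarrow> complex mat set" where
  "block_prod A B = {diag_block_mat [a, b] | a b. a \<in> A \<and> b \<in> B}"

definition diagonal :: "complex mat set \<Rightarrow> complex mat set" where
  "diagonal A = {diag_block_mat [a, a] | a. a \<in> A}"

definition GL_dual_diag :: "nat \<Rightarrow> complex mat set" where
  "GL_dual_diag m = {diag_block_mat [g, transpose_mat (mat_inv g)] | g. g \<in> GL m}"

section \<open>The Hilbert series of the symmetric pairs\<close>

definition HS_U :: "nat \<times> nat \<Rightarrow> real fps" where
  "HS_U = (\<lambda>(p, q). hilbert_series (p + q) (GL (p + q)) (block_prod (GL p) (GL q)))"

definition HS_GL_R :: "nat \<Rightarrow> real fps" where
  "HS_GL_R n = hilbert_series n (GL n) (O_grp n)"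

definition HS_GL_H :: "nat \<Rightarrow> real fps" where
  "HS_GL_H n = hilbert_series (2 * n) (GL (2 * n))
     {g \<in> GL (2 * n). - (J_mat n * transpose_mat (mat_inv g) * J_mat n) = g}"

definition HS_SO_star :: "nat \<Rightarrow> real fps" where
  "HS_SO_star m = hilbert_series (2 * m)
     {g \<in> isometries (2 * m) (D_mat m). Determinant.det g = 1} (GL_dual_diag m)"

definition HS_Sp_R :: "nat \<Rightarrow> real fps" where
  "HS_Sp_R m = hilbert_series (2 * m) (Sp_grp m) (GL_dual_diag m)"

definition HS_O :: "nat \<times> nat \<Rightarrow> real fps" where
  "HS_O = (\<lambda>(p, q). hilbert_series (p + q) (isometries (p + q) (1\<^sub>m (p + q)))
     (block_prod (isometries p (1\<^sub>m p)) (isometries q (1\<^sub>m q))))"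

definition HS_Sp :: "nat \<times> nat \<Rightarrow> real fps" where
  "HS_Sp = (\<lambda>(p, q). hilbert_series (2 * (p + q)) (isometries (2 * (p + q)) (C_mat (p + q)))
     (block_prod (isometries (2 * p) (C_mat p)) (isometries (2 * q) (C_mat q))))"

text \<open>For the complex groups, the product of two copies of the group is realised by block diagonal matrices.\<close>

definition HS_GL_C :: "nat \<Rightarrow> real fps" where
  "HS_GL_C n = hilbert_series (2 * n) (block_prod (GL n) (GL n)) (diagonal (GL n))"

definition HS_O_C :: "nat \<Rightarrow> real fps" where
  "HS_O_C n = hilbert_series (2 * n) (block_prod (O_grp n) (O_grp n)) (diagonal (O_grp n))"

definition HS_Sp_C :: "nat \<Rightarrow> real fps" where
  "HS_Sp_C m = hilbert_series (4 * m) (block_prod (Sp_grp m) (Sp_grp m)) (diagonal (Sp_grp m))"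

end

theory Submission
  imports Defs "HOL-Library.Function_Algebras"
begin

text \<open>
  Via the invariant form of \<open>K\<close>, each of the ten Lie algebras is identified with a space of
  two-tensors (all of them, or the symmetric or skew ones) on the standard representation of \<open>K\<close>, so
  a \<open>K\<close>-invariant of degree \<open>d\<close> is a \<open>K\<close>-invariant tensor with \<open>2d\<close> indices and symmetries.
  In the stable range \<open>3d \<le> n\<close> such a tensor is determined by its values at index words in which every
  basis vector occurs in just one dual pair (a perfect matching of the \<open>2d\<close> positions): the infinitesimal
  relations expand a value at any other word in words using more distinct basis vectors, and move between
  words with the same matching. Conversely, averaging contractions realises every function on the matchings
  with the right symmetries. Hence the stable value of \<open>h\<^sub>d\<close> is the dimension of a space
  \<open>Phi d nR fL nC fR par\<close> of functions \<open>\<phi> (r, \<rho>, c)\<close>, where \<open>\<rho>\<close> is a permutation of the \<open>2d\<close>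
  positions, \<open>r\<close> colours the \<open>d\<close> slots by the factors of \<open>G\<close> and \<open>c\<close> colours the \<open>d\<close> pairs
  by the factors of \<open>K\<close>; \<open>\<phi>\<close> is equivariant under a hyperoctahedral or symmetric group on each
  side. Passing to \<open>\<rho>\<inverse>\<close> exchanges the roles of \<open>G\<close> and \<open>K\<close>, and multiplying by the sign of
  \<open>\<rho>\<close> exchanges orthogonal and symplectic symmetry; these two operations give all the stated equalities.
\<close>

section \<open>Symmetric powers as symmetric tensors\<close>

text \<open>No fundamental theorem of invariant theory is invoked. Evaluation at matching words is
  injective by relations obtained from explicit curves and diagonal isometries, and surjective by
  explicit contractions, so spanning and independence of the contractions never have to be treated
  separately. The constant 3 in the stable range comes from comparing two choices of
  \<open>d\<close> basis vectors through a third choice of \<open>d\<close> vectors that avoids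
  both. Whole permutations of the \<open>2 d\<close> positions are kept instead of bare matchings
  because they orient slots and pairs: every symmetry type becomes an equivariance under
  \<open>hat\<close> and \<open>flip\<close>, of the same shape on both sides of
  \<open>\<rho>\<close>, and this is what lets inversion trade \<open>G\<close> for
  \<open>K\<close>. The twist by the sign works because \<open>flip s\<close> is a single
  transposition while \<open>hat \<pi>\<close> is always even. To bring conjugation into this scheme
  the column index of a matrix is dualised through the form of \<open>K\<close>, at the price of the
  sign \<open>th\<close>; conjugation then acts by the same matrix \<open>h\<close> on both
  indices.\<close>

lemma poly_scale_mult: "poly_scale a p * poly_scale b q = poly_scale (a * b) (p * q)"
proof -
  have "poly_scale (a * b) (p * q) = (Poly_Mapping.single 0 a * Poly_Mapping.single 0 b) * (p * q)"
    by (simp add: poly_scale_def Poly_Mapping.mult_single)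
  then show ?thesis by (simp add: poly_scale_def mult_ac)
qed

lemma poly_scale_mult_left: "poly_scale c p * q = poly_scale c (p * q)"
  by (simp add: poly_scale_def mult.assoc)

lemma poly_scale_prod:
  "finite A \<Longrightarrow> (\<Prod>s\<in>A. poly_scale (a s) (p s)) = poly_scale (\<Prod>s\<in>A. a s) (\<Prod>s\<in>A. p s)"
  by (induction A rule: finite_induct) (simp_all add: poly_scale_mult)

lemma poly_scale_single: "poly_scale c (Poly_Mapping.single m b) = Poly_Mapping.single m (c * b)"
  by (simp add: poly_scale_def Poly_Mapping.mult_single)

lemma lookup_poly_scale: "Poly_Mapping.lookup (poly_scale c p) m = c * Poly_Mapping.lookup p m"
proof -
  have "poly_scale c p = (\<Sum>k\<in>Poly_Mapping.keys p. Poly_Mapping.single k (c * Poly_Mapping.lookup p k))"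
    by (subst poly_eq_sum_single[of p]) (simp add: mat_poly.scale_sum_right poly_scale_single)
  then show ?thesis
    by (simp add: Poly_Mapping.lookup_sum Poly_Mapping.lookup_single when_def in_keys_iff)
qed

lemma prod_matrix_var:
  "finite A \<Longrightarrow> (\<Prod>s\<in>A. matrix_var (e s)) =
     Poly_Mapping.single (\<Sum>s\<in>A. Poly_Mapping.single (e s) 1) 1"
  by (induction A rule: finite_induct) (simp_all add: matrix_var_def Poly_Mapping.mult_single)

lemma PiE_permute:
  assumes "f \<in> A \<rightarrow>\<^sub>E S" "p permutes A"
  shows "f \<circ> p \<in> A \<rightarrow>\<^sub>E S"
  using assms by (auto simp: PiE_iff extensional_def permutes_in_image permutes_not_in)

lemma bij_betw_PiE_permute:
  assumes "p permutes A"
  shows "bij_betw (\<lambda>f. f \<circ> p) (A \<rightarrow>\<^sub>E S) (A \<rightarrow>\<^sub>E S)"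
proof (rule bij_betw_byWitness[where f' = "\<lambda>f. f \<circ> Hilbert_Choice.inv p"])
  show "(\<lambda>f. f \<circ> p) ` (A \<rightarrow>\<^sub>E S) \<subseteq> A \<rightarrow>\<^sub>E S"
    "(\<lambda>f. f \<circ> Hilbert_Choice.inv p) ` (A \<rightarrow>\<^sub>E S) \<subseteq> A \<rightarrow>\<^sub>E S"
    by (intro image_subsetI PiE_permute assms permutes_inv; assumption)+
qed (simp_all add: comp_assoc permutes_inv_o[OF assms])

lemma PiE_upd:
  assumes "f \<in> A \<rightarrow>\<^sub>E S" "a \<in> A" "x \<in> S"
  shows "f(a := x) \<in> A \<rightarrow>\<^sub>E S"
  using assms by (auto simp: PiE_iff extensional_def)

text \<open>
  The elements of \<open>S\<close> index coordinates \<open>sg u * X $$ enc u\<close> on a space of \<open>N\<close> by \<open>N\<close> matrices whose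
  entries outside \<open>enc ` S\<close> vanish and whose coordinates satisfy \<open>crd X (tau u) = eta * crd X u\<close>.
\<close>

locale slot_tensors =
  fixes N d :: nat and S :: "'a set" and enc :: "'a \<Rightarrow> nat \<times> nat" and sg :: "'a \<Rightarrow> complex"
    and tau :: "'a \<Rightarrow> 'a" and eta :: complex
  assumes finite_S: "finite S" and inj_enc: "inj_on enc S"
    and enc_less: "u \<in> S \<Longrightarrow> fst (enc u) < N \<and> snd (enc u) < N"
    and sg_sq: "u \<in> S \<Longrightarrow> sg u * sg u = 1"
    and tau_in: "u \<in> S \<Longrightarrow> tau u \<in> S" and tau_tau: "u \<in> S \<Longrightarrow> tau (tau u) = u"
    and eta_sq: "eta * eta = 1"
begin

text \<open>The sign is absorbed into the variable so that later the group acts on the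
  \<open>yv u\<close> by a tensor square without signs.\<close>

definition yv :: "'a \<Rightarrow> mat_poly" where "yv u = poly_scale (sg u) (matrix_var (enc u))"

definition ym :: "(nat \<Rightarrow> 'a) \<Rightarrow> mat_poly" where "ym f = (\<Prod>s<d. yv (f s))"

definition FF :: "(nat \<Rightarrow> 'a) set" where "FF = {..<d} \<rightarrow>\<^sub>E S"

definition mexp :: "(nat \<Rightarrow> 'a) \<Rightarrow> (nat \<times> nat) \<Rightarrow>\<^sub>0 nat" where
  "mexp f = (\<Sum>s<d. Poly_Mapping.single (enc (f s)) 1)"

definition ten :: "((nat \<Rightarrow> 'a) \<Rightarrow> complex) \<Rightarrow> mat_poly" where
  "ten T = (\<Sum>f\<in>FF. poly_scale (T f) (ym f))"

text \<open>Dual to \<open>ten\<close>: a monomial is produced by all words with the same multiset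
  of matrix positions, and a symmetric tensor takes one value on all of them, whence the division by
  their number. Being defined on every polynomial, \<open>cf\<close> is linear in it.\<close>

definition cf :: "mat_poly \<Rightarrow> (nat \<Rightarrow> 'a) \<Rightarrow> complex" where
  "cf p f = (\<Prod>s<d. sg (f s)) * Poly_Mapping.lookup p (mexp f) / card {g \<in> FF. mexp g = mexp f}"

definition symt :: "((nat \<Rightarrow> 'a) \<Rightarrow> complex) \<Rightarrow> bool" where
  "symt T \<longleftrightarrow> (\<forall>p. p permutes {..<d} \<longrightarrow> (\<forall>f\<in>FF. T (f \<circ> p) = T f))"

definition slott :: "((nat \<Rightarrow> 'a) \<Rightarrow> complex) \<Rightarrow> bool" where
  "slott T \<longleftrightarrow> (\<forall>f\<in>FF. \<forall>s<d. T (f(s := tau (f s))) = eta * T f)"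

definition crd :: "complex mat \<Rightarrow> 'a \<Rightarrow> complex" where "crd X u = sg u * X $$ enc u"

definition VV :: "complex mat set" where
  "VV = {X \<in> carrier_mat N N. (\<forall>i<N. \<forall>j<N. (i, j) \<notin> enc ` S \<longrightarrow> X $$ (i, j) = 0) \<and>
     (\<forall>u\<in>S. crd X (tau u) = eta * crd X u)}"

lemma finite_FF [simp]: "finite FF"
  by (auto simp: FF_def finite_S intro: finite_PiE)

lemma ym_eq: "ym f = Poly_Mapping.single (mexp f) (\<Prod>s<d. sg (f s))"
  by (simp add: ym_def yv_def poly_scale_prod prod_matrix_var poly_scale_single mexp_def)

lemma lookup_mexp: "Poly_Mapping.lookup (mexp f) x = count (image_mset (enc \<circ> f) (mset_set {..<d})) x"
proof -
  have "Poly_Mapping.lookup (\<Sum>s\<in>A. Poly_Mapping.single (enc (f s)) 1) x =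
      count (image_mset (enc \<circ> f) (mset_set A)) x" if "finite A" for A
    using that
    by (induction A rule: finite_induct)
      (auto simp: Poly_Mapping.lookup_add Poly_Mapping.lookup_single when_def)
  then show ?thesis by (simp add: mexp_def)
qed

text \<open>A monomial remembers the multiset of matrix positions, and \<open>enc\<close> is
  injective on \<open>S\<close>; so only the order of the slots is lost.\<close>

lemma mexp_eqD:
  assumes "f \<in> FF" "g \<in> FF" "mexp f = mexp g"
  obtains p where "p permutes {..<d}" "f = g \<circ> p"
proof -
  have "image_mset (enc \<circ> f) (mset_set {..<d}) = image_mset (enc \<circ> g) (mset_set {..<d})"
    using assms(3) by (auto intro!: multiset_eqI simp flip: lookup_mexp)
  then obtain p where p: "p permutes {..<d}" "\<forall>s\<in>{..<d}. (enc \<circ> f) s = (enc \<circ> g) (p s)"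
    using image_mset_eq_implies_permutes[of "{..<d}" "enc \<circ> f" "enc \<circ> g"] by auto
  have "f s = (g \<circ> p) s" for s
  proof (cases "s < d")
    case True
    have "p s < d" using p(1) True permutes_in_image by fastforce
    with True have "f s \<in> S" "g (p s) \<in> S" using assms(1,2) by (auto simp: FF_def)
    then show ?thesis using p(2) True inj_enc by (auto simp: inj_on_def)
  next
    case False
    then show ?thesis using assms(1,2) p(1)
      by (auto simp: FF_def PiE_iff extensional_def permutes_not_in)
  qed
  then show ?thesis using that p(1) by blast
qed

lemma ym_permute: "p permutes {..<d} \<Longrightarrow> ym (f \<circ> p) = ym f"
  unfolding ym_def using prod.permute[of p "{..<d}" "\<lambda>s. yv (f s)"] by (simp add: o_def)

lemma sg_prod_sq: "f \<in> FF \<Longrightarrow> (\<Prod>s<d. sg (f s)) * (\<Prod>s<d. sg (f s)) = 1"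
  by (simp add: sg_sq FF_def PiE_iff flip: prod.distrib)

lemma sg_prod_permute: "p permutes {..<d} \<Longrightarrow> (\<Prod>s<d. sg ((f \<circ> p) s)) = (\<Prod>s<d. sg (f s))"
  using prod.permute[of p "{..<d}" "\<lambda>s. sg (f s)"] by (simp add: o_def)

text \<open>Only the orbit of \<open>f\<close> under slot permutations contributes to the monomial
  of \<open>f\<close>, each word with the same value and the same sign, and the sign squares to 1.
  Hence a symmetric tensor can be recovered from its polynomial.\<close>

lemma cf_ten:
  assumes T: "symt T" and f: "f \<in> FF"
  shows "cf (ten T) f = T f"
proof -
  let ?E = "{g \<in> FF. mexp g = mexp f}"
  have "Poly_Mapping.lookup (ten T) (mexp f) =
      (\<Sum>g\<in>FF. if mexp g = mexp f then T g * (\<Prod>s<d. sg (g s)) else 0)"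
    unfolding ten_def ym_eq poly_scale_single
    by (auto simp: Poly_Mapping.lookup_sum Poly_Mapping.lookup_single when_def intro!: sum.cong)
  also have "\<dots> = (\<Sum>g\<in>?E. T g * (\<Prod>s<d. sg (g s)))"
    by (simp add: sum.inter_filter)
  also have "\<dots> = (\<Sum>g\<in>?E. T f * (\<Prod>s<d. sg (f s)))"
  proof (rule sum.cong)
    fix g assume "g \<in> ?E"
    then obtain p where "p permutes {..<d}" "g = f \<circ> p"
      using mexp_eqD[of g f] f by auto
    then show "T g * (\<Prod>s<d. sg (g s)) = T f * (\<Prod>s<d. sg (f s))"
      using T f sg_prod_permute[of p f] by (simp add: symt_def)
  qed simp
  finally have *: "Poly_Mapping.lookup (ten T) (mexp f) = card ?E * (T f * (\<Prod>s<d. sg (f s)))"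
    by simp
  have E: "card ?E \<noteq> 0" using f by (auto simp: card_eq_0_iff)
  have m: "a * (c * (t * a)) / c = t" if "c \<noteq> 0" "a * a = 1" for a c t :: complex
    using that by (simp add: field_simps)
  show ?thesis unfolding cf_def *
    by (rule m[OF _ sg_prod_sq[OF f]]) (use E in \<open>simp only: of_nat_eq_0_iff not_False_eq_True\<close>)
qed

lemma cf_add: "cf (p + q) f = cf p f + cf q f"
  by (simp add: cf_def Poly_Mapping.lookup_add distrib_left add_divide_distrib)

lemma cf_scale: "cf (poly_scale c p) f = c * cf p f"
  by (simp add: cf_def lookup_poly_scale)

lemma ten_cong: "(\<And>f. f \<in> FF \<Longrightarrow> T f = T' f) \<Longrightarrow> ten T = ten T'"
  by (simp add: ten_def)

text \<open>The variables commute, so \<open>ten\<close> does not see the order of the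
  slots.\<close>

lemma ten_symmetrize: "ten (\<lambda>f. (\<Sum>p | p permutes {..<d}. T (f \<circ> p)) / fact d) = ten T"
proof -
  have *: "(\<Sum>f\<in>FF. poly_scale (T (f \<circ> p)) (ym f)) = ten T" if "p permutes {..<d}" for p
  proof -
    have "(\<Sum>f\<in>FF. poly_scale (T (f \<circ> p)) (ym (f \<circ> p))) = (\<Sum>f\<in>FF. poly_scale (T f) (ym f))"
      using sum.reindex_bij_betw[OF bij_betw_PiE_permute[OF that, of S], of "\<lambda>f. poly_scale (T f) (ym f)"]
      by (simp add: FF_def)
    then show ?thesis by (simp add: ym_permute[OF that] ten_def)
  qed
  have "ten (\<lambda>f. (\<Sum>p | p permutes {..<d}. T (f \<circ> p)) / fact d) =
      poly_scale (1 / fact d) (\<Sum>f\<in>FF. \<Sum>p | p permutes {..<d}. poly_scale (T (f \<circ> p)) (ym f))"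
    unfolding ten_def by (simp add: mat_poly.scale_sum_left[symmetric] mat_poly.scale_sum_right)
  also have "\<dots> = poly_scale (1 / fact d) (\<Sum>p | p permutes {..<d}. ten T)"
    by (subst sum.swap) (simp add: *)
  also have "(\<Sum>p | p permutes {..<d}. ten T) = poly_scale (fact d) (ten T)"
  proof -
    have "of_nat n * p = poly_scale (of_nat n) p" for n and p :: mat_poly
      by (induction n) (simp_all add: mat_poly.scale_left_distrib distrib_right)
    from this[of "fact d"] show ?thesis
      by (simp add: card_permutations[OF refl])
  qed
  finally show ?thesis by (simp add: o_def)
qed

lemma symt_symmetrize: "symt (\<lambda>f. (\<Sum>p | p permutes {..<d}. T (f \<circ> p)) / fact d)"
  unfolding symt_def
proof (intro allI impI ballI)
  fix q f assume q: "q permutes {..<d}"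
  have "(\<Sum>p | p permutes {..<d}. T (f \<circ> q \<circ> p)) = (\<Sum>p | p permutes {..<d}. T (f \<circ> p))"
    using setum_permutations_compose_left[OF q, of "\<lambda>p. T (f \<circ> p)"] by (simp add: o_assoc)
  then show "(\<Sum>p | p permutes {..<d}. T (f \<circ> q \<circ> p)) / fact d =
      (\<Sum>p | p permutes {..<d}. T (f \<circ> p)) / fact d" by simp
qed

lemma of_matrix_VV:
  assumes "X \<in> carrier_mat N N" "\<And>i j. i < N \<Longrightarrow> j < N \<Longrightarrow> (i, j) \<notin> enc ` S \<Longrightarrow> X $$ (i, j) = 0"
  shows "of_matrix X = (\<Sum>u\<in>S. poly_scale (crd X u) (yv u))"
proof -
  have "of_matrix X = (\<Sum>ij\<in>{..<N}\<times>{..<N}. poly_scale (X $$ ij) (matrix_var ij))"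
    using assms by (simp add: of_matrix_def sum.cartesian_product)
  also have "\<dots> = (\<Sum>ij\<in>enc ` S. poly_scale (X $$ ij) (matrix_var ij))"
  proof (rule sum.mono_neutral_right)
    show "enc ` S \<subseteq> {..<N} \<times> {..<N}" using enc_less by (auto simp: mem_Times_iff) (metis fst_conv, metis snd_conv)
  qed (use assms in auto)
  also have "\<dots> = (\<Sum>u\<in>S. poly_scale (X $$ enc u) (matrix_var (enc u)))"
    by (simp add: sum.reindex[OF inj_enc])
  also have "\<dots> = (\<Sum>u\<in>S. poly_scale (crd X u) (yv u))"
  proof (rule sum.cong)
    fix u assume "u \<in> S"
    then have "crd X u * sg u = X $$ enc u" using sg_sq[of u] by (simp add: crd_def mult.commute flip: mult.assoc)
    then show "poly_scale (X $$ enc u) (matrix_var (enc u)) = poly_scale (crd X u) (yv u)"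
      by (simp add: yv_def)
  qed simp
  finally show ?thesis .
qed

lemma prod_sum_ym:
  "(\<Prod>s<d. \<Sum>u\<in>S. poly_scale (c s u) (yv u)) = ten (\<lambda>f. \<Prod>s<d. c s (f s))"
  by (subst prod_sum_PiE) (auto simp: finite_S ten_def FF_def poly_scale_prod ym_def)

lemma FF_tau: "f \<in> FF \<Longrightarrow> s < d \<Longrightarrow> f(s := tau (f s)) \<in> FF"
  unfolding FF_def by (rule PiE_upd) (auto intro!: tau_in)

lemma bij_betw_tau:
  assumes s: "s < d"
  shows "bij_betw (\<lambda>f. f(s := tau (f s))) FF FF"
proof -
  define h where "h = (\<lambda>f. f(s := tau (f s)))"
  have 1: "h f \<in> FF" if "f \<in> FF" for f
    unfolding h_def by (rule FF_tau[OF that s])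
  have 2: "h (h f) = f" if "f \<in> FF" for f
  proof -
    have "f s \<in> S" using that s by (auto simp: FF_def)
    then show ?thesis by (simp add: h_def tau_tau)
  qed
  have "bij_betw h FF FF"
    by (rule bij_betw_byWitness[where f' = h]) (auto simp: 1 2)
  then show ?thesis by (simp add: h_def)
qed

text \<open>Expanding a product of \<open>d\<close> elements of \<open>VV\<close> in coordinates
  gives a tensor with the right behaviour in each slot, but not a symmetric one. Averaging over slot
  permutations keeps the slot condition and does not change the polynomial.\<close>

lemma sym_power_subset: "sym_power d VV \<subseteq> {ten T | T. symt T \<and> slott T}" (is "_ \<subseteq> ?R")
  unfolding sym_power_def
proof (rule mat_poly.span_minimal)
  show "mat_poly.subspace ?R"
    unfolding mat_poly.subspace_def
  proof (intro conjI ballI allI)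
    have "0 = ten (\<lambda>_. 0) \<and> symt (\<lambda>_. 0) \<and> slott (\<lambda>_. 0)"
      by (simp add: symt_def slott_def ten_def)
    then show "0 \<in> ?R" by blast
  next
    fix x y assume "x \<in> ?R" "y \<in> ?R"
    then obtain T T' where "x = ten T" "symt T" "slott T" "y = ten T'" "symt T'" "slott T'" by blast
    then have "x + y = ten (\<lambda>f. T f + T' f) \<and> symt (\<lambda>f. T f + T' f) \<and> slott (\<lambda>f. T f + T' f)"
      by (simp add: symt_def slott_def ten_def mat_poly.scale_left_distrib sum.distrib distrib_left)
    then show "x + y \<in> ?R" by blast
  next
    fix c x assume "x \<in> ?R"
    then obtain T where "x = ten T" "symt T" "slott T" by blast
    then have "poly_scale c x = ten (\<lambda>f. c * T f) \<and> symt (\<lambda>f. c * T f) \<and> slott (\<lambda>f. c * T f)"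
      by (simp add: symt_def slott_def ten_def mat_poly.scale_sum_right mult.left_commute)
    then show "poly_scale c x \<in> ?R" by blast
  qed
  show "{prod_list (map of_matrix Xs) |Xs. length Xs = d \<and> set Xs \<subseteq> VV} \<subseteq> ?R"
  proof
    fix p assume "p \<in> {prod_list (map of_matrix Xs) |Xs. length Xs = d \<and> set Xs \<subseteq> VV}"
    then obtain Xs where p: "p = prod_list (map of_matrix Xs)" and Xs: "length Xs = d" "set Xs \<subseteq> VV"
      by blast
    then have XV: "Xs ! s \<in> VV" if "s < d" for s using that by auto
    define T0 where "T0 = (\<lambda>f. \<Prod>s<d. crd (Xs ! s) (f s))"
    define T where "T = (\<lambda>f. (\<Sum>p | p permutes {..<d}. T0 (f \<circ> p)) / fact d)"
    have "prod_list (map of_matrix Xs) = (\<Prod>s<d. of_matrix (Xs ! s))"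
      using Xs by (simp add: prod.list_conv_set_nth atLeast0LessThan)
    also have "\<dots> = (\<Prod>s<d. \<Sum>u\<in>S. poly_scale (crd (Xs ! s) u) (yv u))"
      by (intro prod.cong refl of_matrix_VV) (use XV in \<open>auto simp: VV_def\<close>)
    also have "\<dots> = ten T0" unfolding T0_def by (rule prod_sum_ym)
    also have "\<dots> = ten T" by (simp add: T_def ten_symmetrize)
    finally have 1: "prod_list (map of_matrix Xs) = ten T" .
    have "T (f(s := tau (f s))) = eta * T f" if f: "f \<in> FF" and s: "s < d" for f s
    proof -
      have "T0 (f(s := tau (f s)) \<circ> p) = eta * T0 (f \<circ> p)" if p: "p permutes {..<d}" for p
      proof -
        \<comment> \<open>After the permutation the altered entry is read by the matrix in place
          \<open>s'\<close>, so it is that factor which supplies \<open>eta\<close>.\<close>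
        obtain s' where s': "s' < d" "p s' = s"
          using permutes_image[OF p] s by (metis imageE lessThan_iff)
        have pin: "p t = s \<longleftrightarrow> t = s'" for t
          using permutes_inj[OF p] s' by (auto simp: inj_def)
        have "f s \<in> S" using f s by (auto simp: FF_def)
        then have "crd (Xs ! s') (tau (f s)) = eta * crd (Xs ! s') (f s)"
          using XV[OF s'(1)] by (auto simp: VV_def)
        moreover have "(\<Prod>t\<in>{..<d}-{s'}. crd (Xs ! t) ((f(s := tau (f s)) \<circ> p) t)) =
            (\<Prod>t\<in>{..<d}-{s'}. crd (Xs ! t) ((f \<circ> p) t))"
          by (rule prod.cong) (auto simp: pin)
        ultimately show ?thesis unfolding T0_def
          using s' by (simp add: prod.remove[of "{..<d}" s'])
      qed
      then have "(\<Sum>p | p permutes {..<d}. T0 (f(s := tau (f s)) \<circ> p)) =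
          (\<Sum>p | p permutes {..<d}. eta * T0 (f \<circ> p))"
        by (intro sum.cong) auto
      then show ?thesis by (simp add: T_def sum_distrib_left)
    qed
    then have "slott T" by (simp add: slott_def)
    moreover have "symt T" unfolding T_def by (rule symt_symmetrize)
    ultimately show "p \<in> ?R" using 1 p by blast
  qed
qed

text \<open>The image of a coordinate vector under the projection (1 + eta tau) / 2 onto the
  eigenspace of the slot involution for \<open>eta\<close>. It is zero when \<open>tau u = u\<close>
  and \<open>eta = - 1\<close>.\<close>

definition basis_mat :: "'a \<Rightarrow> complex mat" where
  "basis_mat u = mat N N (\<lambda>ij. (if ij = enc u then sg u / 2 else 0) +
      (if ij = enc (tau u) then eta * sg (tau u) / 2 else 0))"

lemma crd_basis_mat:
  assumes "u \<in> S" "v \<in> S"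
  shows "crd (basis_mat u) v = (if v = u then 1/2 else 0) + (if v = tau u then eta/2 else 0)"
proof -
  have "enc v = enc u \<longleftrightarrow> v = u" "enc v = enc (tau u) \<longleftrightarrow> v = tau u"
    using assms tau_in inj_enc by (auto simp: inj_on_def)
  then have 1: "basis_mat u $$ enc v = (if v = u then sg v / 2 else 0) + (if v = tau u then eta * sg v / 2 else 0)"
    using assms enc_less[of v] by (cases "enc v") (auto simp: basis_mat_def)
  have 2: "sg v * (eta * sg v / 2) = eta / 2" "sg v * (sg v / 2) = 1 / 2"
    using assms(2) by (simp_all add: sg_sq mult.left_commute[of "sg v" eta])
  show ?thesis
    unfolding crd_def 1 distrib_left
    by (simp only: 2 if_distrib[of "\<lambda>x. sg v * x"] mult_zero_right)
qed

lemma basis_mat_VV: assumes "u \<in> S" shows "basis_mat u \<in> VV"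
proof -
  have 1: "(i, j) \<notin> enc ` S \<Longrightarrow> i < N \<Longrightarrow> j < N \<Longrightarrow> basis_mat u $$ (i, j) = 0" for i j
    using assms tau_in by (auto simp: basis_mat_def)
  have "crd (basis_mat u) (tau v) = eta * crd (basis_mat u) v" if "v \<in> S" for v
  proof -
    have "tau v = u \<longleftrightarrow> v = tau u" "tau v = tau u \<longleftrightarrow> v = u"
      using tau_tau[OF that] tau_tau[OF assms] by metis+
    then show ?thesis
      using eta_sq crd_basis_mat[OF assms that] crd_basis_mat[OF assms tau_in[OF that]]
      by (simp add: distrib_left)
  qed
  with 1 show ?thesis by (simp add: VV_def basis_mat_def)
qed

lemma of_matrix_basis_mat:
  assumes "u \<in> S"
  shows "of_matrix (basis_mat u) = poly_scale (1/2) (yv u + poly_scale eta (yv (tau u)))"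
proof -
  have "of_matrix (basis_mat u) = (\<Sum>v\<in>S. poly_scale (crd (basis_mat u) v) (yv v))"
    using basis_mat_VV[OF assms] by (intro of_matrix_VV) (auto simp: VV_def)
  also have "\<dots> = (\<Sum>v\<in>S. (if v = u then poly_scale (1/2) (yv u) else 0) +
      (if v = tau u then poly_scale (eta/2) (yv (tau u)) else 0))"
    using assms by (intro sum.cong) (auto simp: crd_basis_mat mat_poly.scale_left_distrib)
  also have "\<dots> = poly_scale (1/2) (yv u + poly_scale eta (yv (tau u)))"
    using assms tau_in finite_S by (simp add: sum.distrib mat_poly.scale_right_distrib)
  finally show ?thesis .
qed

text \<open>Under the slot condition each variable \<open>yv u\<close> may be replaced by the matrix
  \<open>basis_mat u\<close>, one slot after the other, without changing \<open>ten T\<close>; the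
  result is a combination of products of elements of \<open>VV\<close>.\<close>

lemma ten_in_sym_power:
  assumes T: "slott T"
  shows "ten T \<in> sym_power d VV"
proof -
  define b where "b = (\<lambda>(A::nat set) (f::nat \<Rightarrow> 'a) s. if s \<in> A then of_matrix (basis_mat (f s)) else yv (f s))"
  have step: "(\<Sum>f\<in>FF. poly_scale (T f) (\<Prod>s<d. b (insert t A) f s)) =
      (\<Sum>f\<in>FF. poly_scale (T f) (\<Prod>s<d. b A f s))" if t: "t < d" "t \<notin> A" for t A
  proof -
    let ?R = "\<lambda>f. \<Prod>s\<in>{..<d}-{t}. b A f s"
    have R: "?R (f(t := tau (f t))) = ?R f" for f
      by (rule prod.cong) (auto simp: b_def)
    have pA: "(\<Prod>s<d. b A f s) = yv (f t) * ?R f" for f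
      using t by (simp add: prod.remove[of "{..<d}" t] b_def)
    have pI: "(\<Prod>s<d. b (insert t A) f s) = of_matrix (basis_mat (f t)) * ?R f" for f
      using t by (simp add: prod.remove[of "{..<d}" t] b_def)
    have tf: "f t \<in> S" if "f \<in> FF" for f using that t by (auto simp: FF_def)
    \<comment> \<open>Reindexing by \<open>tau\<close> in slot \<open>t\<close> absorbs
      \<open>eta\<close> into \<open>T\<close>, so the two halves of \<open>basis_mat\<close>
      contribute equally.\<close>
    have "(\<Sum>f\<in>FF. poly_scale (T f) (poly_scale eta (yv (tau (f t))) * ?R f)) =
        (\<Sum>f\<in>FF. poly_scale (T (f(t := tau (f t)))) (yv ((f(t := tau (f t))) t) * ?R (f(t := tau (f t)))))"
      unfolding R using T t
      by (intro sum.cong) (auto simp: slott_def poly_scale_mult_left mult.commute)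
    also have "\<dots> = (\<Sum>f\<in>FF. poly_scale (T f) (yv (f t) * ?R f))"
      by (rule sum.reindex_bij_betw[OF bij_betw_tau[OF t(1)]])
    finally have *: "(\<Sum>f\<in>FF. poly_scale (T f) (poly_scale eta (yv (tau (f t))) * ?R f)) =
        (\<Sum>f\<in>FF. poly_scale (T f) (yv (f t) * ?R f))" .
    have "(\<Sum>f\<in>FF. poly_scale (T f) (\<Prod>s<d. b (insert t A) f s)) =
       (\<Sum>f\<in>FF. poly_scale (1/2) (poly_scale (T f) (yv (f t) * ?R f) + poly_scale (T f) (poly_scale eta (yv (tau (f t))) * ?R f)))"
      unfolding pI
    proof (intro sum.cong refl)
      fix f assume "f \<in> FF"
      have "poly_scale a (poly_scale c (p + q) * r) = poly_scale c (poly_scale a (p * r) + poly_scale a (q * r))" for a c p q r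
        by (simp add: poly_scale_def algebra_simps)
      then show "poly_scale (T f) (of_matrix (basis_mat (f t)) * ?R f) = poly_scale (1/2) (poly_scale (T f) (yv (f t) * ?R f) + poly_scale (T f) (poly_scale eta (yv (tau (f t))) * ?R f))"
        by (simp add: of_matrix_basis_mat[OF tf[OF \<open>f \<in> FF\<close>]])
    qed
    also have "\<dots> = poly_scale (1/2) ((\<Sum>f\<in>FF. poly_scale (T f) (yv (f t) * ?R f)) + (\<Sum>f\<in>FF. poly_scale (T f) (yv (f t) * ?R f)))"
      by (simp only: mat_poly.scale_sum_right[symmetric] sum.distrib *)
    also have "\<dots> = (\<Sum>f\<in>FF. poly_scale (T f) (yv (f t) * ?R f))"
    proof -
      have "poly_scale (1/2) (p + p) = p" for p
        by (simp only: mat_poly.scale_right_distrib flip: mat_poly.scale_left_distrib) simp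
      then show ?thesis .
    qed
    finally show ?thesis by (simp add: pA)
  qed
  have "(\<Sum>f\<in>FF. poly_scale (T f) (\<Prod>s<d. b A f s)) = ten T" if "finite A" "A \<subseteq> {..<d}" for A
    using that
  proof (induction A rule: finite_induct)
    case empty then show ?case by (simp add: b_def ten_def ym_def)
  next
    case (insert t A) then show ?case by (simp add: step)
  qed
  from this[of "{..<d}"]
  have *: "ten T = (\<Sum>f\<in>FF. poly_scale (T f) (\<Prod>s<d. of_matrix (basis_mat (f s))))"
    by (simp add: b_def)
  have "(\<Prod>s<d. of_matrix (basis_mat (f s))) \<in>
      mat_poly.span {prod_list (map of_matrix Xs) |Xs. length Xs = d \<and> set Xs \<subseteq> VV}" if f: "f \<in> FF" for f
  proof -
    let ?Xs = "map (\<lambda>s. basis_mat (f s)) [0..<d]"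
    have "(\<Prod>s<d. of_matrix (basis_mat (f s))) = prod_list (map of_matrix ?Xs)"
      by (simp add: prod.list_conv_set_nth atLeast0LessThan)
    moreover have "set ?Xs \<subseteq> VV"
      using f basis_mat_VV by (simp add: FF_def PiE_iff image_subset_iff)
    moreover have "length ?Xs = d" by simp
    ultimately have "(\<Prod>s<d. of_matrix (basis_mat (f s))) \<in>
        {prod_list (map of_matrix Xs) |Xs. length Xs = d \<and> set Xs \<subseteq> VV}" by blast
    then show ?thesis by (rule mat_poly.span_base)
  qed
  then show ?thesis unfolding * sym_power_def
    by (intro mat_poly.span_sum mat_poly.span_scale)
qed

lemma sym_power_VV: "sym_power d VV = {ten T | T. symt T \<and> slott T}"
proof (rule equalityI[OF sym_power_subset], rule subsetI)
  fix x assume "x \<in> {ten T | T. symt T \<and> slott T}"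
  then obtain T where "x = ten T" "slott T" by (elim CollectE exE conjE) simp
  then show "x \<in> sym_power d VV" by (simp only: ten_in_sym_power)
qed

definition act :: "('a \<Rightarrow> 'a \<Rightarrow> complex) \<Rightarrow> ((nat \<Rightarrow> 'a) \<Rightarrow> complex) \<Rightarrow> (nat \<Rightarrow> 'a) \<Rightarrow> complex" where
  "act M T f' = (\<Sum>f\<in>FF. T f * (\<Prod>s<d. M (f' s) (f s)))"

lemma sym_Ad_ten:
  assumes M: "\<And>u. u \<in> S \<Longrightarrow> sym_Ad k (yv u) = (\<Sum>u'\<in>S. poly_scale (M u' u) (yv u'))"
  shows "sym_Ad k (ten T) = ten (act M T)"
proof -
  have prod: "poly_subst g (\<Prod>s\<in>A. h s) = (\<Prod>s\<in>A. poly_subst g (h s))" if "finite A"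
    for g h and A :: "nat set"
    using that by (induction A rule: finite_induct) (simp_all add: poly_subst_one poly_subst_mult)
  have "sym_Ad k (ten T) = (\<Sum>f\<in>FF. poly_scale (T f) (\<Prod>s<d. sym_Ad k (yv (f s))))"
    by (simp add: ten_def ym_def sym_Ad_def poly_subst_sum poly_subst_scale prod)
  also have "\<dots> = (\<Sum>f\<in>FF. poly_scale (T f) (\<Prod>s<d. \<Sum>u'\<in>S. poly_scale (M u' (f s)) (yv u')))"
    by (intro sum.cong refl arg_cong2[of _ _ _ _ poly_scale] prod.cong M) (auto simp: FF_def)
  also have "\<dots> = (\<Sum>f\<in>FF. \<Sum>f'\<in>FF. poly_scale (T f * (\<Prod>s<d. M (f' s) (f s))) (ym f'))"
    by (simp add: prod_sum_ym ten_def mat_poly.scale_sum_right)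
  also have "\<dots> = ten (act M T)"
    by (subst sum.swap) (simp add: ten_def act_def mat_poly.scale_sum_left)
  finally show ?thesis .
qed

lemma symt_act: assumes T: "symt T" shows "symt (act M T)"
  unfolding symt_def act_def
proof (intro allI impI ballI)
  fix p g assume p: "p permutes {..<d}"
  have "(\<Sum>f\<in>FF. T f * (\<Prod>s<d. M ((g \<circ> p) s) (f s))) = (\<Sum>f\<in>FF. T (f \<circ> p) * (\<Prod>s<d. M ((g \<circ> p) s) ((f \<circ> p) s)))"
    using sum.reindex_bij_betw[OF bij_betw_PiE_permute[OF p, of S], of "\<lambda>f. T f * (\<Prod>s<d. M ((g \<circ> p) s) (f s))"]
    by (simp add: FF_def)
  also have "\<dots> = (\<Sum>f\<in>FF. T f * (\<Prod>s<d. M (g s) (f s)))"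
  proof (intro sum.cong refl arg_cong2[of _ _ _ _ "(*)"])
    fix f assume "f \<in> FF"
    then show "T (f \<circ> p) = T f" using T p by (simp add: symt_def)
    show "(\<Prod>s<d. M ((g \<circ> p) s) ((f \<circ> p) s)) = (\<Prod>s<d. M (g s) (f s))"
      using prod.permute[OF p, of "\<lambda>s. M (g s) (f s)"] by (simp add: o_def)
  qed
  finally show "(\<Sum>f\<in>FF. T f * (\<Prod>s<d. M ((g \<circ> p) s) (f s))) = (\<Sum>f\<in>FF. T f * (\<Prod>s<d. M (g s) (f s)))" .
qed

end

section \<open>Invariant tensors of the classical groups\<close>

text \<open>
  A label \<open>(c, a, s)\<close> is the \<open>a\<close>-th basis vector of the standard representation of the \<open>c\<close>-th factor of
  \<open>K\<close>. For \<open>KSp\<close> the two halves of a symplectic basis are told apart by \<open>s\<close>; for \<open>KGL\<close> the labels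
  with \<open>s\<close> true are the dual basis, and \<open>beta\<close> is the (non-symmetric) evaluation pairing; for \<open>KO\<close> only
  \<open>s = False\<close> occurs.
\<close>

type_synonym label = "nat \<times> nat \<times> bool"

datatype kind = KO | KGL | KSp

fun beta :: "kind \<Rightarrow> label \<Rightarrow> label \<Rightarrow> complex" where
  "beta k (c, a, s) (c', a', s') = (if c = c' \<and> a = a' then
     (case k of KO \<Rightarrow> 1 | KGL \<Rightarrow> if \<not> s \<and> s' then 1 else 0
      | KSp \<Rightarrow> if s = s' then 0 else if s then - 1 else 1) else 0)"

definition labels :: "kind \<Rightarrow> nat \<Rightarrow> (nat \<Rightarrow> nat) \<Rightarrow> label set" where
  "labels k nC n = {(c, a, s). c < nC \<and> a < n c \<and> (k = KO \<longrightarrow> \<not> s)}"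

lemma labels_iff:
  "x \<in> labels k nC n \<longleftrightarrow> fst x < nC \<and> fst (snd x) < n (fst x) \<and> (k = KO \<longrightarrow> \<not> snd (snd x))"
  by (cases x) (simp add: labels_def)

lemma finite_labels [simp]: "finite (labels k nC n)"
proof -
  have "labels k nC n \<subseteq> (\<Union>c<nC. {c} \<times> {..<n c} \<times> UNIV)" by (auto simp: labels_def)
  then show ?thesis by (rule finite_subset) auto
qed

text \<open>The identity h B h^T = B for the Gram matrix B of \<open>beta\<close>, together with
  preservation of colours. For \<open>KGL\<close> the polarity is preserved too, so \<open>h\<close>
  amounts to general linear matrices together with their contragredients. An \<open>h\<close> is a
  function on all labels, constrained only on those in range.\<close>

definition isom :: "kind \<Rightarrow> nat \<Rightarrow> (nat \<Rightarrow> nat) \<Rightarrow> (label \<Rightarrow> label \<Rightarrow> complex) set" where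
  "isom k nC n = {h. (\<forall>x\<in>labels k nC n. \<forall>y\<in>labels k nC n. h x y \<noteq> 0 \<longrightarrow>
       fst x = fst y \<and> (k = KGL \<longrightarrow> snd (snd x) = snd (snd y))) \<and>
     (\<forall>x\<in>labels k nC n. \<forall>y\<in>labels k nC n.
       (\<Sum>z\<in>labels k nC n. \<Sum>z'\<in>labels k nC n. h x z * h y z' * beta k z z') = beta k x y)}"

text \<open>\<open>L x\<close> is row \<open>x\<close> of \<open>h\<close> as a functional; for
  sparse \<open>h\<close> this replaces the double sum by a short expression.\<close>

lemma isomI:
  assumes L: "\<And>x g. x \<in> labels k nC n \<Longrightarrow> (\<Sum>z\<in>labels k nC n. h x z * g z) = L x g"
    and b: "\<And>x y. x \<in> labels k nC n \<Longrightarrow> y \<in> labels k nC n \<Longrightarrow> L x (\<lambda>z. L y (beta k z)) = beta k x y"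
    and s: "\<And>x y. x \<in> labels k nC n \<Longrightarrow> y \<in> labels k nC n \<Longrightarrow> h x y \<noteq> 0 \<Longrightarrow>
      fst x = fst y \<and> (k = KGL \<longrightarrow> snd (snd x) = snd (snd y))"
  shows "h \<in> isom k nC n"
proof -
  have "(\<Sum>z\<in>labels k nC n. \<Sum>z'\<in>labels k nC n. h x z * h y z' * beta k z z') = beta k x y"
    if "x \<in> labels k nC n" "y \<in> labels k nC n" for x y
  proof -
    have "(\<Sum>z\<in>labels k nC n. \<Sum>z'\<in>labels k nC n. h x z * h y z' * beta k z z') =
       (\<Sum>z\<in>labels k nC n. h x z * (\<Sum>z'\<in>labels k nC n. h y z' * beta k z z'))"
      by (simp add: sum_distrib_left mult.assoc)
    also have "\<dots> = L x (\<lambda>z. L y (beta k z))"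
      by (simp only: L[OF that(2)] L[OF that(1)])
    finally show ?thesis using b[OF that] by simp
  qed
  then have "\<forall>x\<in>labels k nC n. \<forall>y\<in>labels k nC n.
     (\<Sum>z\<in>labels k nC n. \<Sum>z'\<in>labels k nC n. h x z * h y z' * beta k z z') = beta k x y" by simp
  moreover have "\<forall>x\<in>labels k nC n. \<forall>y\<in>labels k nC n. h x y \<noteq> 0 \<longrightarrow>
      fst x = fst y \<and> (k = KGL \<longrightarrow> snd (snd x) = snd (snd y))"
    by (intro ballI impI) (rule s)
  ultimately show ?thesis by (simp only: isom_def mem_Collect_eq)
qed

definition Pos :: "nat \<Rightarrow> (nat \<times> bool) set" where "Pos d = {..<d} \<times> UNIV"

lemma finite_Pos [simp]: "finite (Pos d)"
  by (simp add: Pos_def)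

lemma card_Pos: "card (Pos d) = 2 * d"
  by (simp add: Pos_def card_cartesian_product)

lemma Pos_iff: "p \<in> Pos d \<longleftrightarrow> fst p < d"
  by (cases p) (simp add: Pos_def)

section \<open>Relations satisfied by an invariant tensor\<close>

locale std_inv =
  fixes k :: kind and nC :: nat and n :: "nat \<Rightarrow> nat" and d :: nat
begin

abbreviation "W \<equiv> labels k nC n"

definition WW :: "(nat \<times> bool \<Rightarrow> label) set" where "WW = Pos d \<rightarrow>\<^sub>E W"

definition kinv :: "((nat \<times> bool \<Rightarrow> label) \<Rightarrow> complex) \<Rightarrow> bool" where
  "kinv U \<longleftrightarrow> (\<forall>h\<in>isom k nC n. \<forall>w\<in>WW. (\<Sum>v\<in>WW. U v * (\<Prod>p\<in>Pos d. h (w p) (v p))) = U w)"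

lemma finite_WW [simp]: "finite WW"
  unfolding WW_def by (rule finite_PiE) simp_all

lemma WW_in: "w \<in> WW \<Longrightarrow> p \<in> Pos d \<Longrightarrow> w p \<in> W"
  by (auto simp: WW_def)

lemma WW_upd: "w \<in> WW \<Longrightarrow> p \<in> Pos d \<Longrightarrow> x \<in> W \<Longrightarrow> w(p := x) \<in> WW"
  unfolding WW_def by (rule PiE_upd)

lemma WW_eqI: "w \<in> WW \<Longrightarrow> v \<in> WW \<Longrightarrow> (\<And>p. p \<in> Pos d \<Longrightarrow> w p = v p) \<Longrightarrow> w = v"
  unfolding WW_def by (rule PiE_ext)

text \<open>The product of indicators leaves only the words that agree with \<open>w\<close> away
  from \<open>p\<close>: a derivation acts on a tensor one position at a time.\<close>

lemma sum_single_position: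
  assumes w: "w \<in> WW" and p: "p \<in> Pos d"
  shows "(\<Sum>v\<in>WW. U v * (e (v p) * (\<Prod>q\<in>Pos d - {p}. if w q = v q then 1 else 0))) =
    (\<Sum>x\<in>W. e x * (U (w(p := x)) :: complex))"
proof -
  let ?g = "\<lambda>v. U v * (e (v p) * (\<Prod>q\<in>Pos d - {p}. if w q = v q then 1 else 0))"
  have inj: "inj_on (\<lambda>x. w(p := x)) W" by (auto simp: inj_on_def dest: fun_upd_eqD)
  have "(\<Sum>v\<in>WW. ?g v) = (\<Sum>v\<in>(\<lambda>x. w(p := x)) ` W. ?g v)"
  proof (rule sum.mono_neutral_right)
    show "(\<lambda>x. w(p := x)) ` W \<subseteq> WW" using w p by (auto intro: WW_upd)
    show "\<forall>v\<in>WW - (\<lambda>x. w(p := x)) ` W. ?g v = 0"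
    proof
      fix v assume v: "v \<in> WW - (\<lambda>x. w(p := x)) ` W"
      have "\<exists>q\<in>Pos d - {p}. w q \<noteq> v q"
      proof (rule ccontr)
        assume "\<not> ?thesis"
        then have "v = w(p := v p)"
          using v w p by (intro WW_eqI) (auto intro!: WW_upd WW_in)
        then show False using v p WW_in by blast
      qed
      then show "?g v = 0" by (auto intro!: prod_zero)
    qed
  qed simp
  also have "\<dots> = (\<Sum>x\<in>W. e x * U (w(p := x)))"
    by (simp add: sum.reindex[OF inj] mult.commute)
  finally show ?thesis .
qed

text \<open>The invariance identity along the curve \<open>h t\<close> has a constant side, so its
  derivative at 0 says that the infinitesimal isometry \<open>E\<close> annihilates
  \<open>U\<close>.\<close>

lemma lie_relation:
  assumes U: "kinv U" and w: "w \<in> WW"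
    and h: "\<And>t. h t \<in> isom k nC n"
    and h0: "\<And>x y. x \<in> W \<Longrightarrow> y \<in> W \<Longrightarrow> h 0 x y = (if x = y then 1 else 0)"
    and E: "\<And>x y. x \<in> W \<Longrightarrow> y \<in> W \<Longrightarrow> ((\<lambda>t. h t x y) has_field_derivative E x y) (at 0)"
  shows "(\<Sum>p\<in>Pos d. \<Sum>x\<in>W. E (w p) x * U (w(p := x))) = 0"
proof -
  let ?f = "\<lambda>t::complex. \<Sum>v\<in>WW. U v * (\<Prod>p\<in>Pos d. h t (w p) (v p))"
  let ?D = "\<Sum>v\<in>WW. U v * (\<Sum>p\<in>Pos d. E (w p) (v p) * (\<Prod>q\<in>Pos d - {p}. h 0 (w q) (v q)))"
  have "(?f has_field_derivative ?D) (at 0)"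
    by (intro DERIV_sum DERIV_cmult has_field_derivative_prod E WW_in w)
  moreover have "(?f has_field_derivative 0) (at 0)"
  proof -
    have "?f = (\<lambda>t. U w)" using U h w by (simp add: kinv_def)
    then show ?thesis by (simp only: DERIV_const)
  qed
  ultimately have D0: "?D = 0" by (rule DERIV_unique)
  have "?D = (\<Sum>v\<in>WW. \<Sum>p\<in>Pos d. U v * (E (w p) (v p) * (\<Prod>q\<in>Pos d - {p}. if w q = v q then 1 else 0)))"
    unfolding sum_distrib_left
  proof (intro sum.cong refl)
    fix v p assume v: "v \<in> WW"
    have "(\<Prod>q\<in>Pos d - {p}. h 0 (w q) (v q)) = (\<Prod>q\<in>Pos d - {p}. if w q = v q then 1 else 0)"
      by (rule prod.cong) (simp_all add: h0 WW_in w v)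
    then show "U v * (E (w p) (v p) * (\<Prod>q\<in>Pos d - {p}. h 0 (w q) (v q))) =
       U v * (E (w p) (v p) * (\<Prod>q\<in>Pos d - {p}. if w q = v q then 1 else 0))" by simp
  qed
  also have "\<dots> = (\<Sum>p\<in>Pos d. \<Sum>v\<in>WW. U v * (E (w p) (v p) * (\<Prod>q\<in>Pos d - {p}. if w q = v q then 1 else 0)))"
    by (rule sum.swap)
  also have "\<dots> = (\<Sum>p\<in>Pos d. \<Sum>x\<in>W. E (w p) x * U (w(p := x)))"
    by (rule sum.cong[OF refl], rule sum_single_position[OF w])
  finally show ?thesis using D0 by simp
qed

abbreviation "op \<equiv> k \<noteq> KO"

text \<open>The generator \<open>E\<close> replaces \<open>b\<close> by \<open>a\<close> and, with a
  minus sign, the dual of \<open>a\<close> by the dual of \<open>b\<close>. When dual labels exist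
  these two parts act on different labels and the square of \<open>E\<close> is 0, so
  \<open>1 + t E\<close> is already a curve of isometries. In the orthogonal case the curve is a
  rotation in the plane of the two vectors.\<close>

lemma lie_split:
  assumes U: "kinv U" and w: "w \<in> WW" and A: "(c, a, False) \<in> W" and B: "(c, b, False) \<in> W" and ab: "a \<noteq> b"
  shows "(\<Sum>p | p \<in> Pos d \<and> w p = (c, b, False). U (w(p := (c, a, False)))) =
    (\<Sum>p | p \<in> Pos d \<and> w p = (c, a, op). U (w(p := (c, b, op))))"
proof -
  define E :: "label \<Rightarrow> label \<Rightarrow> complex" where
    "E = (\<lambda>x y. (if y = (c, a, False) then if x = (c, b, False) then 1 else 0 else 0) -
        (if y = (c, b, op) then if x = (c, a, op) then 1 else 0 else 0))"
  have AB: "(c, a, op) \<in> W" "(c, b, op) \<in> W" using A B by (auto simp: labels_def)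
  have "\<exists>h. (\<forall>t. h t \<in> isom k nC n) \<and> (\<forall>x\<in>W. \<forall>y\<in>W. h 0 x y = (if x = y then 1 else 0)) \<and>
     (\<forall>x\<in>W. \<forall>y\<in>W. ((\<lambda>t. h t x y) has_field_derivative E x y) (at 0))"
  proof (cases "k = KO")
    case False
    define h where "h = (\<lambda>t x y. (if y = x then 1 else 0) + t * E x y)"
    have "h t \<in> isom k nC n" for t
    proof (rule isomI)
      show "(\<Sum>z\<in>W. h t x z * g z) = g x + t * ((if x = (c, b, False) then g (c, a, False) else 0) -
          (if x = (c, a, True) then g (c, b, True) else 0))" if "x \<in> W" for x g
      proof -
        have "(\<Sum>z\<in>W. h t x z * g z) = (\<Sum>z\<in>W. (if z = x then g x else 0) +
           t * ((if z = (c, a, False) then (if x = (c, b, False) then g (c, a, False) else 0) else 0) -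
             (if z = (c, b, True) then (if x = (c, a, True) then g (c, b, True) else 0) else 0)))"
          using False by (intro sum.cong) (auto simp: h_def E_def distrib_right)
        then show ?thesis using that A B AB False
          by (simp add: sum.distrib sum_subtractf flip: sum_distrib_left)
      qed
      show "h t x y \<noteq> 0 \<Longrightarrow> fst x = fst y \<and> (k = KGL \<longrightarrow> snd (snd x) = snd (snd y))" for x y
        using False by (auto simp: h_def E_def split: if_splits)
    next
      fix x y assume "x \<in> W" "y \<in> W"
      obtain cx ax sx cy ay sy where xy: "x = (cx, ax, sx)" "y = (cy, ay, sy)" by (cases x, cases y) auto
      have "k = KGL \<or> k = KSp" using False by (cases k) auto
      then show "beta k x y + t * ((if y = (c, b, False) then beta k x (c, a, False) else 0) - (if y = (c, a, True) then beta k x (c, b, True) else 0)) +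
        t * ((if x = (c, b, False) then beta k (c, a, False) y + t * ((if y = (c, b, False) then beta k (c, a, False) (c, a, False) else 0) - (if y = (c, a, True) then beta k (c, a, False) (c, b, True) else 0)) else 0) -
        (if x = (c, a, True) then beta k (c, b, True) y + t * ((if y = (c, b, False) then beta k (c, b, True) (c, a, False) else 0) - (if y = (c, a, True) then beta k (c, b, True) (c, b, True) else 0)) else 0)) = beta k x y"
        unfolding xy using ab by (elim disjE) (auto split: if_splits)
    qed
    moreover have "((\<lambda>t. h t x y) has_field_derivative E x y) (at 0)" for x y
      unfolding h_def by (auto intro!: derivative_eq_intros)
    ultimately show ?thesis by (intro exI[of _ h]) (auto simp: h_def)
  next
    case True
    define h where "h = (\<lambda>t x y. if x = (c, b, False) then (if y = (c, b, False) then cos t else 0) + (if y = (c, a, False) then sin t else 0)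
       else if x = (c, a, False) then (if y = (c, a, False) then cos t else 0) - (if y = (c, b, False) then sin t else 0)
       else (if y = x then 1 else (0::complex)))"
    have "h t \<in> isom k nC n" for t
    proof (rule isomI)
      show "(\<Sum>z\<in>W. h t x z * g z) = (if x = (c, b, False) then cos t * g (c, b, False) + sin t * g (c, a, False)
         else if x = (c, a, False) then cos t * g (c, a, False) - sin t * g (c, b, False) else g x)" if "x \<in> W" for x g
      proof -
        consider "x = (c, b, False)" | "x = (c, a, False)" "x \<noteq> (c, b, False)" | "x \<noteq> (c, a, False)" "x \<noteq> (c, b, False)"
          by blast
        then show ?thesis
        proof cases
          case 1
          have "h t x z * g z = (if z = (c, b, False) then cos t * g (c, b, False) else 0) +
              (if z = (c, a, False) then sin t * g (c, a, False) else 0)" for z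
            using ab by (cases "z = (c, b, False)"; cases "z = (c, a, False)") (simp_all add: h_def 1)
          then show ?thesis using 1 A B by (simp add: sum.distrib)
        next
          case 2
          have "h t x z * g z = (if z = (c, a, False) then cos t * g (c, a, False) else 0) -
              (if z = (c, b, False) then sin t * g (c, b, False) else 0)" for z
            using ab by (cases "z = (c, b, False)"; cases "z = (c, a, False)") (simp_all add: h_def 2)
          then show ?thesis using 2 ab A B by (simp add: sum_subtractf)
        next
          case 3
          have "h t x z * g z = (if z = x then g x else 0)" for z
            using 3 by (simp add: h_def)
          then show ?thesis using 3 that by simp
        qed
      qed
      show "h t x y \<noteq> 0 \<Longrightarrow> fst x = fst y \<and> (k = KGL \<longrightarrow> snd (snd x) = snd (snd y))" for x y
        using True by (auto simp: h_def split: if_splits)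
    next
      fix x y assume W: "x \<in> W" "y \<in> W"
      obtain cx ax sx cy ay sy where xy: "x = (cx, ax, sx)" "y = (cy, ay, sy)" by (cases x, cases y) auto
      have F: "\<not> sx" "\<not> sy" using W xy True by (auto simp: labels_def)
      let ?L = "\<lambda>x g. (if x = (c, b, False) then cos t * g (c, b, False) + sin t * g (c, a, False)
         else if x = (c, a, False) then cos t * g (c, a, False) - sin t * g (c, b, False) else g x)"
      have "sin t * sin t + cos t * cos t = 1" "cos t * cos t + sin t * sin t = 1"
        using sin_cos_squared_add[of t] by (simp_all add: power2_eq_square add.commute)
      then show "?L x (\<lambda>z. ?L y (beta k z)) = beta k x y"
        unfolding xy using F ab True by (auto split: if_splits)
    qed
    moreover have "((\<lambda>t. h t x y) has_field_derivative E x y) (at 0)" for x y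
      unfolding h_def E_def using ab True by (auto intro!: derivative_eq_intros)
    ultimately show ?thesis using True ab by (intro exI[of _ h]) (auto simp: h_def)
  qed
  then obtain h where h: "\<And>t. h t \<in> isom k nC n"
      "\<And>x y. x \<in> W \<Longrightarrow> y \<in> W \<Longrightarrow> h 0 x y = (if x = y then 1 else 0)"
      "\<And>x y. x \<in> W \<Longrightarrow> y \<in> W \<Longrightarrow> ((\<lambda>t. h t x y) has_field_derivative E x y) (at 0)"
    by blast
  have "0 = (\<Sum>p\<in>Pos d. \<Sum>x\<in>W. E (w p) x * U (w(p := x)))"
    using lie_relation[OF U w h] by simp
  also have "\<dots> = (\<Sum>p\<in>Pos d. (if w p = (c, b, False) then U (w(p := (c, a, False))) else 0) -
      (if w p = (c, a, op) then U (w(p := (c, b, op))) else 0))"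
  proof (rule sum.cong)
    fix p
    have "(\<Sum>x\<in>W. E (w p) x * U (w(p := x))) =
       (\<Sum>x\<in>W. (if x = (c, a, False) then if w p = (c, b, False) then U (w(p := (c, a, False))) else 0 else 0) -
        (if x = (c, b, op) then if w p = (c, a, op) then U (w(p := (c, b, op))) else 0 else 0))"
      by (intro sum.cong) (auto simp: E_def)
    also have "\<dots> = (if w p = (c, b, False) then U (w(p := (c, a, False))) else 0) -
      (if w p = (c, a, op) then U (w(p := (c, b, op))) else 0)"
      using A AB by (simp only: sum_subtractf sum.delta finite_labels if_True)
    finally show "(\<Sum>x\<in>W. E (w p) x * U (w(p := x))) = \<dots>" .
  qed simp
  finally show ?thesis
    by (simp add: sum_subtractf sum.inter_filter)
qed

text \<open>A diagonal isometry multiplies the value at a word by the product of its entries, so a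
  nonzero value forces this product to be 1.\<close>

lemma torus_relation:
  assumes U: "kinv U" and w: "w \<in> WW"
    and l: "\<And>x y. x \<in> W \<Longrightarrow> y \<in> W \<Longrightarrow> beta k x y \<noteq> 0 \<Longrightarrow> l x * l y = 1"
  shows "U w * (\<Prod>p\<in>Pos d. l (w p)) = U w"
proof -
  define h where "h = (\<lambda>x y. if y = x then l x else (0::complex))"
  have "h \<in> isom k nC n"
  proof (rule isomI)
    show "(\<Sum>z\<in>W. h x z * g z) = l x * g x" if "x \<in> W" for x g
      using that by (simp add: h_def if_distrib[of "\<lambda>a. a * _"] cong: if_cong)
    show "l x * (l y * beta k x y) = beta k x y" if "x \<in> W" "y \<in> W" for x y
      using l[OF that] by (cases "beta k x y = 0") (auto simp: mult.assoc[symmetric])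
  qed (auto simp: h_def split: if_splits)
  then have "U w = (\<Sum>v\<in>WW. U v * (\<Prod>p\<in>Pos d. h (w p) (v p)))"
    using U w by (simp add: kinv_def)
  also have "\<dots> = (\<Sum>v\<in>WW. if v = w then U w * (\<Prod>p\<in>Pos d. l (w p)) else 0)"
  proof (rule sum.cong)
    fix v assume v: "v \<in> WW"
    show "U v * (\<Prod>p\<in>Pos d. h (w p) (v p)) = (if v = w then U w * (\<Prod>p\<in>Pos d. l (w p)) else 0)"
    proof (cases "v = w")
      case False
      then obtain p where "p \<in> Pos d" "v p \<noteq> w p" using WW_eqI[OF v w] by blast
      then have "(\<Prod>p\<in>Pos d. h (w p) (v p)) = 0" by (intro prod_zero) (auto simp: h_def)
      then show ?thesis using False by simp
    qed (simp add: h_def)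
  qed simp
  finally show ?thesis using w by simp
qed

text \<open>Diagonal isometries detect multiplicities. The reflection with a single entry -1 shows
  that an orthogonal basis vector occurs an even number of times; the entries 2 and 1/2 show that a
  vector and its dual occur equally often.\<close>

lemma partner:
  assumes U: "kinv U" and w: "w \<in> WW" and nz: "U w \<noteq> 0" and p: "p \<in> Pos d" "w p = (c, a, s)"
  shows "\<exists>q\<in>Pos d. q \<noteq> p \<and> w q = (c, a, op \<and> \<not> s)"
proof (cases "k = KO")
  case True
  have s: "\<not> s" using WW_in[OF w p(1)] p(2) True by (auto simp: labels_def)
  let ?A = "{q \<in> Pos d. w q = (c, a, False)}"
  have "U w * (\<Prod>q\<in>Pos d. (if w q = (c, a, False) then - 1 else 1)) = U w"
    by (rule torus_relation[OF U w]) (use True in \<open>auto split: if_splits simp: labels_def\<close>)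
  then have "(\<Prod>q\<in>Pos d. (if w q = (c, a, False) then - 1 else (1::complex))) = 1" using nz by simp
  also have "(\<Prod>q\<in>Pos d. (if w q = (c, a, False) then - 1 else (1::complex))) = (- 1) ^ card ?A"
    by (simp add: prod.inter_filter[symmetric])
  finally have "even (card ?A)" by (cases "even (card ?A)") auto
  moreover have "p \<in> ?A" using p s by simp
  ultimately have "?A \<noteq> {p}" by auto
  with \<open>p \<in> ?A\<close> obtain q where "q \<in> ?A" "q \<noteq> p" by blast
  then show ?thesis using True by auto
next
  case False
  let ?A = "\<lambda>s. {q \<in> Pos d. w q = (c, a, s)}"
  \<comment> \<open>The entry 2 is not a root of unity, so its powers determine the
    exponents.\<close>
  have "U w * (\<Prod>q\<in>Pos d. (if w q = (c, a, False) then 2 else if w q = (c, a, True) then 1/2 else 1)) = U w"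
  proof (rule torus_relation[OF U w])
    fix x y assume "beta k x y \<noteq> 0"
    obtain cx ax sx cy ay sy where xy: "x = (cx, ax, sx)" "y = (cy, ay, sy)" by (cases x, cases y) auto
    have "k = KGL \<or> k = KSp" using False by (cases k) auto
    then show "(if x = (c, a, False) then 2 else if x = (c, a, True) then 1 / 2 else 1) *
         (if y = (c, a, False) then 2 else if y = (c, a, True) then 1 / 2 else 1) = (1::complex)"
      using \<open>beta k x y \<noteq> 0\<close> unfolding xy by (auto split: if_splits)
  qed
  moreover have "(\<Prod>q\<in>Pos d. (if w q = (c, a, False) then 2 else if w q = (c, a, True) then 1/2 else (1::complex))) =
     (\<Prod>q\<in>Pos d. (if w q = (c, a, False) then 2 else 1)) * (\<Prod>q\<in>Pos d. (if w q = (c, a, True) then 1/2 else 1))"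
    unfolding prod.distrib[symmetric] by (intro prod.cong) auto
  ultimately have "(2::complex) ^ card (?A False) * (1/2) ^ card (?A True) = 1"
    using nz by (simp add: prod.inter_filter[symmetric])
  then have "(2::complex) ^ card (?A False) = 2 ^ card (?A True)" by (simp add: power_one_over field_simps)
  then have "of_nat (2 ^ card (?A False)) = (of_nat (2 ^ card (?A True)) :: complex)" by simp
  then have eq: "card (?A False) = card (?A True)" unfolding of_nat_eq_iff by simp
  have fin: "finite (?A s)" for s by simp
  have ps: "p \<in> ?A s" using p by simp
  have "card (?A s) \<noteq> 0"
  proof
    assume "card (?A s) = 0"
    then have "?A s = {}" using fin[of s] by (simp only: card_0_eq)
    then show False using ps by (simp only: empty_iff)
  qed
  then have "card (?A (\<not> s)) \<noteq> 0"
    using eq by (cases s) (simp_all only: not_True_eq_False not_False_eq_True)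
  then have "?A (\<not> s) \<noteq> {}" by (intro notI) (simp only: card.empty)
  then obtain q where "q \<in> ?A (\<not> s)" unfolding ex_in_conv[symmetric] by (elim exE)
  then have "q \<in> Pos d" "w q = (c, a, op \<and> \<not> s)" using False by simp_all
  moreover have "q \<noteq> p"
  proof
    assume "q = p"
    then show False using \<open>w q = _\<close> p(2) False by simp
  qed
  ultimately show ?thesis by blast
qed

text \<open>This is \<open>lie_split\<close> at the word with \<open>b\<close> written at
  \<open>p\<close>. Because \<open>b\<close> is fresh, it occurs there only once, and the left side
  reduces to \<open>U w\<close>.\<close>

lemma split_relation:
  assumes U: "kinv U" and w: "w \<in> WW" and p: "p \<in> Pos d" "w p = (c, a, False)"
    and b: "b < n c" and fresh: "\<And>q s. q \<in> Pos d \<Longrightarrow> w q \<noteq> (c, b, s)"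
  shows "U w = (\<Sum>q | q \<in> Pos d \<and> q \<noteq> p \<and> w q = (c, a, op). U (w(p := (c, b, False), q := (c, b, op))))"
proof -
  let ?w = "w(p := (c, b, False))"
  have A: "(c, a, False) \<in> W" using WW_in[OF w p(1)] p(2) by simp
  then have B: "(c, b, False) \<in> W" using b by (auto simp: labels_def)
  have ab: "a \<noteq> b" using fresh[OF p(1)] p(2) by auto
  have "(\<Sum>q | q \<in> Pos d \<and> ?w q = (c, b, False). U (?w(q := (c, a, False)))) =
    (\<Sum>q | q \<in> Pos d \<and> ?w q = (c, a, op). U (?w(q := (c, b, op))))"
    by (rule lie_split[OF U WW_upd[OF w p(1) B] A B ab])
  moreover have "{q. q \<in> Pos d \<and> ?w q = (c, b, False)} = {p}" using p fresh by auto
  moreover have "{q. q \<in> Pos d \<and> ?w q = (c, a, op)} = {q. q \<in> Pos d \<and> q \<noteq> p \<and> w q = (c, a, op)}"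
    using ab by auto
  moreover have "?w(p := (c, a, False)) = w" using p by auto
  ultimately show ?thesis by simp
qed

text \<open>A symplectic transvection is applied to the word that carries (c, a, False) at both
  \<open>p\<close> and \<open>q\<close>. Replacing either occurrence by the dual label gives the
  pair in one of its two orders, and the two values must cancel.\<close>

lemma flip_relation:
  assumes U: "kinv U" and k: "k = KSp" and w: "w \<in> WW" and p: "p \<in> Pos d" "w p = (c, a, False)"
    and q: "q \<in> Pos d" "w q = (c, a, True)"
    and only: "\<And>u s. u \<in> Pos d \<Longrightarrow> w u = (c, a, s) \<Longrightarrow> u = p \<or> u = q"
  shows "U (w(p := (c, a, True), q := (c, a, False))) = - U w"
proof -
  define E :: "label \<Rightarrow> label \<Rightarrow> complex" where
    "E = (\<lambda>x y. if y = (c, a, True) then if x = (c, a, False) then 1 else 0 else 0)"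
  define h where "h = (\<lambda>t x y. (if y = x then 1 else 0) + t * E x y)"
  have A: "(c, a, False) \<in> W" "(c, a, True) \<in> W" using WW_in[OF w p(1)] WW_in[OF w q(1)] p(2) q(2) by simp_all
  have h: "h t \<in> isom k nC n" for t
  proof (rule isomI)
    show "(\<Sum>z\<in>W. h t x z * g z) = g x + t * (if x = (c, a, False) then g (c, a, True) else 0)" if "x \<in> W" for x g
    proof -
      have "(\<Sum>z\<in>W. h t x z * g z) = (\<Sum>z\<in>W. (if z = x then g x else 0) +
         t * (if z = (c, a, True) then (if x = (c, a, False) then g (c, a, True) else 0) else 0))"
        by (intro sum.cong) (auto simp: h_def E_def distrib_right)
      then show ?thesis using that A by (simp add: sum.distrib flip: sum_distrib_left)
    qed
    fix x y :: label
    obtain cx ax sx cy ay sy where xy: "x = (cx, ax, sx)" "y = (cy, ay, sy)" by (cases x, cases y) auto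
    show "beta k x y + t * (if y = (c, a, False) then beta k x (c, a, True) else 0) +
       t * (if x = (c, a, False) then beta k (c, a, True) y + t * (if y = (c, a, False) then beta k (c, a, True) (c, a, True) else 0) else 0) = beta k x y"
      unfolding xy k by (auto split: if_splits)
  qed (use k in \<open>auto simp: h_def E_def split: if_splits\<close>)
  let ?w = "w(q := (c, a, False))"
  have pq: "p \<noteq> q" using p q by auto
  have "0 = (\<Sum>u\<in>Pos d. \<Sum>x\<in>W. E (?w u) x * U (?w(u := x)))"
    by (rule lie_relation[OF U WW_upd[OF w q(1) A(1)] h, symmetric])
      (auto simp: h_def intro!: derivative_eq_intros)
  also have "\<dots> = (\<Sum>u\<in>Pos d. if ?w u = (c, a, False) then U (?w(u := (c, a, True))) else 0)"
  proof (rule sum.cong)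
    fix u
    have "(\<Sum>x\<in>W. E (?w u) x * U (?w(u := x))) =
       (\<Sum>x\<in>W. if x = (c, a, True) then if ?w u = (c, a, False) then U (?w(u := (c, a, True))) else 0 else 0)"
      by (intro sum.cong) (auto simp: E_def)
    then show "(\<Sum>x\<in>W. E (?w u) x * U (?w(u := x))) = (if ?w u = (c, a, False) then U (?w(u := (c, a, True))) else 0)"
      using A by (simp only: sum.delta finite_labels if_True)
  qed simp
  also have "\<dots> = (\<Sum>u | u \<in> Pos d \<and> ?w u = (c, a, False). U (?w(u := (c, a, True))))"
    by (simp add: sum.inter_filter)
  also have "{u. u \<in> Pos d \<and> ?w u = (c, a, False)} = {p, q}"
    using p q only by auto
  also have "(\<Sum>u\<in>{p, q}. U (?w(u := (c, a, True)))) = U (w(p := (c, a, True), q := (c, a, False))) + U w"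
    using pq q by (simp add: fun_upd_twist fun_upd_idem)
  finally show ?thesis by (simp add: eq_neg_iff_add_eq_0)
qed

end

section \<open>Words attached to matchings\<close>

context std_inv
begin

text \<open>\<open>\<rho>\<close> sends a position to the pair and the end it occupies. Pair
  \<open>j\<close> carries the basis vector \<open>a j\<close> of colour \<open>c j\<close>,
  dualised at the end True; for \<open>KO\<close> both ends carry the same vector.\<close>

definition wm :: "(nat \<times> bool \<Rightarrow> nat \<times> bool) \<Rightarrow> (nat \<Rightarrow> nat) \<Rightarrow> (nat \<Rightarrow> nat) \<Rightarrow> nat \<times> bool \<Rightarrow> label" where
  "wm \<rho> c a = restrict (\<lambda>p. (c (fst (\<rho> p)), a (fst (\<rho> p)), op \<and> snd (\<rho> p))) (Pos d)"

definition valid :: "(nat \<Rightarrow> nat) \<Rightarrow> (nat \<Rightarrow> nat) \<Rightarrow> bool" where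
  "valid c a \<longleftrightarrow> (\<forall>j<d. c j < nC \<and> a j < n (c j)) \<and> (\<forall>i<d. \<forall>j<d. (c i, a i) = (c j, a j) \<longrightarrow> i = j)"

lemma wm_eq: "p \<in> Pos d \<Longrightarrow> wm \<rho> c a p = (c (fst (\<rho> p)), a (fst (\<rho> p)), op \<and> snd (\<rho> p))"
  by (simp add: wm_def)

lemma wm_undefined: "p \<notin> Pos d \<Longrightarrow> wm \<rho> c a p = undefined"
  by (simp add: wm_def)

lemma permutes_fst_less: "\<rho> permutes Pos d \<Longrightarrow> p \<in> Pos d \<Longrightarrow> fst (\<rho> p) < d"
  by (simp add: permutes_in_image flip: Pos_iff)

lemma wm_in:
  assumes "\<rho> permutes Pos d" "\<And>j. j < d \<Longrightarrow> c j < nC \<and> a j < n (c j)"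
  shows "wm \<rho> c a \<in> WW"
  unfolding WW_def
proof (rule PiE_I)
  fix p assume "p \<in> Pos d"
  then show "wm \<rho> c a p \<in> W"
    using assms(2)[OF permutes_fst_less[OF assms(1)]] by (simp add: wm_eq labels_def)
qed (simp add: wm_undefined)

lemma wm_cong:
  assumes "\<rho> permutes Pos d" "\<And>j. j < d \<Longrightarrow> c j = c' j" "\<And>j. j < d \<Longrightarrow> a j = a' j"
  shows "wm \<rho> c a = wm \<rho> c' a'"
  unfolding wm_def using assms permutes_fst_less[OF assms(1)] by (intro restrict_ext) simp

text \<open>In \<open>split_relation\<close> at the False end of pair \<open>j\<close> the only
  possible partner is the True end of the same pair, so the sum has a single term.\<close>

lemma rename_step:
  assumes U: "kinv U" and r: "\<rho> permutes Pos d" and v: "valid c a" and j: "j < d" and b: "b < n (c j)"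
    and fresh: "\<And>i. i < d \<Longrightarrow> (c i, a i) \<noteq> (c j, b)"
  shows "U (wm \<rho> c a) = U (wm \<rho> c (a(j := b)))"
proof -
  let ?s = "Hilbert_Choice.inv \<rho>" and ?w = "wm \<rho> c a"
  have rs: "\<rho> (?s x) = x" "?s (\<rho> x) = x" for x using permutes_inverses[OF r] by simp_all
  have sP: "?s (j, s) \<in> Pos d" for s
    using permutes_in_image[OF permutes_inv[OF r]] j by (simp add: Pos_iff)
  let ?p = "?s (j, False)" and ?q = "?s (j, True)"
  have w: "?w \<in> WW" using v by (intro wm_in r) (simp add: valid_def)
  have "U ?w = (\<Sum>q | q \<in> Pos d \<and> q \<noteq> ?p \<and> ?w q = (c j, a j, op). U (?w(?p := (c j, b, False), q := (c j, b, op))))"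
  proof (rule split_relation[OF U w sP _ b])
    show "?w ?p = (c j, a j, False)" by (simp add: wm_eq sP rs)
    fix q s assume "q \<in> Pos d"
    then show "?w q \<noteq> (c j, b, s)" using fresh[OF permutes_fst_less[OF r \<open>q \<in> Pos d\<close>]] by (auto simp: wm_eq)
  qed
  also have "{q. q \<in> Pos d \<and> q \<noteq> ?p \<and> ?w q = (c j, a j, op)} = {?q}"
  proof (intro equalityI subsetI)
    fix q assume "q \<in> {q. q \<in> Pos d \<and> q \<noteq> ?p \<and> ?w q = (c j, a j, op)}"
    then have q: "q \<in> Pos d" "q \<noteq> ?p" "?w q = (c j, a j, op)" by auto
    then have "fst (\<rho> q) = j"
      using v j permutes_fst_less[OF r q(1)] by (simp add: wm_eq valid_def)
    moreover have "\<rho> q \<noteq> (j, False)" using q(2) rs(2)[of q] by auto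
    ultimately have "\<rho> q = (j, True)" by (cases "\<rho> q") auto
    then show "q \<in> {?q}" using rs(2)[of q] by simp
  next
    fix q assume "q \<in> {?q}"
    moreover have "?q \<noteq> ?p" using rs(1)[of "(j, True)"] rs(1)[of "(j, False)"] by auto
    ultimately show "q \<in> {q. q \<in> Pos d \<and> q \<noteq> ?p \<and> ?w q = (c j, a j, op)}"
      by (simp add: wm_eq sP rs)
  qed
  also have "(\<Sum>q\<in>{?q}. U (?w(?p := (c j, b, False), q := (c j, b, op)))) = U (wm \<rho> c (a(j := b)))"
  proof -
    have "?w(?p := (c j, b, False), ?q := (c j, b, op)) = wm \<rho> c (a(j := b))"
    proof
      fix x
      show "(?w(?p := (c j, b, False), ?q := (c j, b, op))) x = wm \<rho> c (a(j := b)) x"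
      proof (cases "x = ?p \<or> x = ?q")
        case True
        then show ?thesis
          using rs(1)[of "(j, True)"] rs(1)[of "(j, False)"] sP by (auto simp: wm_eq)
      next
        case False
        then have "\<rho> x \<noteq> (j, False)" "\<rho> x \<noteq> (j, True)" using rs(2)[of x] by auto
        then have "fst (\<rho> x) \<noteq> j" by (cases "\<rho> x") auto
        then show ?thesis using False by (cases "x \<in> Pos d") (simp_all add: wm_eq wm_undefined)
      qed
    qed
    then show ?thesis by simp
  qed
  finally show ?thesis .
qed

text \<open>The names are replaced one pair at a time. Since \<open>a'\<close> avoids all values of
  \<open>a\<close>, every mixed assignment met on the way is still valid.\<close>

lemma rename_disjoint:
  assumes U: "kinv U" and r: "\<rho> permutes Pos d" and v: "valid c a"
    and a': "\<And>j. j < d \<Longrightarrow> a' j < n (c j)" "inj_on a' {..<d}" "\<And>i j. i < d \<Longrightarrow> j < d \<Longrightarrow> a' j \<noteq> a i"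
  shows "U (wm \<rho> c a) = U (wm \<rho> c a')"
proof -
  have inj: "i < d \<Longrightarrow> j < d \<Longrightarrow> a' i = a' j \<Longrightarrow> i = j" for i j
    using a'(2) by (auto simp: inj_on_def)
  have "U (wm \<rho> c a) = U (wm \<rho> c (\<lambda>j. if j < m then a' j else a j))" if "m \<le> d" for m
    using that
  proof (induction m)
    case (Suc m)
    let ?a = "\<lambda>j. if j < m then a' j else a j"
    have va: "valid c ?a"
      unfolding valid_def
    proof (intro conjI allI impI)
      fix i j assume ij: "i < d" "j < d" "(c i, ?a i) = (c j, ?a j)"
      have vij: "(c i, a i) = (c j, a j) \<Longrightarrow> i = j" using v ij(1,2) by (simp only: valid_def)
      show "i = j"
      proof (cases "i < m")
        case True
        then have "a' i = a' j" using ij(3) a'(3)[OF ij(2,1)] by (cases "j < m") simp_all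
        then show ?thesis by (rule inj[OF ij(1,2)])
      next
        case False
        then have "(c i, a i) = (c j, a j)" using ij(3) a'(3)[OF ij(1,2)] by (cases "j < m") simp_all
        then show ?thesis by (rule vij)
      qed
    next
      fix j assume "j < d"
      then show "c j < nC" "?a j < n (c j)" using v a'(1) by (simp_all add: valid_def)
    qed
    have "U (wm \<rho> c ?a) = U (wm \<rho> c (?a(m := a' m)))"
    proof (rule rename_step[OF U r va])
      fix i assume i: "i < d"
      show "(c i, ?a i) \<noteq> (c m, a' m)"
        using a'(3)[OF i, of m] inj[OF i, of m] Suc.prems by (cases "i < m") auto
    qed (use Suc.prems a'(1) in simp_all)
    also have "?a(m := a' m) = (\<lambda>j. if j < Suc m then a' j else a j)" by (auto simp: less_Suc_eq)
    finally show ?case using Suc by simp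
  qed simp
  from this[of d] show ?thesis
    using wm_cong[OF r, of c c "\<lambda>j. if j < d then a' j else a j" a'] by simp
qed

text \<open>Direct replacement could collide when the two assignments share names, so both are
  renamed to a third one disjoint from them. This takes \<open>d\<close> names outside at most
  \<open>2 d\<close> used ones, which is the source of the bound \<open>3 d\<close>.\<close>

lemma rename:
  assumes U: "kinv U" and r: "\<rho> permutes Pos d" and v: "valid c a" "valid c a'"
    and big: "\<And>i. i < nC \<Longrightarrow> 3 * d \<le> n i"
  shows "U (wm \<rho> c a) = U (wm \<rho> c a')"
proof -
  let ?S = "{..<3 * d} - (a ` {..<d} \<union> a' ` {..<d})"
  have "card (a ` {..<d} \<union> a' ` {..<d}) \<le> d + d"
    using card_Un_le[of "a ` {..<d}" "a' ` {..<d}"] card_image_le[of "{..<d}" a] card_image_le[of "{..<d}" a']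
    by simp
  then have "d \<le> card ?S"
    using diff_card_le_card_Diff[of "a ` {..<d} \<union> a' ` {..<d}" "{..<3 * d}"] by simp
  then obtain B where B: "B \<subseteq> ?S" "card B = d" "finite B" by (rule obtain_subset_with_card_n)
  obtain e where e: "bij_betw e {0..<d} B" using ex_bij_betw_nat_finite[OF B(3)] B(2) by auto
  have eB: "e j \<in> B" if "j < d" for j using bij_betwE[OF e] that by auto
  have e1: "e j < n (c j)" if "j < d" for j
  proof -
    have "e j < 3 * d" using eB[OF that] B(1) by auto
    also have "\<dots> \<le> n (c j)" using big v(1) that by (auto simp: valid_def)
    finally show ?thesis .
  qed
  have e2: "inj_on e {..<d}" using e by (simp add: bij_betw_def atLeast0LessThan)
  have e3: "e j \<noteq> a i" "e j \<noteq> a' i" if "i < d" "j < d" for i j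
    using eB[OF that(2)] B(1) that by auto
  show ?thesis
    using rename_disjoint[OF U r v(1) e1 e2 e3(1)] rename_disjoint[OF U r v(2) e1 e2 e3(2)] by simp
qed

definition cl :: "(nat \<times> bool \<Rightarrow> label) \<Rightarrow> nat \<times> bool \<Rightarrow> nat \<times> nat" where
  "cl w p = (fst (w p), fst (snd (w p)))"

definition triple_free :: "(nat \<times> bool \<Rightarrow> label) \<Rightarrow> bool" where
  "triple_free w \<longleftrightarrow> (\<forall>p\<in>Pos d. \<forall>q\<in>Pos d. \<forall>u\<in>Pos d. cl w p = cl w q \<and> cl w q = cl w u \<longrightarrow> p = q \<or> q = u \<or> p = u)"

lemma cl_partner:
  assumes U: "kinv U" and w: "w \<in> WW" and nz: "U w \<noteq> 0" and p: "p \<in> Pos d"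
  obtains q where "q \<in> Pos d" "q \<noteq> p" "cl w q = cl w p" "snd (snd (w q)) = (op \<and> \<not> snd (snd (w p)))"
proof -
  obtain c a s where cas: "w p = (c, a, s)" by (cases "w p")
  then obtain q where "q \<in> Pos d" "q \<noteq> p" "w q = (c, a, op \<and> \<not> s)"
    using partner[OF U w nz p cas] by auto
  then show ?thesis using that[of q] by (simp add: cl_def cas)
qed

text \<open>
  If three positions carry the same basis vector (up to duality), \<open>split_relation\<close> moves one dual pair among
  them to an unused basis vector, so the number of distinct basis vectors can be increased.
\<close>

lemma exists_triple_free:
  assumes U: "kinv U" and big: "\<And>i. i < nC \<Longrightarrow> 3 * d \<le> n i"
  shows "w \<in> WW \<Longrightarrow> U w \<noteq> 0 \<Longrightarrow> \<exists>w'\<in>WW. U w' \<noteq> 0 \<and> triple_free w'"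
proof (induction "2 * d - card (cl w ` Pos d)" arbitrary: w rule: less_induct)
  case (less w)
  show ?case
  proof (cases "triple_free w")
    case False
    then obtain p q u where pqu: "p \<in> Pos d" "q \<in> Pos d" "u \<in> Pos d" "cl w q = cl w p" "cl w u = cl w p"
      "p \<noteq> q" "q \<noteq> u" "p \<noteq> u"
      unfolding triple_free_def by metis
    \<comment> \<open>\<open>split_relation\<close> has to start at a label with \<open>s\<close>
      false; if \<open>p\<close> carries the dual label, its partner serves.\<close>
    have "\<exists>p0\<in>Pos d. cl w p0 = cl w p \<and> \<not> snd (snd (w p0))"
    proof (cases "snd (snd (w p))")
      case True
      then have op using WW_in[OF less.prems(1) pqu(1)] by (auto simp: labels_def)
      with True show ?thesis using cl_partner[OF U less.prems pqu(1)] by metis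
    qed (use pqu in blast)
    then obtain p0 where p0: "p0 \<in> Pos d" "cl w p0 = cl w p" "\<not> snd (snd (w p0))" by blast
    obtain c a where ca: "w p0 = (c, a, False)" using p0(3) by (cases "w p0") auto
    have clp: "cl w p = (c, a)" using p0(2) ca by (simp add: cl_def)
    let ?N = "(\<lambda>p. fst (snd (w p))) ` Pos d"
    have cn: "c < nC" using WW_in[OF less.prems(1) p0(1)] ca by (auto simp: labels_def)
    have "d > 0" using p0(1) by (auto simp: Pos_iff)
    moreover have "card ?N \<le> 2 * d" using card_image_le[of "Pos d"] card_Pos by (metis finite_Pos)
    ultimately have "card ?N < card {..<n c}" using big[OF cn] by simp
    then have "\<not> {..<n c} \<subseteq> ?N" using card_mono[of ?N "{..<n c}"] by auto
    then obtain b where b: "b < n c" "b \<notin> ?N" by auto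
    have fresh: "w q \<noteq> (c, b, s)" if "q \<in> Pos d" for q s using b(2) that by force
    have "\<exists>q0. q0 \<in> Pos d \<and> q0 \<noteq> p0 \<and> w q0 = (c, a, op) \<and> U (w(p0 := (c, b, False), q0 := (c, b, op))) \<noteq> 0"
    proof (rule ccontr)
      assume "\<not> ?thesis"
      then have "(\<Sum>q | q \<in> Pos d \<and> q \<noteq> p0 \<and> w q = (c, a, op). U (w(p0 := (c, b, False), q := (c, b, op)))) = 0"
        by (intro sum.neutral) auto
      then show False using split_relation[OF U less.prems(1) p0(1) ca b(1) fresh] less.prems(2) by simp
    qed
    then obtain q0 where q0: "q0 \<in> Pos d" "q0 \<noteq> p0" "w q0 = (c, a, op)"
        "U (w(p0 := (c, b, False), q0 := (c, b, op))) \<noteq> 0" by blast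
    let ?w = "w(p0 := (c, b, False), q0 := (c, b, op))"
    have wW: "?w \<in> WW" using less.prems(1) p0(1) q0(1) cn b(1) by (intro WW_upd) (auto simp: labels_def)
    have cl: "cl ?w x = (if x = p0 \<or> x = q0 then (c, b) else cl w x)" for x by (simp add: cl_def)
    have "insert (c, b) (cl w ` Pos d) \<subseteq> cl ?w ` Pos d"
    proof (intro subsetI)
      fix y assume "y \<in> insert (c, b) (cl w ` Pos d)"
      then consider "y = (c, b)" | "y = (c, a)" | x where "x \<in> Pos d" "y = cl w x" "y \<noteq> (c, a)" by auto
      then show "y \<in> cl ?w ` Pos d"
      proof cases
        case 1
        then show ?thesis using p0(1) cl[of p0] by (intro image_eqI[of _ _ p0]) simp_all
      next
        case 2
        \<comment> \<open>Three positions share the class and only two positions are changed, so the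
          old class survives next to the new one.\<close>
        have "\<exists>x\<in>{p, q, u}. x \<noteq> p0 \<and> x \<noteq> q0" using pqu(6-8) by auto
        then obtain x where x: "x \<in> {p, q, u}" "x \<noteq> p0" "x \<noteq> q0" by blast
        moreover have "x \<in> Pos d" "cl w x = (c, a)" using x(1) pqu clp by auto
        ultimately show ?thesis using 2 cl[of x] by (intro image_eqI[of _ _ x]) simp_all
      next
        case (3 x)
        then have "x \<noteq> p0" "x \<noteq> q0" using ca q0(3) by (auto simp: cl_def)
        then show ?thesis using 3 cl[of x] by (intro image_eqI[of _ _ x]) simp_all
      qed
    qed
    moreover have "(c, b) \<notin> cl w ` Pos d" using b(2) by (auto simp: cl_def)
    ultimately have "Suc (card (cl w ` Pos d)) \<le> card (cl ?w ` Pos d)"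
      using card_mono[of "cl ?w ` Pos d" "insert (c, b) (cl w ` Pos d)"] by simp
    moreover have "card (cl ?w ` Pos d) \<le> 2 * d" using card_image_le[of "Pos d" "cl ?w"] card_Pos by simp
    ultimately show ?thesis using less.hyps[OF _ wW q0(4)] by simp
  qed (use less.prems in blast)
qed

text \<open>Existence of partners gives at least two positions in each class and
  \<open>triple_free\<close> at most two, so the classes are the pairs of a perfect matching, and
  counting positions shows that there are \<open>d\<close> of them. \<open>h\<close> numbers the
  classes and \<open>P\<close> selects an end with \<open>s\<close> false in each.\<close>

lemma matching_form:
  assumes U: "kinv U" and w: "w \<in> WW" and nz: "U w \<noteq> 0" and tf: "triple_free w"
  obtains \<rho> c a where "\<rho> permutes Pos d" "valid c a" "w = wm \<rho> c a"
proof -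
  let ?C = "cl w ` Pos d"
  have fst_ex: "\<exists>p. p \<in> Pos d \<and> cl w p = C \<and> \<not> snd (snd (w p))" if C: "C \<in> ?C" for C
  proof -
    obtain p where p: "p \<in> Pos d" "cl w p = C" using C by blast
    show ?thesis
    proof (cases "snd (snd (w p))")
      case True
      obtain q where q: "q \<in> Pos d" "cl w q = cl w p" "snd (snd (w q)) = (op \<and> \<not> snd (snd (w p)))"
        using cl_partner[OF U w nz p(1)] by metis
      then show ?thesis using p(2) True by (intro exI[of _ q]) simp
    qed (use p in blast)
  qed
  define P where "P = (\<lambda>C. SOME p. p \<in> Pos d \<and> cl w p = C \<and> \<not> snd (snd (w p)))"
  have P: "P C \<in> Pos d" "cl w (P C) = C" "\<not> snd (snd (w (P C)))" if "C \<in> ?C" for C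
    using someI_ex[OF fst_ex[OF that]] by (simp_all add: P_def)
  have two: "card {p \<in> Pos d. cl w p = C} = 2" if C: "C \<in> ?C" for C
  proof -
    obtain q where q: "q \<in> Pos d" "q \<noteq> P C" "cl w q = C"
      using cl_partner[OF U w nz P(1)[OF C]] P(2)[OF C] by metis
    have "{p \<in> Pos d. cl w p = C} = {P C, q}"
    proof (intro equalityI subsetI)
      fix x assume "x \<in> {p \<in> Pos d. cl w p = C}"
      then show "x \<in> {P C, q}" using tf q P[OF C] unfolding triple_free_def by fastforce
    qed (use q P[OF C] in auto)
    then show ?thesis using q(2) by simp
  qed
  have "card (Pos d) = (\<Sum>p\<in>Pos d. 1)" by simp
  also have "\<dots> = (\<Sum>C\<in>?C. \<Sum>p\<in>{p \<in> Pos d. cl w p = C}. 1)"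
    by (rule sum.image_gen) simp
  also have "\<dots> = (\<Sum>C\<in>?C. 2)" by (rule sum.cong) (use two in simp_all)
  finally have "card ?C = d" by (simp add: card_Pos)
  then obtain h where h: "bij_betw h ?C {0..<d}"
    using ex_bij_betw_finite_nat[of ?C] by auto
  define g where "g = inv_into ?C h"
  have gh: "g (h C) = C" "h C < d" if "C \<in> ?C" for C
    using h that bij_betw_inv_into_left[OF h that] bij_betwE[OF h] by (auto simp: g_def)
  have hg: "h (g j) = j" "g j \<in> ?C" if "j < d" for j
    using that bij_betw_inv_into_right[OF h] bij_betwE[OF bij_betw_inv_into[OF h]] by (auto simp: g_def)
  define \<rho> where "\<rho> = (\<lambda>p. if p \<in> Pos d then (h (cl w p), p \<noteq> P (cl w p)) else p)"
  have inj: "inj_on \<rho> (Pos d)"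
  proof (rule inj_onI)
    fix p q assume pq: "p \<in> Pos d" "q \<in> Pos d" "\<rho> p = \<rho> q"
    then have h1: "h (cl w p) = h (cl w q)" and b: "(p = P (cl w p)) = (q = P (cl w q))"
      by (simp_all only: \<rho>_def if_True prod.inject simp_thms)
    have "cl w p \<in> ?C" "cl w q \<in> ?C" using pq by simp_all
    then have e: "cl w p = cl w q" using gh(1) h1 by metis
    show "p = q"
    proof (rule ccontr)
      assume "p \<noteq> q"
      then have "p \<noteq> P (cl w p)" "q \<noteq> P (cl w p)" using b e by metis+
      then show False using tf pq(1,2) e P[of "cl w p"] \<open>p \<noteq> q\<close> unfolding triple_free_def by (metis imageI)
    qed
  qed
  have "\<rho> ` Pos d \<subseteq> Pos d"
  proof (rule image_subsetI)
    fix p assume p: "p \<in> Pos d"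
    then have "h (cl w p) < d" by (intro gh(2) imageI)
    then show "\<rho> p \<in> Pos d" using p by (simp add: \<rho>_def Pos_iff)
  qed
  then have "bij_betw \<rho> (Pos d) (Pos d)"
    using inj endo_inj_surj[of "Pos d" \<rho>] by (simp add: bij_betw_def)
  then have perm: "\<rho> permutes Pos d" by (rule bij_imp_permutes) (simp add: \<rho>_def)
  have g_inj: "i = j" if ij: "i < d" "j < d" "g i = g j" for i j
    using hg(1)[OF ij(1)] hg(1)[OF ij(2)] ij(3) by metis
  have g_in: "fst C < nC \<and> snd C < n (fst C)" if C: "C \<in> ?C" for C
  proof -
    obtain p where p: "C = cl w p" "p \<in> Pos d" using C by (rule imageE)
    have "w p \<in> W" by (rule WW_in[OF w p(2)])
    then show ?thesis unfolding p(1) cl_def labels_iff by simp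
  qed
  have v: "valid (\<lambda>j. fst (g j)) (\<lambda>j. snd (g j))"
    unfolding valid_def prod.collapse using g_in[OF hg(2)] g_inj by simp
  have "w = wm \<rho> (\<lambda>j. fst (g j)) (\<lambda>j. snd (g j))"
  proof (rule WW_eqI[OF w wm_in[OF perm]])
    fix p assume p: "p \<in> Pos d"
    \<comment> \<open>Away from \<open>KO\<close>, the end other than \<open>P (cl w p)\<close>
      carries the dual label, since its partner is the chosen end.\<close>
    have "snd (snd (w p)) = (op \<and> p \<noteq> P (cl w p))"
    proof (cases "p = P (cl w p)")
      case True
      have "\<not> snd (snd (w (P (cl w p))))" by (rule P(3)) (rule imageI[OF p])
      then have "\<not> snd (snd (w p))" using True by metis
      then show ?thesis using True by metis
    next
      case False
      obtain q where q: "q \<in> Pos d" "q \<noteq> p" "cl w q = cl w p" "snd (snd (w q)) = (op \<and> \<not> snd (snd (w p)))"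
        using cl_partner[OF U w nz p] by metis
      have C: "cl w p \<in> ?C" using p by (rule imageI)
      have "q = P (cl w p)"
        using tf p q(1-3) False P(1,2)[OF C] unfolding triple_free_def by metis
      then have nq: "\<not> snd (snd (w q))" using P(3)[OF C] by simp
      show ?thesis
      proof (cases "k = KO")
        case True
        then show ?thesis using WW_in[OF w p] by (simp add: labels_iff)
      next
        case k: False
        then show ?thesis using q(4) nq False by simp
      qed
    qed
    moreover have "g (h (cl w p)) = cl w p" by (rule gh(1)) (rule imageI[OF p])
    ultimately show "w p = wm \<rho> (\<lambda>j. fst (g j)) (\<lambda>j. snd (g j)) p"
      using p by (simp add: wm_eq \<rho>_def cl_def prod_eq_iff)
  qed (use v in \<open>auto simp: valid_def\<close>)
  then show ?thesis using that perm v by blast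
qed

lemma valid_id:
  assumes "\<And>j. j < d \<Longrightarrow> c j < nC" "\<And>i. i < nC \<Longrightarrow> 3 * d \<le> n i"
  shows "valid c id"
  unfolding valid_def
proof (intro conjI allI impI)
  fix j assume j: "j < d"
  show "id j < n (c j)" using assms(2)[OF assms(1)[OF j]] j by simp
qed (use assms(1) in auto)

text \<open>Renaming normalises the names to \<open>id\<close>, so a matching word is recorded by
  \<open>\<rho>\<close> and the colours alone. This is the injectivity half of the
  evaluation.\<close>

theorem determined_by_matchings:
  assumes U: "kinv U" and big: "\<And>i. i < nC \<Longrightarrow> 3 * d \<le> n i"
    and w: "w \<in> WW" "U w \<noteq> 0"
  obtains \<rho> c where "\<rho> permutes Pos d" "c \<in> {..<d} \<rightarrow>\<^sub>E {..<nC}" "U (wm \<rho> c id) \<noteq> 0"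
proof -
  obtain w' where w': "w' \<in> WW" "U w' \<noteq> 0" "triple_free w'"
    using exists_triple_free[OF U big w] by blast
  then obtain \<rho> c a where m: "\<rho> permutes Pos d" "valid c a" "w' = wm \<rho> c a"
    using matching_form[OF U] by blast
  let ?c = "restrict c {..<d}"
  have "U w' = U (wm \<rho> c id)"
    unfolding m(3) using m(2) big by (intro rename[OF U m(1) m(2)] valid_id) (auto simp: valid_def)
  also have "wm \<rho> c id = wm \<rho> ?c id" by (rule wm_cong[OF m(1)]) auto
  finally have "U (wm \<rho> ?c id) \<noteq> 0" using w'(2) by simp
  moreover have "?c \<in> {..<d} \<rightarrow>\<^sub>E {..<nC}" using m(2) by (auto simp: valid_def)
  ultimately show ?thesis using that m(1) by blast
qed

end

section \<open>Functions on coloured matchings\<close>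

text \<open>Moves slots, or pairs, as wholes; together with the maps \<open>flip s\<close> these
  permutations generate the hyperoctahedral group on the positions.\<close>

definition hat :: "(nat \<Rightarrow> nat) \<Rightarrow> nat \<times> bool \<Rightarrow> nat \<times> bool" where
  "hat \<pi> = map_prod \<pi> id"

definition flip :: "nat \<Rightarrow> nat \<times> bool \<Rightarrow> nat \<times> bool" where
  "flip s = Transposition.transpose (s, False) (s, True)"

lemma hat_apply [simp]: "hat \<pi> p = (\<pi> (fst p), snd p)"
  by (cases p) (simp add: hat_def)

lemma hat_comp: "hat (f \<circ> g) = hat f \<circ> hat g"
  by (simp add: fun_eq_iff)

lemma hat_id: "hat id = id"
  by (simp add: fun_eq_iff)

lemma flip_flip: "flip s \<circ> flip s = id"
  by (simp add: flip_def)

lemma flip_apply: "flip s (j, b) = (j, if j = s then \<not> b else b)"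
  by (cases b) (auto simp: flip_def Transposition.transpose_def)

lemma inv_flip: "Hilbert_Choice.inv (flip s) = flip s"
  by (rule inv_unique_comp) (rule flip_flip)+

lemma flip_permutes: "s < d \<Longrightarrow> flip s permutes Pos d"
  unfolding flip_def by (rule permutes_swap_id) (simp_all add: Pos_iff)

lemma hat_permutes:
  assumes "\<pi> permutes {..<d}"
  shows "hat \<pi> permutes Pos d"
proof -
  have "bij (hat \<pi>)"
  proof (rule o_bij)
    show "hat (Hilbert_Choice.inv \<pi>) \<circ> hat \<pi> = id" "hat \<pi> \<circ> hat (Hilbert_Choice.inv \<pi>) = id"
      by (simp_all add: hat_comp[symmetric] permutes_inv_o[OF assms] hat_id)
  qed
  moreover have "hat \<pi> x = x" if "x \<notin> Pos d" for x
    using assms that by (cases x) (simp add: Pos_iff permutes_not_in)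
  ultimately show ?thesis unfolding permutes_def bij_iff by blast
qed

lemma inv_hat:
  assumes "\<pi> permutes {..<d}"
  shows "Hilbert_Choice.inv (hat \<pi>) = hat (Hilbert_Choice.inv \<pi>)"
  by (rule inv_unique_comp) (simp_all add: hat_comp[symmetric] permutes_inv_o[OF assms] hat_id)

lemma inv_comp:
  assumes "f permutes S" "g permutes S"
  shows "Hilbert_Choice.inv (f \<circ> g) = Hilbert_Choice.inv g \<circ> Hilbert_Choice.inv f"
  by (rule o_inv_distrib) (use assms permutes_bij in auto)

type_synonym matching_index = "(nat \<Rightarrow> nat) \<times> (nat \<times> bool \<Rightarrow> nat \<times> bool) \<times> (nat \<Rightarrow> nat)"

text \<open>
  \<open>fL\<close> and \<open>fR\<close> are the signs under exchanging the two ends of a slot and of a pair, \<open>None\<close> meaning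
  that there is no such symmetry; \<open>par\<close> says that the two ends of a pair sit at positions of
  opposite variance. Functions in \<open>Phi\<close> vanish at index triples outside the given finite sets.
\<close>

definition Phi :: "nat \<Rightarrow> nat \<Rightarrow> complex option \<Rightarrow> nat \<Rightarrow> complex option \<Rightarrow> bool \<Rightarrow> (matching_index \<Rightarrow> complex) set" where
  "Phi d nR fL nC fR par = {\<phi>.
     (\<forall>r \<rho> c. \<phi> (r, \<rho>, c) \<noteq> 0 \<longrightarrow> r \<in> {..<d} \<rightarrow>\<^sub>E {..<nR} \<and> \<rho> permutes Pos d \<and> c \<in> {..<d} \<rightarrow>\<^sub>E {..<nC} \<and>
       (par \<longrightarrow> (\<forall>x\<in>Pos d. snd (\<rho> x) = snd x))) \<and>
     (\<forall>r \<rho> c \<pi>. \<pi> permutes {..<d} \<longrightarrow> \<rho> permutes Pos d \<longrightarrow>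
       \<phi> (r \<circ> \<pi>, \<rho> \<circ> hat \<pi>, c) = \<phi> (r, \<rho>, c) \<and> \<phi> (r, hat \<pi> \<circ> \<rho>, c) = \<phi> (r, \<rho>, c \<circ> \<pi>)) \<and>
     (\<forall>r \<rho> c s. s < d \<longrightarrow> \<rho> permutes Pos d \<longrightarrow>
       (\<forall>\<eta>. fL = Some \<eta> \<longrightarrow> \<phi> (r, \<rho> \<circ> flip s, c) = \<eta> * \<phi> (r, \<rho>, c)) \<and>
       (\<forall>\<eta>. fR = Some \<eta> \<longrightarrow> \<phi> (r, flip s \<circ> \<rho>, c) = \<eta> * \<phi> (r, \<rho>, c)))}"

lemma PhiD:
  assumes "\<phi> \<in> Phi d nR fL nC fR par"
  shows "\<phi> (r, \<rho>, c) \<noteq> 0 \<Longrightarrow> r \<in> {..<d} \<rightarrow>\<^sub>E {..<nR} \<and> \<rho> permutes Pos d \<and> c \<in> {..<d} \<rightarrow>\<^sub>E {..<nC}"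
    and "\<phi> (r, \<rho>, c) \<noteq> 0 \<Longrightarrow> par \<Longrightarrow> x \<in> Pos d \<Longrightarrow> snd (\<rho> x) = snd x"
    and "\<pi> permutes {..<d} \<Longrightarrow> \<rho> permutes Pos d \<Longrightarrow> \<phi> (r \<circ> \<pi>, \<rho> \<circ> hat \<pi>, c) = \<phi> (r, \<rho>, c)"
    and "\<pi> permutes {..<d} \<Longrightarrow> \<rho> permutes Pos d \<Longrightarrow> \<phi> (r, hat \<pi> \<circ> \<rho>, c) = \<phi> (r, \<rho>, c \<circ> \<pi>)"
    and "s < d \<Longrightarrow> \<rho> permutes Pos d \<Longrightarrow> fL = Some \<eta> \<Longrightarrow> \<phi> (r, \<rho> \<circ> flip s, c) = \<eta> * \<phi> (r, \<rho>, c)"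
    and "s < d \<Longrightarrow> \<rho> permutes Pos d \<Longrightarrow> fR = Some \<eta> \<Longrightarrow> \<phi> (r, flip s \<circ> \<rho>, c) = \<eta> * \<phi> (r, \<rho>, c)"
  using assms unfolding Phi_def by simp_all

lemma prod_Pos: "(\<Prod>p\<in>Pos d. g p) = (\<Prod>j<d. g (j, False) * g (j, True))"
proof -
  have "(\<Prod>p\<in>Pos d. g p) = (\<Prod>j<d. \<Prod>b\<in>UNIV. g (j, b))"
    unfolding Pos_def by (simp add: prod.cartesian_product)
  then show ?thesis by (simp add: UNIV_bool mult.commute)
qed

fun flip_sign :: "kind \<Rightarrow> complex option" where
  "flip_sign KO = Some 1" | "flip_sign KGL = None" | "flip_sign KSp = Some (- 1)"

section \<open>Evaluation of invariant tensors\<close>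

context std_inv
begin

definition RR :: "nat \<Rightarrow> (nat \<Rightarrow> nat) set" where "RR nR = {..<d} \<rightarrow>\<^sub>E {..<nR}"

text \<open>A family of invariant tensors indexed by the slot colours \<open>r\<close>. A slot
  permutation moves the colour of a slot together with its two labels; \<open>fL\<close> governs the
  exchange of the two labels inside a slot.\<close>

definition tensors :: "nat \<Rightarrow> complex option \<Rightarrow> bool \<Rightarrow> ((nat \<Rightarrow> nat) \<Rightarrow> (nat \<times> bool \<Rightarrow> label) \<Rightarrow> complex) set" where
  "tensors nR fL par = {T. (\<forall>r\<in>RR nR. kinv (T r)) \<and>
     (\<forall>r\<in>RR nR. \<forall>w\<in>WW. \<forall>\<pi>. \<pi> permutes {..<d} \<longrightarrow> T (r \<circ> \<pi>) (w \<circ> hat \<pi>) = T r w) \<and>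
     (\<forall>\<eta>. fL = Some \<eta> \<longrightarrow> (\<forall>r\<in>RR nR. \<forall>w\<in>WW. \<forall>s<d. T r (w \<circ> flip s) = \<eta> * T r w)) \<and>
     (par \<longrightarrow> (\<forall>r\<in>RR nR. \<forall>w\<in>WW. T r w \<noteq> 0 \<longrightarrow> (\<forall>p\<in>Pos d. snd (snd (w p)) = snd p)))}"

definition ev :: "nat \<Rightarrow> ((nat \<Rightarrow> nat) \<Rightarrow> (nat \<times> bool \<Rightarrow> label) \<Rightarrow> complex) \<Rightarrow> matching_index \<Rightarrow> complex" where
  "ev nR T = (\<lambda>(r, \<rho>, c). if r \<in> RR nR \<and> \<rho> permutes Pos d \<and> c \<in> {..<d} \<rightarrow>\<^sub>E {..<nC}
     then T r (wm \<rho> c id) else 0)"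

lemma wm_comp:
  assumes "q permutes Pos d"
  shows "wm (\<rho> \<circ> q) c a = wm \<rho> c a \<circ> q"
proof
  fix p
  show "wm (\<rho> \<circ> q) c a p = (wm \<rho> c a \<circ> q) p"
    using permutes_in_image[OF assms, of p] by (cases "p \<in> Pos d") (simp_all add: wm_eq wm_undefined)
qed

lemma comp_mem_iff:
  assumes "\<pi> permutes A"
  shows "r \<circ> \<pi> \<in> A \<rightarrow>\<^sub>E B \<longleftrightarrow> r \<in> A \<rightarrow>\<^sub>E B"
proof
  assume "r \<circ> \<pi> \<in> A \<rightarrow>\<^sub>E B"
  from PiE_permute[OF this permutes_inv[OF assms]]
  show "r \<in> A \<rightarrow>\<^sub>E B" by (simp add: comp_assoc permutes_inv_o[OF assms])
qed (rule PiE_permute[OF _ assms])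

lemma comp_permutes_iff:
  assumes "q permutes S"
  shows "\<rho> \<circ> q permutes S \<longleftrightarrow> \<rho> permutes S" "q \<circ> \<rho> permutes S \<longleftrightarrow> \<rho> permutes S"
proof -
  have 1: "\<rho> \<circ> q \<circ> Hilbert_Choice.inv q = \<rho>" "Hilbert_Choice.inv q \<circ> (q \<circ> \<rho>) = \<rho>"
    by (simp_all add: comp_assoc permutes_inv_o[OF assms] o_assoc)
  show "\<rho> \<circ> q permutes S \<longleftrightarrow> \<rho> permutes S"
    using permutes_compose[OF assms, of \<rho>] permutes_compose[OF permutes_inv[OF assms], of "\<rho> \<circ> q"] 1(1) by auto
  show "q \<circ> \<rho> permutes S \<longleftrightarrow> \<rho> permutes S"
    using permutes_compose[OF _ assms, of \<rho>] permutes_compose[OF _ permutes_inv[OF assms], of "q \<circ> \<rho>"] 1(2) by auto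
qed

text \<open>Multiplying \<open>\<rho>\<close> on the right permutes the positions of the word, so
  these symmetries are the tensor's own. Multiplying on the left permutes or reverses the pairs:
  permuting is harmless by \<open>rename\<close>, and reversing is trivial for \<open>KO\<close> and
  costs the sign of \<open>flip_relation\<close> for \<open>KSp\<close>.\<close>

lemma ev_in_Phi:
  assumes T: "T \<in> tensors nR fL par" and big: "\<And>i. i < nC \<Longrightarrow> 3 * d \<le> n i" and par: "par \<Longrightarrow> k = KGL"
  shows "ev nR T \<in> Phi d nR fL nC (flip_sign k) par"
proof -
  have Tk: "kinv (T r)" if "r \<in> RR nR" for r using T that by (simp add: tensors_def)
  have wW: "wm \<rho> c id \<in> WW" if "\<rho> permutes Pos d" "c \<in> {..<d} \<rightarrow>\<^sub>E {..<nC}" for \<rho> c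
  proof (rule wm_in[OF that(1)])
    fix j assume "j < d"
    moreover then have "c j < nC" using that(2) by auto
    ultimately show "c j < nC \<and> id j < n (c j)" using big[of "c j"] by simp
  qed
  show ?thesis unfolding Phi_def
  proof (intro CollectI conjI allI impI)
    fix r \<rho> c assume nz: "ev nR T (r, \<rho>, c) \<noteq> 0"
    then have m: "r \<in> RR nR" "\<rho> permutes Pos d" "c \<in> {..<d} \<rightarrow>\<^sub>E {..<nC}" "T r (wm \<rho> c id) \<noteq> 0"
      by (auto simp: ev_def split: if_splits)
    show "r \<in> {..<d} \<rightarrow>\<^sub>E {..<nR}" "\<rho> permutes Pos d" "c \<in> {..<d} \<rightarrow>\<^sub>E {..<nC}"
      using m by (simp_all add: RR_def)
    assume p: par
    have op using par[OF p] by simp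
    show "\<forall>x\<in>Pos d. snd (\<rho> x) = snd x"
    proof
      fix x assume x: "x \<in> Pos d"
      have "snd (snd (wm \<rho> c id x)) = snd x"
        using T m wW[OF m(2,3)] x p by (simp add: tensors_def)
      then show "snd (\<rho> x) = snd x"
        using \<open>op\<close> by (simp only: wm_eq[OF x] snd_conv simp_thms)
    qed
  next
    fix r \<rho> c \<pi> assume pi: "\<pi> permutes {..<d}" and rho: "\<rho> permutes Pos d"
    note hp = hat_permutes[OF pi]
    have RR: "r \<circ> \<pi> \<in> RR nR \<longleftrightarrow> r \<in> RR nR" unfolding RR_def by (rule comp_mem_iff[OF pi])
    have CC: "c \<circ> \<pi> \<in> {..<d} \<rightarrow>\<^sub>E {..<nC} \<longleftrightarrow> c \<in> {..<d} \<rightarrow>\<^sub>E {..<nC}" by (rule comp_mem_iff[OF pi])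
    have "T (r \<circ> \<pi>) (wm \<rho> c id \<circ> hat \<pi>) = T r (wm \<rho> c id)" if "r \<in> RR nR" "c \<in> {..<d} \<rightarrow>\<^sub>E {..<nC}"
      using T that pi wW[OF rho that(2)] by (simp add: tensors_def)
    then show "ev nR T (r \<circ> \<pi>, \<rho> \<circ> hat \<pi>, c) = ev nR T (r, \<rho>, c)"
      using rho by (simp add: ev_def RR comp_permutes_iff[OF hp] wm_comp[OF hp])
    have "T r (wm (hat \<pi> \<circ> \<rho>) c id) = T r (wm \<rho> (c \<circ> \<pi>) id)" if r: "r \<in> RR nR" and c: "c \<in> {..<d} \<rightarrow>\<^sub>E {..<nC}"
    proof -
      have cc: "c \<circ> \<pi> \<in> {..<d} \<rightarrow>\<^sub>E {..<nC}" by (simp only: CC c)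
      have cp: "(c \<circ> \<pi>) j < nC" if "j < d" for j
        using PiE_mem[OF cc, of j] that by (simp only: lessThan_iff)
      have v1: "valid (c \<circ> \<pi>) id" by (rule valid_id[OF cp big])
      have v2: "valid (c \<circ> \<pi>) (id \<circ> \<pi>)"
        unfolding valid_def
      proof (intro conjI allI impI)
        fix i j assume "((c \<circ> \<pi>) i, (id \<circ> \<pi>) i) = ((c \<circ> \<pi>) j, (id \<circ> \<pi>) j)"
        then show "i = j" using permutes_inj[OF pi] by (simp add: inj_eq)
      next
        fix j assume j: "j < d"
        show "(c \<circ> \<pi>) j < nC" by (rule cp[OF j])
        have "\<pi> j < d" using permutes_in_image[OF pi, of j] j by simp
        then show "(id \<circ> \<pi>) j < n ((c \<circ> \<pi>) j)" using big[OF cp[OF j]] by simp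
      qed
      \<comment> \<open>A permutation of the pairs acts on colours and names together; the names are
        then renamed back to \<open>id\<close>.\<close>
      have e: "wm (hat \<pi> \<circ> \<rho>) c id = wm \<rho> (c \<circ> \<pi>) (id \<circ> \<pi>)" by (simp add: wm_def)
      show ?thesis unfolding e by (rule rename[OF Tk[OF r] rho v2 v1 big])
    qed
    then show "ev nR T (r, hat \<pi> \<circ> \<rho>, c) = ev nR T (r, \<rho>, c \<circ> \<pi>)"
      using rho by (simp add: ev_def CC comp_permutes_iff[OF hp])
  next
    fix r \<rho> c s \<eta> assume s: "s < d" and rho: "\<rho> permutes Pos d" and e: "fL = Some \<eta>"
    note fp = flip_permutes[OF s]
    show "ev nR T (r, \<rho> \<circ> flip s, c) = \<eta> * ev nR T (r, \<rho>, c)"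
      using T e s rho wW by (simp add: ev_def comp_permutes_iff[OF fp] wm_comp[OF fp] tensors_def)
  next
    fix r \<rho> c s \<eta> assume s: "s < d" and rho: "\<rho> permutes Pos d" and e: "flip_sign k = Some \<eta>"
    note fp = flip_permutes[OF s]
    let ?q = "\<lambda>b. Hilbert_Choice.inv \<rho> (s, b)"
    have rs: "\<rho> (?q b) = (s, b)" "Hilbert_Choice.inv \<rho> (\<rho> x) = x" for b x using permutes_inverses[OF rho] by simp_all
    have qP: "?q b \<in> Pos d" for b using permutes_in_image[OF permutes_inv[OF rho]] s by (simp add: Pos_iff)
    have "T r (wm (flip s \<circ> \<rho>) c id) = \<eta> * T r (wm \<rho> c id)" if r: "r \<in> RR nR" and c: "c \<in> {..<d} \<rightarrow>\<^sub>E {..<nC}"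
    proof (cases "k = KO")
      case True
      have "fst (flip s x) = fst x" for x by (cases x) (simp add: flip_apply)
      then have "wm (flip s \<circ> \<rho>) c id = wm \<rho> c id" unfolding wm_def using True by simp
      moreover have "\<eta> = 1" using e unfolding True by simp
      ultimately show ?thesis by (simp only: mult_1)
    next
      case False
      then have k: "k = KSp" and eta: "\<eta> = - 1" using e by (cases k; simp)+
      let ?w = "wm \<rho> c id"
      have "T r (?w(?q False := (c s, s, True), ?q True := (c s, s, False))) = - T r ?w"
      proof (rule flip_relation[OF Tk[OF r] k wW[OF rho c] qP _ qP])
        show "?w (?q False) = (c s, s, False)" "?w (?q True) = (c s, s, True)"
          using False by (simp_all add: wm_eq[OF qP] rs)
        fix u b assume u: "u \<in> Pos d" "?w u = (c s, s, b)"
        obtain i b' where ib: "\<rho> u = (i, b')" by (cases "\<rho> u")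
        have "i = s" using u(2) unfolding wm_eq[OF u(1)] ib by simp
        then have "u = ?q b'" using rs(2)[of u] unfolding ib by simp
        then show "u = ?q False \<or> u = ?q True" by (cases b') simp_all
      qed
      moreover have "?w(?q False := (c s, s, True), ?q True := (c s, s, False)) = wm (flip s \<circ> \<rho>) c id"
      proof
        fix x
        show "(?w(?q False := (c s, s, True), ?q True := (c s, s, False))) x = wm (flip s \<circ> \<rho>) c id x"
        proof (cases "x \<in> Pos d")
          case x: True
          consider "x = ?q True" | "x = ?q False" | "fst (\<rho> x) \<noteq> s"
            by (cases "\<rho> x") (metis fst_conv rs(2))
          then show ?thesis
          proof cases
            case 1
            then show ?thesis using False qP by (simp add: wm_eq rs flip_apply)
          next
            case 2
            moreover have "?q False \<noteq> ?q True" using rs(1)[of True] rs(1)[of False] by auto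
            ultimately show ?thesis using False qP by (simp add: wm_eq rs flip_apply)
          next
            case 3
            then have "x \<noteq> ?q True" "x \<noteq> ?q False" using rs(1) by auto
            moreover have "flip s (\<rho> x) = \<rho> x" using 3 by (cases "\<rho> x") (simp add: flip_apply)
            ultimately show ?thesis using x by (simp add: wm_eq)
          qed
        next
          case x: False
          then have "x \<noteq> ?q True" "x \<noteq> ?q False" using qP by metis+
          then show ?thesis using x by (simp add: wm_undefined)
        qed
      qed
      ultimately show ?thesis by (simp only: eta minus_mult_left mult_1 mult_minus1)
    qed
    then show "ev nR T (r, flip s \<circ> \<rho>, c) = \<eta> * ev nR T (r, \<rho>, c)"
      using rho by (simp add: ev_def comp_permutes_iff[OF fp])
  qed
qed

lemma ev_eq_0:
  assumes T: "T \<in> tensors nR fL par" and big: "\<And>i. i < nC \<Longrightarrow> 3 * d \<le> n i"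
    and z: "ev nR T = (\<lambda>_. 0)" and r: "r \<in> RR nR" and w: "w \<in> WW"
  shows "T r w = 0"
proof (rule ccontr)
  assume nz: "T r w \<noteq> 0"
  have U: "kinv (T r)" using T r by (simp add: tensors_def)
  obtain \<rho> c where "\<rho> permutes Pos d" "c \<in> {..<d} \<rightarrow>\<^sub>E {..<nC}" "T r (wm \<rho> c id) \<noteq> 0"
    by (rule determined_by_matchings[OF U big w nz])
  then show False using r fun_cong[OF z, of "(r, \<rho>, c)"] by (simp add: ev_def)
qed

end

section \<open>Contractions as an inverse of the evaluation\<close>

context std_inv
begin

text \<open>Complete contraction of a word along a matching. Here \<open>\<sigma>\<close> leads from
  ends of pairs to positions, so it plays the role of the inverse of \<open>\<rho>\<close>.\<close>

definition pairing :: "(nat \<times> bool \<Rightarrow> nat \<times> bool) \<Rightarrow> (nat \<times> bool \<Rightarrow> label) \<Rightarrow> complex" where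
  "pairing \<sigma> w = (\<Prod>j<d. beta k (w (\<sigma> (j, False))) (w (\<sigma> (j, True))))"

definition pcols :: "(nat \<times> bool \<Rightarrow> nat \<times> bool) \<Rightarrow> (nat \<times> bool \<Rightarrow> label) \<Rightarrow> nat \<Rightarrow> nat" where
  "pcols \<sigma> w = restrict (\<lambda>j. fst (w (\<sigma> (j, False)))) {..<d}"

text \<open>Summation over all \<open>\<sigma>\<close> turns the equivariance of
  \<open>\<phi>\<close> into symmetry of the tensor. Colours are read at the False ends only, which
  suffices because \<open>beta\<close> vanishes on unequal colours.\<close>

definition Ft :: "(matching_index \<Rightarrow> complex) \<Rightarrow> (nat \<Rightarrow> nat) \<Rightarrow> (nat \<times> bool \<Rightarrow> label) \<Rightarrow> complex" where
  "Ft \<phi> r w = (\<Sum>\<sigma> | \<sigma> permutes Pos d. \<phi> (r, Hilbert_Choice.inv \<sigma>, pcols \<sigma> w) * pairing \<sigma> w)"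

text \<open>A word on the \<open>2 d\<close> positions is a \<open>d\<close>-tuple of pairs of
  labels, so the sum over words factors.\<close>

lemma sum_WW_pairs:
  "(\<Sum>v\<in>WW. \<Prod>j<d. G j (v (j, False)) (v (j, True))) = (\<Prod>j<d. \<Sum>z\<in>W. \<Sum>z'\<in>W. G j z z' :: complex)"
proof -
  have "(\<Prod>j<d. \<Sum>z\<in>W. \<Sum>z'\<in>W. G j z z') = (\<Prod>j<d. \<Sum>x\<in>W \<times> W. G j (fst x) (snd x))"
    by (simp add: sum.cartesian_product split_beta)
  also have "\<dots> = (\<Sum>g\<in>{..<d} \<rightarrow>\<^sub>E W \<times> W. \<Prod>j<d. G j (fst (g j)) (snd (g j)))"
    by (rule prod_sum_PiE) simp_all
  also have "\<dots> = (\<Sum>v\<in>WW. \<Prod>j<d. G j (v (j, False)) (v (j, True)))"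
  proof -
    define V where "V = (\<lambda>g :: nat \<Rightarrow> label \<times> label.
      restrict (\<lambda>p. if snd p then snd (g (fst p)) else fst (g (fst p))) (Pos d))"
    define H where "H = (\<lambda>v :: nat \<times> bool \<Rightarrow> label. restrict (\<lambda>s. (v (s, False), v (s, True))) {..<d})"
    have V: "V g (s, False) = fst (g s)" "V g (s, True) = snd (g s)" if "s < d" for g s
      using that by (simp_all add: V_def Pos_iff)
    have 1: "V g \<in> WW" if g: "g \<in> {..<d} \<rightarrow>\<^sub>E W \<times> W" for g
      unfolding WW_def
    proof (rule PiE_I)
      fix p assume p: "p \<in> Pos d"
      then have "g (fst p) \<in> W \<times> W" by (intro PiE_mem[OF g]) (simp add: Pos_iff)
      then show "V g p \<in> W" using p by (simp add: mem_Times_iff V_def)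
    qed (simp add: V_def)
    have 2: "H v \<in> {..<d} \<rightarrow>\<^sub>E W \<times> W" if v: "v \<in> WW" for v
    proof (rule PiE_I)
      fix s assume s: "s \<in> {..<d}"
      then have "v (s, b) \<in> W" for b by (intro WW_in[OF v]) (simp add: Pos_iff)
      then show "H v s \<in> W \<times> W" using s by (simp add: H_def)
    qed (simp add: H_def)
    have 3: "H (V g) = g" if g: "g \<in> {..<d} \<rightarrow>\<^sub>E W \<times> W" for g
    proof (rule PiE_ext[OF 2[OF 1[OF g]] g])
      fix s assume "s \<in> {..<d}"
      then show "H (V g) s = g s" by (simp add: H_def V)
    qed
    have 4: "V (H v) = v" if v: "v \<in> WW" for v
    proof (rule WW_eqI[OF 1[OF 2[OF v]] v])
      fix p assume p: "p \<in> Pos d"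
      obtain s b where sb: "p = (s, b)" by (cases p)
      then show "V (H v) p = v p" using p by (cases b) (simp_all add: V_def H_def Pos_iff)
    qed
    have "bij_betw V ({..<d} \<rightarrow>\<^sub>E W \<times> W) WW"
      by (rule bij_betw_byWitness[where f' = H])
        (use 1 2 3 4 in \<open>simp_all only: image_subset_iff, simp_all\<close>)
    from sum.reindex_bij_betw[OF this, of "\<lambda>v. \<Prod>j<d. G j (v (j, False)) (v (j, True))", symmetric]
    show ?thesis by (simp add: V)
  qed
  finally show ?thesis by simp
qed

lemma WW_comp: "w \<in> WW \<Longrightarrow> \<sigma> permutes Pos d \<Longrightarrow> w \<circ> \<sigma> \<in> WW"
  unfolding WW_def by (rule PiE_permute)

text \<open>After reindexing by \<open>\<sigma>\<close> the sum factors over the pairs, and each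
  factor is the defining identity of an isometry.\<close>

lemma pairing_invariant:
  assumes h: "h \<in> isom k nC n" and w: "w \<in> WW" and s: "\<sigma> permutes Pos d"
  shows "(\<Sum>v\<in>WW. pairing \<sigma> v * (\<Prod>p\<in>Pos d. h (w p) (v p))) = pairing \<sigma> w"
proof -
  let ?w = "w \<circ> \<sigma>"
  have wW: "?w \<in> WW" by (rule WW_comp[OF w s])
  let ?G = "\<lambda>j z z'. h (?w (j, False)) z * h (?w (j, True)) z' * beta k z z'"
  have 1: "pairing \<sigma> v * (\<Prod>p\<in>Pos d. h (w p) (v p)) =
      (\<Prod>j<d. ?G j ((v \<circ> \<sigma>) (j, False)) ((v \<circ> \<sigma>) (j, True)))" for v
  proof -
    have "(\<Prod>p\<in>Pos d. h (w p) (v p)) = (\<Prod>p\<in>Pos d. h (w (\<sigma> p)) (v (\<sigma> p)))"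
      using prod.permute[OF s, of "\<lambda>p. h (w p) (v p)"] by (simp add: o_def)
    then show ?thesis
      by (simp add: pairing_def prod_Pos prod.distrib mult_ac)
  qed
  have "(\<Sum>v\<in>WW. pairing \<sigma> v * (\<Prod>p\<in>Pos d. h (w p) (v p))) =
     (\<Sum>v\<in>WW. \<Prod>j<d. ?G j ((v \<circ> \<sigma>) (j, False)) ((v \<circ> \<sigma>) (j, True)))"
    by (simp only: 1)
  also have "\<dots> = (\<Sum>v\<in>WW. \<Prod>j<d. ?G j (v (j, False)) (v (j, True)))"
    using sum.reindex_bij_betw[OF bij_betw_PiE_permute[OF s, of W],
        of "\<lambda>v. \<Prod>j<d. ?G j (v (j, False)) (v (j, True))"] by (simp only: WW_def)
  also have "\<dots> = (\<Prod>j<d. \<Sum>z\<in>W. \<Sum>z'\<in>W. ?G j z z')" by (rule sum_WW_pairs)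
  also have "\<dots> = (\<Prod>j<d. beta k (?w (j, False)) (?w (j, True)))"
  proof (rule prod.cong[OF refl])
    fix j assume "j \<in> {..<d}"
    then have "?w (j, False) \<in> W" "?w (j, True) \<in> W" by (intro WW_in[OF wW]; simp add: Pos_iff)+
    then show "(\<Sum>z\<in>W. \<Sum>z'\<in>W. ?G j z z') = beta k (?w (j, False)) (?w (j, True))"
      using h unfolding isom_def by blast
  qed
  finally show ?thesis by (simp add: pairing_def)
qed

text \<open>The coefficient depends on the word through \<open>pcols\<close>, so invariance of the
  contractions is not enough by itself. Isometries preserve colours, however: wherever the product
  of entries of \<open>h\<close> is nonzero, \<open>v\<close> and \<open>w\<close> have the same
  colours.\<close>

lemma kinv_Ft: "kinv (Ft \<phi> r)"
  unfolding kinv_def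
proof (intro ballI)
  fix h w assume h: "h \<in> isom k nC n" and w: "w \<in> WW"
  let ?H = "\<lambda>v. \<Prod>p\<in>Pos d. h (w p) (v p)"
  have c: "\<phi> (r, \<rho>, pcols \<sigma> v) * ?H v = \<phi> (r, \<rho>, pcols \<sigma> w) * ?H v"
    if v: "v \<in> WW" and s: "\<sigma> permutes Pos d" for v \<sigma> \<rho>
  proof (cases "?H v = 0")
    case False
    have e1: "fst (v p) = fst (w p)" if p: "p \<in> Pos d" for p
    proof -
      have "h (w p) (v p) \<noteq> 0" using False p by (auto simp: prod_zero_iff)
      then have "fst (w p) = fst (v p)"
        using h WW_in[OF v p] WW_in[OF w p] unfolding isom_def by blast
      then show ?thesis by simp
    qed
    have e2: "\<sigma> (j, False) \<in> Pos d" if "j < d" for j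
      using permutes_in_image[OF s] that by (simp add: Pos_iff)
    have "pcols \<sigma> v = pcols \<sigma> w" unfolding pcols_def by (rule restrict_ext) (simp add: e1 e2)
    then show ?thesis by simp
  qed simp
  have "(\<Sum>v\<in>WW. Ft \<phi> r v * ?H v) =
     (\<Sum>v\<in>WW. \<Sum>\<sigma> | \<sigma> permutes Pos d. \<phi> (r, Hilbert_Choice.inv \<sigma>, pcols \<sigma> v) * ?H v * pairing \<sigma> v)"
    unfolding Ft_def sum_distrib_right by (intro sum.cong refl) (simp add: mult_ac)
  also have "\<dots> = (\<Sum>v\<in>WW. \<Sum>\<sigma> | \<sigma> permutes Pos d. \<phi> (r, Hilbert_Choice.inv \<sigma>, pcols \<sigma> w) * (pairing \<sigma> v * ?H v))"
  proof (intro sum.cong refl)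
    fix v \<sigma> assume v: "v \<in> WW" and "\<sigma> \<in> {\<sigma>. \<sigma> permutes Pos d}"
    then have s: "\<sigma> permutes Pos d" by simp
    show "\<phi> (r, Hilbert_Choice.inv \<sigma>, pcols \<sigma> v) * ?H v * pairing \<sigma> v =
        \<phi> (r, Hilbert_Choice.inv \<sigma>, pcols \<sigma> w) * (pairing \<sigma> v * ?H v)"
      unfolding c[OF v s] by (simp only: mult_ac)
  qed
  also have "\<dots> = (\<Sum>\<sigma> | \<sigma> permutes Pos d. \<phi> (r, Hilbert_Choice.inv \<sigma>, pcols \<sigma> w) * (\<Sum>v\<in>WW. pairing \<sigma> v * ?H v))"
    by (subst sum.swap) (simp add: sum_distrib_left)
  also have "\<dots> = Ft \<phi> r w"
    unfolding Ft_def by (intro sum.cong refl) (simp add: pairing_invariant[OF h w])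
  finally show "(\<Sum>v\<in>WW. Ft \<phi> r v * ?H v) = Ft \<phi> r w" .
qed

text \<open>Substituting the composite of \<open>q\<close> and \<open>\<sigma>\<close> for
  \<open>\<sigma>\<close> transfers a permutation of the positions from the word to the right of the
  permutation in \<open>\<phi>\<close>.\<close>

lemma Ft_comp:
  assumes q: "q permutes Pos d"
  shows "Ft \<phi> r w = (\<Sum>\<sigma> | \<sigma> permutes Pos d. \<phi> (r, Hilbert_Choice.inv \<sigma> \<circ> Hilbert_Choice.inv q, pcols \<sigma> (w \<circ> q)) * pairing \<sigma> (w \<circ> q))"
  unfolding Ft_def
proof (subst setum_permutations_compose_left[OF q], intro sum.cong refl)
  fix \<sigma> assume "\<sigma> \<in> {\<sigma>. \<sigma> permutes Pos d}"
  then have "Hilbert_Choice.inv (q \<circ> \<sigma>) = Hilbert_Choice.inv \<sigma> \<circ> Hilbert_Choice.inv q"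
    by (intro inv_comp[OF q]) simp
  moreover have "pcols (q \<circ> \<sigma>) w = pcols \<sigma> (w \<circ> q)" "pairing (q \<circ> \<sigma>) w = pairing \<sigma> (w \<circ> q)"
    by (simp_all add: pcols_def pairing_def)
  ultimately show "\<phi> (r, Hilbert_Choice.inv (q \<circ> \<sigma>), pcols (q \<circ> \<sigma>) w) * pairing (q \<circ> \<sigma>) w =
      \<phi> (r, Hilbert_Choice.inv \<sigma> \<circ> Hilbert_Choice.inv q, pcols \<sigma> (w \<circ> q)) * pairing \<sigma> (w \<circ> q)" by simp
qed

lemma Ft_in_tensors:
  assumes phi: "\<phi> \<in> Phi d nR fL nC fR par" and par: "par \<Longrightarrow> k = KGL"
  shows "Ft \<phi> \<in> tensors nR fL par"
  unfolding tensors_def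
proof (intro CollectI conjI ballI allI impI)
  show "kinv (Ft \<phi> r)" for r by (rule kinv_Ft)
next
  fix r w \<pi>
  assume pi: "\<pi> permutes {..<d}"
  note hp = hat_permutes[OF pi]
  have e: "\<phi> (r \<circ> \<pi>, Hilbert_Choice.inv \<sigma>, c) = \<phi> (r, Hilbert_Choice.inv \<sigma> \<circ> Hilbert_Choice.inv (hat \<pi>), c)"
    if s: "\<sigma> permutes Pos d" for \<sigma> c
  proof -
    have "Hilbert_Choice.inv \<sigma> \<circ> Hilbert_Choice.inv (hat \<pi>) permutes Pos d"
      by (intro permutes_compose permutes_inv hp s)
    from PhiD(3)[OF phi pi this, of r c] show ?thesis
      by (simp add: comp_assoc permutes_inv_o[OF hp])
  qed
  have "Ft \<phi> (r \<circ> \<pi>) (w \<circ> hat \<pi>) = Ft \<phi> r w"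
    unfolding Ft_comp[OF hp, of \<phi> r w] Ft_def[of \<phi> "r \<circ> \<pi>"]
    by (rule sum.cong[OF refl]) (simp only: mem_Collect_eq e)
  then show "Ft \<phi> (r \<circ> \<pi>) (w \<circ> hat \<pi>) = Ft \<phi> r w" .
next
  fix \<eta> r and w :: "nat \<times> bool \<Rightarrow> label" and s assume e: "fL = Some \<eta>" and s: "s < d"
  have "w \<circ> flip s \<circ> flip s = w" by (simp add: comp_assoc flip_flip)
  then have "Ft \<phi> r (w \<circ> flip s) =
     (\<Sum>\<sigma> | \<sigma> permutes Pos d. \<phi> (r, Hilbert_Choice.inv \<sigma> \<circ> flip s, pcols \<sigma> w) * pairing \<sigma> w)"
    using Ft_comp[OF flip_permutes[OF s], of \<phi> r "w \<circ> flip s"] by (simp add: inv_flip)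
  also have "\<dots> = (\<Sum>\<sigma> | \<sigma> permutes Pos d. \<eta> * (\<phi> (r, Hilbert_Choice.inv \<sigma>, pcols \<sigma> w) * pairing \<sigma> w))"
    by (intro sum.cong refl) (simp add: PhiD(5)[OF phi s permutes_inv e])
  finally show "Ft \<phi> r (w \<circ> flip s) = \<eta> * Ft \<phi> r w"
    by (simp add: Ft_def sum_distrib_left)
next
  fix r and w :: "nat \<times> bool \<Rightarrow> label" and p assume par': par and nz: "Ft \<phi> r w \<noteq> 0" and p: "p \<in> Pos d"
  have k: "k = KGL" by (rule par[OF par'])
  obtain \<sigma> where s: "\<sigma> permutes Pos d" "\<phi> (r, Hilbert_Choice.inv \<sigma>, pcols \<sigma> w) * pairing \<sigma> w \<noteq> 0"
    using nz unfolding Ft_def by (elim sum.not_neutral_contains_not_neutral) simp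
  \<comment> \<open>\<open>\<phi>\<close> forces \<open>\<sigma>\<close> to keep the ends, and
    \<open>beta\<close> for \<open>KGL\<close> is nonzero only on a plain label followed by a dual
    one. So the label at a position has the polarity of its end.\<close>
  let ?x = "Hilbert_Choice.inv \<sigma> p"
  have "\<phi> (r, Hilbert_Choice.inv \<sigma>, pcols \<sigma> w) \<noteq> 0" using s(2) by simp
  from PhiD(2)[OF phi this par' p] have x: "snd ?x = snd p" .
  have xd: "fst ?x < d" using permutes_fst_less[OF permutes_inv[OF s(1)] p] .
  have "pairing \<sigma> w \<noteq> 0" using s(2) by simp
  then have "beta k (w (\<sigma> (fst ?x, False))) (w (\<sigma> (fst ?x, True))) \<noteq> 0"
    using xd by (auto simp: pairing_def prod_zero_iff)
  moreover have "beta KGL a b \<noteq> 0 \<Longrightarrow> \<not> snd (snd a) \<and> snd (snd b)" for a b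
    by (cases a, cases b) (auto split: if_splits)
  ultimately have "\<not> snd (snd (w (\<sigma> (fst ?x, False))))" "snd (snd (w (\<sigma> (fst ?x, True))))" using k by auto
  then have "snd (snd (w (\<sigma> (fst ?x, b)))) = b" for b by (cases b) simp_all
  from this[of "snd ?x"] have "snd (snd (w (\<sigma> ?x))) = snd ?x" by (simp only: prod.collapse)
  then show "snd (snd (w p)) = snd p" by (simp only: permutes_inverses(1)[OF s(1)] x)
qed


lemma beta_swap: "flip_sign k = Some \<zeta> \<Longrightarrow> beta k x y = \<zeta> * beta k y x"
  by (cases k; cases x; cases y) auto

lemma flip_sign_sq: "flip_sign k = Some \<zeta> \<Longrightarrow> \<zeta> * \<zeta> = 1"
  by (cases k) auto

text \<open>
  The \<open>\<sigma>\<close> that contribute to \<open>Ft \<phi>\<close> at a matching word; each contributes the same value, so \<open>ev\<close> inverts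
  \<open>Ft\<close> up to the factor \<open>card good\<close>.
\<close>

definition good :: "(nat \<times> bool \<Rightarrow> nat \<times> bool) set" where
  "good = {\<sigma>. \<sigma> permutes Pos d \<and> (\<forall>j<d. fst (\<sigma> (j, False)) = fst (\<sigma> (j, True))) \<and>
     (k = KGL \<longrightarrow> (\<forall>j<d. \<not> snd (\<sigma> (j, False)) \<and> snd (\<sigma> (j, True))))}"

lemma good_subset: "good \<subseteq> {\<sigma>. \<sigma> permutes Pos d}"
  by (rule subsetI) (simp add: good_def)

text \<open>Reversing one pair multiplies both the coefficient and the contraction by the sign
  \<open>\<zeta>\<close>, whose square is 1. Once all wrongly oriented pairs are reversed,
  \<open>\<sigma>\<close> has the form \<open>hat \<pi>\<close>, and the equivariance of
  \<open>\<phi>\<close> absorbs it; the induction counts the pairs still to be reversed.\<close>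

lemma good_term:
  assumes phi: "\<phi> \<in> Phi d nR fL nC (flip_sign k) par" and rho: "\<rho> permutes Pos d"
    and c: "c \<in> {..<d} \<rightarrow>\<^sub>E {..<nC}"
  shows "\<sigma> \<in> good \<Longrightarrow>
    \<phi> (r, Hilbert_Choice.inv \<sigma> \<circ> \<rho>, pcols \<sigma> (wm id c id)) * pairing \<sigma> (wm id c id) = \<phi> (r, \<rho>, c)"
proof (induction "card {j. j < d \<and> snd (\<sigma> (j, False))}" arbitrary: \<sigma> rule: less_induct)
  case (less \<sigma>)
  let ?w = "wm id c id"
  have s: "\<sigma> permutes Pos d" and sf: "\<And>j. j < d \<Longrightarrow> fst (\<sigma> (j, True)) = fst (\<sigma> (j, False))"
    and sk: "\<And>j. k = KGL \<Longrightarrow> j < d \<Longrightarrow> \<not> snd (\<sigma> (j, False)) \<and> snd (\<sigma> (j, True))"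
    using less.prems unfolding good_def by simp_all
  have sP: "\<sigma> (j, b) \<in> Pos d" if "j < d" for j b
    using permutes_in_image[OF s] that by (simp add: Pos_iff)
  have w: "?w p = (c (fst p), fst p, op \<and> snd p)" if "p \<in> Pos d" for p
    using that by (simp add: wm_eq)
  show ?case
  proof (cases "\<exists>j<d. snd (\<sigma> (j, False))")
    case False
    then have nF: "\<not> snd (\<sigma> (j, False))" if "j < d" for j using that by blast
    have sT: "snd (\<sigma> (j, True))" if j: "j < d" for j
    proof (rule ccontr)
      assume "\<not> snd (\<sigma> (j, True))"
      then have "\<sigma> (j, True) = \<sigma> (j, False)" using sf[OF j] nF[OF j] by (simp add: prod_eq_iff)
      then show False using permutes_inj[OF s] by (simp add: inj_eq)
    qed
    define \<pi> where "\<pi> = (\<lambda>j. if j < d then fst (\<sigma> (j, False)) else j)"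
    have sh: "\<sigma> = hat \<pi>"
    proof
      fix p :: "nat \<times> bool"
      obtain j b where p: "p = (j, b)" by (cases p)
      show "\<sigma> p = hat \<pi> p"
      proof (cases "j < d")
        case True
        then show ?thesis using nF[OF True] sT[OF True] sf[OF True] unfolding p
          by (cases b) (simp_all add: \<pi>_def prod_eq_iff)
      next
        case j: False
        then show ?thesis using permutes_not_in[OF s, of p] unfolding p by (simp add: \<pi>_def Pos_iff)
      qed
    qed
    have "inj_on \<pi> {..<d}"
    proof (rule inj_onI)
      fix i j assume ij: "i \<in> {..<d}" "j \<in> {..<d}" "\<pi> i = \<pi> j"
      then have "\<sigma> (i, False) = \<sigma> (j, False)" unfolding sh by simp
      then show "i = j" using permutes_inj[OF s] by (simp add: inj_eq)
    qed
    moreover have "\<pi> ` {..<d} \<subseteq> {..<d}"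
    proof (rule image_subsetI)
      fix j assume "j \<in> {..<d}"
      then show "\<pi> j \<in> {..<d}" using sP[of j False] by (simp add: \<pi>_def Pos_iff)
    qed
    ultimately have "bij_betw \<pi> {..<d} {..<d}"
      using endo_inj_surj[of "{..<d}" \<pi>] by (simp add: bij_betw_def)
    then have pi: "\<pi> permutes {..<d}" by (rule bij_imp_permutes) (simp add: \<pi>_def)
    have pd: "\<pi> j < d" if "j < d" for j using permutes_in_image[OF pi, of j] that by simp
    have "pcols \<sigma> ?w = c \<circ> \<pi>"
    proof
      fix j
      show "pcols \<sigma> ?w j = (c \<circ> \<pi>) j"
        using pd[of j] PiE_arb[OF c, of j] permutes_not_in[OF pi, of j] unfolding sh
        by (cases "j < d") (simp_all add: pcols_def w Pos_iff)
    qed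
    moreover have "pairing \<sigma> ?w = 1"
      unfolding pairing_def
    proof (rule prod.neutral, rule ballI)
      fix j assume "j \<in> {..<d}"
      then show "beta k (?w (\<sigma> (j, False))) (?w (\<sigma> (j, True))) = 1"
        using pd[of j] unfolding sh by (simp add: w Pos_iff) (cases k; simp)
    qed
    moreover have "\<phi> (r, Hilbert_Choice.inv \<sigma> \<circ> \<rho>, c \<circ> \<pi>) = \<phi> (r, \<rho>, c)"
      unfolding sh inv_hat[OF pi] PhiD(4)[OF phi permutes_inv[OF pi] rho]
      by (simp add: comp_assoc permutes_inv_o[OF pi])
    ultimately show ?thesis by simp
  next
    case True
    then obtain j where j: "j < d" "snd (\<sigma> (j, False))" by blast
    have "k \<noteq> KGL" using sk[OF _ j(1)] j(2) by blast
    then obtain \<zeta> where z: "flip_sign k = Some \<zeta>" by (cases k) simp_all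
    define \<sigma>' where "\<sigma>' = \<sigma> \<circ> flip j"
    have s': "\<sigma>' permutes Pos d" unfolding \<sigma>'_def by (rule permutes_compose[OF flip_permutes[OF j(1)] s])
    have s'i: "\<sigma>' (i, b) = \<sigma> (i, if i = j then \<not> b else b)" for i b
      by (simp add: \<sigma>'_def flip_apply)
    have ss: "\<sigma> = \<sigma>' \<circ> flip j" by (simp add: \<sigma>'_def comp_assoc flip_flip)
    have good': "\<sigma>' \<in> good" using s' sf \<open>k \<noteq> KGL\<close> by (simp add: good_def s'i)
    have "\<not> snd (\<sigma> (j, True))"
    proof
      assume "snd (\<sigma> (j, True))"
      then have "\<sigma> (j, True) = \<sigma> (j, False)" using sf[OF j(1)] j(2) by (simp add: prod_eq_iff)
      then show False using permutes_inj[OF s] by (simp add: inj_eq)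
    qed
    then have "{i. i < d \<and> snd (\<sigma>' (i, False))} = {i. i < d \<and> snd (\<sigma> (i, False))} - {j}"
      by (auto simp: s'i split: if_splits)
    then have "card {i. i < d \<and> snd (\<sigma>' (i, False))} < card {i. i < d \<and> snd (\<sigma> (i, False))}"
      unfolding \<open>{i. i < d \<and> snd (\<sigma>' (i, False))} = _\<close> using j by (intro card_Diff1_less) simp_all
    from less.hyps[OF this good']
    have IH: "\<phi> (r, Hilbert_Choice.inv \<sigma>' \<circ> \<rho>, pcols \<sigma>' ?w) * pairing \<sigma>' ?w = \<phi> (r, \<rho>, c)" .
    have fw: "fst (?w (\<sigma> (j, True))) = fst (?w (\<sigma> (j, False)))"
      using sf[OF j(1)] by (simp add: w sP[OF j(1)])
    have pc: "pcols \<sigma>' ?w = pcols \<sigma> ?w"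
      unfolding pcols_def by (rule restrict_ext) (simp add: s'i fw)
    have pp: "pairing \<sigma> ?w = \<zeta> * pairing \<sigma>' ?w"
    proof -
      have r: "pairing \<sigma> ?w = beta k (?w (\<sigma> (j, False))) (?w (\<sigma> (j, True))) *
          (\<Prod>i\<in>{..<d}-{j}. beta k (?w (\<sigma> (i, False))) (?w (\<sigma> (i, True))))"
        unfolding pairing_def by (rule prod.remove) (use j in simp_all)
      have r': "pairing \<sigma>' ?w = beta k (?w (\<sigma> (j, True))) (?w (\<sigma> (j, False))) *
          (\<Prod>i\<in>{..<d}-{j}. beta k (?w (\<sigma>' (i, False))) (?w (\<sigma>' (i, True))))"
        unfolding pairing_def using prod.remove[of "{..<d}" j "\<lambda>i. beta k (?w (\<sigma>' (i, False))) (?w (\<sigma>' (i, True)))"] j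
        by (simp add: s'i)
      have "(\<Prod>i\<in>{..<d}-{j}. beta k (?w (\<sigma>' (i, False))) (?w (\<sigma>' (i, True)))) =
          (\<Prod>i\<in>{..<d}-{j}. beta k (?w (\<sigma> (i, False))) (?w (\<sigma> (i, True))))"
        by (rule prod.cong) (simp_all add: s'i)
      then show ?thesis unfolding r r' using beta_swap[OF z, of "?w (\<sigma> (j, False))"] by simp
    qed
    have "Hilbert_Choice.inv \<sigma> = flip j \<circ> Hilbert_Choice.inv \<sigma>'"
      unfolding ss inv_comp[OF s' flip_permutes[OF j(1)]] by (simp only: inv_flip)
    then have "\<phi> (r, Hilbert_Choice.inv \<sigma> \<circ> \<rho>, pcols \<sigma> ?w) = \<phi> (r, flip j \<circ> (Hilbert_Choice.inv \<sigma>' \<circ> \<rho>), pcols \<sigma>' ?w)"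
      by (simp only: pc comp_assoc)
    also have "\<dots> = \<zeta> * \<phi> (r, Hilbert_Choice.inv \<sigma>' \<circ> \<rho>, pcols \<sigma>' ?w)"
      by (rule PhiD(6)[OF phi j(1) _ z]) (intro permutes_compose rho permutes_inv s')
    finally have pe: "\<phi> (r, Hilbert_Choice.inv \<sigma> \<circ> \<rho>, pcols \<sigma> ?w) = \<zeta> * \<phi> (r, Hilbert_Choice.inv \<sigma>' \<circ> \<rho>, pcols \<sigma>' ?w)" .
    have "\<phi> (r, Hilbert_Choice.inv \<sigma> \<circ> \<rho>, pcols \<sigma> ?w) * pairing \<sigma> ?w =
       (\<zeta> * \<zeta>) * (\<phi> (r, Hilbert_Choice.inv \<sigma>' \<circ> \<rho>, pcols \<sigma>' ?w) * pairing \<sigma>' ?w)"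
      unfolding pe pp by (simp only: mult_ac)
    then show ?thesis unfolding IH flip_sign_sq[OF z] by simp
  qed
qed

text \<open>With the names \<open>id\<close> distinct pairs carry distinct vectors, so a contraction
  across two pairs, or in the wrong order for \<open>KGL\<close>, is zero.\<close>

lemma bad_term:
  assumes s: "\<sigma> permutes Pos d" and b: "\<sigma> \<notin> good"
  shows "pairing \<sigma> (wm id c id) = 0"
proof -
  have sP: "\<sigma> (j, b) \<in> Pos d" if "j < d" for j b
    using permutes_in_image[OF s] that by (simp add: Pos_iff)
  obtain j where j: "j < d" "fst (\<sigma> (j, False)) \<noteq> fst (\<sigma> (j, True)) \<or> k = KGL \<and> (snd (\<sigma> (j, False)) \<or> \<not> snd (\<sigma> (j, True)))"
    using s b unfolding good_def by blast
  have "beta k (wm id c id (\<sigma> (j, False))) (wm id c id (\<sigma> (j, True))) = 0"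
    unfolding wm_eq[OF sP[OF j(1)]] using j(2) by auto
  then show ?thesis unfolding pairing_def by (intro prod_zero) (use j(1) in auto)
qed

text \<open>\<open>Ft_comp\<close> with the inverse of \<open>\<rho>\<close> reduces the word to
  that of the identity matching; there the good terms are all equal to
  \<open>\<phi> (r, \<rho>, c)\<close> and the others vanish.\<close>

lemma ev_Ft:
  assumes phi: "\<phi> \<in> Phi d nR fL nC (flip_sign k) par"
  shows "ev nR (Ft \<phi>) = (\<lambda>x. of_nat (card good) * \<phi> x)"
proof
  fix x :: matching_index
  obtain r \<rho> c where x: "x = (r, \<rho>, c)" by (cases x)
  show "ev nR (Ft \<phi>) x = of_nat (card good) * \<phi> x"
  proof (cases "r \<in> RR nR \<and> \<rho> permutes Pos d \<and> c \<in> {..<d} \<rightarrow>\<^sub>E {..<nC}")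
    case True
    then have rho: "\<rho> permutes Pos d" and c: "c \<in> {..<d} \<rightarrow>\<^sub>E {..<nC}" by simp_all
    let ?t = "\<lambda>\<sigma>. \<phi> (r, Hilbert_Choice.inv \<sigma> \<circ> \<rho>, pcols \<sigma> (wm id c id)) * pairing \<sigma> (wm id c id)"
    have "wm \<rho> c id \<circ> Hilbert_Choice.inv \<rho> = wm id c id"
      using wm_comp[OF permutes_inv[OF rho], of \<rho> c id] by (simp add: permutes_inv_o[OF rho])
    then have "Ft \<phi> r (wm \<rho> c id) = (\<Sum>\<sigma> | \<sigma> permutes Pos d. ?t \<sigma>)"
      unfolding Ft_comp[OF permutes_inv[OF rho]] by (simp add: permutes_inv_inv[OF rho])
    also have "\<dots> = (\<Sum>\<sigma>\<in>good. ?t \<sigma>)"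
    proof (rule sum.mono_neutral_right)
      show "finite {\<sigma>. \<sigma> permutes Pos d}" by (rule finite_permutations) simp
      show "\<forall>\<sigma>\<in>{\<sigma>. \<sigma> permutes Pos d} - good. ?t \<sigma> = 0" using bad_term by simp
    qed (rule good_subset)
    also have "\<dots> = (\<Sum>\<sigma>\<in>good. \<phi> (r, \<rho>, c))"
      by (rule sum.cong[OF refl]) (rule good_term[OF phi rho c])
    finally show ?thesis using True by (simp add: x ev_def)
  next
    case False
    have z: "\<phi> (r, \<rho>, c) = 0"
    proof (rule ccontr)
      assume "\<phi> (r, \<rho>, c) \<noteq> 0"
      from PhiD(1)[OF phi this] have "r \<in> RR nR \<and> \<rho> permutes Pos d \<and> c \<in> {..<d} \<rightarrow>\<^sub>E {..<nC}"
        by (simp only: RR_def simp_thms)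
      with False show False by (rule notE)
    qed
    show ?thesis unfolding x ev_def prod.case if_not_P[OF False] z by (rule mult_zero_right[symmetric])
  qed
qed

lemma card_good: "card good \<noteq> 0"
proof -
  have "finite good"
    by (rule finite_subset[OF good_subset finite_permutations]) simp
  moreover have "good \<noteq> {}"
  proof
    assume e: "good = {}"
    have "id \<in> good" unfolding good_def by (simp add: permutes_id)
    then show False unfolding e by (rule emptyE)
  qed
  ultimately show ?thesis by (simp only: card_0_eq not_False_eq_True)
qed

lemma Phi_scale:
  assumes "\<phi> \<in> Phi d nR fL nC f par"
  shows "(\<lambda>x. a * \<phi> x) \<in> Phi d nR fL nC f par"
  unfolding Phi_def
proof (intro CollectI conjI allI impI)
  fix r \<rho> c assume "a * \<phi> (r, \<rho>, c) \<noteq> 0"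
  then have nz: "\<phi> (r, \<rho>, c) \<noteq> 0" by simp
  show "r \<in> {..<d} \<rightarrow>\<^sub>E {..<nR}" "\<rho> permutes Pos d" "c \<in> {..<d} \<rightarrow>\<^sub>E {..<nC}"
    using PhiD(1)[OF assms nz] by simp_all
  assume par
  then show "\<forall>x\<in>Pos d. snd (\<rho> x) = snd x" by (intro ballI PhiD(2)[OF assms nz])
qed (simp_all add: PhiD(3-6)[OF assms] mult.left_commute)

theorem ev_surj:
  assumes phi: "\<phi> \<in> Phi d nR fL nC (flip_sign k) par" and par: "par \<Longrightarrow> k = KGL"
  obtains T where "T \<in> tensors nR fL par" "ev nR T = \<phi>"
proof -
  let ?f = "\<lambda>x. (1 / of_nat (card good)) * \<phi> x"
  have f: "?f \<in> Phi d nR fL nC (flip_sign k) par" by (rule Phi_scale[OF phi])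
  have "ev nR (Ft ?f) = \<phi>" unfolding ev_Ft[OF f] using card_good by simp
  then show ?thesis using that Ft_in_tensors[OF f par] by blast
qed

end

section \<open>Dimension of the space of invariants\<close>

lemma dim_inj_image:
  assumes "vector_space s1" "vector_space s2" and f: "Vector_Spaces.linear s1 s2 f"
    and S: "module.subspace s1 S" and inj: "inj_on f S"
  shows "vector_space.dim s2 (f ` S) = vector_space.dim s1 S"
proof -
  interpret v1: vector_space s1 by fact
  interpret v2: vector_space s2 by fact
  interpret l: Vector_Spaces.linear s1 s2 f by fact
  obtain B where B: "B \<subseteq> S" "v1.independent B" "S \<subseteq> v1.span B" "card B = v1.dim S"
    using v1.basis_exists by blast
  have sB: "v1.span B = S"
    using B(1,3) v1.span_minimal[OF B(1) S] by (intro equalityI)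
  have ind: "v2.independent (f ` B)"
    by (rule l.independent_inj_on_image[OF B(2)]) (use inj sB in simp)
  have "card (f ` B) = card B" using inj B(1) by (meson card_image inj_on_subset)
  moreover have "v2.dim (f ` S) = card (f ` B)"
  proof (rule v2.dim_unique[OF _ _ ind refl])
    show "f ` B \<subseteq> f ` S" using B(1) by (rule image_mono)
    show "f ` S \<subseteq> v2.span (f ` B)" unfolding l.span_image sB by simp
  qed
  ultimately show ?thesis using B(4) by simp
qed

definition fscale :: "complex \<Rightarrow> ('z \<Rightarrow> complex) \<Rightarrow> 'z \<Rightarrow> complex" where
  "fscale c f = (\<lambda>x. c * f x)"

global_interpretation fun_vs: vector_space "fscale :: complex \<Rightarrow> ('z \<Rightarrow> complex) \<Rightarrow> 'z \<Rightarrow> complex"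
  by unfold_locales (simp_all add: fscale_def fun_eq_iff algebra_simps)

context slot_tensors
begin

definition repr :: "complex mat \<Rightarrow> ('a \<Rightarrow> 'a \<Rightarrow> complex) \<Rightarrow> bool" where
  "repr g M \<longleftrightarrow> (\<forall>u\<in>S. sym_Ad g (yv u) = (\<Sum>u'\<in>S. poly_scale (M u' u) (yv u')))"

lemma sym_Ad_fixed_iff:
  assumes M: "repr g M" and T: "symt T"
  shows "sym_Ad g (ten T) = ten T \<longleftrightarrow> (\<forall>f\<in>FF. act M T f = T f)"
proof -
  have e: "sym_Ad g (ten T) = ten (act M T)"
    by (rule sym_Ad_ten) (use M in \<open>simp add: repr_def\<close>)
  show ?thesis
  proof
    assume "sym_Ad g (ten T) = ten T"
    with e have e': "ten (act M T) = ten T" by simp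
    show "\<forall>f\<in>FF. act M T f = T f"
    proof
      fix f assume f: "f \<in> FF"
      show "act M T f = T f"
        using cf_ten[OF symt_act[OF T] f, of M] cf_ten[OF T f] unfolding e' by simp
    qed
  next
    assume "\<forall>f\<in>FF. act M T f = T f"
    then show "sym_Ad g (ten T) = ten T" unfolding e by (intro ten_cong) simp
  qed
qed

text \<open>A symmetric tensor is determined by its polynomial, so fixing the polynomial is the same
  as fixing the tensor. \<open>K\<close> and \<open>MM\<close> need only realise each other's
  operators; no bijection between them is involved.\<close>

lemma invariants_iff:
  assumes L: "Lie N G = VV"
    and A: "\<And>g. g \<in> K \<Longrightarrow> \<exists>M\<in>MM. repr g M" and B: "\<And>M. M \<in> MM \<Longrightarrow> \<exists>g\<in>K. repr g M"
  shows "p \<in> invariants N G K d \<longleftrightarrow>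
    (\<exists>T. p = ten T \<and> symt T \<and> slott T \<and> (\<forall>M\<in>MM. \<forall>f\<in>FF. act M T f = T f))"
proof -
  have *: "(\<forall>g\<in>K. sym_Ad g (ten T) = ten T) \<longleftrightarrow> (\<forall>M\<in>MM. \<forall>f\<in>FF. act M T f = T f)" if T: "symt T" for T
  proof
    assume K: "\<forall>g\<in>K. sym_Ad g (ten T) = ten T"
    show "\<forall>M\<in>MM. \<forall>f\<in>FF. act M T f = T f"
    proof
      fix M assume "M \<in> MM"
      then obtain g where g: "g \<in> K" "repr g M" using B by metis
      have "sym_Ad g (ten T) = ten T" using K g(1) by (rule bspec)
      then show "\<forall>f\<in>FF. act M T f = T f" using sym_Ad_fixed_iff[OF g(2) T] by (simp only: simp_thms)
    qed
  next
    assume MM: "\<forall>M\<in>MM. \<forall>f\<in>FF. act M T f = T f"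
    show "\<forall>g\<in>K. sym_Ad g (ten T) = ten T"
    proof
      fix g assume "g \<in> K"
      then obtain M where M: "M \<in> MM" "repr g M" using A by metis
      have "\<forall>f\<in>FF. act M T f = T f" using MM M(1) by (rule bspec)
      then show "sym_Ad g (ten T) = ten T" using sym_Ad_fixed_iff[OF M(2) T] by (simp only: simp_thms)
    qed
  qed
  show ?thesis
  proof
    assume "p \<in> invariants N G K d"
    then have p: "p \<in> sym_power d VV" "\<forall>g\<in>K. sym_Ad g p = p" unfolding invariants_def L by simp_all
    from p(1) obtain T where T: "p = ten T" "symt T" "slott T" unfolding sym_power_VV
      by (elim CollectE exE conjE) simp
    from p(2) *[OF T(2)] have "\<forall>M\<in>MM. \<forall>f\<in>FF. act M T f = T f" unfolding T(1) by (simp only: simp_thms)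
    with T show "\<exists>T. p = ten T \<and> symt T \<and> slott T \<and> (\<forall>M\<in>MM. \<forall>f\<in>FF. act M T f = T f)"
      by (intro exI[of _ T] conjI)
  next
    assume "\<exists>T. p = ten T \<and> symt T \<and> slott T \<and> (\<forall>M\<in>MM. \<forall>f\<in>FF. act M T f = T f)"
    then obtain T where T: "p = ten T" "symt T" "slott T" "\<forall>M\<in>MM. \<forall>f\<in>FF. act M T f = T f" by (elim exE conjE)
    have "\<forall>g\<in>K. sym_Ad g p = p" using *[OF T(2)] T(4) unfolding T(1) by (simp only: simp_thms)
    moreover have "p \<in> sym_power d VV" unfolding T(1) by (rule ten_in_sym_power[OF T(3)])
    ultimately show "p \<in> invariants N G K d" unfolding invariants_def L by simp
  qed
qed

end

lemma subspace_invariants: "mat_poly.subspace (invariants N G K d)"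
proof -
  have sp: "mat_poly.subspace (sym_power d V)" for V
    unfolding sym_power_def by (rule mat_poly.subspace_span)
  have "sym_Ad g 0 = 0" "sym_Ad g (p + q) = sym_Ad g p + sym_Ad g q"
    "sym_Ad g (poly_scale c p) = poly_scale c (sym_Ad g p)" for g p q c
    unfolding sym_Ad_def by (simp_all add: poly_subst_add poly_subst_scale)
  then show ?thesis
    unfolding mat_poly.subspace_def invariants_def
    using mat_poly.subspace_0[OF sp] mat_poly.subspace_add[OF sp] mat_poly.subspace_scale[OF sp] by simp
qed

section \<open>Slots as pairs of labels\<close>

lemma isom_supp:
  assumes "h \<in> isom k nC n" "x \<in> labels k nC n" "y \<in> labels k nC n" "h x y \<noteq> 0"
  shows "fst x = fst y \<and> (k = KGL \<longrightarrow> snd (snd x) = snd (snd y))"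
proof -
  have *: "\<forall>x\<in>labels k nC n. \<forall>y\<in>labels k nC n. h x y \<noteq> 0 \<longrightarrow>
       fst x = fst y \<and> (k = KGL \<longrightarrow> snd (snd x) = snd (snd y))"
    using assms(1) unfolding isom_def by (elim CollectE conjE)
  show ?thesis by (rule mp[OF bspec[OF bspec[OF * assms(2)] assms(3)] assms(4)])
qed

text \<open>A slot colour with two labels, indexing two-tensors on the representation of
  \<open>K\<close>. Under \<open>par\<close> the second label is dual, so the slots of one colour
  index V tensor V*, the space of matrices.\<close>

definition slots :: "label set \<Rightarrow> nat \<Rightarrow> bool \<Rightarrow> (nat \<times> label \<times> label) set" where
  "slots W nR par = {u. fst u < nR \<and> fst (snd u) \<in> W \<and> snd (snd u) \<in> W \<and>
     (par \<longrightarrow> \<not> snd (snd (fst (snd u))) \<and> snd (snd (snd (snd u))))}"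

definition swap_slot :: "complex option \<Rightarrow> nat \<times> label \<times> label \<Rightarrow> nat \<times> label \<times> label" where
  "swap_slot fL u = (if fL = None then u else (fst u, snd (snd u), fst (snd u)))"

definition slot_sign :: "complex option \<Rightarrow> complex" where
  "slot_sign fL = (case fL of None \<Rightarrow> 1 | Some \<eta> \<Rightarrow> \<eta>)"

text \<open>Tensor square of \<open>h\<close>, one copy for every factor of \<open>G\<close>: all
  copies use the same \<open>h\<close>.\<close>

definition slot_mat :: "(label \<Rightarrow> label \<Rightarrow> complex) \<Rightarrow> nat \<times> label \<times> label \<Rightarrow> nat \<times> label \<times> label \<Rightarrow> complex" where
  "slot_mat h u' u = (if fst u = fst u' then h (fst (snd u')) (fst (snd u)) * h (snd (snd u')) (snd (snd u)) else 0)"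

text \<open>The common shape of the ten families: \<open>act_K\<close> and \<open>K_act\<close> say
  that \<open>K\<close> and \<open>isom\<close> induce the same operators on slots, and
  \<open>big\<close> is the stable range.\<close>

locale family = std_inv k nC n d +
  slot_tensors N d "slots (labels k nC n) nR par" enc sg "swap_slot fL" "slot_sign fL"
  for k nC n d N nR par fL enc sg +
  fixes G K :: "complex mat set"
  assumes par_KGL: "par \<Longrightarrow> k = KGL" and par_None: "par \<Longrightarrow> fL = None"
    and Lie_eq: "Lie N G = VV"
    and act_K: "g \<in> K \<Longrightarrow> \<exists>h\<in>isom k nC n. repr g (slot_mat h)"
    and K_act: "h \<in> isom k nC n \<Longrightarrow> \<exists>g\<in>K. repr g (slot_mat h)"
    and big: "i < nC \<Longrightarrow> 3 * d \<le> n i"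
begin

definition rof :: "(nat \<Rightarrow> nat \<times> label \<times> label) \<Rightarrow> nat \<Rightarrow> nat" where
  "rof f = restrict (\<lambda>s. fst (f s)) {..<d}"

definition wof :: "(nat \<Rightarrow> nat \<times> label \<times> label) \<Rightarrow> nat \<times> bool \<Rightarrow> label" where
  "wof f = restrict (\<lambda>p. if snd p then snd (snd (f (fst p))) else fst (snd (f (fst p)))) (Pos d)"

definition fof :: "(nat \<Rightarrow> nat) \<Rightarrow> (nat \<times> bool \<Rightarrow> label) \<Rightarrow> nat \<Rightarrow> nat \<times> label \<times> label" where
  "fof r w = restrict (\<lambda>s. (r s, w (s, False), w (s, True))) {..<d}"

lemma FF_slot: "f \<in> FF \<Longrightarrow> s < d \<Longrightarrow> f s \<in> slots W nR par"
  unfolding FF_def using PiE_mem[of f "{..<d}" "\<lambda>_. slots W nR par" s] by simp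

lemma rof_in: "f \<in> FF \<Longrightarrow> rof f \<in> RR nR"
  unfolding RR_def by (rule PiE_I) (use FF_slot in \<open>simp_all add: rof_def slots_def\<close>)

lemma wof_apply: "s < d \<Longrightarrow> wof f (s, b) = (if b then snd (snd (f s)) else fst (snd (f s)))"
  by (simp add: wof_def Pos_iff)

lemma wof_in:
  assumes f: "f \<in> FF"
  shows "wof f \<in> WW"
  unfolding WW_def
proof (rule PiE_I)
  fix p assume "p \<in> Pos d"
  then show "wof f p \<in> W" using FF_slot[OF f, of "fst p"] by (simp add: wof_def Pos_iff slots_def)
qed (simp add: wof_def)

lemma fof_of:
  assumes f: "f \<in> FF"
  shows "fof (rof f) (wof f) = f"
proof
  fix s
  show "fof (rof f) (wof f) s = f s"
    using f PiE_arb[of f "{..<d}"] by (cases "s < d") (simp_all add: fof_def rof_def wof_apply FF_def)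
qed

lemma rof_fof: "r \<in> RR nR \<Longrightarrow> rof (fof r w) = r"
proof
  fix s assume "r \<in> RR nR"
  then show "rof (fof r w) s = r s"
    using PiE_arb[of r "{..<d}"] by (cases "s < d") (simp_all add: fof_def rof_def RR_def)
qed

lemma wof_fof:
  assumes w: "w \<in> WW"
  shows "wof (fof r w) = w"
proof
  fix p :: "nat \<times> bool"
  obtain s b where p: "p = (s, b)" by (cases p)
  show "wof (fof r w) p = w p"
    using PiE_arb[OF w[unfolded WW_def], of p] unfolding p
    by (cases "s < d"; cases b) (simp_all add: wof_def fof_def Pos_iff)
qed

definition parok :: "(nat \<times> bool \<Rightarrow> label) \<Rightarrow> bool" where
  "parok w \<longleftrightarrow> (par \<longrightarrow> (\<forall>p\<in>Pos d. snd (snd (w p)) = snd p))"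

lemma fof_in_iff:
  assumes r: "r \<in> RR nR" and w: "w \<in> WW"
  shows "fof r w \<in> FF \<longleftrightarrow> parok w"
proof
  assume f: "fof r w \<in> FF"
  show "parok w" unfolding parok_def
  proof (intro impI ballI)
    fix p assume par and p: "p \<in> Pos d"
    obtain s b where sb: "p = (s, b)" by (cases p)
    then have "s < d" using p by (simp add: Pos_iff)
    from FF_slot[OF f this] show "snd (snd (w p)) = snd p"
      using \<open>par\<close> \<open>s < d\<close> unfolding sb by (cases b) (simp_all add: slots_def fof_def)
  qed
next
  assume ok: "parok w"
  show "fof r w \<in> FF" unfolding FF_def
  proof (rule PiE_I)
    fix s assume s: "s \<in> {..<d}"
    have sP: "(s, b) \<in> Pos d" for b using s by (simp add: Pos_iff)
    have "r s < nR" using PiE_mem[of r "{..<d}" "\<lambda>_. {..<nR}" s] r s by (simp add: RR_def)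
    moreover have "par \<Longrightarrow> snd (snd (w (s, b))) = b" for b
      using ok sP[of b] unfolding parok_def by fastforce
    ultimately show "fof r w s \<in> slots W nR par"
      using s WW_in[OF w sP] by (simp add: fof_def slots_def)
  qed (simp add: fof_def)
qed

lemma parok_wof: "f \<in> FF \<Longrightarrow> parok (wof f)"
  using fof_in_iff[OF rof_in wof_in, of f f] fof_of[of f] by simp

text \<open>Extension by zero to the label words that come from no slot word, so that arbitrary
  label words can be used in the relations for invariant tensors.\<close>

definition lift :: "((nat \<Rightarrow> nat \<times> label \<times> label) \<Rightarrow> complex) \<Rightarrow> (nat \<Rightarrow> nat) \<Rightarrow> (nat \<times> bool \<Rightarrow> label) \<Rightarrow> complex" where
  "lift T r w = (if parok w then T (fof r w) else 0)"

lemma lift_wof: "f \<in> FF \<Longrightarrow> lift T (rof f) (wof f) = T f"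
  by (simp add: lift_def parok_wof fof_of)

text \<open>Slot matrices vanish between different slot colours, so only slot words with colours
  \<open>r\<close> contribute, and these correspond to the label words of admissible
  polarity.\<close>

lemma act_lift:
  assumes r: "r \<in> RR nR" and w: "w \<in> WW"
  shows "(\<Sum>v\<in>WW. lift T r v * (\<Prod>p\<in>Pos d. h (w p) (v p))) = act (slot_mat h) T (fof r w)"
proof -
  let ?g = "\<lambda>f. T f * (\<Prod>s<d. slot_mat h (fof r w s) (f s))"
  have "act (slot_mat h) T (fof r w) = (\<Sum>f\<in>{f \<in> FF. rof f = r}. ?g f)"
    unfolding act_def
  proof (rule sum.mono_neutral_right)
    show "\<forall>f\<in>FF - {f \<in> FF. rof f = r}. ?g f = 0"
    proof
      fix f assume f: "f \<in> FF - {f \<in> FF. rof f = r}"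
      then have "f \<in> FF" "rof f \<noteq> r" by simp_all
      then obtain s where s: "s < d" "rof f s \<noteq> r s"
        using PiE_ext[OF rof_in[OF \<open>f \<in> FF\<close>, unfolded RR_def] r[unfolded RR_def]] by auto
      then have "slot_mat h (fof r w s) (f s) = 0" by (simp add: slot_mat_def fof_def rof_def)
      then have "(\<Prod>s<d. slot_mat h (fof r w s) (f s)) = 0" using s(1) by (intro prod_zero) auto
      then show "?g f = 0" by simp
    qed
  qed simp_all
  also have "\<dots> = (\<Sum>v\<in>{v \<in> WW. parok v}. ?g (fof r v))"
  proof (rule sum.reindex_bij_betw[symmetric], rule bij_betw_byWitness[where f' = wof])
    show "\<forall>v\<in>{v \<in> WW. parok v}. wof (fof r v) = v" by (simp add: wof_fof)
    show "\<forall>f\<in>{f \<in> FF. rof f = r}. fof r (wof f) = f" using fof_of by fastforce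
    show "fof r ` {v \<in> WW. parok v} \<subseteq> {f \<in> FF. rof f = r}"
      by (rule image_subsetI) (simp add: fof_in_iff[OF r] rof_fof[OF r])
    show "wof ` {f \<in> FF. rof f = r} \<subseteq> {v \<in> WW. parok v}"
      by (rule image_subsetI) (simp add: wof_in parok_wof)
  qed
  also have "\<dots> = (\<Sum>v\<in>{v \<in> WW. parok v}. lift T r v * (\<Prod>p\<in>Pos d. h (w p) (v p)))"
  proof (rule sum.cong[OF refl])
    fix v assume v: "v \<in> {v \<in> WW. parok v}"
    have "(\<Prod>s<d. slot_mat h (fof r w s) (fof r v s)) = (\<Prod>p\<in>Pos d. h (w p) (v p))"
      unfolding prod_Pos by (rule prod.cong) (simp_all add: slot_mat_def fof_def)
    then show "?g (fof r v) = lift T r v * (\<Prod>p\<in>Pos d. h (w p) (v p))" using v by (simp add: lift_def)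
  qed
  also have "\<dots> = (\<Sum>v\<in>WW. lift T r v * (\<Prod>p\<in>Pos d. h (w p) (v p)))"
    by (rule sum.mono_neutral_left) (simp_all add: lift_def subset_iff)
  finally show ?thesis by simp
qed

text \<open>Isometries for \<open>KGL\<close> preserve polarity, so they never lead from a word of
  wrong polarity to one on which \<open>lift\<close> is nonzero.\<close>

lemma act_not_parok:
  assumes r: "r \<in> RR nR" and w: "w \<in> WW" and h: "h \<in> isom k nC n" and np: "\<not> parok w"
  shows "(\<Sum>v\<in>WW. lift T r v * (\<Prod>p\<in>Pos d. h (w p) (v p))) = 0"
proof (rule sum.neutral, rule ballI)
  fix v assume v: "v \<in> WW"
  show "lift T r v * (\<Prod>p\<in>Pos d. h (w p) (v p)) = 0"
  proof (cases "parok v")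
    case True
    obtain p where p: "par" "p \<in> Pos d" "snd (snd (w p)) \<noteq> snd p" using np unfolding parok_def by blast
    have vp: "snd (snd (v p)) = snd p"
      by (rule bspec[OF mp[OF True[unfolded parok_def] p(1)] p(2)])
    have "h (w p) (v p) = 0"
    proof (rule ccontr)
      assume "h (w p) (v p) \<noteq> 0"
      then have "snd (snd (w p)) = snd (snd (v p))"
        using isom_supp[OF h WW_in[OF w p(2)] WW_in[OF v p(2)]] par_KGL[OF p(1)] by simp
      then show False using vp p(3) by simp
    qed
    then have "\<exists>p\<in>Pos d. h (w p) (v p) = 0" using p(2) by (rule bexI)
    then have "(\<Prod>p\<in>Pos d. h (w p) (v p)) = 0" by (rule prod_zero[OF finite_Pos])
    then show ?thesis by simp
  qed (simp add: lift_def)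
qed

text \<open>At words of wrong polarity both sides of the invariance identity are 0; at the others it
  is the identity for slot words.\<close>

lemma kinv_lift_iff:
  "(\<forall>r\<in>RR nR. kinv (lift T r)) \<longleftrightarrow> (\<forall>M\<in>slot_mat ` isom k nC n. \<forall>f\<in>FF. act M T f = T f)"
proof
  assume K: "\<forall>r\<in>RR nR. kinv (lift T r)"
  show "\<forall>M\<in>slot_mat ` isom k nC n. \<forall>f\<in>FF. act M T f = T f"
  proof (intro ballI)
    fix M f assume "M \<in> slot_mat ` isom k nC n" and f: "f \<in> FF"
    then obtain h where h: "h \<in> isom k nC n" "M = slot_mat h" by blast
    have "kinv (lift T (rof f))" using K rof_in[OF f] by (rule bspec)
    then have "(\<Sum>v\<in>WW. lift T (rof f) v * (\<Prod>p\<in>Pos d. h (wof f p) (v p))) = lift T (rof f) (wof f)"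
      using h(1) wof_in[OF f] unfolding kinv_def by blast
    then show "act M T f = T f"
      unfolding act_lift[OF rof_in[OF f] wof_in[OF f]] fof_of[OF f] lift_wof[OF f] h(2) .
  qed
next
  assume M: "\<forall>M\<in>slot_mat ` isom k nC n. \<forall>f\<in>FF. act M T f = T f"
  show "\<forall>r\<in>RR nR. kinv (lift T r)"
    unfolding kinv_def
  proof (intro ballI)
    fix r h w assume r: "r \<in> RR nR" and h: "h \<in> isom k nC n" and w: "w \<in> WW"
    show "(\<Sum>v\<in>WW. lift T r v * (\<Prod>p\<in>Pos d. h (w p) (v p))) = lift T r w"
    proof (cases "parok w")
      case True
      then have "fof r w \<in> FF" by (simp add: fof_in_iff[OF r w])
      then have "act (slot_mat h) T (fof r w) = T (fof r w)" using M h by blast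
      then show ?thesis unfolding act_lift[OF r w] using True by (simp add: lift_def)
    next
      case False
      then show ?thesis using act_not_parok[OF r w h False] by (simp add: lift_def)
    qed
  qed
qed


lemma fof_comp: "\<pi> permutes {..<d} \<Longrightarrow> fof (r \<circ> \<pi>) (w \<circ> hat \<pi>) = fof r w \<circ> \<pi>"
proof
  fix s assume pi: "\<pi> permutes {..<d}"
  show "fof (r \<circ> \<pi>) (w \<circ> hat \<pi>) s = (fof r w \<circ> \<pi>) s"
    using permutes_in_image[OF pi, of s] by (cases "s < d") (simp_all add: fof_def)
qed

lemma parok_comp:
  assumes pi: "\<pi> permutes {..<d}"
  shows "parok (w \<circ> hat \<pi>) \<longleftrightarrow> parok w"
proof -
  note hp = hat_permutes[OF pi]
  have "(\<forall>p\<in>Pos d. snd (snd (w (hat \<pi> p))) = snd (hat \<pi> p)) \<longleftrightarrow> (\<forall>p\<in>hat \<pi> ` Pos d. snd (snd (w p)) = snd p)"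
    by (simp only: ball_simps)
  then show ?thesis unfolding permutes_image[OF hp] by (simp add: parok_def)
qed

lemma kinv_cong:
  assumes "\<And>w. w \<in> WW \<Longrightarrow> U w = U' w" "kinv U"
  shows "kinv U'"
  unfolding kinv_def
proof (intro ballI)
  fix h w assume h: "h \<in> isom k nC n" and w: "w \<in> WW"
  have "(\<Sum>v\<in>WW. U' v * (\<Prod>p\<in>Pos d. h (w p) (v p))) = (\<Sum>v\<in>WW. U v * (\<Prod>p\<in>Pos d. h (w p) (v p)))"
    by (rule sum.cong[OF refl]) (simp add: assms(1))
  also have "\<dots> = U w" using assms(2) h w unfolding kinv_def by simp
  finally show "(\<Sum>v\<in>WW. U' v * (\<Prod>p\<in>Pos d. h (w p) (v p))) = U' w" by (simp add: assms(1)[OF w])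
qed

definition invt :: "((nat \<Rightarrow> nat \<times> label \<times> label) \<Rightarrow> complex) \<Rightarrow> bool" where
  "invt T \<longleftrightarrow> symt T \<and> slott T \<and> (\<forall>M\<in>slot_mat ` isom k nC n. \<forall>f\<in>FF. act M T f = T f)"

lemma flip_swap_fof:
  assumes e: "fL = Some \<eta>" and s: "s < d"
  shows "fof r (w \<circ> flip s) = (fof r w)(s := swap_slot fL (fof r w s))"
proof
  fix t
  show "fof r (w \<circ> flip s) t = ((fof r w)(s := swap_slot fL (fof r w s))) t"
    using s by (cases "t < d") (simp_all add: fof_def flip_apply swap_slot_def e)
qed

lemma lift_in_tensors:
  assumes T: "invt T"
  shows "lift T \<in> tensors nR fL par"
proof -
  have sy: "symt T" and sl: "slott T" using T by (simp_all add: invt_def)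
  show ?thesis
    unfolding tensors_def
  proof (intro CollectI conjI)
    show "\<forall>r\<in>RR nR. kinv (lift T r)" using T kinv_lift_iff by (simp add: invt_def)
    show "\<forall>r\<in>RR nR. \<forall>w\<in>WW. \<forall>\<pi>. \<pi> permutes {..<d} \<longrightarrow> lift T (r \<circ> \<pi>) (w \<circ> hat \<pi>) = lift T r w"
    proof (intro ballI allI impI)
      fix r w \<pi> assume r: "r \<in> RR nR" and w: "w \<in> WW" and pi: "\<pi> permutes {..<d}"
      show "lift T (r \<circ> \<pi>) (w \<circ> hat \<pi>) = lift T r w"
      proof (cases "parok w")
        case True
        then have "fof r w \<in> FF" by (simp add: fof_in_iff[OF r w])
        then have "T (fof r w \<circ> \<pi>) = T (fof r w)" using sy pi unfolding symt_def by blast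
        then show ?thesis unfolding lift_def parok_comp[OF pi] fof_comp[OF pi] by simp
      qed (simp add: lift_def parok_comp[OF pi])
    qed
    show "\<forall>\<eta>. fL = Some \<eta> \<longrightarrow> (\<forall>r\<in>RR nR. \<forall>w\<in>WW. \<forall>s<d. lift T r (w \<circ> flip s) = \<eta> * lift T r w)"
    proof (intro allI impI ballI)
      fix \<eta> r w s assume e: "fL = Some \<eta>" and r: "r \<in> RR nR" and w: "w \<in> WW" and s: "s < d"
      have "\<not> par" using par_None e by auto
      then have ok: "parok v" for v unfolding parok_def by simp
      have sgn: "slot_sign fL = \<eta>" by (simp add: slot_sign_def e)
      have "fof r w \<in> FF" using ok by (simp add: fof_in_iff[OF r w])
      then have "T ((fof r w)(s := swap_slot fL (fof r w s))) = slot_sign fL * T (fof r w)"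
        using sl s unfolding slott_def by blast
      then show "lift T r (w \<circ> flip s) = \<eta> * lift T r w"
        unfolding lift_def flip_swap_fof[OF e s] if_P[OF ok] sgn .
    qed
    show "par \<longrightarrow> (\<forall>r\<in>RR nR. \<forall>w\<in>WW. lift T r w \<noteq> 0 \<longrightarrow> (\<forall>p\<in>Pos d. snd (snd (w p)) = snd p))"
    proof (intro impI ballI)
      fix r w p assume par': par and nz: "lift T r w \<noteq> 0" and p: "p \<in> Pos d"
      have "parok w" using nz unfolding lift_def by (cases "parok w") simp_all
      then show "snd (snd (w p)) = snd p" by (rule bspec[OF mp[OF iffD1[OF parok_def] par'] p])
    qed
  qed
qed

text \<open>The polarity clause in \<open>tensors\<close> makes \<open>T'\<close> vanish off the
  image of the slot words, so nothing is lost by reading it on slots.\<close>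

lemma tensors_lift:
  assumes T': "T' \<in> tensors nR fL par"
  obtains T where "invt T" "\<And>r w. r \<in> RR nR \<Longrightarrow> w \<in> WW \<Longrightarrow> lift T r w = T' r w"
proof -
  define T where "T = (\<lambda>f. T' (rof f) (wof f))"
  have l: "lift T r w = T' r w" if r: "r \<in> RR nR" and w: "w \<in> WW" for r w
  proof (cases "parok w")
    case True
    then show ?thesis by (simp add: lift_def T_def rof_fof[OF r] wof_fof[OF w])
  next
    case False
    then obtain p where p: par "p \<in> Pos d" "snd (snd (w p)) \<noteq> snd p" unfolding parok_def by blast
    have "T' r w = 0"
    proof (rule ccontr)
      assume "T' r w \<noteq> 0"
      then have "\<forall>p\<in>Pos d. snd (snd (w p)) = snd p" using T' r w p(1) unfolding tensors_def by simp
      with p(2,3) show False by blast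
    qed
    with False show ?thesis unfolding lift_def by simp
  qed
  have "\<forall>r\<in>RR nR. kinv (lift T r)"
  proof
    fix r assume r: "r \<in> RR nR"
    have "kinv (T' r)" using T' r unfolding tensors_def by blast
    then show "kinv (lift T r)" by (rule kinv_cong[rotated]) (simp add: l[OF r])
  qed
  then have inv: "\<forall>M\<in>slot_mat ` isom k nC n. \<forall>f\<in>FF. act M T f = T f" by (simp only: kinv_lift_iff)
  have "symt T" unfolding symt_def
  proof (intro allI impI ballI)
    fix p f assume p: "p permutes {..<d}" and f: "f \<in> FF"
    have "rof (f \<circ> p) = rof f \<circ> p"
    proof
      fix s show "rof (f \<circ> p) s = (rof f \<circ> p) s"
        using permutes_in_image[OF p, of s] by (cases "s < d") (simp_all add: rof_def)
    qed
    moreover have "wof (f \<circ> p) = wof f \<circ> hat p"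
    proof
      fix q show "wof (f \<circ> p) q = (wof f \<circ> hat p) q"
        using permutes_in_image[OF p, of "fst q"] by (cases "fst q < d") (simp_all add: wof_def Pos_iff)
    qed
    ultimately show "T (f \<circ> p) = T f"
      using T' rof_in[OF f] wof_in[OF f] p unfolding tensors_def T_def by simp
  qed
  moreover have "slott T" unfolding slott_def
  proof (intro ballI allI impI)
    fix f s assume f: "f \<in> FF" and s: "s < d"
    show "T (f(s := swap_slot fL (f s))) = slot_sign fL * T f"
    proof (cases fL)
      case None
      then show ?thesis by (simp add: swap_slot_def slot_sign_def)
    next
      case (Some \<eta>)
      have 1: "rof (f(s := swap_slot fL (f s))) = rof f"
        unfolding rof_def by (rule restrict_ext) (simp add: swap_slot_def)
      have 2: "wof (f(s := swap_slot fL (f s))) = wof f \<circ> flip s"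
      proof
        fix q :: "nat \<times> bool"
        obtain t b where q: "q = (t, b)" by (cases q)
        show "wof (f(s := swap_slot fL (f s))) q = (wof f \<circ> flip s) q"
          unfolding q by (cases "t < d") (simp_all add: wof_def Pos_iff flip_apply swap_slot_def Some)
      qed
      have "T' (rof f) (wof f \<circ> flip s) = \<eta> * T' (rof f) (wof f)"
        using T' rof_in[OF f] wof_in[OF f] s Some unfolding tensors_def by simp
      then show ?thesis unfolding T_def 1 2 by (simp add: slot_sign_def Some)
    qed
  qed
  ultimately have "invt T" using inv by (simp add: invt_def)
  then show ?thesis using l that by blast
qed

text \<open>The evaluation written on polynomials through \<open>cf\<close> instead of through a
  chosen tensor, which makes it linear by construction.\<close>

definition Psi :: "mat_poly \<Rightarrow> matching_index \<Rightarrow> complex" where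
  "Psi p = (\<lambda>(r, \<rho>, c). if r \<in> RR nR \<and> \<rho> permutes Pos d \<and> c \<in> {..<d} \<rightarrow>\<^sub>E {..<nC} \<and> parok (wm \<rho> c id)
     then cf p (fof r (wm \<rho> c id)) else 0)"

lemma Psi_ten:
  assumes T: "symt T"
  shows "Psi (ten T) = ev nR (lift T)"
proof
  fix x :: matching_index
  obtain r \<rho> c where x: "x = (r, \<rho>, c)" by (cases x)
  show "Psi (ten T) x = ev nR (lift T) x"
  proof (cases "r \<in> RR nR \<and> \<rho> permutes Pos d \<and> c \<in> {..<d} \<rightarrow>\<^sub>E {..<nC} \<and> parok (wm \<rho> c id)")
    case True
    then have r: "r \<in> RR nR" and rho: "\<rho> permutes Pos d" and c: "c \<in> {..<d} \<rightarrow>\<^sub>E {..<nC}" by simp_all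
    have "wm \<rho> c id \<in> WW"
    proof (rule wm_in[OF rho])
      fix j assume j: "j < d"
      then have "c j < nC" using PiE_mem[OF c, of j] by simp
      then show "c j < nC \<and> id j < n (c j)" using big[of "c j"] j by simp
    qed
    then have "fof r (wm \<rho> c id) \<in> FF" using True by (simp add: fof_in_iff[OF r])
    then show ?thesis using True cf_ten[OF T] unfolding x Psi_def ev_def prod.case lift_def by simp
  next
    case False
    then show ?thesis unfolding x Psi_def ev_def prod.case lift_def by simp
  qed
qed

lemma in_invariants_iff: "p \<in> invariants N G K d \<longleftrightarrow> (\<exists>T. p = ten T \<and> invt T)"
  unfolding invt_def
proof (rule invariants_iff[OF Lie_eq])
  fix g assume "g \<in> K"
  then show "\<exists>M\<in>slot_mat ` isom k nC n. repr g M" using act_K by blast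
next
  fix M assume "M \<in> slot_mat ` isom k nC n"
  then obtain h where "h \<in> isom k nC n" "M = slot_mat h" by (elim imageE)
  then show "\<exists>g\<in>K. repr g M" using K_act by blast
qed

text \<open>\<open>Psi\<close> maps the invariants isomorphically onto \<open>Phi\<close>: an
  element of the kernel vanishes at all matching words and hence everywhere by
  \<open>ev_eq_0\<close>, and \<open>ev_surj\<close> supplies preimages. The right side no longer
  contains the sizes \<open>n\<close>.\<close>

theorem dim_invariants:
  "mat_poly.dim (invariants N G K d) = fun_vs.dim (Phi d nR fL nC (flip_sign k) par)"
proof -
  have lin: "Vector_Spaces.linear poly_scale fscale Psi"
    by (intro Vector_Spaces.linear.intro module_hom.intro module_hom_axioms.intro mat_poly.vector_space_axioms
        fun_vs.vector_space_axioms mat_poly.module_axioms fun_vs.module_axioms)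
      (simp_all add: fun_eq_iff Psi_def fscale_def cf_add cf_scale)
  interpret l: Vector_Spaces.linear poly_scale fscale Psi by (rule lin)
  let ?I = "invariants N G K d"
  have inj: "inj_on Psi ?I"
  proof (rule inj_onI)
    fix p q assume pq: "p \<in> ?I" "q \<in> ?I" "Psi p = Psi q"
    have "p - q \<in> ?I" by (rule mat_poly.subspace_diff[OF subspace_invariants pq(1,2)])
    then obtain T where T: "p - q = ten T" "invt T" unfolding in_invariants_iff by (elim exE conjE)
    have "Psi (p - q) = 0" using pq(3) by (simp add: l.diff)
    then have z: "ev nR (lift T) = (\<lambda>_. 0)"
      using T Psi_ten[of T] by (simp add: invt_def zero_fun_def)
    have "T f = 0" if f: "f \<in> FF" for f
      using ev_eq_0[OF lift_in_tensors[OF T(2)] big z rof_in[OF f] wof_in[OF f]] lift_wof[OF f] by simp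
    then have "ten T = 0" by (simp add: ten_def)
    then show "p = q" using T(1) by simp
  qed
  have "Psi ` ?I = Phi d nR fL nC (flip_sign k) par"
  proof (intro equalityI subsetI)
    fix \<phi> assume "\<phi> \<in> Psi ` ?I"
    then obtain p where p: "p \<in> ?I" "\<phi> = Psi p" by blast
    then obtain T where T: "p = ten T" "invt T" unfolding in_invariants_iff by (elim exE conjE)
    then have "\<phi> = ev nR (lift T)" using p(2) Psi_ten by (simp add: invt_def)
    then show "\<phi> \<in> Phi d nR fL nC (flip_sign k) par"
      using ev_in_Phi[OF lift_in_tensors[OF T(2)] big par_KGL] by simp
  next
    fix \<phi> assume "\<phi> \<in> Phi d nR fL nC (flip_sign k) par"
    then obtain T' where T': "T' \<in> tensors nR fL par" "ev nR T' = \<phi>" by (rule ev_surj[OF _ par_KGL])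
    obtain T where T: "invt T" "\<And>r w. r \<in> RR nR \<Longrightarrow> w \<in> WW \<Longrightarrow> lift T r w = T' r w"
      using tensors_lift[OF T'(1)] by blast
    have "ev nR (lift T) = ev nR T'"
    proof
      fix x :: matching_index
      obtain r \<rho> c where x: "x = (r, \<rho>, c)" by (cases x)
      show "ev nR (lift T) x = ev nR T' x"
      proof (cases "r \<in> RR nR \<and> \<rho> permutes Pos d \<and> c \<in> {..<d} \<rightarrow>\<^sub>E {..<nC}")
        case True
        then have r: "r \<in> RR nR" and rho: "\<rho> permutes Pos d" and c: "c \<in> {..<d} \<rightarrow>\<^sub>E {..<nC}" by simp_all
        have "wm \<rho> c id \<in> WW"
        proof (rule wm_in[OF rho])
          fix j assume j: "j < d"
          then have "c j < nC" using PiE_mem[OF c, of j] by simp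
          then show "c j < nC \<and> id j < n (c j)" using big[of "c j"] j by simp
        qed
        then show ?thesis using True T(2)[OF r] unfolding x ev_def prod.case by simp
      next
        case False
        show ?thesis unfolding x ev_def prod.case if_not_P[OF False] by (rule refl)
      qed
    qed
    then have "\<phi> = Psi (ten T)" using T'(2) Psi_ten[of T] T(1) by (simp add: invt_def)
    moreover have "ten T \<in> ?I" using T(1) in_invariants_iff by blast
    ultimately show "\<phi> \<in> Psi ` ?I" by (rule image_eqI)
  qed
  then show ?thesis
    using dim_inj_image[OF mat_poly.vector_space_axioms fun_vs.vector_space_axioms lin subspace_invariants inj] by simp
qed

end

section \<open>Encodings of matrix indices by labels\<close>

text \<open>The only label on which \<open>beta\<close> can be nonzero together with the given one,
  in one of the two orders.\<close>

fun other_end :: "kind \<Rightarrow> label \<Rightarrow> label" where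
  "other_end k (c, a, s) = (c, a, if k = KO then s else \<not> s)"

lemma other_end_other_end [simp]: "other_end k (other_end k x) = x"
  by (cases x) simp

lemma other_end_in: "x \<in> labels k nC n \<Longrightarrow> other_end k x \<in> labels k nC n"
  by (cases x) (simp add: labels_iff)

lemma snd_other_end: "k \<noteq> KO \<Longrightarrow> snd (snd (other_end k x)) = (\<not> snd (snd x))"
  by (cases x) simp

lemma fst_other_end: "fst (other_end k x) = fst x"
  by (cases x) simp

lemma beta_other_end: "beta k x y = (if y = other_end k x then beta k x (other_end k x) else 0)"
  if "x \<in> labels k nC n" "y \<in> labels k nC n"
  using that by (cases x; cases y; cases k) (auto simp: labels_iff)

text \<open>The sign with which a column index enters when \<open>g\<inverse>\<close> is rewritten through the invariant form.\<close>

definition unit_sign :: "kind \<Rightarrow> (label \<Rightarrow> complex) \<Rightarrow> bool" where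
  "unit_sign k th \<longleftrightarrow> (\<forall>x. th x * th x = 1) \<and>
     (if k = KGL then \<forall>x y. snd (snd x) = snd (snd y) \<longrightarrow> th x = th y
      else \<forall>x. th x = beta k (other_end k x) x)"

text \<open>The identity h B h^T = B read as a formula for the inverse of \<open>h\<close>. For
  \<open>KGL\<close> the form pairs in one order only: a plain \<open>x\<close> uses the identity
  for (x, y), a dual \<open>x\<close> the one for (y, x) after exchanging the ends in the
  summation.\<close>

lemma isom_inverse:
  assumes h: "h \<in> isom k nC n" and th: "unit_sign k th" and x: "x \<in> labels k nC n" and y: "y \<in> labels k nC n"
  shows "(\<Sum>z\<in>labels k nC n. h x z * h y (other_end k z) * th (other_end k z) * th y) =
    (if x = other_end k y then 1 else 0)"
proof -
  let ?W = "labels k nC n" and ?e = "other_end k"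
  have I: "(\<Sum>z\<in>?W. h x z * h y (?e z) * beta k z (?e z)) = beta k x y" if x: "x \<in> ?W" and y: "y \<in> ?W" for x y
  proof -
    have "(\<Sum>z'\<in>?W. h x z * h y z' * beta k z z') = h x z * h y (?e z) * beta k z (?e z)" if z: "z \<in> ?W" for z
    proof -
      have "(\<Sum>z'\<in>?W. h x z * h y z' * beta k z z') =
          (\<Sum>z'\<in>?W. if z' = ?e z then h x z * h y (?e z) * beta k z (?e z) else 0)"
      proof (rule sum.cong[OF refl])
        fix z' assume z': "z' \<in> ?W"
        show "h x z * h y z' * beta k z z' = (if z' = ?e z then h x z * h y (?e z) * beta k z (?e z) else 0)"
          by (subst beta_other_end[OF z z']) simp
      qed
      then show ?thesis using other_end_in[OF z] by simp
    qed
    then have "(\<Sum>z\<in>?W. h x z * h y (?e z) * beta k z (?e z)) = (\<Sum>z\<in>?W. \<Sum>z'\<in>?W. h x z * h y z' * beta k z z')"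
      by simp
    also have "\<dots> = beta k x y"
    proof -
      have "\<forall>x\<in>?W. \<forall>y\<in>?W. (\<Sum>z\<in>?W. \<Sum>z'\<in>?W. h x z * h y z' * beta k z z') = beta k x y"
        using h unfolding isom_def by (elim CollectE conjE)
      then show ?thesis by (rule bspec[OF bspec[OF _ x] y])
    qed
    finally show ?thesis .
  qed
  have xe: "x = ?e y \<longleftrightarrow> y = ?e x" by (metis other_end_other_end)
  show ?thesis
  proof (cases "k = KGL")
    case False
    have "if k = KGL then \<forall>x y. snd (snd x) = snd (snd y) \<longrightarrow> th x = th y else \<forall>x. th x = beta k (?e x) x"
      using th unfolding unit_sign_def by (rule conjunct2)
    then have all: "\<forall>x. th x = beta k (?e x) x" unfolding if_not_P[OF False] .
    have t: "th (?e z) = beta k z (?e z)" for z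
      using spec[OF all, of "?e z"] by (simp only: other_end_other_end)
    have "(\<Sum>z\<in>?W. h x z * h y (?e z) * th (?e z) * th y) = beta k x y * th y"
      unfolding t I[OF x y, symmetric] by (simp add: sum_distrib_right)
    also have "\<dots> = (if x = ?e y then 1 else 0)"
    proof (cases "x = ?e y")
      case True
      have "\<forall>y. th y * th y = 1" using th unfolding unit_sign_def by (rule conjunct1)
      then have "th y * th y = 1" by (rule spec)
      moreover have "beta k (?e y) y = th y" using spec[OF all, of y] by (rule sym)
      ultimately show ?thesis using True by simp
    next
      case False
      then have "beta k x y = 0" using beta_other_end[OF x y] xe by simp
      then show ?thesis using False by simp
    qed
    finally show ?thesis .
  next
    case True
    have "if k = KGL then \<forall>x y. snd (snd x) = snd (snd y) \<longrightarrow> th x = th y else \<forall>x. th x = beta k (?e x) x"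
      using th unfolding unit_sign_def by (rule conjunct2)
    then have all: "\<forall>x y. snd (snd x) = snd (snd y) \<longrightarrow> th x = th y" unfolding if_P[OF True] .
    have sq: "\<forall>y. th y * th y = 1" using th unfolding unit_sign_def by (rule conjunct1)
    have tt: "th a * th b = 1" if "snd (snd a) = snd (snd b)" for a b
      using mp[OF spec[OF spec[OF all, of a], of b] that] spec[OF sq, of b] by simp
    have pol: "h a b = 0" if ab: "a \<in> ?W" "b \<in> ?W" "snd (snd a) \<noteq> snd (snd b)" for a b
    proof (rule ccontr)
      assume "h a b \<noteq> 0"
      from isom_supp[OF h ab(1,2) this] show False using True ab(3) by simp
    qed
    have e: "snd (snd (?e z)) = (\<not> snd (snd z))" for z by (rule snd_other_end) (simp add: True)
    have t: "h x z * h y (?e z) * th (?e z) * th y = h x z * h y (?e z)" if z: "z \<in> ?W" for z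
    proof (cases "snd (snd (?e z)) = snd (snd y)")
      case True
      then show ?thesis using tt[OF True] by (simp add: mult.assoc)
    next
      case False
      then have "h y (?e z) = 0" using pol[OF y other_end_in[OF z]] by simp
      then show ?thesis by simp
    qed
    have b: "beta k u (?e u) = (if snd (snd u) then 0 else 1)" for u using True by (cases u) simp
    have bb: "beta k u v = (if v = ?e u \<and> \<not> snd (snd u) then 1 else 0)" if "u \<in> ?W" "v \<in> ?W" for u v
      using beta_other_end[OF that] b by simp
    have "(\<Sum>z\<in>?W. h x z * h y (?e z)) = (if x = ?e y then 1 else 0)"
    proof (cases "snd (snd x)")
      case False
      have "(\<Sum>z\<in>?W. h x z * h y (?e z)) = (\<Sum>z\<in>?W. h x z * h y (?e z) * beta k z (?e z))"
      proof (rule sum.cong[OF refl])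
        fix z assume "z \<in> ?W"
        then show "h x z * h y (?e z) = h x z * h y (?e z) * beta k z (?e z)"
          using pol[OF x, of z] False b[of z] by (cases "snd (snd z)") simp_all
      qed
      then show ?thesis unfolding I[OF x y] bb[OF x y] xe using False by simp
    next
      case xT: True
      have "(\<Sum>z\<in>?W. h x z * h y (?e z)) = (\<Sum>z\<in>?W. h x (?e z) * h y (?e (?e z)))"
        by (rule sum.reindex_bij_witness[where i = ?e and j = ?e]) (simp_all add: other_end_in)
      also have "\<dots> = (\<Sum>z\<in>?W. h y z * h x (?e z) * beta k z (?e z))"
      proof (rule sum.cong[OF refl])
        fix z assume "z \<in> ?W"
        then show "h x (?e z) * h y (?e (?e z)) = h y z * h x (?e z) * beta k z (?e z)"
          using pol[OF x other_end_in, of z] e[of z] b[of z] xT by (cases "snd (snd z)") simp_all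
      qed
      also have "\<dots> = (if x = ?e y then 1 else 0)" unfolding I[OF y x] bb[OF y x] using e[of y] xT by auto
      finally show ?thesis .
    qed
    then show ?thesis by (simp add: t cong: sum.cong)
  qed
qed

text \<open>The row indices of \<open>G\<close>: a factor of \<open>G\<close> and a label. Under
  \<open>par\<close> only plain labels occur, because the rows span the standard representation and
  dual labels come from the columns.\<close>

definition block_labels :: "label set \<Rightarrow> nat \<Rightarrow> bool \<Rightarrow> (nat \<times> label) set" where
  "block_labels W nR par = {u. fst u < nR \<and> snd u \<in> W \<and> (par \<longrightarrow> \<not> snd (snd (snd u)))}"

text \<open>\<open>rho\<close> numbers the rows of the matrices by labels, so that the concrete
  groups can be compared entrywise with the label model.\<close>

locale encoding =
  fixes k :: kind and nC :: nat and n :: "nat \<Rightarrow> nat" and N nR :: nat and par :: bool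
    and rho :: "nat \<times> label \<Rightarrow> nat" and th :: "label \<Rightarrow> complex" and fL :: "complex option"
  assumes rho: "bij_betw rho (block_labels (labels k nC n) nR par) {..<N}"
    and th: "unit_sign k th"
    and par_GL: "par \<Longrightarrow> k = KGL" and par_fL: "par \<Longrightarrow> fL = None"
    and fL_sq: "slot_sign fL * slot_sign fL = 1"
begin

abbreviation "W \<equiv> labels k nC n"
abbreviation "D \<equiv> block_labels W nR par"
abbreviation "S \<equiv> slots W nR par"

text \<open>A matrix unit is a vector times a covector. The form of \<open>K\<close> turns the
  covector into a vector, so the tensor with second label y sits in the column of
  \<open>other_end k y\<close>.\<close>

definition enc :: "nat \<times> label \<times> label \<Rightarrow> nat \<times> nat" where
  "enc u = (rho (fst u, fst (snd u)), rho (fst u, other_end k (snd (snd u))))"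

definition sg :: "nat \<times> label \<times> label \<Rightarrow> complex" where "sg u = th (snd (snd u))"

text \<open>One copy of \<open>h\<close> for every factor of \<open>G\<close>; under
  \<open>par\<close> only the plain part of \<open>h\<close> is visible in \<open>g\<close>.\<close>

definition of_isom :: "(label \<Rightarrow> label \<Rightarrow> complex) \<Rightarrow> complex mat \<Rightarrow> bool" where
  "of_isom h g \<longleftrightarrow> g \<in> carrier_mat N N \<and>
     (\<forall>u\<in>D. \<forall>v\<in>D. g $$ (rho u, rho v) = (if fst u = fst v then h (snd u) (snd v) else 0))"

lemma rho_less: "u \<in> D \<Longrightarrow> rho u < N"
  using bij_betwE[OF rho] by blast

lemma rho_inj: "u \<in> D \<Longrightarrow> v \<in> D \<Longrightarrow> rho u = rho v \<longleftrightarrow> u = v"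
  using bij_betw_imp_inj_on[OF rho] by (auto dest: inj_onD)

lemma rho_surj: "i < N \<Longrightarrow> \<exists>u\<in>D. i = rho u"
  using bij_betw_imp_surj_on[OF rho] by blast

lemma slot_rows: "u \<in> S \<Longrightarrow> (fst u, fst (snd u)) \<in> D"
  by (simp add: slots_def block_labels_def)

lemma slot_cols: "u \<in> S \<Longrightarrow> (fst u, other_end k (snd (snd u))) \<in> D"
proof -
  assume u: "u \<in> S"
  have "\<not> snd (snd (other_end k (snd (snd u))))" if p: par
    using u p snd_other_end[of k "snd (snd u)"] by (simp add: slots_def par_GL[OF p])
  then show ?thesis using u by (simp add: slots_def block_labels_def other_end_in)
qed

lemma th_sq: "th x * th x = 1"
proof -
  have "\<forall>y. th y * th y = 1" using th unfolding unit_sign_def by (rule conjunct1)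
  then show ?thesis by (rule spec)
qed

lemma finite_D: "finite D"
  using bij_betw_finite[OF rho] by simp

sublocale slot_tensors N d S enc sg "swap_slot fL" "slot_sign fL" for d
proof
  have "S \<subseteq> {..<nR} \<times> W \<times> W" unfolding slots_def by (rule subsetI) (simp add: mem_Times_iff)
  then show "finite S" by (rule finite_subset) simp
  show "inj_on enc S"
  proof (rule inj_onI)
    fix u v assume u: "u \<in> S" and v: "v \<in> S" and e: "enc u = enc v"
    then have "(fst u, fst (snd u)) = (fst v, fst (snd v))"
      "(fst u, other_end k (snd (snd u))) = (fst v, other_end k (snd (snd v)))"
      using rho_inj[OF slot_rows[OF u] slot_rows[OF v]] rho_inj[OF slot_cols[OF u] slot_cols[OF v]]
      unfolding enc_def by simp_all
    then have "fst u = fst v" "fst (snd u) = fst (snd v)"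
      "other_end k (other_end k (snd (snd u))) = other_end k (other_end k (snd (snd v)))" by simp_all
    then show "u = v" by (simp add: prod_eq_iff)
  qed
  show "fst (enc u) < N \<and> snd (enc u) < N" if "u \<in> S" for u
    using rho_less[OF slot_rows[OF that]] rho_less[OF slot_cols[OF that]] by (simp add: enc_def)
  show "sg u * sg u = 1" for u by (simp add: sg_def th_sq)
  show "swap_slot fL u \<in> S" if "u \<in> S" for u
  proof (cases "fL = None")
    case True
    then show ?thesis using that by (simp add: swap_slot_def)
  next
    case False
    then have "\<not> par" using par_fL by blast
    then show ?thesis using that False by (simp add: swap_slot_def slots_def)
  qed
  show "swap_slot fL (swap_slot fL u) = u" for u by (simp add: swap_slot_def)
  show "slot_sign fL * slot_sign fL = 1" by (rule fL_sq)
qed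

lemma sum_rho: "(\<Sum>i<N. f i) = (\<Sum>u\<in>D. f (rho u))"
  using sum.reindex_bij_betw[OF rho, of f] by simp

text \<open>By \<open>isom_inverse\<close> the matrix with the stated entries is a right inverse of
  \<open>g\<close>, and for square matrices this is enough.\<close>

lemma of_isom_inverse:
  assumes h: "h \<in> isom k nC n" and g: "of_isom h g"
  shows "invertible_mat g" "mat_inv g \<in> carrier_mat N N"
    and "u \<in> D \<Longrightarrow> v \<in> D \<Longrightarrow> mat_inv g $$ (rho u, rho v) = (if fst u = fst v then
      th (other_end k (snd u)) * th (other_end k (snd v)) * h (other_end k (snd v)) (other_end k (snd u)) else 0)"
proof -
  let ?e = "other_end k"
  define e :: "nat \<times> label \<Rightarrow> nat \<times> label \<Rightarrow> complex" where "e = (\<lambda>u v. if fst u = fst v then th (?e (snd u)) * th (?e (snd v)) * h (?e (snd v)) (?e (snd u)) else (0 :: complex))"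
  define ri where "ri = inv_into D rho"
  have ri: "ri (rho u) = u" if "u \<in> D" for u
    unfolding ri_def by (rule bij_betw_inv_into_left[OF rho that])
  define g' where "g' = mat N N (\<lambda>(i, j). e (ri i) (ri j))"
  have g'c: "g' \<in> carrier_mat N N" by (simp add: g'_def)
  have g'e: "g' $$ (rho u, rho v) = e u v" if "u \<in> D" "v \<in> D" for u v
    using that by (simp add: g'_def rho_less ri)
  have gc: "g \<in> carrier_mat N N" and ge: "u \<in> D \<Longrightarrow> v \<in> D \<Longrightarrow> g $$ (rho u, rho v) = (if fst u = fst v then h (snd u) (snd v) else 0)" for u v
    using g unfolding of_isom_def by simp_all
  have m: "g * g' = 1\<^sub>m N"
  proof (rule eq_matI)
    fix i j assume ij: "i < dim_row (1\<^sub>m N :: complex mat)" "j < dim_col (1\<^sub>m N :: complex mat)"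
    then have iN: "i < N" "j < N" by simp_all
    obtain u where u: "u \<in> D" "i = rho u" using rho_surj[OF iN(1)] by (elim bexE)
    obtain v where v: "v \<in> D" "j = rho v" using rho_surj[OF iN(2)] by (elim bexE)
    have "(g * g') $$ (i, j) = (\<Sum>l<N. g $$ (i, l) * g' $$ (l, j))"
      using ij gc g'c by (simp add: scalar_prod_def atLeast0LessThan)
    also have "\<dots> = (\<Sum>z\<in>D. g $$ (rho u, rho z) * g' $$ (rho z, rho v))" unfolding u v by (rule sum_rho)
    also have "\<dots> = (\<Sum>z\<in>D. if fst z = fst u then (if fst u = fst v then h (snd u) (snd z) * h (?e (snd v)) (?e (snd z)) * th (?e (snd z)) * th (?e (snd v)) else 0) else 0)"
      by (rule sum.cong[OF refl]) (simp add: ge g'e u v e_def)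
    also have "\<dots> = (\<Sum>z\<in>{z \<in> D. fst z = fst u}. if fst u = fst v then h (snd u) (snd z) * h (?e (snd v)) (?e (snd z)) * th (?e (snd z)) * th (?e (snd v)) else 0)"
      by (rule sum.inter_filter[symmetric]) (rule finite_D)
    also have "\<dots> = (\<Sum>z\<in>{z \<in> W. par \<longrightarrow> \<not> snd (snd z)}. if fst u = fst v then h (snd u) z * h (?e (snd v)) (?e z) * th (?e z) * th (?e (snd v)) else 0)"
      by (rule sum.reindex_bij_witness[where i = "\<lambda>z. (fst u, z)" and j = snd])
        (use u(1) in \<open>auto simp: block_labels_def\<close>)
    \<comment> \<open>Under \<open>par\<close> the sum runs over plain labels only. The dual ones
      may be added because the row of \<open>u\<close> is plain and \<open>h\<close> preserves
      polarity.\<close>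
    also have "\<dots> = (\<Sum>z\<in>W. if fst u = fst v then h (snd u) z * h (?e (snd v)) (?e z) * th (?e z) * th (?e (snd v)) else 0)"
    proof (rule sum.mono_neutral_left)
      show "\<forall>z\<in>W - {z \<in> W. par \<longrightarrow> \<not> snd (snd z)}. (if fst u = fst v then h (snd u) z * h (?e (snd v)) (?e z) * th (?e z) * th (?e (snd v)) else 0) = 0"
      proof
        fix z assume "z \<in> W - {z \<in> W. par \<longrightarrow> \<not> snd (snd z)}"
        then have z: "z \<in> W" "par" "snd (snd z)" by auto
        have "h (snd u) z = 0"
        proof (rule ccontr)
          assume "h (snd u) z \<noteq> 0"
          then have "snd (snd (snd u)) = snd (snd z)"
            using isom_supp[OF h _ z(1), of "snd u"] u(1) par_GL[OF z(2)] by (simp add: block_labels_def)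
          then show False using z u(1) by (simp add: block_labels_def)
        qed
        then show "(if fst u = fst v then h (snd u) z * h (?e (snd v)) (?e z) * th (?e z) * th (?e (snd v)) else 0) = 0" by simp
      qed
    qed auto
    also have "\<dots> = (if fst u = fst v then (if snd u = snd v then 1 else 0) else 0)"
    proof (cases "fst u = fst v")
      case True
      have "snd u \<in> W" "?e (snd v) \<in> W" using u(1) v(1) by (simp_all add: block_labels_def other_end_in)
      from isom_inverse[OF h th this] show ?thesis using True by simp
    qed simp
    also have "\<dots> = 1\<^sub>m N $$ (i, j)"
      using ij rho_inj[OF u(1) v(1)] by (auto simp: u v prod_eq_iff)
    finally show "(g * g') $$ (i, j) = 1\<^sub>m N $$ (i, j)" .
  qed (use gc g'c in auto)
  have m': "g' * g = 1\<^sub>m N" by (rule mat_mult_left_right_inverse[OF gc g'c m])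
  show inv: "invertible_mat g"
    unfolding invertible_mat_def inverts_mat_def using gc g'c m m' by auto
  show ic: "mat_inv g \<in> carrier_mat N N" by (rule mat_inv(1)[OF gc inv])
  have "mat_inv g = g'"
  proof -
    have "mat_inv g = mat_inv g * (g * g')" using m ic by simp
    also have "\<dots> = mat_inv g * g * g'" using assoc_mult_mat[OF ic gc g'c] by simp
    also have "\<dots> = g'" using mat_inv(3)[OF gc inv] g'c by simp
    finally show ?thesis .
  qed
  then show "u \<in> D \<Longrightarrow> v \<in> D \<Longrightarrow> mat_inv g $$ (rho u, rho v) = (if fst u = fst v then
      th (?e (snd u)) * th (?e (snd v)) * h (?e (snd v)) (?e (snd u)) else 0)"
    using g'e by (simp add: e_def)
qed

text \<open>Conjugation sends a matrix unit to a column of \<open>g\<close> times a row of its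
  inverse. \<open>of_isom_inverse\<close> expresses that row by \<open>h\<close> with two signs
  \<open>th\<close>, and these cancel against the signs in the coordinates.\<close>

lemma of_isom_repr:
  assumes h: "h \<in> isom k nC n" and g: "of_isom h g"
  shows "repr g (slot_mat h)"
  unfolding repr_def
proof
  fix u assume u: "u \<in> S"
  let ?e = "other_end k"
  note inv = of_isom_inverse[OF h g]
  have gc: "g \<in> carrier_mat N N" and ge: "u \<in> D \<Longrightarrow> v \<in> D \<Longrightarrow> g $$ (rho u, rho v) = (if fst u = fst v then h (snd u) (snd v) else 0)" for u v
    using g unfolding of_isom_def by simp_all
  note ru = slot_rows[OF u] and cu = slot_cols[OF u]
  let ?X = "Ad g (matrix_unit N (enc u))"
  have Xe: "?X $$ (rho a, rho b) = (if fst a = fst u \<and> fst u = fst b then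
      h (snd a) (fst (snd u)) * (th (snd (snd u)) * th (?e (snd b)) * h (?e (snd b)) (snd (snd u))) else 0)"
    if a: "a \<in> D" and b: "b \<in> D" for a b
    unfolding enc_def Ad_unit_entry[OF gc inv(2) rho_less[OF ru] rho_less[OF cu] rho_less[OF a] rho_less[OF b]]
    by (simp add: ge[OF a ru] inv(3)[OF cu b])
  have "matrix_unit N (enc u) \<in> carrier_mat N N" by (simp add: matrix_unit_def)
  then have Xc: "?X \<in> carrier_mat N N" unfolding Ad_def by (intro mult_carrier_mat[of _ N N] gc inv(2))
  have X0: "?X $$ (i, j) = 0" if ij: "i < N" "j < N" "(i, j) \<notin> enc ` S" for i j
  proof -
    obtain a where a: "a \<in> D" "i = rho a" using rho_surj[OF ij(1)] by (elim bexE)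
    obtain b where b: "b \<in> D" "j = rho b" using rho_surj[OF ij(2)] by (elim bexE)
    have "fst a \<noteq> fst b"
    proof
      assume ab: "fst a = fst b"
      let ?v = "(fst a, snd a, ?e (snd b))"
      have "?v \<in> S"
        using a(1) b(1) par_GL snd_other_end[of k "snd b"] by (auto simp: slots_def block_labels_def other_end_in)
      moreover have "enc ?v = (i, j)" by (simp add: enc_def a b) (simp add: ab)
      ultimately show False using ij(3) by (metis imageI)
    qed
    then show ?thesis unfolding a b by (subst Xe[OF a(1) b(1)]) auto
  qed
  have "sym_Ad g (yv u) = poly_scale (sg u) (of_matrix ?X)"
    using gc by (simp add: sym_Ad_def yv_def poly_subst_scale poly_subst_var)
  also have "\<dots> = (\<Sum>u'\<in>S. poly_scale (sg u * crd ?X u') (yv u'))"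
    by (simp add: of_matrix_VV[OF Xc X0] mat_poly.scale_sum_right)
  also have "\<dots> = (\<Sum>u'\<in>S. poly_scale (slot_mat h u' u) (yv u'))"
  proof (rule sum.cong[OF refl])
    fix u' assume u': "u' \<in> S"
    have "?X $$ enc u' = (if fst u' = fst u then
        h (fst (snd u')) (fst (snd u)) * (th (snd (snd u)) * th (snd (snd u')) * h (snd (snd u')) (snd (snd u))) else 0)"
      unfolding enc_def[of u'] by (simp add: Xe[OF slot_rows[OF u'] slot_cols[OF u']])
    then have "sg u * crd ?X u' = (th (snd (snd u)) * th (snd (snd u))) * (th (snd (snd u')) * th (snd (snd u'))) * slot_mat h u' u"
      by (simp add: crd_def sg_def slot_mat_def)
    then show "poly_scale (sg u * crd ?X u') (yv u') = poly_scale (slot_mat h u' u) (yv u')"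
      by (simp add: th_sq)
  qed
  finally show "sym_Ad g (yv u) = (\<Sum>u'\<in>S. poly_scale (slot_mat h u' u) (yv u'))" .
qed

theorem dim_invariants_encoding:
  assumes L: "Lie N G = VV"
    and K1: "\<And>g. g \<in> K \<Longrightarrow> \<exists>h\<in>isom k nC n. of_isom h g"
    and K2: "\<And>h. h \<in> isom k nC n \<Longrightarrow> \<exists>g\<in>K. of_isom h g"
    and big: "\<And>i. i < nC \<Longrightarrow> 3 * d \<le> n i"
  shows "mat_poly.dim (invariants N G K d) = fun_vs.dim (Phi d nR fL nC (flip_sign k) par)"
proof -
  interpret f: family k nC n d N nR par fL enc sg G K
  proof
    show "\<exists>h\<in>isom k nC n. repr g (slot_mat h)" if "g \<in> K" for g
      using K1[OF that] of_isom_repr by blast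
    show "\<exists>g\<in>K. repr g (slot_mat h)" if "h \<in> isom k nC n" for h
      using K2[OF that] of_isom_repr[OF that] by blast
  qed (use L big par_GL par_fL in auto)
  show ?thesis by (rule f.dim_invariants)
qed

end

section \<open>Lie algebras of isometry groups\<close>

lemma holomorphic_det:
  assumes "\<And>i j. i < n \<Longrightarrow> j < n \<Longrightarrow> (\<lambda>z. A z $$ (i, j)) holomorphic_on T" and "\<And>z. A z \<in> carrier_mat n n"
  shows "(\<lambda>z. Determinant.det (A z)) holomorphic_on T"
proof -
  have e: "Determinant.det (A z) = (\<Sum>p | p permutes {0..<n}. signof p * (\<Prod>i = 0..<n. A z $$ (i, p i)))" for z
    by (rule det_def'[OF assms(2)])
  show ?thesis unfolding e
    by (intro holomorphic_intros assms(1)) (auto simp: permutes_def permutes_in_image)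
qed

lemma mult_entry:
  assumes "M \<in> carrier_mat n n" "C \<in> carrier_mat n n" "i < n" "j < n"
  shows "(M * C) $$ (i, j) = (\<Sum>l<n. M $$ (i, l) * C $$ (l, j))"
  using carrier_matD[OF assms(1)] carrier_matD[OF assms(2)] assms(3,4)
  by (simp add: scalar_prod_def atLeast0LessThan)

lemma mult3_entry:
  assumes A: "A \<in> carrier_mat n n" and B: "B \<in> carrier_mat n n" and C: "C \<in> carrier_mat n n" and ij: "i < n" "j < n"
  shows "(A * B * C) $$ (i, j) = (\<Sum>l<n. (\<Sum>k<n. A $$ (i, k) * B $$ (k, l)) * C $$ (l, j))"
  unfolding mult_entry[OF mult_carrier_mat[OF A B] C ij]
  by (rule sum.cong[OF refl]) (simp only: lessThan_iff mult_entry[OF A B ij(1)])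

text \<open>Testing on unit vectors turns the condition on vectors into a matrix identity.\<close>

lemma isometries_eq:
  assumes B: "B \<in> carrier_mat n n"
  shows "isometries n B = {g \<in> GL n. transpose_mat g * B * g = B}"
proof -
  have e: "scalar_prod (g *\<^sub>v x) (B *\<^sub>v (g *\<^sub>v y)) = scalar_prod x ((transpose_mat g * B * g) *\<^sub>v y)"
    if g: "g \<in> carrier_mat n n" and x: "x \<in> carrier_vec n" and y: "y \<in> carrier_vec n" for g x y
  proof -
    have "(transpose_mat g * B * g) *\<^sub>v y = transpose_mat g *\<^sub>v (B *\<^sub>v (g *\<^sub>v y))"
    proof -
      have "(transpose_mat g * B * g) *\<^sub>v y = (transpose_mat g * B) *\<^sub>v (g *\<^sub>v y)"
        by (rule assoc_mult_mat_vec[of _ n n]) (use g B y in auto)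
      also have "\<dots> = transpose_mat g *\<^sub>v (B *\<^sub>v (g *\<^sub>v y))"
        by (rule assoc_mult_mat_vec[of _ n n]) (use g B y in auto)
      finally show ?thesis .
    qed
    moreover have "scalar_prod x (transpose_mat g *\<^sub>v v) = scalar_prod (g *\<^sub>v x) v" if v: "v \<in> carrier_vec n" for v
    proof -
      have "scalar_prod (transpose_mat (transpose_mat g) *\<^sub>v x) v = scalar_prod x (transpose_mat g *\<^sub>v v)"
        by (rule transpose_vec_mult_scalar) (use g x v in auto)
      then show ?thesis by simp
    qed
    ultimately show ?thesis using g B y by simp
  qed
  have unit: "M = B" if M: "M \<in> carrier_mat n n"
    and h: "\<And>x y. x \<in> carrier_vec n \<Longrightarrow> y \<in> carrier_vec n \<Longrightarrow> scalar_prod x (M *\<^sub>v y) = scalar_prod x (B *\<^sub>v y)" for M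
  proof (rule eq_matI)
    fix i j assume "i < dim_row B" "j < dim_col B"
    then have ij: "i < n" "j < n" using B by auto
    have "scalar_prod (unit_vec n i) (C *\<^sub>v unit_vec n j) = C $$ (i, j)" if "C \<in> carrier_mat n n" for C :: "complex mat"
      using that ij by (simp add: scalar_prod_left_unit scalar_prod_right_unit)
    then show "M $$ (i, j) = B $$ (i, j)" using h[of "unit_vec n i" "unit_vec n j"] M B by simp
  qed (use M B in auto)
  show ?thesis
  proof (rule Set.set_eqI)
    fix g
    show "g \<in> isometries n B \<longleftrightarrow> g \<in> {g \<in> GL n. transpose_mat g * B * g = B}"
    proof (cases "g \<in> GL n")
      case True
      then have g: "g \<in> carrier_mat n n" by (simp add: GL_def)
      have Mc: "transpose_mat g * B * g \<in> carrier_mat n n" using g B by simp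
      have "(\<forall>x\<in>carrier_vec n. \<forall>y\<in>carrier_vec n. scalar_prod (g *\<^sub>v x) (B *\<^sub>v (g *\<^sub>v y)) = scalar_prod x (B *\<^sub>v y)) \<longleftrightarrow>
         transpose_mat g * B * g = B"
      proof
        assume h: "\<forall>x\<in>carrier_vec n. \<forall>y\<in>carrier_vec n. scalar_prod (g *\<^sub>v x) (B *\<^sub>v (g *\<^sub>v y)) = scalar_prod x (B *\<^sub>v y)"
        show "transpose_mat g * B * g = B"
        proof (rule unit[OF Mc])
          fix x y :: "complex vec" assume xy: "x \<in> carrier_vec n" "y \<in> carrier_vec n"
          show "scalar_prod x ((transpose_mat g * B * g) *\<^sub>v y) = scalar_prod x (B *\<^sub>v y)"
            using bspec[OF bspec[OF h xy(1)] xy(2)] unfolding e[OF g xy] .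
        qed
      next
        assume h: "transpose_mat g * B * g = B"
        show "\<forall>x\<in>carrier_vec n. \<forall>y\<in>carrier_vec n. scalar_prod (g *\<^sub>v x) (B *\<^sub>v (g *\<^sub>v y)) = scalar_prod x (B *\<^sub>v y)"
          by (intro ballI) (simp only: e[OF g] h)
      qed
      then show ?thesis using True unfolding isometries_def by simp
    next
      case False
      then show ?thesis unfolding isometries_def by simp
    qed
  qed
qed

lemma GL_iff_det: "g \<in> GL n \<longleftrightarrow> g \<in> carrier_mat n n \<and> Determinant.det g \<noteq> 0"
proof
  assume g: "g \<in> GL n"
  then have c: "g \<in> carrier_mat n n" "invertible_mat g" by (simp_all add: GL_def)
  have "Determinant.det g * Determinant.det (mat_inv g) = Determinant.det (g * mat_inv g)"
    by (rule det_mult[symmetric, OF c(1) mat_inv(1)[OF c]])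
  then have "Determinant.det g * Determinant.det (mat_inv g) = 1" unfolding mat_inv(2)[OF c] by simp
  then show "g \<in> carrier_mat n n \<and> Determinant.det g \<noteq> 0" using c by auto
next
  assume g: "g \<in> carrier_mat n n \<and> Determinant.det g \<noteq> 0"
  then have c: "g \<in> carrier_mat n n" by simp
  let ?B = "(1 / Determinant.det g) \<cdot>\<^sub>m adj_mat g"
  note adj = adj_mat[OF c]
  have B: "?B \<in> carrier_mat n n" using adj(1) by simp
  have 1: "g * ?B = 1\<^sub>m n"
    unfolding mult_smult_distrib[OF c adj(1)] adj(2) using g by (intro eq_matI) auto
  have 2: "?B * g = 1\<^sub>m n" by (rule mat_mult_left_right_inverse[OF c B 1])
  show "g \<in> GL n" unfolding GL_def invertible_mat_def inverts_mat_def using c B 1 2 by auto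
qed

definition tangent_curve :: "nat \<Rightarrow> complex mat \<Rightarrow> real \<Rightarrow> (complex \<Rightarrow> complex mat) \<Rightarrow> bool" where
  "tangent_curve n X r c \<longleftrightarrow> r > 0 \<and> c 0 = 1\<^sub>m n \<and> (\<forall>i<n. \<forall>j<n. (\<lambda>z. c z $$ (i, j)) holomorphic_on ball 0 r \<and>
     deriv (\<lambda>z. c z $$ (i, j)) 0 = X $$ (i, j))"

lemma Lie_iff: "X \<in> Lie n G \<longleftrightarrow> X \<in> carrier_mat n n \<and> (\<exists>r c. tangent_curve n X r c \<and> (\<forall>z\<in>ball 0 r. c z \<in> G))"
  unfolding Lie_def tangent_curve_def by blast

text \<open>The Cayley transform \<open>(1 - zX/2)\<inverse>(1 + zX/2) = 1 + z(1 - zX/2)\<inverse>X\<close>.\<close>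

lemma cayley_curve:
  assumes X: "X \<in> carrier_mat n n" and B: "B \<in> carrier_mat n n"
    and XB: "transpose_mat X * B = - (B * X)"
  obtains r c where "tangent_curve n X r c" "\<And>z. z \<in> ball 0 r \<Longrightarrow> c z \<in> isometries n B"
    "\<And>z. z \<in> ball 0 r \<Longrightarrow> Determinant.det B \<noteq> 0 \<Longrightarrow> Determinant.det (c z) = 1"
proof -
  define A where "A = (\<lambda>z. 1\<^sub>m n + (- (z / 2)) \<cdot>\<^sub>m X)"
  have A: "A z \<in> carrier_mat n n" for z using X by (simp add: A_def)
  have Aij: "A z $$ (i, j) = (if i = j then 1 else 0) - z / 2 * X $$ (i, j)" if "i < n" "j < n" for z i j
    using that X by (simp add: A_def)
  have holA: "(\<lambda>z. A z $$ (i, j)) holomorphic_on T" if "i < n" "j < n" for i j T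
    unfolding Aij[OF that] by (intro holomorphic_intros) auto
  define D where "D = (\<lambda>z. Determinant.det (A z))"
  have holD: "D holomorphic_on UNIV" unfolding D_def by (rule holomorphic_det[of n]) (use holA A in auto)
  have A0: "A 0 = 1\<^sub>m n" unfolding A_def using X by (intro eq_matI) auto
  have D0: "D 0 = 1" by (simp add: D_def A0)
  \<comment> \<open>\<open>D\<close> equals 1 at 0 and the ball is symmetric, so \<open>A z\<close>
    and \<open>A (- z)\<close> are both invertible on a small ball.\<close>
  have "continuous_on UNIV D" by (rule holomorphic_on_imp_continuous_on[OF holD])
  then have "isCont D 0" by (simp add: continuous_on_eq_continuous_at[OF open_UNIV])
  then obtain r where r: "r > 0" "\<And>z. dist 0 z < r \<Longrightarrow> D z \<noteq> 0"
    using continuous_at_avoid[of 0 D 0] D0 by auto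
  have Dz: "D z \<noteq> 0" "D (- z) \<noteq> 0" if "z \<in> ball 0 r" for z
    using that r(2)[of z] r(2)[of "- z"] by (auto simp: dist_norm)
  define V where "V = (\<lambda>z. (1 / D z) \<cdot>\<^sub>m adj_mat (A z))"
  have V: "V z \<in> carrier_mat n n" for z using adj_mat(1)[OF A] by (simp add: V_def)
  have AV: "A z * V z = 1\<^sub>m n" if "D z \<noteq> 0" for z
    unfolding V_def mult_smult_distrib[OF A adj_mat(1)[OF A]] adj_mat(2)[OF A]
    using that by (intro eq_matI) (auto simp: D_def)
  have VA: "V z * A z = 1\<^sub>m n" if "D z \<noteq> 0" for z
    by (rule mat_mult_left_right_inverse[OF A V AV[OF that]])
  \<comment> \<open>Cramer's rule: the entries of the inverse are cofactors divided by
    \<open>D\<close>.\<close>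
  have holV: "(\<lambda>z. V z $$ (i, j)) holomorphic_on ball 0 r" if ij: "i < n" "j < n" for i j
  proof -
    have e: "V z $$ (i, j) = 1 / D z * ((- 1) ^ (j + i) * Determinant.det (mat_delete (A z) j i))" for z
      using ij A[of z] by (simp add: V_def adj_mat_def cofactor_def carrier_matD)
    have "(\<lambda>z. Determinant.det (mat_delete (A z) j i)) holomorphic_on ball 0 r"
    proof (rule holomorphic_det[of "n - 1"])
      show "mat_delete (A z) j i \<in> carrier_mat (n - 1) (n - 1)" for z by (rule mat_delete_carrier[OF A])
      fix a b assume ab: "a < n - 1" "b < n - 1"
      let ?a = "if a < j then a else Suc a" and ?b = "if b < i then b else Suc b"
      have md: "mat_delete (A z) j i $$ (a, b) = A z $$ (?a, ?b)" for z
        unfolding mat_delete_def using ab carrier_matD[OF A[of z]] by simp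
      show "(\<lambda>z. mat_delete (A z) j i $$ (a, b)) holomorphic_on ball 0 r"
        unfolding md by (rule holA) (use ab in auto)
    qed
    then show ?thesis unfolding e
      by (intro holomorphic_intros holomorphic_on_subset[OF holD]) (use Dz in auto)
  qed
  define c where "c = (\<lambda>z. 1\<^sub>m n + z \<cdot>\<^sub>m (V z * X))"
  have VX: "V z * X \<in> carrier_mat n n" for z by (rule mult_carrier_mat[OF V X])
  have c: "c z \<in> carrier_mat n n" for z using VX by (simp add: c_def)
  have V0: "V 0 = 1\<^sub>m n" using AV[of 0] D0 V[of 0] by (simp add: A0)
  have tc: "tangent_curve n X r c"
    unfolding tangent_curve_def
  proof (intro conjI allI impI)
    show "c 0 = 1\<^sub>m n" unfolding c_def using carrier_matD[OF V[of 0]] carrier_matD[OF X] by (intro eq_matI) auto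
    fix i j assume ij: "i < n" "j < n"
    let ?g = "\<lambda>z. \<Sum>l<n. V z $$ (i, l) * X $$ (l, j)"
    have ce: "c z $$ (i, j) = (if i = j then 1 else 0) + z * ?g z" for z
      using ij carrier_matD[OF V[of z]] carrier_matD[OF X] by (simp add: c_def scalar_prod_def atLeast0LessThan)
    have holg: "?g holomorphic_on ball 0 r" by (intro holomorphic_intros holV) (use ij in auto)
    show "(\<lambda>z. c z $$ (i, j)) holomorphic_on ball 0 r" unfolding ce by (intro holomorphic_intros holg)
    have "(?g has_field_derivative deriv ?g 0) (at 0)"
      by (rule holomorphic_derivI[OF holg]) (use r in auto)
    then have "((\<lambda>z. (if i = j then 1 else 0) + z * ?g z) has_field_derivative (0 + (1 * ?g 0 + deriv ?g 0 * 0))) (at 0)"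
      by (intro DERIV_add DERIV_const DERIV_mult DERIV_ident)
    then have "deriv (\<lambda>z. c z $$ (i, j)) 0 = ?g 0" unfolding ce by (intro DERIV_imp_deriv) simp
    also have "?g 0 = X $$ (i, j)" using ij unfolding V0 by (simp add: if_distrib[of "\<lambda>x. x * _"] cong: if_cong)
    finally show "deriv (\<lambda>z. c z $$ (i, j)) 0 = X $$ (i, j)" .
  qed (rule r(1))
  have Aneg: "A (- z) = 1\<^sub>m n + (z / 2) \<cdot>\<^sub>m X" for z by (simp add: A_def)
  \<comment> \<open>\<open>A z\<close> and \<open>A (- z)\<close> are polynomials in
    \<open>X\<close> and therefore commute, so the different ways of writing the Cayley transform
    agree.\<close>
  have cA: "c z = A (- z) * V z" "A (- z) * A z = A z * A (- z)" "c z * A z = A (- z)" if z: "D z \<noteq> 0" for z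
  proof -
    have s: "A (- z) = A z + z \<cdot>\<^sub>m X" unfolding A_def using X by (intro eq_matI) (auto simp: field_simps)
    have aX: "a \<cdot>\<^sub>m X \<in> carrier_mat n n" for a using X by simp
    have XA: "X * A z = A z * X"
      unfolding A_def mult_add_distrib_mat[OF X one_carrier_mat aX] add_mult_distrib_mat[OF one_carrier_mat aX X]
        mult_smult_distrib[OF X X] mult_smult_assoc_mat[OF X X] left_mult_one_mat[OF X] right_mult_one_mat[OF X] ..
    have com: "A (- z) * A z = A z * A (- z)"
      unfolding s add_mult_distrib_mat[OF A aX A] mult_add_distrib_mat[OF A A aX]
        mult_smult_distrib[OF A X] mult_smult_assoc_mat[OF X A] XA ..
    show "A (- z) * A z = A z * A (- z)" by (rule com)
    have zX: "z \<cdot>\<^sub>m X \<in> carrier_mat n n" using X by simp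
    have "V z * A (- z) = V z * A z + V z * (z \<cdot>\<^sub>m X)"
      unfolding s by (rule mult_add_distrib_mat[OF V A zX])
    also have "\<dots> = c z" unfolding VA[OF z] c_def mult_smult_distrib[OF V X] ..
    finally have c1: "V z * A (- z) = c z" .
    have "c z * A z = V z * (A (- z) * A z)" unfolding c1[symmetric] by (rule assoc_mult_mat[OF V A A])
    also have "\<dots> = (V z * A z) * A (- z)" unfolding com by (rule assoc_mult_mat[OF V A A, symmetric])
    also have "\<dots> = A (- z)" unfolding VA[OF z] by (rule left_mult_one_mat[OF A])
    finally show c2: "c z * A z = A (- z)" .
    have "A (- z) * V z = c z * (A z * V z)" unfolding c2[symmetric] by (rule assoc_mult_mat[OF c A V])
    then show "c z = A (- z) * V z" unfolding AV[OF z] right_mult_one_mat[OF c] by simp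
  qed
  \<comment> \<open>The infinitesimal condition moves \<open>A z\<close> across \<open>B\<close> at
    the price of replacing \<open>z\<close> by \<open>- z\<close>; this is what makes the transform
    an isometry.\<close>
  have TB: "transpose_mat (A z) * B = B * A (- z)" for z
  proof -
    have zX: "a \<cdot>\<^sub>m X \<in> carrier_mat n n" for a using X by simp
    have tX: "transpose_mat X \<in> carrier_mat n n" using X by simp
    have t: "transpose_mat (A z) = 1\<^sub>m n + (- (z / 2)) \<cdot>\<^sub>m transpose_mat X"
      unfolding A_def using X by (intro eq_matI) auto
    have "transpose_mat (A z) * B = 1\<^sub>m n * B + ((- (z / 2)) \<cdot>\<^sub>m transpose_mat X) * B"
      unfolding t by (rule add_mult_distrib_mat) (use tX B in auto)
    also have "((- (z / 2)) \<cdot>\<^sub>m transpose_mat X) * B = (z / 2) \<cdot>\<^sub>m (B * X)"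
      unfolding mult_smult_assoc_mat[OF tX B] XB using mult_carrier_mat[OF B X] by (intro eq_matI) auto
    also have "1\<^sub>m n * B + (z / 2) \<cdot>\<^sub>m (B * X) = B * 1\<^sub>m n + B * ((z / 2) \<cdot>\<^sub>m X)"
      unfolding mult_smult_distrib[OF B X] using B by simp
    also have "\<dots> = B * A (- z)"
      unfolding Aneg by (rule mult_add_distrib_mat[symmetric, OF B _ zX]) simp
    finally show ?thesis .
  qed
  have detc: "Determinant.det (c z) \<noteq> 0" if z: "z \<in> ball 0 r" for z
  proof -
    have "Determinant.det (c z) * D z = D (- z)"
      unfolding D_def det_mult[OF c A, symmetric] cA(3)[OF Dz(1)[OF z]] ..
    then show ?thesis using Dz(2)[OF z] by auto
  qed
  have iso: "c z \<in> isometries n B" if z: "z \<in> ball 0 r" for z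
  proof -
    note nz = Dz(1)[OF z]
    let ?t = "transpose_mat"
    have tA: "?t (A y) \<in> carrier_mat n n" for y using A[of y] by simp
    have tV: "?t (V z) \<in> carrier_mat n n" using V[of z] by simp
    have tVA: "?t (V z) * ?t (A z) = 1\<^sub>m n"
      unfolding transpose_mult[OF A V, symmetric] AV[OF nz] by simp
    have BA: "B * A y \<in> carrier_mat n n" for y by (rule mult_carrier_mat[OF B A])
    have "?t (c z) = ?t (V z) * ?t (A (- z))" unfolding cA(1)[OF nz] by (rule transpose_mult[OF A V])
    then have "?t (c z) * B = ?t (V z) * (?t (A (- z)) * B)" by (simp only: assoc_mult_mat[OF tV tA B])
    also have "\<dots> = ?t (V z) * (B * A z)" using TB[of "- z"] by simp
    finally have 1: "?t (c z) * B = ?t (V z) * (B * A z)" .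
    have "?t (c z) * B * c z = ?t (V z) * (B * A z * c z)" unfolding 1 by (rule assoc_mult_mat[OF tV BA c])
    also have "B * A z * c z = B * (A z * c z)" by (rule assoc_mult_mat[OF B A c])
    also have "A z * c z = A (- z)"
    proof -
      have "A z * c z = A z * A (- z) * V z" unfolding cA(1)[OF nz] by (rule assoc_mult_mat[symmetric, OF A A V])
      also have "\<dots> = A (- z) * (A z * V z)" unfolding cA(2)[OF nz, symmetric] by (rule assoc_mult_mat[OF A A V])
      finally show ?thesis unfolding AV[OF nz] right_mult_one_mat[OF A] .
    qed
    also have "B * A (- z) = ?t (A z) * B" by (rule TB[symmetric])
    also have "?t (V z) * (?t (A z) * B) = B"
      unfolding assoc_mult_mat[symmetric, OF tV tA B] tVA by (rule left_mult_one_mat[OF B])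
    finally have "?t (c z) * B * c z = B" .
    moreover have "c z \<in> GL n" unfolding GL_iff_det using c detc[OF z] by simp
    ultimately show ?thesis unfolding isometries_eq[OF B] by simp
  qed
  \<comment> \<open>Determinants of the same identity give \<open>D (- z) = D z\<close> for
    nondegenerate \<open>B\<close>, so the curve stays in the special group.\<close>
  have detone: "Determinant.det (c z) = 1" if z: "z \<in> ball 0 r" and dB: "Determinant.det B \<noteq> 0" for z
  proof -
    have "Determinant.det (transpose_mat (A z) * B) = Determinant.det (B * A (- z))" unfolding TB ..
    then have "D z * Determinant.det B = Determinant.det B * D (- z)"
      using det_mult[of "transpose_mat (A z)" n B] det_mult[OF B A[of "- z"]] A[of z] B det_transpose[OF A[of z]]
      by (simp add: D_def)
    then have "D (- z) = D z" using dB by (simp add: mult.commute)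
    moreover have "Determinant.det (c z) * D z = D (- z)"
      unfolding D_def det_mult[OF c A, symmetric] cA(3)[OF Dz(1)[OF z]] ..
    ultimately show ?thesis using Dz(1)[OF z] by simp
  qed
  show ?thesis by (rule that[OF tc iso detone])
qed

text \<open>X^T B + B X = 0, entry by entry.\<close>

definition lie_form :: "nat \<Rightarrow> complex mat \<Rightarrow> complex mat set" where
  "lie_form n B = {X \<in> carrier_mat n n. \<forall>i<n. \<forall>j<n.
     (\<Sum>k<n. X $$ (k, i) * B $$ (k, j)) + (\<Sum>k<n. B $$ (i, k) * X $$ (k, j)) = 0}"

text \<open>One inclusion differentiates the isometry identity, the other is the Cayley curve. The
  shape of \<open>G'\<close> admits the full isometry group of any form, degenerate ones included,
  as well as its part of determinant 1 when the form is nondegenerate.\<close>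

lemma Lie_isometries:
  assumes B: "B \<in> carrier_mat n n" and G: "G \<subseteq> isometries n B"
    and G': "\<And>g. g \<in> isometries n B \<Longrightarrow> (Determinant.det B \<noteq> 0 \<Longrightarrow> Determinant.det g = 1) \<Longrightarrow> g \<in> G"
  shows "Lie n G = lie_form n B"
proof (intro equalityI subsetI)
  fix X assume "X \<in> Lie n G"
  then obtain r c where X: "X \<in> carrier_mat n n" and tc: "tangent_curve n X r c" and cG: "\<And>z. z \<in> ball 0 r \<Longrightarrow> c z \<in> G"
    unfolding Lie_iff by blast
  have r: "r > 0" and c0: "c 0 = 1\<^sub>m n" and hol: "\<And>i j. i < n \<Longrightarrow> j < n \<Longrightarrow> (\<lambda>z. c z $$ (i, j)) holomorphic_on ball 0 r"
    and dX: "\<And>i j. i < n \<Longrightarrow> j < n \<Longrightarrow> deriv (\<lambda>z. c z $$ (i, j)) 0 = X $$ (i, j)"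
    using tc unfolding tangent_curve_def by blast+
  have der: "((\<lambda>z. c z $$ (i, j)) has_field_derivative X $$ (i, j)) (at 0)" if "i < n" "j < n" for i j
    using holomorphic_derivI[OF hol[OF that] open_ball, of 0] dX[OF that] r by simp
  show "X \<in> lie_form n B"
    unfolding lie_form_def
  proof (intro CollectI conjI allI impI X)
    fix i j assume ij: "i < n" "j < n"
    let ?f = "\<lambda>z. \<Sum>l<n. (\<Sum>k<n. c z $$ (k, i) * B $$ (k, l)) * c z $$ (l, j)"
    have f: "?f z = B $$ (i, j)" if z: "z \<in> ball 0 r" for z
    proof -
      have g: "c z \<in> isometries n B" using cG[OF z] G by blast
      then have gc: "c z \<in> carrier_mat n n" by (simp add: isometries_def GL_def)
      have tc: "transpose_mat (c z) \<in> carrier_mat n n" using gc by simp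
      have "(transpose_mat (c z) * B * c z) $$ (i, j) = ?f z"
        unfolding mult3_entry[OF tc B gc ij] using ij carrier_matD[OF gc] by simp
      moreover have "transpose_mat (c z) * B * c z = B" using g unfolding isometries_eq[OF B] by (elim CollectE conjE)
      ultimately show ?thesis by (simp only:)
    qed
    have "(?f has_field_derivative (\<Sum>l<n. (\<Sum>k<n. X $$ (k, i) * B $$ (k, l)) * c 0 $$ (l, j) + X $$ (l, j) * (\<Sum>k<n. c 0 $$ (k, i) * B $$ (k, l)))) (at 0)"
      by (intro DERIV_sum DERIV_mult DERIV_cmult_right der) (use ij in auto)
    then have "((\<lambda>z. B $$ (i, j)) has_field_derivative (\<Sum>l<n. (\<Sum>k<n. X $$ (k, i) * B $$ (k, l)) * c 0 $$ (l, j) + X $$ (l, j) * (\<Sum>k<n. c 0 $$ (k, i) * B $$ (k, l)))) (at 0)"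
    proof (rule has_field_derivative_transform_within_open[where S = "ball 0 r"])
      show "0 \<in> ball (0::complex) r" using r by simp
    qed (rule open_ball, rule f)
    then have z: "(\<Sum>l<n. (\<Sum>k<n. X $$ (k, i) * B $$ (k, l)) * c 0 $$ (l, j) + X $$ (l, j) * (\<Sum>k<n. c 0 $$ (k, i) * B $$ (k, l))) = 0"
      by (rule DERIV_unique) (rule DERIV_const)
    have "(\<Sum>k<n. c 0 $$ (k, i) * B $$ (k, l)) = B $$ (i, l)" for l
    proof -
      have "(\<Sum>k<n. c 0 $$ (k, i) * B $$ (k, l)) = (\<Sum>k<n. if k = i then B $$ (i, l) else 0)"
        unfolding c0 by (rule sum.cong) (use ij in auto)
      then show ?thesis using ij by simp
    qed
    moreover have "(\<Sum>l<n. (\<Sum>k<n. X $$ (k, i) * B $$ (k, l)) * c 0 $$ (l, j)) = (\<Sum>k<n. X $$ (k, i) * B $$ (k, j))"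
    proof -
      have "(\<Sum>l<n. (\<Sum>k<n. X $$ (k, i) * B $$ (k, l)) * c 0 $$ (l, j)) = (\<Sum>l<n. if l = j then (\<Sum>k<n. X $$ (k, i) * B $$ (k, j)) else 0)"
        unfolding c0 by (rule sum.cong) (use ij in auto)
      then show ?thesis using ij by simp
    qed
    ultimately show "(\<Sum>k<n. X $$ (k, i) * B $$ (k, j)) + (\<Sum>k<n. B $$ (i, k) * X $$ (k, j)) = 0"
      using z by (simp add: sum.distrib mult.commute)
  qed
next
  fix X assume X': "X \<in> lie_form n B"
  then have X: "X \<in> carrier_mat n n" by (simp add: lie_form_def)
  have XB: "transpose_mat X * B = - (B * X)"
  proof (rule eq_matI)
    fix i j assume "i < dim_row (- (B * X))" "j < dim_col (- (B * X))"
    then have ij: "i < n" "j < n" using B X by auto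
    have "(\<Sum>k<n. X $$ (k, i) * B $$ (k, j)) = - (\<Sum>k<n. B $$ (i, k) * X $$ (k, j))"
      using X' ij by (simp add: lie_form_def eq_neg_iff_add_eq_0)
    moreover have tX: "transpose_mat X \<in> carrier_mat n n" using X by simp
    have "(transpose_mat X * B) $$ (i, j) = (\<Sum>k<n. X $$ (k, i) * B $$ (k, j))"
      unfolding mult_entry[OF tX B ij] using ij carrier_matD[OF X] by simp
    moreover have "(- (B * X)) $$ (i, j) = - (\<Sum>k<n. B $$ (i, k) * X $$ (k, j))"
      using ij carrier_matD[OF X] carrier_matD[OF B] mult_entry[OF B X ij] by simp
    ultimately show "(transpose_mat X * B) $$ (i, j) = (- (B * X)) $$ (i, j)" by (simp only:)
  qed (use carrier_matD[OF X] carrier_matD[OF B] in simp_all)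
  show "X \<in> Lie n G"
  proof (rule cayley_curve[OF X B XB])
    fix r c assume c: "tangent_curve n X r c" "\<And>z. z \<in> ball 0 r \<Longrightarrow> c z \<in> isometries n B"
      "\<And>z. z \<in> ball 0 r \<Longrightarrow> Determinant.det B \<noteq> 0 \<Longrightarrow> Determinant.det (c z) = 1"
    show "X \<in> Lie n G" unfolding Lie_iff
    proof (intro conjI exI[of _ r] exI[of _ c] ballI X c(1))
      fix z assume z: "z \<in> ball (0::complex) r"
      show "c z \<in> G" by (rule G'[OF c(2)[OF z] c(3)[OF z]])
    qed
  qed
qed

text \<open>The general linear group is the isometry group of the zero form.\<close>

lemma Lie_GL: "Lie n (GL n) = carrier_mat n n"
proof -
  have "isometries n (0\<^sub>m n n) = GL n"
  proof -
    have "transpose_mat g * 0\<^sub>m n n * g = 0\<^sub>m n n" if "g \<in> GL n" for g :: "complex mat"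
    proof -
      have g: "g \<in> carrier_mat n n" "transpose_mat g \<in> carrier_mat n n" using that by (simp_all add: GL_def)
      show ?thesis unfolding right_mult_zero_mat[OF g(2)] by (rule left_mult_zero_mat[OF g(1)])
    qed
    then show ?thesis unfolding isometries_eq[OF zero_carrier_mat] by (intro equalityI subsetI) simp_all
  qed
  then have "Lie n (GL n) = lie_form n (0\<^sub>m n n)"
    by (intro Lie_isometries) simp_all
  also have "\<dots> = carrier_mat n n" unfolding lie_form_def by (intro equalityI subsetI) simp_all
  finally show ?thesis .
qed

section \<open>Block-diagonal matrices and Lie algebras of products\<close>

lemma tangent_curveD:
  assumes "tangent_curve n X r c" "i < n" "j < n"
  shows "(\<lambda>z. c z $$ (i, j)) holomorphic_on ball 0 r" "deriv (\<lambda>z. c z $$ (i, j)) 0 = X $$ (i, j)"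
  using assms unfolding tangent_curve_def by simp_all

definition diag2 :: "complex mat \<Rightarrow> complex mat \<Rightarrow> complex mat" where
  "diag2 a b = diag_block_mat [a, b]"

lemma diag2_carrier: "a \<in> carrier_mat n n \<Longrightarrow> b \<in> carrier_mat m m \<Longrightarrow> diag2 a b \<in> carrier_mat (n + m) (n + m)"
  unfolding diag2_def carrier_mat_def by (simp add: dim_diag_block_mat)

lemma diag2_entry:
  assumes "a \<in> carrier_mat n n" "b \<in> carrier_mat m m" "i < n + m" "j < n + m"
  shows "diag2 a b $$ (i, j) = (if i < n \<and> j < n then a $$ (i, j)
    else if n \<le> i \<and> n \<le> j then b $$ (i - n, j - n) else 0)"
  using assms by (auto simp: diag2_def Let_def)

definition top_left :: "nat \<Rightarrow> complex mat \<Rightarrow> complex mat" where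
  "top_left n Z = mat n n (\<lambda>(i, j). Z $$ (i, j))"

definition bottom_right :: "nat \<Rightarrow> nat \<Rightarrow> complex mat \<Rightarrow> complex mat" where
  "bottom_right n m Z = mat m m (\<lambda>(i, j). Z $$ (n + i, n + j))"

lemma diag2_parts:
  assumes "a \<in> carrier_mat n n" "b \<in> carrier_mat m m"
  shows "top_left n (diag2 a b) = a" "bottom_right n m (diag2 a b) = b"
  using assms by (intro eq_matI; auto simp: top_left_def bottom_right_def diag2_entry)+

lemma diag2_of_parts:
  assumes Z: "Z \<in> carrier_mat (n + m) (n + m)"
    and 0: "\<And>i j. i < n + m \<Longrightarrow> j < n + m \<Longrightarrow> (i < n) \<noteq> (j < n) \<Longrightarrow> Z $$ (i, j) = 0"
  shows "diag2 (top_left n Z) (bottom_right n m Z) = Z"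
proof (rule eq_matI)
  have t: "top_left n Z \<in> carrier_mat n n" "bottom_right n m Z \<in> carrier_mat m m"
    by (simp_all add: top_left_def bottom_right_def)
  show "dim_row (diag2 (top_left n Z) (bottom_right n m Z)) = dim_row Z"
    "dim_col (diag2 (top_left n Z) (bottom_right n m Z)) = dim_col Z"
    using diag2_carrier[OF t] Z by auto
  fix i j assume "i < dim_row Z" "j < dim_col Z"
  then have ij: "i < n + m" "j < n + m" using Z by auto
  show "diag2 (top_left n Z) (bottom_right n m Z) $$ (i, j) = Z $$ (i, j)"
    using 0[OF ij] ij unfolding diag2_entry[OF t ij] by (auto simp: top_left_def bottom_right_def)
qed

text \<open>A curve in the product is cut into its diagonal blocks; conversely two curves are glued
  on the smaller of the two balls.\<close>

lemma Lie_block_prod: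
  assumes G1: "G1 \<subseteq> carrier_mat n n" and G2: "G2 \<subseteq> carrier_mat m m"
  shows "Lie (n + m) (block_prod G1 G2) = {Z \<in> carrier_mat (n + m) (n + m).
    (\<forall>i<n+m. \<forall>j<n+m. (i < n) \<noteq> (j < n) \<longrightarrow> Z $$ (i, j) = 0) \<and>
    top_left n Z \<in> Lie n G1 \<and> bottom_right n m Z \<in> Lie m G2}" (is "_ = ?R")
proof (intro equalityI subsetI)
  fix Z assume "Z \<in> Lie (n + m) (block_prod G1 G2)"
  then obtain r c where Z: "Z \<in> carrier_mat (n + m) (n + m)" and tc: "tangent_curve (n + m) Z r c"
    and cG: "\<And>z. z \<in> ball 0 r \<Longrightarrow> c z \<in> block_prod G1 G2"
    unfolding Lie_iff by blast
  have r: "r > 0" and c0: "c 0 = 1\<^sub>m (n + m)"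
    and cc: "\<And>i j. i < n + m \<Longrightarrow> j < n + m \<Longrightarrow> (\<lambda>z. c z $$ (i, j)) holomorphic_on ball 0 r \<and> deriv (\<lambda>z. c z $$ (i, j)) 0 = Z $$ (i, j)"
    using tc unfolding tangent_curve_def by blast+
  have cd: "\<exists>a\<in>G1. \<exists>b\<in>G2. c z = diag2 a b" if "z \<in> ball 0 r" for z
    using cG[OF that] unfolding block_prod_def diag2_def by blast
  have off: "Z $$ (i, j) = 0" if ij: "i < n + m" "j < n + m" "(i < n) \<noteq> (j < n)" for i j
  proof -
    have "c z $$ (i, j) = 0" if z: "z \<in> ball 0 r" for z
    proof -
      obtain a b where ab: "a \<in> G1" "b \<in> G2" "c z = diag2 a b" using cd[OF z] by blast
      then have "a \<in> carrier_mat n n" "b \<in> carrier_mat m m" using G1 G2 by auto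
      then show ?thesis unfolding ab(3) using ij by (auto simp: diag2_entry)
    qed
    then have "((\<lambda>z. c z $$ (i, j)) has_field_derivative 0) (at 0)"
      by (intro has_field_derivative_transform_within_open[OF DERIV_const[of 0] open_ball[of 0 r]]) (use r in auto)
    then show ?thesis using cc[OF ij(1,2)] DERIV_imp_deriv by metis
  qed
  have "top_left n Z \<in> Lie n G1" unfolding Lie_iff
  proof (intro conjI exI[of _ r] exI[of _ "\<lambda>z. top_left n (c z)"] ballI)
    show "tangent_curve n (top_left n Z) r (\<lambda>z. top_left n (c z))"
      unfolding tangent_curve_def
    proof (intro conjI allI impI r)
      show "top_left n (c 0) = 1\<^sub>m n" unfolding c0 top_left_def by (intro eq_matI) auto
      fix i j assume "i < n" "j < n"
      then show "(\<lambda>z. top_left n (c z) $$ (i, j)) holomorphic_on ball 0 r"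
        "deriv (\<lambda>z. top_left n (c z) $$ (i, j)) 0 = top_left n Z $$ (i, j)"
        using cc[of i j] by (simp_all add: top_left_def)
    qed
    fix z assume "z \<in> ball (0::complex) r"
    then obtain a b where ab: "a \<in> G1" "b \<in> G2" "c z = diag2 a b" using cd by blast
    then have "a \<in> carrier_mat n n" "b \<in> carrier_mat m m" using G1 G2 by auto
    then show "top_left n (c z) \<in> G1" unfolding ab(3) using ab(1) by (simp add: diag2_parts)
  qed (simp add: top_left_def)
  moreover have "bottom_right n m Z \<in> Lie m G2" unfolding Lie_iff
  proof (intro conjI exI[of _ r] exI[of _ "\<lambda>z. bottom_right n m (c z)"] ballI)
    show "tangent_curve m (bottom_right n m Z) r (\<lambda>z. bottom_right n m (c z))"
      unfolding tangent_curve_def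
    proof (intro conjI allI impI r)
      show "bottom_right n m (c 0) = 1\<^sub>m m" unfolding c0 bottom_right_def by (intro eq_matI) auto
      fix i j assume "i < m" "j < m"
      then show "(\<lambda>z. bottom_right n m (c z) $$ (i, j)) holomorphic_on ball 0 r"
        "deriv (\<lambda>z. bottom_right n m (c z) $$ (i, j)) 0 = bottom_right n m Z $$ (i, j)"
        using cc[of "n + i" "n + j"] by (simp_all add: bottom_right_def)
    qed
    fix z assume "z \<in> ball (0::complex) r"
    then obtain a b where ab: "a \<in> G1" "b \<in> G2" "c z = diag2 a b" using cd by blast
    then have "a \<in> carrier_mat n n" "b \<in> carrier_mat m m" using G1 G2 by auto
    then show "bottom_right n m (c z) \<in> G2" unfolding ab(3) using ab(2) by (simp add: diag2_parts)
  qed (simp add: bottom_right_def)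
  ultimately show "Z \<in> ?R" using Z off by simp
next
  fix Z assume "Z \<in> ?R"
  then have Z: "Z \<in> carrier_mat (n + m) (n + m)"
    and off: "\<And>i j. i < n + m \<Longrightarrow> j < n + m \<Longrightarrow> (i < n) \<noteq> (j < n) \<Longrightarrow> Z $$ (i, j) = 0"
    and t: "top_left n Z \<in> Lie n G1" and b: "bottom_right n m Z \<in> Lie m G2" by simp_all
  obtain r1 c1 where 1: "tangent_curve n (top_left n Z) r1 c1" "\<And>z. z \<in> ball 0 r1 \<Longrightarrow> c1 z \<in> G1"
    using t unfolding Lie_iff by blast
  obtain r2 c2 where 2: "tangent_curve m (bottom_right n m Z) r2 c2" "\<And>z. z \<in> ball 0 r2 \<Longrightarrow> c2 z \<in> G2"
    using b unfolding Lie_iff by blast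
  let ?r = "min r1 r2"
  have rp: "r1 > 0" "r2 > 0" using 1(1) 2(1) by (simp_all add: tangent_curve_def)
  \<comment> \<open>The glued curve is given entrywise with a fixed size, since \<open>c1\<close>
    and \<open>c2\<close> are known to lie in the groups only inside their balls; each entry is then
    a single function of \<open>z\<close>.\<close>
  define c where "c = (\<lambda>z. mat (n + m) (n + m) (\<lambda>(i, j). if i < n \<and> j < n then c1 z $$ (i, j) else if n \<le> i \<and> n \<le> j then c2 z $$ (i - n, j - n) else 0))"
  have cd: "c z = diag2 (c1 z) (c2 z)" if z: "z \<in> ball 0 ?r" for z
  proof -
    have "c1 z \<in> carrier_mat n n" "c2 z \<in> carrier_mat m m" using 1(2)[of z] 2(2)[of z] z G1 G2 by auto
    from diag2_entry[OF this] diag2_carrier[OF this] show ?thesis unfolding c_def by (intro eq_matI) auto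
  qed
  have "tangent_curve (n + m) Z ?r c" unfolding tangent_curve_def
  proof (intro conjI allI impI)
    show "?r > 0" using rp by simp
    show "c 0 = 1\<^sub>m (n + m)" using 1(1) 2(1) unfolding c_def tangent_curve_def by (intro eq_matI) auto
    fix i j assume ij: "i < n + m" "j < n + m"
    have sub: "ball 0 ?r \<subseteq> ball (0::complex) r1" "ball 0 ?r \<subseteq> ball (0::complex) r2" by auto
    consider "i < n" "j < n" | "n \<le> i" "n \<le> j" | "(i < n) \<noteq> (j < n)" by linarith
    then have "(\<lambda>z. c z $$ (i, j)) holomorphic_on ball 0 ?r \<and> deriv (\<lambda>z. c z $$ (i, j)) 0 = Z $$ (i, j)"
    proof cases
      case 1
      then have e: "c z $$ (i, j) = c1 z $$ (i, j)" for z by (simp add: c_def)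
      show ?thesis unfolding e
        using tangent_curveD[OF \<open>tangent_curve n (top_left n Z) r1 c1\<close> 1] 1 holomorphic_on_subset[OF _ sub(1)]
        by (simp add: top_left_def)
    next
      case 2
      then have e: "c z $$ (i, j) = c2 z $$ (i - n, j - n)" for z using ij by (simp add: c_def)
      have l: "i - n < m" "j - n < m" using ij 2 by auto
      have "bottom_right n m Z $$ (i - n, j - n) = Z $$ (i, j)" using l 2 by (simp add: bottom_right_def)
      then show ?thesis unfolding e
        using tangent_curveD[OF \<open>tangent_curve m (bottom_right n m Z) r2 c2\<close> l] holomorphic_on_subset[OF _ sub(2)]
        by simp
    next
      case 3
      then have e: "c z $$ (i, j) = 0" for z using ij by (auto simp: c_def)
      show ?thesis unfolding e using off[OF ij 3] by simp
    qed
    then show "(\<lambda>z. c z $$ (i, j)) holomorphic_on ball 0 ?r" "deriv (\<lambda>z. c z $$ (i, j)) 0 = Z $$ (i, j)" by simp_all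
  qed
  moreover have "c z \<in> block_prod G1 G2" if z: "z \<in> ball 0 ?r" for z
    unfolding cd[OF z] block_prod_def diag2_def using 1(2)[of z] 2(2)[of z] z by auto
  ultimately show "Z \<in> Lie (n + m) (block_prod G1 G2)" unfolding Lie_iff using Z by blast
qed

section \<open>Groups and Lie algebras in label coordinates\<close>

context encoding
begin

lemma in_enc_iff:
  assumes u: "u \<in> D" and v: "v \<in> D"
  shows "(rho u, rho v) \<in> enc ` S \<longleftrightarrow> fst u = fst v"
proof
  assume "(rho u, rho v) \<in> enc ` S"
  then obtain w where w: "w \<in> S" "(rho u, rho v) = enc w" by (elim imageE)
  then have "u = (fst w, fst (snd w))" "v = (fst w, other_end k (snd (snd w)))"
    using rho_inj[OF u slot_rows[OF w(1)]] rho_inj[OF v slot_cols[OF w(1)]] by (simp_all add: enc_def)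
  then show "fst u = fst v" by simp
next
  assume uv: "fst u = fst v"
  let ?w = "(fst u, snd u, other_end k (snd v))"
  have "par \<Longrightarrow> snd (snd (other_end k (snd v)))"
    using v par_GL snd_other_end[of k "snd v"] by (simp add: block_labels_def)
  then have "?w \<in> S" using u v by (simp add: slots_def block_labels_def other_end_in)
  moreover have "enc ?w = (rho u, rho v)"
  proof -
    have "(fst u, snd v) = v" using uv by (simp add: prod_eq_iff)
    then show ?thesis by (simp only: enc_def fst_conv snd_conv other_end_other_end prod.collapse)
  qed
  ultimately show "(rho u, rho v) \<in> enc ` S" by (metis imageI)
qed

lemma VV_iff:
  "X \<in> VV \<longleftrightarrow> X \<in> carrier_mat N N \<and> (\<forall>u\<in>D. \<forall>v\<in>D. fst u \<noteq> fst v \<longrightarrow> X $$ (rho u, rho v) = 0) \<and>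
     (\<forall>u\<in>S. crd X (swap_slot fL u) = slot_sign fL * crd X u)"
proof -
  have "(\<forall>i<N. \<forall>j<N. (i, j) \<notin> enc ` S \<longrightarrow> X $$ (i, j) = 0) \<longleftrightarrow>
    (\<forall>u\<in>D. \<forall>v\<in>D. fst u \<noteq> fst v \<longrightarrow> X $$ (rho u, rho v) = 0)"
  proof
    assume h: "\<forall>i<N. \<forall>j<N. (i, j) \<notin> enc ` S \<longrightarrow> X $$ (i, j) = 0"
    show "\<forall>u\<in>D. \<forall>v\<in>D. fst u \<noteq> fst v \<longrightarrow> X $$ (rho u, rho v) = 0"
    proof (intro ballI impI)
      fix u v assume uv: "u \<in> D" "v \<in> D" "fst u \<noteq> fst v"
      then show "X $$ (rho u, rho v) = 0"
        using h in_enc_iff[OF uv(1,2)] rho_less[OF uv(1)] rho_less[OF uv(2)] by simp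
    qed
  next
    assume h: "\<forall>u\<in>D. \<forall>v\<in>D. fst u \<noteq> fst v \<longrightarrow> X $$ (rho u, rho v) = 0"
    show "\<forall>i<N. \<forall>j<N. (i, j) \<notin> enc ` S \<longrightarrow> X $$ (i, j) = 0"
    proof (intro allI impI)
      fix i j assume ij: "i < N" "j < N" "(i, j) \<notin> enc ` S"
      obtain u where u: "u \<in> D" "i = rho u" using rho_surj[OF ij(1)] by (elim bexE)
      obtain v where v: "v \<in> D" "j = rho v" using rho_surj[OF ij(2)] by (elim bexE)
      have "fst u \<noteq> fst v" using ij(3) in_enc_iff[OF u(1) v(1)] unfolding u v by simp
      then show "X $$ (i, j) = 0" using h u v by simp
    qed
  qed
  then show ?thesis unfolding VV_def by simp
qed

lemma VV_None:
  assumes "fL = None"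
  shows "VV = {X \<in> carrier_mat N N. \<forall>u\<in>D. \<forall>v\<in>D. fst u \<noteq> fst v \<longrightarrow> X $$ (rho u, rho v) = 0}"
proof (rule Set.set_eqI)
  fix X
  have "swap_slot fL u = u" "slot_sign fL = 1" for u by (simp_all add: swap_slot_def slot_sign_def assms)
  then show "X \<in> VV \<longleftrightarrow> X \<in> {X \<in> carrier_mat N N. \<forall>u\<in>D. \<forall>v\<in>D. fst u \<noteq> fst v \<longrightarrow> X $$ (rho u, rho v) = 0}"
    unfolding VV_iff by simp
qed

lemma VV_one_block:
  assumes "fL = None" "nR = 1"
  shows "VV = carrier_mat N N"
proof -
  have e: "fst u = fst v" if "u \<in> D" "v \<in> D" for u v
    using that assms(2) by (simp add: block_labels_def)
  have 0: "\<forall>u\<in>D. \<forall>v\<in>D. fst u \<noteq> fst v \<longrightarrow> X $$ (rho u, rho v) = 0" for X :: "complex mat"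
  proof (intro ballI impI)
    fix u v assume uv: "u \<in> D" "v \<in> D" and ne: "fst u \<noteq> fst v"
    from ne e[OF uv] show "X $$ (rho u, rho v) = 0" by (rule notE)
  qed
  show ?thesis
  proof (rule Set.set_eqI)
    fix X :: "complex mat"
    show "X \<in> VV \<longleftrightarrow> X \<in> carrier_mat N N"
      unfolding VV_None[OF assms(1)] by (simp only: mem_Collect_eq eqTrueI[OF 0[of X]] simp_thms)
  qed
qed

definition form_of :: "complex mat \<Rightarrow> bool" where
  "form_of B \<longleftrightarrow> B \<in> carrier_mat N N \<and> (\<forall>x\<in>W. \<forall>y\<in>W. B $$ (rho (0, x), rho (0, y)) = beta k x y)"

definition colour_ok :: "complex mat \<Rightarrow> bool" where
  "colour_ok g \<longleftrightarrow> (\<forall>u\<in>D. \<forall>v\<in>D. g $$ (rho u, rho v) \<noteq> 0 \<longrightarrow>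
     fst (snd u) = fst (snd v) \<and> (k = KGL \<longrightarrow> snd (snd (snd u)) = snd (snd (snd v))))"

lemma of_isom_ex: "\<exists>g. of_isom h g"
proof -
  define ri where "ri = inv_into D rho"
  have ri: "ri (rho u) = u" if "u \<in> D" for u
    unfolding ri_def by (rule bij_betw_inv_into_left[OF rho that])
  have "of_isom h (mat N N (\<lambda>(i, j). if fst (ri i) = fst (ri j) then h (snd (ri i)) (snd (ri j)) else 0))"
    by (simp add: of_isom_def rho_less ri)
  then show ?thesis by blast
qed

text \<open>In coordinates the identity in \<open>isom\<close> is g B g^T = B, with the transpose on
  the right, whereas \<open>isometries\<close> is about g^T B g; \<open>form_flip\<close> reconciles
  the two later.\<close>

lemma of_isom_form_iff:
  assumes nR: "nR = 1" and np: "\<not> par" and B: "form_of B" and g: "of_isom h g"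
  shows "h \<in> isom k nC n \<longleftrightarrow> colour_ok g \<and> g * B * transpose_mat g = B"
proof -
  have D: "(0, x) \<in> D \<longleftrightarrow> x \<in> W" for x using nR np by (simp add: block_labels_def)
  have D0: "u \<in> D \<Longrightarrow> u = (0, snd u) \<and> snd u \<in> W" for u using nR by (cases u) (simp add: block_labels_def)
  have gc: "g \<in> carrier_mat N N" and ge: "\<And>x y. x \<in> W \<Longrightarrow> y \<in> W \<Longrightarrow> g $$ (rho (0, x), rho (0, y)) = h x y"
    using g D unfolding of_isom_def by simp_all
  have Bc: "B \<in> carrier_mat N N" and Be: "\<And>x y. x \<in> W \<Longrightarrow> y \<in> W \<Longrightarrow> B $$ (rho (0, x), rho (0, y)) = beta k x y"
    using B unfolding form_of_def by simp_all
  have tc: "transpose_mat g \<in> carrier_mat N N" using gc by simp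
  have "bij_betw (\<lambda>x. rho (0, x)) W {..<N}"
  proof -
    have "bij_betw (\<lambda>x. (0::nat, x)) W D"
      by (rule bij_betw_byWitness[where f' = snd]) (use D D0 in auto)
    from bij_betw_trans[OF this rho] show ?thesis by (simp add: o_def)
  qed
  from sum.reindex_bij_betw[OF this, symmetric]
  have sumW: "(\<Sum>i<N. f i) = (\<Sum>x\<in>W. f (rho (0, x)))" for f :: "nat \<Rightarrow> complex" .
  have less: "x \<in> W \<Longrightarrow> rho (0, x) < N" for x using rho_less D by simp
  have e: "(g * B * transpose_mat g) $$ (rho (0, x), rho (0, y)) = (\<Sum>z\<in>W. \<Sum>z'\<in>W. h x z * h y z' * beta k z z')"
    if x: "x \<in> W" and y: "y \<in> W" for x y
  proof -
    have "(g * B * transpose_mat g) $$ (rho (0, x), rho (0, y)) =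
        (\<Sum>z'\<in>W. (\<Sum>z\<in>W. g $$ (rho (0, x), rho (0, z)) * B $$ (rho (0, z), rho (0, z'))) * transpose_mat g $$ (rho (0, z'), rho (0, y)))"
      unfolding mult3_entry[OF gc Bc tc less[OF x] less[OF y]] sumW ..
    also have "\<dots> = (\<Sum>z'\<in>W. \<Sum>z\<in>W. h x z * h y z' * beta k z z')"
      unfolding sum_distrib_right
      using less y gc carrier_matD[OF gc]
      by (intro sum.cong refl) (simp add: ge Be x)
    also have "\<dots> = (\<Sum>z\<in>W. \<Sum>z'\<in>W. h x z * h y z' * beta k z z')" by (rule sum.swap)
    finally show ?thesis .
  qed
  have 1: "colour_ok g \<longleftrightarrow> (\<forall>x\<in>W. \<forall>y\<in>W. h x y \<noteq> 0 \<longrightarrow> fst x = fst y \<and> (k = KGL \<longrightarrow> snd (snd x) = snd (snd y)))"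
  proof
    assume c: "colour_ok g"
    show "\<forall>x\<in>W. \<forall>y\<in>W. h x y \<noteq> 0 \<longrightarrow> fst x = fst y \<and> (k = KGL \<longrightarrow> snd (snd x) = snd (snd y))"
    proof (intro ballI impI)
      fix x y assume x: "x \<in> W" and y: "y \<in> W" and nz: "h x y \<noteq> 0"
      have "(0, x) \<in> D" "(0, y) \<in> D" using D x y by simp_all
      from bspec[OF bspec[OF c[unfolded colour_ok_def] this(1)] this(2)]
      show "fst x = fst y \<and> (k = KGL \<longrightarrow> snd (snd x) = snd (snd y))" using nz ge[OF x y] by simp
    qed
  next
    assume c: "\<forall>x\<in>W. \<forall>y\<in>W. h x y \<noteq> 0 \<longrightarrow> fst x = fst y \<and> (k = KGL \<longrightarrow> snd (snd x) = snd (snd y))"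
    show "colour_ok g" unfolding colour_ok_def
    proof (intro ballI)
      fix u v assume "u \<in> D" "v \<in> D"
      then obtain x y where u: "u = (0, x)" "x \<in> W" and v: "v = (0, y)" "y \<in> W" using D0 by metis
      show "g $$ (rho u, rho v) \<noteq> 0 \<longrightarrow> fst (snd u) = fst (snd v) \<and> (k = KGL \<longrightarrow> snd (snd (snd u)) = snd (snd (snd v)))"
        using bspec[OF bspec[OF c u(2)] v(2)] ge[OF u(2) v(2)] unfolding u v by simp
    qed
  qed
  have 2: "g * B * transpose_mat g = B \<longleftrightarrow> (\<forall>x\<in>W. \<forall>y\<in>W. (\<Sum>z\<in>W. \<Sum>z'\<in>W. h x z * h y z' * beta k z z') = beta k x y)"
  proof
    assume m: "g * B * transpose_mat g = B"
    show "\<forall>x\<in>W. \<forall>y\<in>W. (\<Sum>z\<in>W. \<Sum>z'\<in>W. h x z * h y z' * beta k z z') = beta k x y"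
    proof (intro ballI)
      fix x y assume x: "x \<in> W" and y: "y \<in> W"
      show "(\<Sum>z\<in>W. \<Sum>z'\<in>W. h x z * h y z' * beta k z z') = beta k x y"
        using e[OF x y] Be[OF x y] unfolding m by simp
    qed
  next
    assume m: "\<forall>x\<in>W. \<forall>y\<in>W. (\<Sum>z\<in>W. \<Sum>z'\<in>W. h x z * h y z' * beta k z z') = beta k x y"
    show "g * B * transpose_mat g = B"
    proof (rule eq_matI)
      fix i j assume "i < dim_row B" "j < dim_col B"
      then have ij: "i < N" "j < N" using Bc by simp_all
      obtain u where u: "u \<in> D" "i = rho u" using rho_surj[OF ij(1)] by (elim bexE)
      obtain v where v: "v \<in> D" "j = rho v" using rho_surj[OF ij(2)] by (elim bexE)
      obtain x y where x: "u = (0, x)" "x \<in> W" and y: "v = (0, y)" "y \<in> W" using D0[OF u(1)] D0[OF v(1)] by metis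
      show "(g * B * transpose_mat g) $$ (i, j) = B $$ (i, j)"
        unfolding u(2) v(2) x(1) y(1) e[OF x(2) y(2)] Be[OF x(2) y(2)] by (rule bspec[OF bspec[OF m x(2)] y(2)])
    qed (use gc Bc in simp_all)
  qed
  show ?thesis unfolding 1 2 isom_def by simp
qed

lemma form_group_K:
  assumes nR: "nR = 1" and np: "\<not> par" and B: "form_of B"
    and K: "K = {g \<in> carrier_mat N N. colour_ok g \<and> g * B * transpose_mat g = B}"
  shows "g \<in> K \<Longrightarrow> \<exists>h\<in>isom k nC n. of_isom h g" and "h \<in> isom k nC n \<Longrightarrow> \<exists>g\<in>K. of_isom h g"
proof -
  assume g: "g \<in> K"
  let ?h = "\<lambda>x y. g $$ (rho (0, x), rho (0, y))"
  have "of_isom ?h g" using g nR unfolding K of_isom_def by (auto simp: block_labels_def)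
  then show "\<exists>h\<in>isom k nC n. of_isom h g" using of_isom_form_iff[OF nR np B] g unfolding K by blast
next
  assume h: "h \<in> isom k nC n"
  obtain g where g: "of_isom h g" using of_isom_ex by blast
  then have "g \<in> K" using of_isom_form_iff[OF nR np B g] h unfolding K by (simp add: of_isom_def)
  then show "\<exists>g\<in>K. of_isom h g" using g by blast
qed

text \<open>Rows are indexed by plain labels only, so \<open>h\<close> has to be completed on the
  dual labels by the contragredient of \<open>g\<close>. The condition on \<open>mat_inv g\<close>
  makes this second part respect colours as well.\<close>

lemma GL_group_K:
  assumes nR: "nR = 1" and p: par
    and K: "K = {g \<in> GL N. colour_ok g \<and> colour_ok (mat_inv g)}"
  shows "g \<in> K \<Longrightarrow> \<exists>h\<in>isom k nC n. of_isom h g" and "h \<in> isom k nC n \<Longrightarrow> \<exists>g\<in>K. of_isom h g"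
proof -
  let ?e = "other_end k" and ?pol = "\<lambda>x :: label. snd (snd x)"
  have k: "k = KGL" by (rule par_GL[OF p])
  have D: "(0, x) \<in> D \<longleftrightarrow> x \<in> W \<and> \<not> ?pol x" for x using nR p by (simp add: block_labels_def)
  have D0: "u \<in> D \<Longrightarrow> u = (0, snd u) \<and> snd u \<in> W \<and> \<not> ?pol (snd u)" for u using nR p by (simp add: block_labels_def prod_eq_iff)
  have pe: "?pol (?e x) = (\<not> ?pol x)" for x by (rule snd_other_end) (simp add: k)
  show "\<exists>h\<in>isom k nC n. of_isom h g" if g: "g \<in> K"
  proof -
    have gG: "g \<in> GL N" and c1: "colour_ok g" and c2: "colour_ok (mat_inv g)" using g unfolding K by simp_all
    then have gc: "g \<in> carrier_mat N N" "invertible_mat g" by (simp_all add: GL_def)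
    note ic = mat_inv(1)[OF gc] and im = mat_inv(2)[OF gc]
    define h where "h = (\<lambda>x y. if \<not> ?pol x \<and> \<not> ?pol y then g $$ (rho (0, x), rho (0, y))
      else if ?pol x \<and> ?pol y then mat_inv g $$ (rho (0, ?e y), rho (0, ?e x)) else 0)"
    have oi: "of_isom h g" unfolding of_isom_def
    proof (intro conjI ballI gc(1))
      fix u v assume "u \<in> D" "v \<in> D"
      from D0[OF this(1)] D0[OF this(2)] show "g $$ (rho u, rho v) = (if fst u = fst v then h (snd u) (snd v) else 0)"
        by (cases u; cases v) (simp add: h_def)
    qed
    have supp: "fst x = fst y \<and> (k = KGL \<longrightarrow> ?pol x = ?pol y)" if x: "x \<in> W" and y: "y \<in> W" and nz: "h x y \<noteq> 0" for x y
    proof (cases "?pol x")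
      case False
      then have py: "\<not> ?pol y" and g0: "g $$ (rho (0, x), rho (0, y)) \<noteq> 0" using nz by (auto simp: h_def split: if_splits)
      have "(0, x) \<in> D" "(0, y) \<in> D" using D x y False py by simp_all
      from bspec[OF bspec[OF c1[unfolded colour_ok_def] this(1)] this(2)] show ?thesis using g0 False py by simp
    next
      case True
      then have py: "?pol y" and g0: "mat_inv g $$ (rho (0, ?e y), rho (0, ?e x)) \<noteq> 0" using nz by (auto simp: h_def split: if_splits)
      have "(0, ?e y) \<in> D" "(0, ?e x) \<in> D" using D x y True py by (simp_all add: pe other_end_in)
      from bspec[OF bspec[OF c2[unfolded colour_ok_def] this(1)] this(2)] show ?thesis using g0 True py by (simp add: fst_other_end)
    qed
    have b: "beta k u v = (if v = ?e u \<and> \<not> ?pol u then 1 else 0)" if "u \<in> W" "v \<in> W" for u v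
      using beta_other_end[OF that] k by (cases u) auto
    have sum: "(\<Sum>z\<in>W. \<Sum>z'\<in>W. h x z * h y z' * beta k z z') = beta k x y" if x: "x \<in> W" and y: "y \<in> W" for x y
    proof -
      have "(\<Sum>z\<in>W. \<Sum>z'\<in>W. h x z * h y z' * beta k z z') = (\<Sum>z\<in>W. if \<not> ?pol z then h x z * h y (?e z) else 0)"
      proof (rule sum.cong[OF refl])
        fix z assume z: "z \<in> W"
        have "(\<Sum>z'\<in>W. h x z * h y z' * beta k z z') = (\<Sum>z'\<in>W. if z' = ?e z then (if \<not> ?pol z then h x z * h y (?e z) else 0) else 0)"
          by (rule sum.cong[OF refl]) (simp add: b[OF z])
        then show "(\<Sum>z'\<in>W. h x z * h y z' * beta k z z') = (if \<not> ?pol z then h x z * h y (?e z) else 0)"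
          using other_end_in[OF z] by simp
      qed
      \<comment> \<open>For plain \<open>x\<close> and dual \<open>y\<close> the sum is a row of
        \<open>g\<close> times a column of its inverse; in all other cases each term contains an
        entry of \<open>h\<close> between labels of different polarity.\<close>
      also have "\<dots> = (if \<not> ?pol x \<and> ?pol y then \<Sum>z\<in>W. if \<not> ?pol z then g $$ (rho (0, x), rho (0, z)) * mat_inv g $$ (rho (0, z), rho (0, ?e y)) else 0 else 0)"
        by (cases "?pol x"; cases "?pol y") (simp_all add: h_def pe cong: sum.cong if_cong)
      also have "\<dots> = beta k x y"
      proof (cases "\<not> ?pol x \<and> ?pol y")
        case True
        have xD: "(0, x) \<in> D" and yD: "(0, ?e y) \<in> D" using D x y True by (simp_all add: pe other_end_in)
        have "(\<Sum>z\<in>W. if \<not> ?pol z then g $$ (rho (0, x), rho (0, z)) * mat_inv g $$ (rho (0, z), rho (0, ?e y)) else 0)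
          = (\<Sum>z\<in>{z \<in> W. \<not> ?pol z}. g $$ (rho (0, x), rho (0, z)) * mat_inv g $$ (rho (0, z), rho (0, ?e y)))"
          by (rule sum.inter_filter[symmetric]) simp
        also have "\<dots> = (\<Sum>u\<in>D. g $$ (rho (0, x), rho u) * mat_inv g $$ (rho u, rho (0, ?e y)))"
          by (rule sum.reindex_bij_witness[where i = snd and j = "\<lambda>z. (0, z)"]) (use D D0 in auto)
        also have "\<dots> = (g * mat_inv g) $$ (rho (0, x), rho (0, ?e y))"
          unfolding mult_entry[OF gc(1) ic rho_less[OF xD] rho_less[OF yD]] by (rule sum_rho[symmetric])
        also have "\<dots> = (if x = ?e y then 1 else 0)"
          unfolding im using rho_less[OF xD] rho_less[OF yD] rho_inj[OF xD yD] by simp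
        also have "\<dots> = beta k x y"
        proof -
          have "x = ?e y \<longleftrightarrow> y = ?e x" by (metis other_end_other_end)
          then show ?thesis unfolding b[OF x y] using True by simp
        qed
        finally show ?thesis unfolding if_P[OF True] .
      next
        case False
        have n: "\<not> (y = ?e x \<and> \<not> ?pol x)"
        proof
          assume a: "y = ?e x \<and> \<not> ?pol x"
          then have "?pol y = (\<not> ?pol x)" by (simp only: pe)
          then show False using False a by blast
        qed
        show ?thesis unfolding b[OF x y] if_not_P[OF False] if_not_P[OF n] ..
      qed
      finally show ?thesis .
    qed
    have "h \<in> isom k nC n" unfolding isom_def
    proof (intro CollectI conjI ballI impI)
      fix x y assume xy: "x \<in> W" "y \<in> W"
      show "(\<Sum>z\<in>W. \<Sum>z'\<in>W. h x z * h y z' * beta k z z') = beta k x y" by (rule sum[OF xy])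
    next
      fix x y assume xy: "x \<in> W" "y \<in> W" and nz: "h x y \<noteq> 0"
      show "fst x = fst y" by (rule conjunct1[OF supp[OF xy nz]])
      show "?pol x = ?pol y" using supp[OF xy nz] by (simp only: k simp_thms)
    qed
    then show ?thesis using oi by blast
  qed
  show "\<exists>g\<in>K. of_isom h g" if h: "h \<in> isom k nC n"
  proof -
    obtain g where g: "of_isom h g" using of_isom_ex by blast
    note inv = of_isom_inverse[OF h g]
    have gc: "g \<in> carrier_mat N N" using g by (simp add: of_isom_def)
    have "colour_ok g" unfolding colour_ok_def
    proof (intro ballI impI)
      fix u v assume uv: "u \<in> D" "v \<in> D" and nz: "g $$ (rho u, rho v) \<noteq> 0"
      then have "h (snd u) (snd v) \<noteq> 0" using g unfolding of_isom_def by (auto split: if_splits)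
      then show "fst (snd u) = fst (snd v) \<and> (k = KGL \<longrightarrow> ?pol (snd u) = ?pol (snd v))"
        using isom_supp[OF h, of "snd u" "snd v"] D0[OF uv(1)] D0[OF uv(2)] by simp
    qed
    moreover have "colour_ok (mat_inv g)" unfolding colour_ok_def
    proof (intro ballI impI)
      fix u v assume uv: "u \<in> D" "v \<in> D" and nz: "mat_inv g $$ (rho u, rho v) \<noteq> 0"
      then have "h (?e (snd v)) (?e (snd u)) \<noteq> 0" unfolding inv(3)[OF uv] by (auto split: if_splits)
      then show "fst (snd u) = fst (snd v) \<and> (k = KGL \<longrightarrow> ?pol (snd u) = ?pol (snd v))"
        using isom_supp[OF h, of "?e (snd v)" "?e (snd u)"] D0[OF uv(1)] D0[OF uv(2)]
        by (simp add: other_end_in fst_other_end)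
    qed
    ultimately have "g \<in> K" unfolding K GL_def using gc inv(1) by simp
    then show ?thesis using g by blast
  qed
qed

end

context encoding
begin

text \<open>For a form supported on the pairs (x, \<open>other_end k x\<close>), the equation X^T B
  + B X = 0 relates the entries of \<open>X\<close> two at a time. In the signed coordinates
  \<open>crd\<close> this is symmetry or antisymmetry under exchange of the two labels; the
  assumption \<open>eta\<close> compares the signs of the form with those of the
  coordinates.\<close>

lemma lie_form_VV:
  assumes nR: "nR = 1" and np: "\<not> par" and fL: "fL = Some \<eta>"
    and Bc: "B \<in> carrier_mat N N"
    and Be: "\<And>x y. x \<in> W \<Longrightarrow> y \<in> W \<Longrightarrow> B $$ (rho (0, x), rho (0, y)) = (if y = other_end k x then b x else 0)"
    and b: "\<And>x. x \<in> W \<Longrightarrow> b x * b x = 1"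
    and eta: "\<And>x y. x \<in> W \<Longrightarrow> y \<in> W \<Longrightarrow> - (b y * b (other_end k x)) = \<eta> * th x * th y"
  shows "lie_form N B = VV"
proof (rule Set.set_eqI)
  fix X :: "complex mat"
  let ?e = "other_end k"
  have D: "(0, x) \<in> D \<longleftrightarrow> x \<in> W" for x using nR np by (simp add: block_labels_def)
  have D0: "u \<in> D \<Longrightarrow> u = (0, snd u) \<and> snd u \<in> W" for u using nR by (simp add: block_labels_def prod_eq_iff)
  have less: "x \<in> W \<Longrightarrow> rho (0, x) < N" for x using rho_less D by simp
  have "bij_betw (\<lambda>x. rho (0, x)) W {..<N}"
  proof -
    have "bij_betw (\<lambda>x. (0::nat, x)) W D"
      by (rule bij_betw_byWitness[where f' = snd]) (use D D0 in auto)
    from bij_betw_trans[OF this rho] show ?thesis by (simp add: o_def)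
  qed
  from sum.reindex_bij_betw[OF this, symmetric]
  have sumW: "(\<Sum>i<N. f i) = (\<Sum>x\<in>W. f (rho (0, x)))" for f :: "nat \<Rightarrow> complex" .
  define x' where "x' = (\<lambda>x y. X $$ (rho (0, x), rho (0, y)))"
  have lf: "(\<Sum>i<N. X $$ (i, rho (0, x)) * B $$ (i, rho (0, y))) + (\<Sum>i<N. B $$ (rho (0, x), i) * X $$ (i, rho (0, y))) =
      x' (?e y) x * b (?e y) + b x * x' (?e x) y" if x: "x \<in> W" and y: "y \<in> W" for x y
  proof -
    have "(\<Sum>i<N. X $$ (i, rho (0, x)) * B $$ (i, rho (0, y))) = (\<Sum>z\<in>W. if z = ?e y then x' (?e y) x * b (?e y) else 0)"
      unfolding sumW
    proof (rule sum.cong[OF refl])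
      fix z assume z: "z \<in> W"
      have "y = ?e z \<longleftrightarrow> z = ?e y" by (metis other_end_other_end)
      then show "X $$ (rho (0, z), rho (0, x)) * B $$ (rho (0, z), rho (0, y)) = (if z = ?e y then x' (?e y) x * b (?e y) else 0)"
        unfolding Be[OF z y] x'_def by simp
    qed
    moreover have "(\<Sum>i<N. B $$ (rho (0, x), i) * X $$ (i, rho (0, y))) = (\<Sum>z\<in>W. if z = ?e x then b x * x' (?e x) y else 0)"
      unfolding sumW
    proof (rule sum.cong[OF refl])
      fix z assume z: "z \<in> W"
      show "B $$ (rho (0, x), rho (0, z)) * X $$ (rho (0, z), rho (0, y)) = (if z = ?e x then b x * x' (?e x) y else 0)"
        unfolding Be[OF x z] x'_def by simp
    qed
    ultimately show ?thesis using other_end_in[OF x] other_end_in[OF y] by simp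
  qed
  have key: "x' (?e (?e y)) (?e x) * b (?e (?e y)) + b (?e x) * x' (?e (?e x)) (?e y) = 0 \<longleftrightarrow>
      th x * x' y (?e x) = \<eta> * (th y * x' x (?e y))" if x: "x \<in> W" and y: "y \<in> W" for x y
  proof -
    have s: "b y * b y = 1" "th x * th x = 1" using b[OF y] th_sq by simp_all
    have "x' y (?e x) * b y + b (?e x) * x' x (?e y) = 0 \<longleftrightarrow> b y * (x' y (?e x) * b y + b (?e x) * x' x (?e y)) = 0"
      using s(1) by auto
    also have "b y * (x' y (?e x) * b y + b (?e x) * x' x (?e y)) = (b y * b y) * x' y (?e x) - (- (b y * b (?e x))) * x' x (?e y)"
      by (simp add: algebra_simps)
    also have "\<dots> = x' y (?e x) - \<eta> * th x * th y * x' x (?e y)" unfolding eta[OF x y] s(1) by simp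
    also have "\<dots> = 0 \<longleftrightarrow> th x * (x' y (?e x) - \<eta> * th x * th y * x' x (?e y)) = 0"
      using s(2) by auto
    also have "th x * (x' y (?e x) - \<eta> * th x * th y * x' x (?e y)) = th x * x' y (?e x) - (th x * th x) * (\<eta> * (th y * x' x (?e y)))"
      by (simp add: algebra_simps)
    finally show ?thesis unfolding s(2) by simp
  qed
  have 1: "X \<in> lie_form N B \<longleftrightarrow> X \<in> carrier_mat N N \<and> (\<forall>x\<in>W. \<forall>y\<in>W. x' (?e y) x * b (?e y) + b x * x' (?e x) y = 0)"
  proof
    assume "X \<in> lie_form N B"
    then have Xc: "X \<in> carrier_mat N N" and h: "\<And>i j. i < N \<Longrightarrow> j < N \<Longrightarrow> (\<Sum>k<N. X $$ (k, i) * B $$ (k, j)) + (\<Sum>k<N. B $$ (i, k) * X $$ (k, j)) = 0"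
      by (simp_all add: lie_form_def)
    show "X \<in> carrier_mat N N \<and> (\<forall>x\<in>W. \<forall>y\<in>W. x' (?e y) x * b (?e y) + b x * x' (?e x) y = 0)"
    proof (intro conjI ballI Xc)
      fix x y assume x: "x \<in> W" and y: "y \<in> W"
      show "x' (?e y) x * b (?e y) + b x * x' (?e x) y = 0" unfolding lf[OF x y, symmetric] by (rule h[OF less[OF x] less[OF y]])
    qed
  next
    assume h: "X \<in> carrier_mat N N \<and> (\<forall>x\<in>W. \<forall>y\<in>W. x' (?e y) x * b (?e y) + b x * x' (?e x) y = 0)"
    show "X \<in> lie_form N B" unfolding lie_form_def
    proof (intro CollectI conjI allI impI)
      fix i j assume ij: "i < N" "j < N"
      obtain u where u: "u \<in> D" "i = rho u" using rho_surj[OF ij(1)] by (elim bexE)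
      obtain v where v: "v \<in> D" "j = rho v" using rho_surj[OF ij(2)] by (elim bexE)
      obtain x y where x: "u = (0, x)" "x \<in> W" and y: "v = (0, y)" "y \<in> W" using D0[OF u(1)] D0[OF v(1)] by metis
      show "(\<Sum>k<N. X $$ (k, i) * B $$ (k, j)) + (\<Sum>k<N. B $$ (i, k) * X $$ (k, j)) = 0"
        unfolding u(2) v(2) x(1) y(1) lf[OF x(2) y(2)] by (rule bspec[OF bspec[OF conjunct2[OF h] x(2)] y(2)])
    qed (rule conjunct1[OF h])
  qed
  have sw: "swap_slot fL u = (fst u, snd (snd u), fst (snd u))" "slot_sign fL = \<eta>" for u
    by (simp_all add: swap_slot_def slot_sign_def fL)
  have 2: "X \<in> VV \<longleftrightarrow> X \<in> carrier_mat N N \<and> (\<forall>x\<in>W. \<forall>y\<in>W. th x * x' y (?e x) = \<eta> * (th y * x' x (?e y)))"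
  proof -
    have off: "\<forall>u\<in>D. \<forall>v\<in>D. fst u \<noteq> fst v \<longrightarrow> X $$ (rho u, rho v) = 0"
    proof (intro ballI impI)
      fix u v assume uv: "u \<in> D" "v \<in> D" and ne: "fst u \<noteq> fst v"
      have "fst u = fst v" using uv nR by (simp add: block_labels_def)
      with ne show "X $$ (rho u, rho v) = 0" by (rule notE)
    qed
    have "(\<forall>u\<in>S. crd X (swap_slot fL u) = slot_sign fL * crd X u) \<longleftrightarrow>
      (\<forall>x\<in>W. \<forall>y\<in>W. th x * x' y (?e x) = \<eta> * (th y * x' x (?e y)))"
    proof
      assume h: "\<forall>u\<in>S. crd X (swap_slot fL u) = slot_sign fL * crd X u"
      show "\<forall>x\<in>W. \<forall>y\<in>W. th x * x' y (?e x) = \<eta> * (th y * x' x (?e y))"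
      proof (intro ballI)
        fix x y assume "x \<in> W" "y \<in> W"
        then have "(0, x, y) \<in> S" using nR np by (simp add: slots_def)
        from bspec[OF h this] show "th x * x' y (?e x) = \<eta> * (th y * x' x (?e y))"
          unfolding sw by (simp add: crd_def sg_def enc_def x'_def)
      qed
    next
      assume h: "\<forall>x\<in>W. \<forall>y\<in>W. th x * x' y (?e x) = \<eta> * (th y * x' x (?e y))"
      show "\<forall>u\<in>S. crd X (swap_slot fL u) = slot_sign fL * crd X u"
      proof
        fix u assume "u \<in> S"
        then have "fst u = 0" "fst (snd u) \<in> W" "snd (snd u) \<in> W" using nR by (simp_all add: slots_def)
        then show "crd X (swap_slot fL u) = slot_sign fL * crd X u"
          using bspec[OF bspec[OF h \<open>fst (snd u) \<in> W\<close>] \<open>snd (snd u) \<in> W\<close>]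
          unfolding sw by (simp add: crd_def sg_def enc_def x'_def)
      qed
    qed
    then show ?thesis unfolding VV_iff by (simp only: eqTrueI[OF off] simp_thms)
  qed
  have "(\<forall>x\<in>W. \<forall>y\<in>W. x' (?e y) x * b (?e y) + b x * x' (?e x) y = 0) \<longleftrightarrow>
     (\<forall>x\<in>W. \<forall>y\<in>W. th x * x' y (?e x) = \<eta> * (th y * x' x (?e y)))" (is "?L \<longleftrightarrow> ?R")
  proof
    assume h: ?L
    show ?R
    proof (intro ballI)
      fix x y assume x: "x \<in> W" and y: "y \<in> W"
      from bspec[OF bspec[OF h other_end_in[OF x]] other_end_in[OF y]]
      show "th x * x' y (?e x) = \<eta> * (th y * x' x (?e y))" unfolding key[OF x y] .
    qed
  next
    assume h: ?R
    show ?L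
    proof (intro ballI)
      fix x y assume x: "x \<in> W" and y: "y \<in> W"
      from bspec[OF bspec[OF h other_end_in[OF x]] other_end_in[OF y]]
      have "x' (?e (?e (?e y))) (?e (?e x)) * b (?e (?e (?e y))) + b (?e (?e x)) * x' (?e (?e (?e x))) (?e (?e y)) = 0"
        unfolding key[OF other_end_in[OF x] other_end_in[OF y]] .
      then show "x' (?e y) x * b (?e y) + b x * x' (?e x) y = 0" by (simp only: other_end_other_end)
    qed
  qed
  then show "X \<in> lie_form N B \<longleftrightarrow> X \<in> VV" unfolding 1 2 by (simp only:)
qed

end

section \<open>Two copies of a group and the diagonal subgroup\<close>

locale doubled = one: encoding k nC n N 1 par rho th fL for k nC n N par rho th fL
begin

definition rho2 :: "nat \<times> label \<Rightarrow> nat" where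
  "rho2 u = fst u * N + rho (0, snd u)"

abbreviation "D2 \<equiv> block_labels (labels k nC n) 2 par"

lemma D2_cases: "u \<in> D2 \<Longrightarrow> (0, snd u) \<in> one.D \<and> (fst u = 0 \<or> fst u = 1)"
  by (auto simp: block_labels_def)

sublocale two: encoding k nC n "N + N" 2 par rho2 th fL
proof
  show "bij_betw rho2 D2 {..<N + N}"
    unfolding bij_betw_def
  proof
    show "inj_on rho2 D2"
    proof (rule inj_onI)
      fix u v assume u: "u \<in> D2" and v: "v \<in> D2" and e: "rho2 u = rho2 v"
      note cu = D2_cases[OF u] and cv = D2_cases[OF v]
      have l: "rho (0, snd u) < N" "rho (0, snd v) < N" using one.rho_less cu cv by blast+
      have f: "fst u = fst v" and r: "rho (0, snd u) = rho (0, snd v)"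
        using e l cu cv by (auto simp: rho2_def)
      have "(0::nat, snd u) = (0, snd v)" using one.rho_inj cu cv r by blast
      then show "u = v" using f by (simp add: prod_eq_iff)
    qed
    show "rho2 ` D2 = {..<N + N}"
    proof (intro equalityI subsetI)
      fix i assume "i \<in> rho2 ` D2"
      then obtain u where u: "u \<in> D2" "i = rho2 u" by (elim imageE)
      have "rho (0, snd u) < N" using one.rho_less D2_cases[OF u(1)] by blast
      then show "i \<in> {..<N + N}" using D2_cases[OF u(1)] u(2) by (auto simp: rho2_def)
    next
      fix i assume i: "i \<in> {..<N + N}"
      show "i \<in> rho2 ` D2"
      proof (cases "i < N")
        case True
        obtain u where u: "u \<in> one.D" "i = rho u" using one.rho_surj[OF True] by (elim bexE)
        have "fst u = 0" using u(1) by (simp add: block_labels_def)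
        then have "rho2 u = i" using u(2) by (simp add: rho2_def) (metis prod.collapse)
        moreover have "u \<in> D2" using u(1) by (simp add: block_labels_def)
        ultimately show ?thesis by (metis imageI)
      next
        case False
        then have "i - N < N" using i by simp
        then obtain u where u: "u \<in> one.D" "i - N = rho u" using one.rho_surj by blast
        have f: "fst u = 0" using u(1) by (simp add: block_labels_def)
        then have "(0, snd u) = u" by (simp add: prod_eq_iff)
        then have "rho2 (1, snd u) = i" using u(2) False by (simp add: rho2_def)
        moreover have "(1, snd u) \<in> D2" using u(1) by (simp add: block_labels_def)
        ultimately show ?thesis by (metis imageI)
      qed
    qed
  qed
qed (rule one.th, rule one.par_GL, assumption, rule one.par_fL, assumption, rule one.fL_sq)

text \<open>Slots of colour 0 and of colour 1 are the coordinates of the two diagonal blocks, and no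
  slot lies outside the blocks.\<close>

lemma VV2_iff:
  "Z \<in> two.VV \<longleftrightarrow> Z \<in> carrier_mat (N + N) (N + N) \<and>
    (\<forall>i<N+N. \<forall>j<N+N. (i < N) \<noteq> (j < N) \<longrightarrow> Z $$ (i, j) = 0) \<and>
    top_left N Z \<in> one.VV \<and> bottom_right N N Z \<in> one.VV"
proof -
  have lt: "u \<in> D2 \<Longrightarrow> rho2 u < N \<longleftrightarrow> fst u = 0" for u
    using D2_cases[of u] one.rho_less[of "(0, snd u)"] by (auto simp: rho2_def)
  have A: "(\<forall>u\<in>D2. \<forall>v\<in>D2. fst u \<noteq> fst v \<longrightarrow> Z $$ (rho2 u, rho2 v) = 0) \<longleftrightarrow>
    (\<forall>i<N+N. \<forall>j<N+N. (i < N) \<noteq> (j < N) \<longrightarrow> Z $$ (i, j) = 0)"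
  proof
    assume h: "\<forall>u\<in>D2. \<forall>v\<in>D2. fst u \<noteq> fst v \<longrightarrow> Z $$ (rho2 u, rho2 v) = 0"
    show "\<forall>i<N+N. \<forall>j<N+N. (i < N) \<noteq> (j < N) \<longrightarrow> Z $$ (i, j) = 0"
    proof (intro allI impI)
      fix i j assume ij: "i < N + N" "j < N + N" "(i < N) \<noteq> (j < N)"
      obtain u where u: "u \<in> D2" "i = rho2 u" using two.rho_surj[OF ij(1)] by (elim bexE)
      obtain v where v: "v \<in> D2" "j = rho2 v" using two.rho_surj[OF ij(2)] by (elim bexE)
      have "fst u \<noteq> fst v" using ij(3) lt[OF u(1)] lt[OF v(1)] unfolding u(2) v(2) by auto
      then show "Z $$ (i, j) = 0" using h u v by simp
    qed
  next
    assume h: "\<forall>i<N+N. \<forall>j<N+N. (i < N) \<noteq> (j < N) \<longrightarrow> Z $$ (i, j) = 0"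
    show "\<forall>u\<in>D2. \<forall>v\<in>D2. fst u \<noteq> fst v \<longrightarrow> Z $$ (rho2 u, rho2 v) = 0"
    proof (intro ballI impI)
      fix u v assume uv: "u \<in> D2" "v \<in> D2" "fst u \<noteq> fst v"
      have "(rho2 u < N) \<noteq> (rho2 v < N)" using uv(3) lt[OF uv(1)] lt[OF uv(2)] D2_cases[OF uv(1)] D2_cases[OF uv(2)] by auto
      then show "Z $$ (rho2 u, rho2 v) = 0" using h two.rho_less[OF uv(1)] two.rho_less[OF uv(2)] by simp
    qed
  qed
  have e0: "two.crd Z (0, x, y) = one.crd (top_left N Z) (0, x, y)" if "(0, x, y) \<in> one.S" for x y
    using one.rho_less[OF one.slot_rows[OF that]] one.rho_less[OF one.slot_cols[OF that]]
    by (simp add: two.crd_def one.crd_def two.sg_def one.sg_def two.enc_def one.enc_def rho2_def top_left_def)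
  have e1: "two.crd Z (1, x, y) = one.crd (bottom_right N N Z) (0, x, y)" if "(0, x, y) \<in> one.S" for x y
    using one.rho_less[OF one.slot_rows[OF that]] one.rho_less[OF one.slot_cols[OF that]]
    by (simp add: two.crd_def one.crd_def two.sg_def one.sg_def two.enc_def one.enc_def rho2_def bottom_right_def)
  have S2: "(r, x, y) \<in> two.S \<longleftrightarrow> (0, x, y) \<in> one.S \<and> (r = 0 \<or> r = 1)" for r x y
    by (auto simp: slots_def)
  have sw1: "fL = None \<Longrightarrow> swap_slot fL (r, x, y) = (r, x, y)"
    and sw2: "fL \<noteq> None \<Longrightarrow> swap_slot fL (r, x, y) = (r, y, x)" for r x y
    by (simp_all only: swap_slot_def fst_conv snd_conv simp_thms if_True if_False)
  have swS: "(0, x, y) \<in> one.S \<Longrightarrow> fL \<noteq> None \<Longrightarrow> (0, y, x) \<in> one.S" for x y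
  proof -
    assume "(0, x, y) \<in> one.S" and ne: "fL \<noteq> None"
    from one.tau_in[OF this(1)] show "(0, y, x) \<in> one.S" unfolding sw2[OF ne] .
  qed
  have B: "(\<forall>u\<in>two.S. two.crd Z (swap_slot fL u) = slot_sign fL * two.crd Z u) \<longleftrightarrow>
    (\<forall>u\<in>one.S. one.crd (top_left N Z) (swap_slot fL u) = slot_sign fL * one.crd (top_left N Z) u) \<and>
    (\<forall>u\<in>one.S. one.crd (bottom_right N N Z) (swap_slot fL u) = slot_sign fL * one.crd (bottom_right N N Z) u)"
    (is "?T \<longleftrightarrow> ?O1 \<and> ?O2")
  proof -
    have c0: "two.crd Z (swap_slot fL (0, x, y)) = slot_sign fL * two.crd Z (0, x, y) \<longleftrightarrow>
       one.crd (top_left N Z) (swap_slot fL (0, x, y)) = slot_sign fL * one.crd (top_left N Z) (0, x, y)"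
      if s: "(0, x, y) \<in> one.S" for x y
    proof (cases "fL = None")
      case True
      show ?thesis unfolding sw1[OF True] e0[OF s] ..
    next
      case False
      show ?thesis unfolding sw2[OF False] e0[OF s] e0[OF swS[OF s False]] ..
    qed
    have c1: "two.crd Z (swap_slot fL (1, x, y)) = slot_sign fL * two.crd Z (1, x, y) \<longleftrightarrow>
       one.crd (bottom_right N N Z) (swap_slot fL (0, x, y)) = slot_sign fL * one.crd (bottom_right N N Z) (0, x, y)"
      if s: "(0, x, y) \<in> one.S" for x y
    proof (cases "fL = None")
      case True
      show ?thesis unfolding sw1[OF True] e1[OF s] ..
    next
      case False
      show ?thesis unfolding sw2[OF False] e1[OF s] e1[OF swS[OF s False]] ..
    qed
    have S1: "u \<in> one.S \<Longrightarrow> u = (0, fst (snd u), snd (snd u))" for u by (simp add: slots_def prod_eq_iff)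
    show ?thesis
    proof
      assume h: ?T
      show "?O1 \<and> ?O2"
      proof (intro conjI ballI)
        fix u assume "u \<in> one.S"
        then obtain x y where u: "u = (0, x, y)" "(0, x, y) \<in> one.S" using S1 by metis
        have "(0, x, y) \<in> two.S" "(1, x, y) \<in> two.S" using S2 u(2) by simp_all
        from bspec[OF h this(1)] bspec[OF h this(2)]
        show "one.crd (top_left N Z) (swap_slot fL u) = slot_sign fL * one.crd (top_left N Z) u"
          "one.crd (bottom_right N N Z) (swap_slot fL u) = slot_sign fL * one.crd (bottom_right N N Z) u"
          unfolding u(1) c0[OF u(2)] c1[OF u(2)] by simp_all
      qed
    next
      assume h: "?O1 \<and> ?O2"
      show ?T
      proof
        fix u assume us: "u \<in> two.S"
        obtain r x y where u: "u = (r, x, y)" by (cases u)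
        then have s: "(0, x, y) \<in> one.S" and r: "r = 0 \<or> r = 1" using us S2 by simp_all
        from r show "two.crd Z (swap_slot fL u) = slot_sign fL * two.crd Z u"
        proof
          assume r: "r = 0"
          show ?thesis unfolding u r c0[OF s] by (rule bspec[OF conjunct1[OF h] s])
        next
          assume r: "r = 1"
          show ?thesis unfolding u r c1[OF s] by (rule bspec[OF conjunct2[OF h] s])
        qed
      qed
    qed
  qed
  have off1: "(\<forall>u\<in>one.D. \<forall>v\<in>one.D. fst u \<noteq> fst v \<longrightarrow> X $$ (rho u, rho v) = 0)" for X :: "complex mat"
  proof (intro ballI impI)
    fix u v assume uv: "u \<in> one.D" "v \<in> one.D" and ne: "fst u \<noteq> fst v"
    have "fst u = fst v" using uv by (simp add: block_labels_def)
    with ne show "X $$ (rho u, rho v) = 0" by (rule notE)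
  qed
  have V1: "X \<in> one.VV \<longleftrightarrow> X \<in> carrier_mat N N \<and> (\<forall>u\<in>one.S. one.crd X (swap_slot fL u) = slot_sign fL * one.crd X u)" for X
    unfolding one.VV_iff by (simp only: eqTrueI[OF off1[of X]] simp_thms)
  have "top_left N Z \<in> carrier_mat N N" "bottom_right N N Z \<in> carrier_mat N N"
    by (simp_all add: top_left_def bottom_right_def)
  then show ?thesis unfolding two.VV_iff A B V1 by (simp only: simp_thms)
qed

lemma of_isom_diag2:
  assumes a: "one.of_isom h a"
  shows "two.of_isom h (diag2 a a)"
proof -
  have ac: "a \<in> carrier_mat N N" using a unfolding one.of_isom_def by (rule conjunct1)
  show ?thesis unfolding two.of_isom_def
  proof (intro conjI ballI diag2_carrier ac)
    fix u v assume u: "u \<in> D2" and v: "v \<in> D2"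
    have du: "(0, snd u) \<in> one.D" and dv: "(0, snd v) \<in> one.D" using D2_cases u v by blast+
    have e: "a $$ (rho (0, snd u), rho (0, snd v)) = h (snd u) (snd v)"
      using bspec[OF bspec[OF conjunct2[OF a[unfolded one.of_isom_def]] du] dv] by simp
    show "diag2 a a $$ (rho2 u, rho2 v) = (if fst u = fst v then h (snd u) (snd v) else 0)"
      unfolding diag2_entry[OF ac ac two.rho_less[OF u] two.rho_less[OF v]]
      using D2_cases[OF u] D2_cases[OF v] one.rho_less[OF du] one.rho_less[OF dv] e
      by (auto simp: rho2_def)
  qed
qed

text \<open>A diagonal element acts on both copies through the same \<open>h\<close>, so doubling
  \<open>G\<close> only gives the slots two colours, while the colours coming from \<open>K\<close>
  stay as they were.\<close>

theorem dim_invariants_doubled: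
  assumes G: "G \<subseteq> carrier_mat N N" and L: "Lie N G = one.VV"
    and K1: "\<And>g. g \<in> K \<Longrightarrow> \<exists>h\<in>isom k nC n. one.of_isom h g"
    and K2: "\<And>h. h \<in> isom k nC n \<Longrightarrow> \<exists>g\<in>K. one.of_isom h g"
    and big: "\<And>i. i < nC \<Longrightarrow> 3 * d \<le> n i"
  shows "mat_poly.dim (invariants (N + N) (block_prod G G) (diagonal K) d) =
    fun_vs.dim (Phi d 2 fL nC (flip_sign k) par)"
proof (rule two.dim_invariants_encoding)
  show "Lie (N + N) (block_prod G G) = two.VV"
    unfolding Lie_block_prod[OF G G] L by (rule Set.set_eqI) (simp only: mem_Collect_eq VV2_iff)
  show "\<exists>h\<in>isom k nC n. two.of_isom h g" if gK: "g \<in> diagonal K" for g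
  proof -
    obtain a where a: "a \<in> K" "g = diag2 a a" using gK unfolding diagonal_def diag2_def by blast
    obtain h where h: "h \<in> isom k nC n" "one.of_isom h a" using K1[OF a(1)] by (elim bexE)
    show ?thesis unfolding a(2) by (rule bexI, rule of_isom_diag2[OF h(2)], rule h(1))
  qed
  show "\<exists>g\<in>diagonal K. two.of_isom h g" if h: "h \<in> isom k nC n" for h
  proof -
    obtain a where a: "a \<in> K" "one.of_isom h a" using K2[OF h] by (elim bexE)
    have "diag2 a a \<in> diagonal K" using a(1) unfolding diagonal_def diag2_def by blast
    show ?thesis by (rule bexI, rule of_isom_diag2[OF a(2)], rule \<open>diag2 a a \<in> diagonal K\<close>)
  qed
  show "3 * d \<le> n i" if "i < nC" for i by (rule big[OF that])
qed

end

section \<open>Isomorphisms between spaces of functions on matchings\<close>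

lemma subspace_Phi: "fun_vs.subspace (Phi d nR fL nC fR par)"
proof (rule fun_vs.subspaceI)
  show "0 \<in> Phi d nR fL nC fR par" by (simp add: Phi_def)
next
  fix f g :: "matching_index \<Rightarrow> complex"
  assume f: "f \<in> Phi d nR fL nC fR par" and g: "g \<in> Phi d nR fL nC fR par"
  show "f + g \<in> Phi d nR fL nC fR par" unfolding Phi_def
  proof (intro CollectI conjI allI impI)
    fix r \<rho> c assume "(f + g) (r, \<rho>, c) \<noteq> 0"
    then have nz: "f (r, \<rho>, c) \<noteq> 0 \<or> g (r, \<rho>, c) \<noteq> 0" by auto
    then show "r \<in> {..<d} \<rightarrow>\<^sub>E {..<nR}" "\<rho> permutes Pos d" "c \<in> {..<d} \<rightarrow>\<^sub>E {..<nC}"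
      using PhiD(1)[OF f] PhiD(1)[OF g] by blast+
    assume par
    show "\<forall>x\<in>Pos d. snd (\<rho> x) = snd x"
      using nz PhiD(2)[OF f _ \<open>par\<close>] PhiD(2)[OF g _ \<open>par\<close>] by blast
  qed (simp_all add: PhiD(3-6)[OF f] PhiD(3-6)[OF g] algebra_simps)
next
  fix a f assume f: "f \<in> Phi d nR fL nC fR par"
  show "fscale a f \<in> Phi d nR fL nC fR par" unfolding Phi_def
  proof (intro CollectI conjI allI impI)
    fix r \<rho> c assume "fscale a f (r, \<rho>, c) \<noteq> 0"
    then have nz: "f (r, \<rho>, c) \<noteq> 0" by (auto simp: fscale_def)
    then show "r \<in> {..<d} \<rightarrow>\<^sub>E {..<nR}" "\<rho> permutes Pos d" "c \<in> {..<d} \<rightarrow>\<^sub>E {..<nC}"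
      using PhiD(1)[OF f] by blast+
    assume par
    show "\<forall>x\<in>Pos d. snd (\<rho> x) = snd x" using nz PhiD(2)[OF f _ \<open>par\<close>] by blast
  qed (simp_all add: PhiD(3-6)[OF f] fscale_def)
qed

text \<open>One map \<open>F\<close> serves in both directions, as both the transposition and the
  twist are involutions exchanging two spaces.\<close>

lemma dim_Phi_eq:
  assumes f: "\<And>\<phi>. \<phi> \<in> Phi d nR fL nC fR par \<Longrightarrow> F \<phi> \<in> Phi d nR' fL' nC' fR' par \<and> F (F \<phi>) = \<phi>"
    and f': "\<And>\<phi>. \<phi> \<in> Phi d nR' fL' nC' fR' par \<Longrightarrow> F \<phi> \<in> Phi d nR fL nC fR par \<and> F (F \<phi>) = \<phi>"
    and add: "\<And>\<phi> \<psi>. F (\<phi> + \<psi>) = F \<phi> + F \<psi>" and scale: "\<And>a \<phi>. F (fscale a \<phi>) = fscale a (F \<phi>)"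
  shows "fun_vs.dim (Phi d nR' fL' nC' fR' par) = fun_vs.dim (Phi d nR fL nC fR par)"
proof -
  have lin: "Vector_Spaces.linear fscale fscale F"
    by (intro Vector_Spaces.linear.intro module_hom.intro module_hom_axioms.intro fun_vs.vector_space_axioms fun_vs.module_axioms)
      (rule add scale)+
  have inj: "inj_on F (Phi d nR fL nC fR par)"
    by (rule inj_on_inverseI[where g = F]) (simp add: f)
  have "F ` Phi d nR fL nC fR par = Phi d nR' fL' nC' fR' par"
  proof (intro equalityI subsetI)
    fix \<phi> assume h: "\<phi> \<in> Phi d nR' fL' nC' fR' par"
    have "F (F \<phi>) \<in> F ` Phi d nR fL nC fR par" by (rule imageI) (simp add: f'[OF h])
    then show "\<phi> \<in> F ` Phi d nR fL nC fR par" by (simp add: f'[OF h])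
  next
    fix \<phi> assume "\<phi> \<in> F ` Phi d nR fL nC fR par"
    then obtain \<psi> where "\<phi> = F \<psi>" "\<psi> \<in> Phi d nR fL nC fR par" by (rule imageE)
    then show "\<phi> \<in> Phi d nR' fL' nC' fR' par" by (simp add: f)
  qed
  with dim_inj_image[OF fun_vs.vector_space_axioms fun_vs.vector_space_axioms lin subspace_Phi inj]
  show ?thesis by simp
qed

text \<open>Inverting \<open>\<rho>\<close> exchanges slots with pairs, so left and right
  equivariance and the two colourings trade places. The guard gives the value 0 where
  \<open>\<rho>\<close> is no permutation of the positions.\<close>

definition transp :: "nat \<Rightarrow> (matching_index \<Rightarrow> complex) \<Rightarrow> matching_index \<Rightarrow> complex" where
  "transp d \<phi> = (\<lambda>(r, \<rho>, c). if \<rho> permutes Pos d then \<phi> (c, Hilbert_Choice.inv \<rho>, r) else 0)"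

lemma transp_in_Phi:
  assumes f: "\<phi> \<in> Phi d nR fL nC fR par"
  shows "transp d \<phi> \<in> Phi d nC fR nR fL par"
  unfolding Phi_def
proof (intro CollectI conjI allI impI)
  fix r \<rho> c assume "transp d \<phi> (r, \<rho>, c) \<noteq> 0"
  then have rho: "\<rho> permutes Pos d" and nz: "\<phi> (c, Hilbert_Choice.inv \<rho>, r) \<noteq> 0"
    by (auto simp: transp_def split: if_splits)
  show "r \<in> {..<d} \<rightarrow>\<^sub>E {..<nC}" "\<rho> permutes Pos d" "c \<in> {..<d} \<rightarrow>\<^sub>E {..<nR}"
    using PhiD(1)[OF f nz] rho by simp_all
  assume p: par
  show "\<forall>x\<in>Pos d. snd (\<rho> x) = snd x"
  proof
    fix x assume "x \<in> Pos d"
    then have "\<rho> x \<in> Pos d" using permutes_in_image[OF rho] by simp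
    from PhiD(2)[OF f nz p this] show "snd (\<rho> x) = snd x" by (simp add: permutes_inverses[OF rho])
  qed
next
  fix r \<rho> c \<pi> assume pi: "\<pi> permutes {..<d}" and rho: "\<rho> permutes Pos d"
  note hp = hat_permutes[OF pi] and ip = permutes_inv[OF pi] and ir = permutes_inv[OF rho]
  have perm: "\<rho> \<circ> hat \<pi> permutes Pos d" "hat \<pi> \<circ> \<rho> permutes Pos d"
    by (rule permutes_compose[OF hp rho] permutes_compose[OF rho hp])+
  have i: "Hilbert_Choice.inv (\<rho> \<circ> hat \<pi>) = hat (Hilbert_Choice.inv \<pi>) \<circ> Hilbert_Choice.inv \<rho>"
    "Hilbert_Choice.inv (hat \<pi> \<circ> \<rho>) = Hilbert_Choice.inv \<rho> \<circ> hat (Hilbert_Choice.inv \<pi>)"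
    by (simp_all add: inv_comp[OF rho hp] inv_comp[OF hp rho] inv_hat[OF pi])
  show "transp d \<phi> (r \<circ> \<pi>, \<rho> \<circ> hat \<pi>, c) = transp d \<phi> (r, \<rho>, c)"
    using PhiD(4)[OF f ip ir, of c "r \<circ> \<pi>"] rho perm i by (simp add: transp_def comp_assoc permutes_inv_o[OF pi])
  show "transp d \<phi> (r, hat \<pi> \<circ> \<rho>, c) = transp d \<phi> (r, \<rho>, c \<circ> \<pi>)"
    using PhiD(3)[OF f ip ir, of "c \<circ> \<pi>" r] rho perm i by (simp add: transp_def comp_assoc permutes_inv_o[OF pi])
next
  fix r \<rho> c s \<eta> assume s: "s < d" and rho: "\<rho> permutes Pos d" and e: "fR = Some \<eta>"
  note fp = flip_permutes[OF s]
  show "transp d \<phi> (r, \<rho> \<circ> flip s, c) = \<eta> * transp d \<phi> (r, \<rho>, c)"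
    using PhiD(6)[OF f s permutes_inv[OF rho] e, of c r] rho permutes_compose[OF fp rho]
    by (simp add: transp_def inv_comp[OF rho fp] inv_flip)
next
  fix r \<rho> c s \<eta> assume s: "s < d" and rho: "\<rho> permutes Pos d" and e: "fL = Some \<eta>"
  note fp = flip_permutes[OF s]
  show "transp d \<phi> (r, flip s \<circ> \<rho>, c) = \<eta> * transp d \<phi> (r, \<rho>, c)"
    using PhiD(5)[OF f s permutes_inv[OF rho] e, of c r] rho permutes_compose[OF rho fp]
    by (simp add: transp_def inv_comp[OF fp rho] inv_flip)
qed

lemma transp_transp:
  assumes f: "\<phi> \<in> Phi d nR fL nC fR par"
  shows "transp d (transp d \<phi>) = \<phi>"
proof
  fix u :: matching_index
  obtain r \<rho> c where u: "u = (r, \<rho>, c)" by (cases u)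
  show "transp d (transp d \<phi>) u = \<phi> u"
  proof (cases "\<rho> permutes Pos d")
    case True
    then show ?thesis unfolding u by (simp add: transp_def permutes_inv inv_inv_eq permutes_bij)
  next
    case False
    then have "\<phi> (r, \<rho>, c) = 0" using PhiD(1)[OF f] by blast
    then show ?thesis unfolding u using False by (simp add: transp_def)
  qed
qed

lemma dim_Phi_transp: "fun_vs.dim (Phi d nR fL nC fR par) = fun_vs.dim (Phi d nC fR nR fL par)"
  by (rule dim_Phi_eq[where F = "transp d"])
    (simp_all add: transp_in_Phi transp_transp, simp_all add: transp_def fscale_def fun_eq_iff)

text \<open>\<open>hat \<pi>\<close> consists of two copies of \<open>\<pi>\<close>, one on the
  False ends and one on the True ends, so its sign is a square.\<close>

lemma sign_hat:
  assumes "\<pi> permutes {..<d}"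
  shows "sign (hat \<pi>) = 1"
proof -
  have "finite {..<d}" by simp
  from assms this show ?thesis
  proof (induction rule: permutes_induct)
    case id
    then show ?case by (simp add: hat_id)
  next
    case (swap a b p)
    have h: "hat (Transposition.transpose a b) =
        Transposition.transpose (a, False) (b, False) \<circ> Transposition.transpose (a, True) (b, True)"
      by (auto simp: fun_eq_iff Transposition.transpose_def)
    have pp: "permutation (hat p)" by (rule permutes_imp_permutation[OF finite_Pos hat_permutes[OF swap(4)]])
    have "sign (hat (Transposition.transpose a b)) = 1"
      unfolding h by (simp add: sign_compose permutation_swap_id permutation_compose sign_swap_id)
    moreover have "permutation (hat (Transposition.transpose a b))"
      unfolding h by (intro permutation_compose permutation_swap_id)
    ultimately show ?case using swap(5) pp by (simp only: hat_comp sign_compose mult_1_left)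
  qed
qed

definition twist :: "(matching_index \<Rightarrow> complex) \<Rightarrow> matching_index \<Rightarrow> complex" where
  "twist \<phi> = (\<lambda>(r, \<rho>, c). of_int (sign \<rho>) * \<phi> (r, \<rho>, c))"

lemma twist_twist: "twist (twist \<phi>) = \<phi>"
  by (auto simp: twist_def fun_eq_iff sign_def)

text \<open>\<open>flip s\<close> is a transposition, so the sign of \<open>\<rho>\<close> negates
  the two flip signs; \<open>hat \<pi>\<close> is even and leaves the other conditions
  alone.\<close>

lemma twist_in_Phi:
  assumes f: "\<phi> \<in> Phi d nR fL nC fR par"
    and L: "fL' = map_option uminus fL" and R: "fR' = map_option uminus fR"
  shows "twist \<phi> \<in> Phi d nR fL' nC fR' par"
  unfolding Phi_def
proof (intro CollectI conjI allI impI)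
  fix r \<rho> c assume "twist \<phi> (r, \<rho>, c) \<noteq> 0"
  then have nz: "\<phi> (r, \<rho>, c) \<noteq> 0" by (auto simp: twist_def)
  show "r \<in> {..<d} \<rightarrow>\<^sub>E {..<nR}" "\<rho> permutes Pos d" "c \<in> {..<d} \<rightarrow>\<^sub>E {..<nC}"
    using PhiD(1)[OF f nz] by simp_all
  assume p: par
  show "\<forall>x\<in>Pos d. snd (\<rho> x) = snd x" using PhiD(2)[OF f nz p] by blast
next
  fix r \<rho> c \<pi> assume pi: "\<pi> permutes {..<d}" and rho: "\<rho> permutes Pos d"
  note hp = hat_permutes[OF pi]
  have "sign (\<rho> \<circ> hat \<pi>) = sign \<rho>" "sign (hat \<pi> \<circ> \<rho>) = sign \<rho>"
    using permutes_imp_permutation[OF finite_Pos hp] permutes_imp_permutation[OF finite_Pos rho]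
    by (simp_all add: sign_compose sign_hat[OF pi])
  then show "twist \<phi> (r \<circ> \<pi>, \<rho> \<circ> hat \<pi>, c) = twist \<phi> (r, \<rho>, c)"
    "twist \<phi> (r, hat \<pi> \<circ> \<rho>, c) = twist \<phi> (r, \<rho>, c \<circ> \<pi>)"
    using PhiD(3,4)[OF f pi rho] by (simp_all add: twist_def)
next
  fix r \<rho> c s \<eta> assume s: "s < d" and rho: "\<rho> permutes Pos d" and e: "fL' = Some \<eta>"
  then have e': "fL = Some (- \<eta>)" using L by (cases fL) auto
  have "sign (\<rho> \<circ> flip s) = - sign \<rho>"
    using permutes_imp_permutation[OF finite_Pos rho]
    by (simp add: flip_def sign_compose permutation_swap_id sign_swap_id)
  then show "twist \<phi> (r, \<rho> \<circ> flip s, c) = \<eta> * twist \<phi> (r, \<rho>, c)"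
    using PhiD(5)[OF f s rho e'] by (simp add: twist_def)
next
  fix r \<rho> c s \<eta> assume s: "s < d" and rho: "\<rho> permutes Pos d" and e: "fR' = Some \<eta>"
  then have e': "fR = Some (- \<eta>)" using R by (cases fR) auto
  have "sign (flip s \<circ> \<rho>) = - sign \<rho>"
    using permutes_imp_permutation[OF finite_Pos rho]
    by (simp add: flip_def sign_compose permutation_swap_id sign_swap_id)
  then show "twist \<phi> (r, flip s \<circ> \<rho>, c) = \<eta> * twist \<phi> (r, \<rho>, c)"
    using PhiD(6)[OF f s rho e'] by (simp add: twist_def)
qed

lemma dim_Phi_twist:
  "fun_vs.dim (Phi d nR fL nC fR par) = fun_vs.dim (Phi d nR (map_option uminus fL) nC (map_option uminus fR) par)"
proof (rule dim_Phi_eq[where F = twist])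
  have mm: "map_option uminus (map_option uminus f) = f" for f :: "complex option" by (cases f) simp_all
  show "twist \<phi> \<in> Phi d nR fL nC fR par \<and> twist (twist \<phi>) = \<phi>"
    if "\<phi> \<in> Phi d nR (map_option uminus fL) nC (map_option uminus fR) par" for \<phi>
    by (intro conjI twist_twist twist_in_Phi[OF that]) (simp_all only: mm)
  show "twist \<phi> \<in> Phi d nR (map_option uminus fL) nC (map_option uminus fR) par \<and> twist (twist \<phi>) = \<phi>"
    if "\<phi> \<in> Phi d nR fL nC fR par" for \<phi>
    by (intro conjI twist_twist twist_in_Phi[OF that] refl)
qed (simp_all add: twist_def fscale_def fun_eq_iff algebra_simps)

section \<open>The ten families\<close>

text \<open>A monomial matrix along an involution squares to a scalar when the weights in each orbit
  multiply to the same constant; this covers \<open>J_mat\<close>, \<open>D_mat\<close> and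
  \<open>C_mat\<close> at once.\<close>

lemma scalar_square:
  fixes B :: "complex mat"
  assumes B: "B \<in> carrier_mat n n"
    and e: "\<And>i j. i < n \<Longrightarrow> j < n \<Longrightarrow> B $$ (i, j) = (if j = \<sigma> i then b i else 0)"
    and \<sigma>: "\<And>i. i < n \<Longrightarrow> \<sigma> i < n \<and> \<sigma> (\<sigma> i) = i \<and> b i * b (\<sigma> i) = c"
  shows "B * B = c \<cdot>\<^sub>m 1\<^sub>m n"
proof (rule eq_matI)
  fix i j assume "i < dim_row (c \<cdot>\<^sub>m 1\<^sub>m n)" "j < dim_col (c \<cdot>\<^sub>m 1\<^sub>m n)"
  then have ij: "i < n" "j < n" by simp_all
  have "(B * B) $$ (i, j) = (\<Sum>l<n. B $$ (i, l) * B $$ (l, j))" by (rule mult_entry[OF B B ij])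
  also have "\<dots> = (\<Sum>l<n. if l = \<sigma> i then b i * B $$ (\<sigma> i, j) else 0)"
    by (rule sum.cong[OF refl]) (simp add: e ij)
  also have "\<dots> = b i * B $$ (\<sigma> i, j)" using \<sigma>[OF ij(1)] by simp
  also have "\<dots> = (if j = i then c else 0)" using \<sigma>[OF ij(1)] e[of "\<sigma> i" j] ij by simp
  finally show "(B * B) $$ (i, j) = (c \<cdot>\<^sub>m 1\<^sub>m n) $$ (i, j)" using ij by simp
qed (use B in simp_all)

lemma GL_I:
  assumes "a \<in> carrier_mat n n" "b \<in> carrier_mat n n" "a * b = 1\<^sub>m n"
  shows "a \<in> GL n" "mat_inv a = b" "b * a = 1\<^sub>m n"
proof -
  show ba: "b * a = 1\<^sub>m n" by (rule mat_mult_left_right_inverse[OF assms])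
  have inv: "invertible_mat a"
    using assms ba by (auto simp: invertible_mat_def inverts_mat_def)
  then show "a \<in> GL n" using assms by (simp add: GL_def)
  note m = mat_inv[OF assms(1) inv]
  have "mat_inv a = mat_inv a * (a * b)" using m(1) assms by simp
  also have "\<dots> = mat_inv a * a * b" by (rule assoc_mult_mat[symmetric, OF m(1) assms(1,2)])
  also have "\<dots> = b" using assms unfolding m(3) by simp
  finally show "mat_inv a = b" .
qed

lemma smult_smult:
  fixes A :: "complex mat"
  shows "a \<cdot>\<^sub>m (b \<cdot>\<^sub>m A) = (a * b) \<cdot>\<^sub>m A" "1 \<cdot>\<^sub>m A = A"
  by (rule eq_matI; simp)+

text \<open>Since B^2 = c, the matrix c B g^T B is a left inverse of \<open>g\<close>. It is then
  also a right inverse, which carries the transpose to the other side.\<close>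

lemma form_flip:
  assumes B: "B \<in> carrier_mat n n" and BB: "B * B = c \<cdot>\<^sub>m 1\<^sub>m n" and c: "c * c = 1"
    and g: "g \<in> carrier_mat n n" and gB: "transpose_mat g * B * g = B"
  shows "g * B * transpose_mat g = B" and "g \<in> GL n"
proof -
  let ?t = "transpose_mat g" and ?h = "c \<cdot>\<^sub>m (B * transpose_mat g * B)"
  have t: "?t \<in> carrier_mat n n" using g by simp
  have h: "?h \<in> carrier_mat n n" using B t by simp
  note as = assoc_mult_mat[of _ n n _ n _ n]
  have Bt: "B * ?t \<in> carrier_mat n n" and tB: "?t * B \<in> carrier_mat n n" using B t by simp_all
  have "?h * g = c \<cdot>\<^sub>m (B * ?t * B * g)" by (rule mult_smult_assoc_mat[OF mult_carrier_mat[OF Bt B] g])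
  also have "B * ?t * B * g = B * (?t * B * g)" unfolding as[OF B t B] by (rule as[OF B tB g])
  also have "c \<cdot>\<^sub>m \<dots> = 1\<^sub>m n" unfolding gB BB smult_smult c ..
  finally have "?h * g = 1\<^sub>m n" .
  note r = GL_I(3)[OF h g this]
  show "g \<in> GL n" by (rule GL_I(1)[OF g h r])
  have "B = (g * ?h) * B" using r B by simp
  also have "\<dots> = c \<cdot>\<^sub>m (g * B * ?t * (B * B))"
    using B t g by (simp add: assoc_mult_mat[of _ n n _ n _ n] mult_smult_distrib[of _ n n _ n] mult_smult_assoc_mat[of _ n n _ n])
  also have "\<dots> = g * B * ?t"
    using B t g c by (simp add: BB mult_smult_distrib[of _ n n _ n] smult_smult)
  finally show "g * B * ?t = B" by simp
qed

lemma isometries_right: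
  assumes B: "B \<in> carrier_mat n n" and BB: "B * B = c \<cdot>\<^sub>m 1\<^sub>m n" and c: "c * c = 1"
  shows "isometries n B = {g \<in> carrier_mat n n. g * B * transpose_mat g = B}"
proof (rule Set.set_eqI)
  fix g :: "complex mat"
  note f = form_flip[OF B BB c]
  have "g \<in> GL n \<Longrightarrow> g \<in> carrier_mat n n" by (simp add: GL_def)
  moreover have "transpose_mat g * B * g = B \<and> g \<in> GL n"
    if "g \<in> carrier_mat n n" "g * B * transpose_mat g = B"
    using f[of "transpose_mat g"] that f(2)[of g] by simp
  ultimately show "g \<in> isometries n B \<longleftrightarrow> g \<in> {g \<in> carrier_mat n n. g * B * transpose_mat g = B}"
    unfolding isometries_eq[OF B] using f(1)[of g] by blast
qed

lemma O_grp_eq: "O_grp n = isometries n (1\<^sub>m n)"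
proof -
  have "isometries n (1\<^sub>m n) = {g \<in> carrier_mat n n. g * transpose_mat g = 1\<^sub>m n}"
    by (subst isometries_right[of _ _ 1]) auto
  moreover have "g \<in> GL n \<and> mat_inv g = transpose_mat g \<longleftrightarrow> g \<in> carrier_mat n n \<and> g * transpose_mat g = 1\<^sub>m n"
    for g :: "complex mat"
    using GL_I[of g n "transpose_mat g"] mat_inv(2)[of g n] by (auto simp: GL_def)
  ultimately show ?thesis by (simp add: O_grp_def)
qed

lemma J_mat_carrier: "J_mat m \<in> carrier_mat (2 * m) (2 * m)"
  unfolding mult_2 J_mat_def by (rule four_block_carrier_mat) simp_all

lemma J_entry: "i < 2 * m \<Longrightarrow> j < 2 * m \<Longrightarrow>
    J_mat m $$ (i, j) = (if j = i + m then 1 else if i = j + m then - 1 else 0)"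
  by (auto simp: J_mat_def)

lemma D_mat_carrier: "D_mat m \<in> carrier_mat (2 * m) (2 * m)"
  unfolding mult_2 D_mat_def by (rule four_block_carrier_mat) simp_all

lemma D_entry: "i < 2 * m \<Longrightarrow> j < 2 * m \<Longrightarrow>
    D_mat m $$ (i, j) = (if j = i + m \<or> i = j + m then 1 else 0)"
  by (auto simp: D_mat_def)

lemma J_square: "J_mat m * J_mat m = (- 1) \<cdot>\<^sub>m 1\<^sub>m (2 * m)"
  by (rule scalar_square[where \<sigma> = "\<lambda>i. if i < m then i + m else i - m" and b = "\<lambda>i. if i < m then 1 else - 1",
    OF J_mat_carrier]) (auto simp: J_entry)

lemma D_square: "D_mat m * D_mat m = 1 \<cdot>\<^sub>m 1\<^sub>m (2 * m)"
  by (rule scalar_square[where \<sigma> = "\<lambda>i. if i < m then i + m else i - m" and b = "\<lambda>i. 1",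
    OF D_mat_carrier]) (auto simp: D_entry)

lemma C_mat_carrier: "C_mat k \<in> carrier_mat (2 * k) (2 * k)"
proof (induction k)
  case (Suc k)
  then show ?case using J_mat_carrier[of 1] by (auto simp: C_mat_def Let_def)
qed (simp add: C_mat_def)

lemma C_Suc: "C_mat (Suc k) = four_block_mat (J_mat 1) (0\<^sub>m 2 (2 * k)) (0\<^sub>m (2 * k) 2) (C_mat k)"
  using C_mat_carrier[of k] J_mat_carrier[of 1] by (simp add: C_mat_def Let_def)

text \<open>Splitting off the first block shifts indices by 2, which preserves parity and hence the
  partner of an index.\<close>

lemma C_entry: "i < 2 * k \<Longrightarrow> j < 2 * k \<Longrightarrow>
    C_mat k $$ (i, j) = (if j = (if even i then i + 1 else i - 1) then if even i then 1 else - 1 else 0)"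
proof (induction k arbitrary: i j)
  case (Suc k)
  note c = carrier_matD[OF C_mat_carrier[of k]] carrier_matD[OF J_mat_carrier[of 1]]
  have e: "C_mat (Suc k) $$ (i, j) = (if i < 2 then if j < 2 then J_mat 1 $$ (i, j) else 0
      else if j < 2 then 0 else C_mat k $$ (i - 2, j - 2))"
    using Suc(2,3) c unfolding C_Suc by simp
  show ?case
  proof (cases "i < 2 \<or> j < 2")
    case True
    have "j < 2 \<Longrightarrow> j = 0 \<or> j = 1" "i < 2 \<Longrightarrow> i = 0 \<or> i = 1" by linarith+
    then show ?thesis using True J_entry[of i 1 j] unfolding e by (cases "i < 2"; cases "j < 2") (auto elim: oddE)
  next
    case False
    define a b where "a = i - 2" and "b = j - 2"
    have "2 \<le> i" "2 \<le> j" using False by simp_all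
    then have ab: "i = a + 2" "j = b + 2" unfolding a_def b_def by linarith+
    have "C_mat k $$ (a, b) = (if b = (if even a then a + 1 else a - 1) then if even a then 1 else - 1 else 0)"
      using Suc.prems by (intro Suc.IH) (simp_all add: ab)
    then show ?thesis unfolding e unfolding ab by (auto elim: oddE)
  qed
qed simp

lemma C_square: "C_mat k * C_mat k = (- 1) \<cdot>\<^sub>m 1\<^sub>m (2 * k)"
proof (rule scalar_square[where \<sigma> = "\<lambda>i. if even i then i + 1 else i - 1" and b = "\<lambda>i. if even i then 1 else - 1",
    OF C_mat_carrier C_entry])
  fix i assume "i < 2 * k"
  then show "(if even i then i + 1 else i - 1) < 2 * k \<and>
    (if even (if even i then i + 1 else i - 1) then (if even i then i + 1 else i - 1) + 1
      else (if even i then i + 1 else i - 1) - 1) = i \<and>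
    (if even i then 1 else - 1) * (if even (if even i then i + 1 else i - 1) then 1 else - 1) = (- 1 :: complex)"
    by (cases "even i") (auto elim!: evenE oddE)
qed

lemma det_nonzero_square:
  fixes B :: "complex mat"
  assumes B: "B \<in> carrier_mat n n" and BB: "B * B = c \<cdot>\<^sub>m 1\<^sub>m n" and c: "c * c = 1"
  shows "Determinant.det B \<noteq> 0"
proof -
  have "Determinant.det B * Determinant.det B = c ^ n"
    using det_mult[OF B B] unfolding BB by (simp add: det_smult)
  moreover have "c ^ n \<noteq> 0" using c by auto
  ultimately show ?thesis by auto
qed

section \<open>Block-diagonal subgroups as zero patterns\<close>

lemma diag2_mult:
  assumes "a \<in> carrier_mat n n" "b \<in> carrier_mat m m" "a' \<in> carrier_mat n n" "b' \<in> carrier_mat m m"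
  shows "diag2 a b * diag2 a' b' = diag2 (a * a') (b * b')"
proof -
  have d: "diag2 x y = four_block_mat x (0\<^sub>m n m) (0\<^sub>m m n) y" if "x \<in> carrier_mat n n" "y \<in> carrier_mat m m" for x y
    using that by (intro eq_matI) (auto simp: diag2_def Let_def)
  show ?thesis
    unfolding d[OF assms(1,2)] d[OF assms(3,4)] d[OF mult_carrier_mat[OF assms(1,3)] mult_carrier_mat[OF assms(2,4)]]
    using assms by (simp add: mult_four_block_mat[of _ n n _ m _ m _ _ n _ m])
qed

lemma diag2_transpose:
  assumes "a \<in> carrier_mat n n" "b \<in> carrier_mat m m"
  shows "transpose_mat (diag2 a b) = diag2 (transpose_mat a) (transpose_mat b)"
proof (rule eq_matI)
  have t: "transpose_mat a \<in> carrier_mat n n" "transpose_mat b \<in> carrier_mat m m" using assms by simp_all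
  note c = carrier_matD[OF diag2_carrier[OF assms]] carrier_matD[OF diag2_carrier[OF t]]
  show "dim_row (transpose_mat (diag2 a b)) = dim_row (diag2 (transpose_mat a) (transpose_mat b))"
    "dim_col (transpose_mat (diag2 a b)) = dim_col (diag2 (transpose_mat a) (transpose_mat b))"
    by (simp_all add: c)
  fix i j assume "i < dim_row (diag2 (transpose_mat a) (transpose_mat b))" "j < dim_col (diag2 (transpose_mat a) (transpose_mat b))"
  then have ij: "i < n + m" "j < n + m" by (simp_all add: c)
  then show "transpose_mat (diag2 a b) $$ (i, j) = diag2 (transpose_mat a) (transpose_mat b) $$ (i, j)"
    using carrier_matD[OF assms(1)] carrier_matD[OF assms(2)] by (auto simp: c diag2_entry[OF assms] diag2_entry[OF t])
qed

lemma diag2_inject: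
  assumes "a \<in> carrier_mat n n" "b \<in> carrier_mat m m" "a' \<in> carrier_mat n n" "b' \<in> carrier_mat m m"
  shows "diag2 a b = diag2 a' b' \<longleftrightarrow> a = a' \<and> b = b'"
  using diag2_parts[OF assms(1,2)] diag2_parts[OF assms(3,4)] by metis

lemma diag2_one: "diag2 (1\<^sub>m n) (1\<^sub>m m) = 1\<^sub>m (n + m)"
  using carrier_matD[OF diag2_carrier[OF one_carrier_mat one_carrier_mat, of n m]]
  by (intro eq_matI) (auto simp: diag2_entry[OF one_carrier_mat one_carrier_mat])

text \<open>Block-diagonality with a cut at \<open>p\<close>. For \<open>p = N\<close> the condition
  is void, so groups with a single block fit the same statements.\<close>

definition off_zero :: "nat \<Rightarrow> nat \<Rightarrow> complex mat \<Rightarrow> bool" where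
  "off_zero N p g \<longleftrightarrow> (\<forall>i<N. \<forall>j<N. (i < p) \<noteq> (j < p) \<longrightarrow> g $$ (i, j) = 0)"

lemma off_zero_diag2: "a \<in> carrier_mat p p \<Longrightarrow> b \<in> carrier_mat q q \<Longrightarrow> off_zero (p + q) p (diag2 a b)"
  by (auto simp: off_zero_def diag2_entry)

lemma off_zero_cases:
  assumes "g \<in> carrier_mat (p + q) (p + q)" "off_zero (p + q) p g"
  obtains a b where "g = diag2 a b" "a \<in> carrier_mat p p" "b \<in> carrier_mat q q"
proof
  show "g = diag2 (top_left p g) (bottom_right p q g)"
    using assms by (intro diag2_of_parts[symmetric]) (auto simp: off_zero_def)
qed (simp_all add: top_left_def bottom_right_def)

lemma off_zero_all: "off_zero N N g"
  by (simp add: off_zero_def)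

lemma diag2_form_iff:
  assumes a: "a \<in> carrier_mat p p" and b: "b \<in> carrier_mat q q" and B1: "B1 \<in> carrier_mat p p" and B2: "B2 \<in> carrier_mat q q"
  shows "diag2 a b * diag2 B1 B2 * transpose_mat (diag2 a b) = diag2 B1 B2 \<longleftrightarrow>
    a * B1 * transpose_mat a = B1 \<and> b * B2 * transpose_mat b = B2"
proof -
  have t: "transpose_mat a \<in> carrier_mat p p" "transpose_mat b \<in> carrier_mat q q" using a b by simp_all
  note m = mult_carrier_mat[OF a B1] mult_carrier_mat[OF b B2]
  show ?thesis
    unfolding diag2_transpose[OF a b] diag2_mult[OF a b B1 B2] diag2_mult[OF m t]
    by (rule diag2_inject[OF mult_carrier_mat[OF m(1) t(1)] mult_carrier_mat[OF m(2) t(2)] B1 B2])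
qed

lemma block_prodI: "a \<in> A \<Longrightarrow> b \<in> B \<Longrightarrow> diag2 a b \<in> block_prod A B"
  unfolding block_prod_def diag2_def by blast

lemma block_prod_isometries:
  assumes B1: "B1 \<in> carrier_mat p p" "B1 * B1 = c \<cdot>\<^sub>m 1\<^sub>m p" and B2: "B2 \<in> carrier_mat q q" "B2 * B2 = c \<cdot>\<^sub>m 1\<^sub>m q"
    and c: "c * c = 1" and N: "N = p + q"
  shows "block_prod (isometries p B1) (isometries q B2) =
    {g \<in> carrier_mat N N. off_zero N p g \<and> g * diag2 B1 B2 * transpose_mat g = diag2 B1 B2}"
proof (rule Set.set_eqI)
  fix g :: "complex mat"
  show "g \<in> block_prod (isometries p B1) (isometries q B2) \<longleftrightarrow>
    g \<in> {g \<in> carrier_mat N N. off_zero N p g \<and> g * diag2 B1 B2 * transpose_mat g = diag2 B1 B2}"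
  proof
    assume "g \<in> block_prod (isometries p B1) (isometries q B2)"
    then obtain a b where ab: "g = diag2 a b" "a \<in> carrier_mat p p" "b \<in> carrier_mat q q"
      "a * B1 * transpose_mat a = B1" "b * B2 * transpose_mat b = B2"
      unfolding block_prod_def isometries_right[OF B1 c] isometries_right[OF B2 c] diag2_def by blast
    then show "g \<in> {g \<in> carrier_mat N N. off_zero N p g \<and> g * diag2 B1 B2 * transpose_mat g = diag2 B1 B2}"
      using diag2_form_iff[OF ab(2,3) B1(1) B2(1)] diag2_carrier[OF ab(2,3)] off_zero_diag2[OF ab(2,3)]
      unfolding N by simp
  next
    assume g: "g \<in> {g \<in> carrier_mat N N. off_zero N p g \<and> g * diag2 B1 B2 * transpose_mat g = diag2 B1 B2}"
    then have gc: "g \<in> carrier_mat (p + q) (p + q)" and go: "off_zero (p + q) p g"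
      and gB: "g * diag2 B1 B2 * transpose_mat g = diag2 B1 B2" unfolding N by simp_all
    obtain a b where ab: "g = diag2 a b" "a \<in> carrier_mat p p" "b \<in> carrier_mat q q"
      by (rule off_zero_cases[OF gc go])
    have "a * B1 * transpose_mat a = B1" "b * B2 * transpose_mat b = B2"
      using gB diag2_form_iff[OF ab(2,3) B1(1) B2(1)] unfolding ab(1) by simp_all
    then show "g \<in> block_prod (isometries p B1) (isometries q B2)"
      unfolding ab(1) isometries_right[OF B1 c] isometries_right[OF B2 c] by (intro block_prodI CollectI conjI ab(2,3))
  qed
qed

text \<open>The pattern is recorded for the inverse too, because \<open>GL_group_K\<close> reads the
  dual part of an isometry from the inverse.\<close>

lemma block_prod_GL:
  assumes N: "N = p + q"
  shows "block_prod (GL p) (GL q) = {g \<in> GL N. off_zero N p g \<and> off_zero N p (mat_inv g)}"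
proof (rule Set.set_eqI)
  fix g :: "complex mat"
  show "g \<in> block_prod (GL p) (GL q) \<longleftrightarrow> g \<in> {g \<in> GL N. off_zero N p g \<and> off_zero N p (mat_inv g)}"
  proof
    assume "g \<in> block_prod (GL p) (GL q)"
    then obtain a b where g: "g = diag2 a b" and ab: "a \<in> carrier_mat p p" "invertible_mat a" "b \<in> carrier_mat q q" "invertible_mat b"
      unfolding block_prod_def diag2_def GL_def by blast
    note ia = mat_inv[OF ab(1,2)] and ib = mat_inv[OF ab(3,4)]
    have "diag2 a b * diag2 (mat_inv a) (mat_inv b) = 1\<^sub>m (p + q)"
      unfolding diag2_mult[OF ab(1,3) ia(1) ib(1)] ia(2) ib(2) by (rule diag2_one)
    note G = GL_I[OF diag2_carrier[OF ab(1,3)] diag2_carrier[OF ia(1) ib(1)] this]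
    then show "g \<in> {g \<in> GL N. off_zero N p g \<and> off_zero N p (mat_inv g)}"
      unfolding g N using off_zero_diag2[OF ab(1,3)] off_zero_diag2[OF ia(1) ib(1)] by simp
  next
    assume "g \<in> {g \<in> GL N. off_zero N p g \<and> off_zero N p (mat_inv g)}"
    then have gc: "g \<in> carrier_mat (p + q) (p + q)" "invertible_mat g" and go: "off_zero (p + q) p g" "off_zero (p + q) p (mat_inv g)"
      unfolding N GL_def by simp_all
    note i = mat_inv[OF gc]
    obtain a b where ab: "g = diag2 a b" "a \<in> carrier_mat p p" "b \<in> carrier_mat q q"
      by (rule off_zero_cases[OF gc(1) go(1)])
    obtain a' b' where ab': "mat_inv g = diag2 a' b'" "a' \<in> carrier_mat p p" "b' \<in> carrier_mat q q"
      by (rule off_zero_cases[OF i(1) go(2)])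
    have "diag2 (a * a') (b * b') = diag2 (1\<^sub>m p) (1\<^sub>m q)"
      using i(2) unfolding ab' diag2_one diag2_mult[OF ab(2,3) ab'(2,3), symmetric] ab(1)[symmetric] .
    then have "a * a' = 1\<^sub>m p" "b * b' = 1\<^sub>m q"
      using diag2_inject[OF mult_carrier_mat[OF ab(2) ab'(2)] mult_carrier_mat[OF ab(3) ab'(3)] one_carrier_mat one_carrier_mat] by simp_all
    then have "a \<in> GL p" "b \<in> GL q" using GL_I(1)[OF ab(2) ab'(2)] GL_I(1)[OF ab(3) ab'(3)] by simp_all
    then show "g \<in> block_prod (GL p) (GL q)" unfolding ab(1) by (rule block_prodI)
  qed
qed

text \<open>
  The evaluation pairing between \<open>\<complex>\<^sup>m\<close> and its dual; its isometries that are block diagonal form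
  \<open>GL_dual_diag m\<close>.
\<close>

definition E_mat :: "nat \<Rightarrow> complex mat" where
  "E_mat m = four_block_mat (0\<^sub>m m m) (1\<^sub>m m) (0\<^sub>m m m) (0\<^sub>m m m)"

lemma E_mat_carrier: "E_mat m \<in> carrier_mat (2 * m) (2 * m)"
  unfolding mult_2 E_mat_def by (rule four_block_carrier_mat) simp_all

lemma E_entry: "i < 2 * m \<Longrightarrow> j < 2 * m \<Longrightarrow> E_mat m $$ (i, j) = (if j = i + m then 1 else 0)"
  by (auto simp: E_mat_def)

text \<open>Only the upper right block of the product survives, so the identity says that
  \<open>b\<close> is contragredient to \<open>a\<close>.\<close>

lemma diag2_E_iff:
  assumes a: "a \<in> carrier_mat m m" and b: "b \<in> carrier_mat m m"
  shows "diag2 a b * E_mat m * transpose_mat (diag2 a b) = E_mat m \<longleftrightarrow> a * transpose_mat b = 1\<^sub>m m"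
proof -
  have t: "transpose_mat a \<in> carrier_mat m m" "transpose_mat b \<in> carrier_mat m m" using a b by simp_all
  have d: "diag2 x y = four_block_mat x (0\<^sub>m m m) (0\<^sub>m m m) y" if "x \<in> carrier_mat m m" "y \<in> carrier_mat m m" for x y
    using that by (intro eq_matI) (auto simp: diag2_def Let_def)
  have prod: "four_block_mat a (0\<^sub>m m m) (0\<^sub>m m m) b * four_block_mat (0\<^sub>m m m) (1\<^sub>m m) (0\<^sub>m m m) (0\<^sub>m m m) *
      four_block_mat x (0\<^sub>m m m) (0\<^sub>m m m) y = four_block_mat (0\<^sub>m m m) (a * y) (0\<^sub>m m m) (0\<^sub>m m m)"
    if "x \<in> carrier_mat m m" "y \<in> carrier_mat m m" for x y
    using a b that by (simp add: mult_four_block_mat[of _ m m _ m _ m _ _ m _ m])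
  have "diag2 a b * E_mat m * transpose_mat (diag2 a b) =
      four_block_mat (0\<^sub>m m m) (a * transpose_mat b) (0\<^sub>m m m) (0\<^sub>m m m)" (is "_ = ?F (a * transpose_mat b)")
    unfolding diag2_transpose[OF a b] unfolding d[OF a b] d[OF t] E_mat_def by (rule prod[OF t])
  moreover have "?F x = ?F y \<longleftrightarrow> x = y" if x: "x \<in> carrier_mat m m" and y: "y \<in> carrier_mat m m" for x y
  proof
    assume e: "?F x = ?F y"
    show "x = y"
    proof (rule eq_matI)
      fix i j assume "i < dim_row y" "j < dim_col y"
      then have ij: "i < m" "j < m" using y by simp_all
      have "?F x $$ (i, j + m) = ?F y $$ (i, j + m)" unfolding e ..
      then show "x $$ (i, j) = y $$ (i, j)" using ij x y by simp
    qed (use x y in simp_all)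
  qed simp
  ultimately show ?thesis unfolding E_mat_def using a t by simp
qed

lemma GL_dual_diag_eq:
  "GL_dual_diag m = {g \<in> carrier_mat (2 * m) (2 * m). off_zero (2 * m) m g \<and> g * E_mat m * transpose_mat g = E_mat m}"
proof (rule Set.set_eqI)
  fix g :: "complex mat"
  have tt: "transpose_mat (transpose_mat x) = x" for x :: "complex mat" by simp
  show "g \<in> GL_dual_diag m \<longleftrightarrow>
    g \<in> {g \<in> carrier_mat (2 * m) (2 * m). off_zero (2 * m) m g \<and> g * E_mat m * transpose_mat g = E_mat m}"
  proof
    assume "g \<in> GL_dual_diag m"
    then obtain a where g: "g = diag2 a (transpose_mat (mat_inv a))" and a: "a \<in> carrier_mat m m" "invertible_mat a"
      unfolding GL_dual_diag_def diag2_def GL_def by blast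
    note i = mat_inv[OF a]
    have t: "transpose_mat (mat_inv a) \<in> carrier_mat m m" using i(1) by simp
    show "g \<in> {g \<in> carrier_mat (2 * m) (2 * m). off_zero (2 * m) m g \<and> g * E_mat m * transpose_mat g = E_mat m}"
      unfolding g using diag2_E_iff[OF a(1) t] i(2) diag2_carrier[OF a(1) t] off_zero_diag2[OF a(1) t]
      by (simp add: mult_2)
  next
    assume "g \<in> {g \<in> carrier_mat (2 * m) (2 * m). off_zero (2 * m) m g \<and> g * E_mat m * transpose_mat g = E_mat m}"
    then have gc: "g \<in> carrier_mat (m + m) (m + m)" and go: "off_zero (m + m) m g" and gE: "g * E_mat m * transpose_mat g = E_mat m"
      by (simp_all add: mult_2)
    obtain a b where ab: "g = diag2 a b" "a \<in> carrier_mat m m" "b \<in> carrier_mat m m"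
      by (rule off_zero_cases[OF gc go])
    have t: "transpose_mat b \<in> carrier_mat m m" using ab(3) by simp
    have "a * transpose_mat b = 1\<^sub>m m" using gE unfolding ab(1) diag2_E_iff[OF ab(2,3)] .
    note G = GL_I[OF ab(2) t this]
    have "b = transpose_mat (mat_inv a)" unfolding G(2) tt ..
    show "g \<in> GL_dual_diag m" unfolding GL_dual_diag_def ab(1) diag2_def
      by (intro CollectI exI[of _ a] conjI G(1)) (simp only: \<open>b = transpose_mat (mat_inv a)\<close>[symmetric])
  qed
qed

text \<open>As J^2 = -1, the fixed point condition g = - J (g^-1)^T J is the same as g J = J
  (g^-1)^T, which is invariance of the symplectic form.\<close>

lemma GL_H_group_eq:
  "{g \<in> GL (2 * n). - (J_mat n * transpose_mat (mat_inv g) * J_mat n) = g} =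
   {g \<in> carrier_mat (2 * n) (2 * n). g * J_mat n * transpose_mat g = J_mat n}"
proof (rule Set.set_eqI)
  fix g :: "complex mat"
  let ?N = "2 * n" and ?J = "J_mat n" and ?t = "transpose_mat g"
  note J = J_mat_carrier[of n]
  have nn: "- ((- 1) \<cdot>\<^sub>m x) = x" for x :: "complex mat" by (rule eq_matI) simp_all
  show "g \<in> {g \<in> GL ?N. - (?J * transpose_mat (mat_inv g) * ?J) = g} \<longleftrightarrow>
    g \<in> {g \<in> carrier_mat ?N ?N. g * ?J * transpose_mat g = ?J}"
  proof
    assume "g \<in> {g \<in> GL ?N. - (?J * transpose_mat (mat_inv g) * ?J) = g}"
    then have g: "g \<in> carrier_mat ?N ?N" "invertible_mat g" and e: "- (?J * transpose_mat (mat_inv g) * ?J) = g"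
      by (simp_all add: GL_def)
    note i = mat_inv[OF g]
    define h where "h = transpose_mat (mat_inv g)"
    have h: "h \<in> carrier_mat ?N ?N" and t: "?t \<in> carrier_mat ?N ?N" using i(1) g(1) by (simp_all add: h_def)
    have ht: "h * ?t = 1\<^sub>m ?N" unfolding h_def using transpose_mult[OF g(1) i(1)] i(2) by simp
    have "g * ?J = - (?J * h * ?J) * ?J" using e unfolding h_def by simp
    also have "\<dots> = - (?J * h * (?J * ?J))" using J h by (simp add: assoc_mult_mat[of _ ?N ?N _ ?N _ ?N])
    also have "\<dots> = ?J * h" unfolding J_square using J h by (simp add: mult_smult_distrib[of _ ?N ?N _ ?N] nn)
    finally have "g * ?J * ?t = ?J * (h * ?t)" using J h t by (simp add: assoc_mult_mat[of _ ?N ?N _ ?N _ ?N])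
    then show "g \<in> {g \<in> carrier_mat ?N ?N. g * ?J * transpose_mat g = ?J}" using g J unfolding ht by simp
  next
    assume "g \<in> {g \<in> carrier_mat ?N ?N. g * ?J * transpose_mat g = ?J}"
    then have g: "g \<in> carrier_mat ?N ?N" and e: "g * ?J * ?t = ?J" by simp_all
    have t: "?t \<in> carrier_mat ?N ?N" using g by simp
    have "g \<in> isometries ?N ?J" using g e unfolding isometries_right[OF J J_square, simplified] by simp
    then have G: "g \<in> GL ?N" by (simp add: isometries_def)
    then have iv: "invertible_mat g" by (simp add: GL_def)
    note i = mat_inv[OF g iv]
    define h where "h = transpose_mat (mat_inv g)"
    have h: "h \<in> carrier_mat ?N ?N" using i(1) by (simp add: h_def)
    have th: "?t * h = 1\<^sub>m ?N" unfolding h_def using transpose_mult[OF i(1) g] i(3) by simp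
    have "?J * h = g * ?J * ?t * h" unfolding e ..
    also have "\<dots> = g * ?J * (?t * h)" using g J h t by (simp add: assoc_mult_mat[of _ ?N ?N _ ?N _ ?N])
    also have "\<dots> = g * ?J" unfolding th using g J by simp
    finally have "?J * h * ?J = g * (?J * ?J)" using g J by (simp add: assoc_mult_mat[of _ ?N ?N _ ?N _ ?N])
    also have "- \<dots> = g" unfolding J_square using g by (simp add: mult_smult_distrib[of _ ?N ?N _ ?N] nn)
    finally show "g \<in> {g \<in> GL ?N. - (?J * transpose_mat (mat_inv g) * ?J) = g}" using G unfolding h_def by simp
  qed
qed

lemma Lie_isometries_eq: "B \<in> carrier_mat n n \<Longrightarrow> Lie n (isometries n B) = lie_form n B"
  by (rule Lie_isometries) simp_all

context encoding
begin

lemma colour_ok_iff: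
  assumes c: "\<And>u v. u \<in> D \<Longrightarrow> v \<in> D \<Longrightarrow> (rho u < p \<longleftrightarrow> rho v < p) \<longleftrightarrow>
    fst (snd u) = fst (snd v) \<and> (k = KGL \<longrightarrow> snd (snd (snd u)) = snd (snd (snd v)))"
  shows "colour_ok g \<longleftrightarrow> off_zero N p g"
proof
  assume h: "colour_ok g"
  show "off_zero N p g" unfolding off_zero_def
  proof (intro allI impI)
    fix i j assume ij: "i < N" "j < N" "(i < p) \<noteq> (j < p)"
    obtain u where u: "u \<in> D" "i = rho u" using rho_surj[OF ij(1)] by (elim bexE)
    obtain v where v: "v \<in> D" "j = rho v" using rho_surj[OF ij(2)] by (elim bexE)
    have "\<not> (rho u < p \<longleftrightarrow> rho v < p)" using ij(3) unfolding u(2) v(2) .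
    then show "g $$ (i, j) = 0"
      using bspec[OF bspec[OF h[unfolded colour_ok_def] u(1)] v(1)] unfolding c[OF u(1) v(1)] u(2) v(2) by blast
  qed
next
  assume h: "off_zero N p g"
  show "colour_ok g" unfolding colour_ok_def
  proof (intro ballI impI)
    fix u v assume u: "u \<in> D" and v: "v \<in> D" and nz: "g $$ (rho u, rho v) \<noteq> 0"
    have "(rho u < p) = (rho v < p)"
      using h nz rho_less[OF u] rho_less[OF v] unfolding off_zero_def by blast
    then show "fst (snd u) = fst (snd v) \<and> (k = KGL \<longrightarrow> snd (snd (snd u)) = snd (snd (snd v)))"
      unfolding c[OF u v] .
  qed
qed

text \<open>With an index lowered by the form, an orthogonal Lie algebra consists of the skew
  two-tensors and a symplectic one of the symmetric two-tensors; hence the opposite signs of slots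
  and pairs.\<close>

lemma lie_form_beta:
  assumes nR: "nR = 1" and np: "\<not> par" and B: "form_of B" and fL: "fL = Some \<eta>"
    and k: "k = KO \<and> \<eta> = - 1 \<or> k = KSp \<and> \<eta> = 1"
  shows "lie_form N B = VV"
proof (rule lie_form_VV[where b = "\<lambda>x. beta k x (other_end k x)", OF nR np fL])
  show "B \<in> carrier_mat N N" using B by (simp add: form_of_def)
  show "B $$ (rho (0, x), rho (0, y)) = (if y = other_end k x then beta k x (other_end k x) else 0)"
    if "x \<in> W" "y \<in> W" for x y
    using B that beta_other_end[OF that] by (simp only: form_of_def)
  have "k \<noteq> KGL" using k by auto
  from th have "\<forall>x. th x = beta k (other_end k x) x" unfolding unit_sign_def if_not_P[OF \<open>k \<noteq> KGL\<close>] by (rule conjunct2)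
  then have t: "th x = beta k (other_end k x) x" for x by (rule spec)
  show "beta k x (other_end k x) * beta k x (other_end k x) = 1" for x
    using k by (cases x) auto
  show "- (beta k y (other_end k y) * beta k (other_end k x) (other_end k (other_end k x))) = \<eta> * th x * th y" for x y
    unfolding t using k by (cases x; cases y) auto
qed

end

section \<open>Numberings of the labels for the concrete groups\<close>

definition two_sizes :: "nat \<Rightarrow> nat \<Rightarrow> nat \<Rightarrow> nat" where
  "two_sizes p q c = (if c = 0 then p else q)"

text \<open>Ordering by colour when no row has a dual label, that is for \<open>KO\<close> or under
  \<open>par\<close>.\<close>

definition rho_flat :: "nat \<Rightarrow> nat \<times> label \<Rightarrow> nat" where
  "rho_flat p u = fst (snd (snd u)) + (if fst (snd u) = 0 then 0 else p)"

text \<open>Ordering with the dual basis as second half, adapted to \<open>J_mat\<close>,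
  \<open>D_mat\<close> and \<open>E_mat\<close>.\<close>

definition rho_halves :: "nat \<Rightarrow> nat \<times> label \<Rightarrow> nat" where
  "rho_halves m u = fst (snd (snd u)) + (if snd (snd (snd u)) then m else 0)"

text \<open>Ordering with dual vectors as neighbours and the colours in succession, adapted to
  \<open>C_mat\<close>.\<close>

definition rho_pairs :: "nat \<Rightarrow> nat \<times> label \<Rightarrow> nat" where
  "rho_pairs p u = 2 * (fst (snd (snd u)) + (if fst (snd u) = 0 then 0 else p)) + (if snd (snd (snd u)) then 1 else 0)"

text \<open>The sign that \<open>unit_sign\<close> forces for \<open>KSp\<close>. For
  \<open>KGL\<close> it is one of the admissible choices, the one needed where the form of
  \<open>G\<close> is alternating.\<close>

definition pol_sign :: "label \<Rightarrow> complex" where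
  "pol_sign x = (if snd (snd x) then 1 else - 1)"

lemma unit_sign_one: "k \<noteq> KSp \<Longrightarrow> unit_sign k (\<lambda>_. 1)"
  by (cases k) (auto simp: unit_sign_def)

lemma unit_sign_pol: "k \<noteq> KO \<Longrightarrow> unit_sign k pol_sign"
  by (cases k) (auto simp: unit_sign_def pol_sign_def)

lemma encoding_flat:
  assumes k: "k = KO \<and> \<not> par \<or> k = KGL \<and> par" and N: "nC = 1 \<and> N = p \<or> nC = 2 \<and> N = p + q"
    and fL: "par \<Longrightarrow> fL = None" "slot_sign fL * slot_sign fL = 1"
  shows "encoding k nC (two_sizes p q) N 1 par (rho_flat p) (\<lambda>_. 1) fL"
proof
  show "bij_betw (rho_flat p) (block_labels (labels k nC (two_sizes p q)) 1 par) {..<N}"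
    by (rule bij_betw_byWitness[where f' = "\<lambda>i. (0, if i < p then (0, i, False) else (1, i - p, False))"])
      (use k N in \<open>auto simp: block_labels_def labels_def two_sizes_def rho_flat_def less_2_cases_iff split: if_splits\<close>)
  show "unit_sign k (\<lambda>_. 1)" by (rule unit_sign_one) (use k in auto)
qed (use k fL in auto)

lemma encoding_halves:
  assumes k: "k \<noteq> KO" and th: "unit_sign k th" and fL: "slot_sign fL * slot_sign fL = 1"
  shows "encoding k 1 (two_sizes m 0) (2 * m) 1 False (rho_halves m) th fL"
proof
  show "bij_betw (rho_halves m) (block_labels (labels k 1 (two_sizes m 0)) 1 False) {..<2 * m}"
    by (rule bij_betw_byWitness[where f' = "\<lambda>i. (0, if i < m then (0, i, False) else (0, i - m, True))"])
      (use k in \<open>auto simp: block_labels_def labels_def two_sizes_def rho_halves_def split: if_splits\<close>)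
qed (use th fL in auto)

lemma encoding_pairs: "encoding KSp 2 (two_sizes p q) (2 * (p + q)) 1 False (rho_pairs p) pol_sign (Some 1)"
proof
  show "bij_betw (rho_pairs p) (block_labels (labels KSp 2 (two_sizes p q)) 1 False) {..<2 * (p + q)}"
  proof (rule bij_betw_byWitness[where f' = "\<lambda>i. (0, if i div 2 < p then (0, i div 2, odd i) else (1, i div 2 - p, odd i))"])
    show "rho_pairs p ` block_labels (labels KSp 2 (two_sizes p q)) 1 False \<subseteq> {..<2 * (p + q)}"
      by (auto simp: block_labels_def labels_def two_sizes_def rho_pairs_def split: if_splits)
    show "\<forall>i\<in>{..<2 * (p + q)}. rho_pairs p (0, if i div 2 < p then (0, i div 2, odd i) else (1, i div 2 - p, odd i)) = i"
      by (auto simp: rho_pairs_def; presburger)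
  qed (auto simp: block_labels_def labels_def two_sizes_def rho_pairs_def less_2_cases_iff split: if_splits)
  show "unit_sign KSp pol_sign" by (rule unit_sign_pol) simp
qed (simp_all add: slot_sign_def)

lemma flat_colours:
  assumes k: "k = KO \<and> \<not> par \<or> k = KGL \<and> par"
    and u: "u \<in> block_labels (labels k nC (two_sizes p q)) 1 par" and v: "v \<in> block_labels (labels k nC (two_sizes p q)) 1 par"
    and nC: "nC = 1 \<or> nC = 2"
  shows "(rho_flat p u < p \<longleftrightarrow> rho_flat p v < p) \<longleftrightarrow>
    fst (snd u) = fst (snd v) \<and> (k = KGL \<longrightarrow> snd (snd (snd u)) = snd (snd (snd v)))"
  using assms by (cases u; cases v) (auto simp: block_labels_def labels_def two_sizes_def rho_flat_def less_2_cases_iff split: if_splits)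

text \<open>For \<open>KGL\<close> the cut at \<open>m\<close> separates the two polarities;
  otherwise there is a single colour and the cut at the full size separates nothing.\<close>

lemma halves_colours:
  assumes u: "u \<in> block_labels (labels k 1 (two_sizes m 0)) 1 False" and v: "v \<in> block_labels (labels k 1 (two_sizes m 0)) 1 False"
  shows "k = KGL \<Longrightarrow> (rho_halves m u < m \<longleftrightarrow> rho_halves m v < m) \<longleftrightarrow>
    fst (snd u) = fst (snd v) \<and> (k = KGL \<longrightarrow> snd (snd (snd u)) = snd (snd (snd v)))"
  and "k \<noteq> KGL \<Longrightarrow> (rho_halves m u < 2 * m \<longleftrightarrow> rho_halves m v < 2 * m) \<longleftrightarrow>
    fst (snd u) = fst (snd v) \<and> (k = KGL \<longrightarrow> snd (snd (snd u)) = snd (snd (snd v)))"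
  using assms by (cases u; cases v; auto simp: block_labels_def labels_def two_sizes_def rho_halves_def)+

lemma pairs_colours:
  assumes u: "u \<in> block_labels (labels KSp 2 (two_sizes p q)) 1 False" and v: "v \<in> block_labels (labels KSp 2 (two_sizes p q)) 1 False"
  shows "(rho_pairs p u < 2 * p \<longleftrightarrow> rho_pairs p v < 2 * p) \<longleftrightarrow>
    fst (snd u) = fst (snd v) \<and> (KSp = KGL \<longrightarrow> snd (snd (snd u)) = snd (snd (snd v)))"
  using assms by (cases u; cases v) (auto simp: block_labels_def labels_def two_sizes_def rho_pairs_def less_2_cases_iff split: if_splits)

lemma flat_form:
  assumes N: "nC = 1 \<and> N = p \<or> nC = 2 \<and> N = p + q"
    and x: "x \<in> labels KO nC (two_sizes p q)" and y: "y \<in> labels KO nC (two_sizes p q)"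
  shows "1\<^sub>m N $$ (rho_flat p (0, x), rho_flat p (0, y)) = beta KO x y"
  using assms by (cases x; cases y) (auto simp: labels_def two_sizes_def rho_flat_def less_2_cases_iff split: if_splits)

lemma halves_less: "x \<in> labels k 1 (two_sizes m 0) \<Longrightarrow> rho_halves m (0, x) < 2 * m"
  by (auto simp: labels_def two_sizes_def rho_halves_def)

lemma J_form:
  assumes x: "x \<in> labels k 1 (two_sizes m 0)" and y: "y \<in> labels k 1 (two_sizes m 0)"
  shows "J_mat m $$ (rho_halves m (0, x), rho_halves m (0, y)) = beta KSp x y"
  unfolding J_entry[OF halves_less[OF x] halves_less[OF y]]
  using assms by (cases x; cases y) (auto simp: labels_def two_sizes_def rho_halves_def)

lemma E_form:
  assumes x: "x \<in> labels k 1 (two_sizes m 0)" and y: "y \<in> labels k 1 (two_sizes m 0)"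
  shows "E_mat m $$ (rho_halves m (0, x), rho_halves m (0, y)) = beta KGL x y"
  unfolding E_entry[OF halves_less[OF x] halves_less[OF y]]
  using assms by (cases x; cases y) (auto simp: labels_def two_sizes_def rho_halves_def)

lemma D_form:
  assumes x: "x \<in> labels KGL 1 (two_sizes m 0)" and y: "y \<in> labels KGL 1 (two_sizes m 0)"
  shows "D_mat m $$ (rho_halves m (0, x), rho_halves m (0, y)) = (if y = other_end KGL x then 1 else 0)"
  unfolding D_entry[OF halves_less[OF x] halves_less[OF y]]
  using assms by (cases x; cases y) (auto simp: labels_def two_sizes_def rho_halves_def)

lemma C_form:
  assumes x: "x \<in> labels KSp 2 (two_sizes p q)" and y: "y \<in> labels KSp 2 (two_sizes p q)"
  shows "C_mat (p + q) $$ (rho_pairs p (0, x), rho_pairs p (0, y)) = beta KSp x y"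
proof -
  have l: "rho_pairs p (0, z) < 2 * (p + q)" if "z \<in> labels KSp 2 (two_sizes p q)" for z
    using that by (cases z) (auto simp: labels_def two_sizes_def rho_pairs_def split: if_splits)
  define ix where "ix = (\<lambda>z :: label. fst (snd z) + (if fst z = 0 then 0 else p))"
  have r: "rho_pairs p (0, z) = 2 * ix z + (if snd (snd z) then 1 else 0)" for z
    by (simp add: rho_pairs_def ix_def)
  have i: "ix x = ix y \<longleftrightarrow> fst x = fst y \<and> fst (snd x) = fst (snd y)"
    using assms by (cases x; cases y) (auto simp: labels_def two_sizes_def ix_def less_2_cases_iff split: if_splits)
  have b: "beta KSp x y = (if ix x = ix y then if snd (snd x) = snd (snd y) then 0 else if snd (snd x) then - 1 else 1 else 0)"
    unfolding i by (cases x; cases y) simp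
  show ?thesis
    unfolding C_entry[OF l[OF x] l[OF y]] b unfolding r
    by (cases "snd (snd x)"; cases "snd (snd y)"; auto; presburger)
qed

context encoding
begin

lemma form_K:
  assumes nR: "nR = 1" and np: "\<not> par" and B: "form_of B"
    and c: "\<And>u v. u \<in> D \<Longrightarrow> v \<in> D \<Longrightarrow> (rho u < p \<longleftrightarrow> rho v < p) \<longleftrightarrow>
      fst (snd u) = fst (snd v) \<and> (k = KGL \<longrightarrow> snd (snd (snd u)) = snd (snd (snd v)))"
    and K: "K = {g \<in> carrier_mat N N. off_zero N p g \<and> g * B * transpose_mat g = B}"
  shows "g \<in> K \<Longrightarrow> \<exists>h\<in>isom k nC n. of_isom h g" and "h \<in> isom k nC n \<Longrightarrow> \<exists>g\<in>K. of_isom h g"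
proof -
  have ci: "colour_ok g \<longleftrightarrow> off_zero N p g" for g by (rule colour_ok_iff) (rule c)
  have "K = {g \<in> carrier_mat N N. colour_ok g \<and> g * B * transpose_mat g = B}"
    unfolding K ci by (rule refl)
  note F = form_group_K[OF nR np B this]
  show "g \<in> K \<Longrightarrow> \<exists>h\<in>isom k nC n. of_isom h g" by (rule F(1))
  show "h \<in> isom k nC n \<Longrightarrow> \<exists>g\<in>K. of_isom h g" by (rule F(2))
qed

lemma GL_K:
  assumes nR: "nR = 1" and p: par
    and c: "\<And>u v. u \<in> D \<Longrightarrow> v \<in> D \<Longrightarrow> (rho u < p \<longleftrightarrow> rho v < p) \<longleftrightarrow>
      fst (snd u) = fst (snd v) \<and> (k = KGL \<longrightarrow> snd (snd (snd u)) = snd (snd (snd v)))"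
    and K: "K = {g \<in> GL N. off_zero N p g \<and> off_zero N p (mat_inv g)}"
  shows "g \<in> K \<Longrightarrow> \<exists>h\<in>isom k nC n. of_isom h g" and "h \<in> isom k nC n \<Longrightarrow> \<exists>g\<in>K. of_isom h g"
proof -
  have ci: "colour_ok g \<longleftrightarrow> off_zero N p g" for g by (rule colour_ok_iff) (rule c)
  have "K = {g \<in> GL N. colour_ok g \<and> colour_ok (mat_inv g)}"
    unfolding K ci by (rule refl)
  note F = GL_group_K[OF nR p this]
  show "g \<in> K \<Longrightarrow> \<exists>h\<in>isom k nC n. of_isom h g" by (rule F(1))
  show "h \<in> isom k nC n \<Longrightarrow> \<exists>g\<in>K. of_isom h g" by (rule F(2))
qed

end

section \<open>Stable dimensions of the ten pairs\<close>

lemma isometries_off_zero: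
  assumes B: "B \<in> carrier_mat n n" and BB: "B * B = c \<cdot>\<^sub>m 1\<^sub>m n" and c: "c * c = 1"
  shows "isometries n B = {g \<in> carrier_mat n n. off_zero n n g \<and> g * B * transpose_mat g = B}"
  unfolding isometries_right[OF B BB c] by (simp only: off_zero_all simp_thms)

lemma one_square: "1\<^sub>m n * 1\<^sub>m n = (1 :: complex) \<cdot>\<^sub>m 1\<^sub>m n"
  by (rule eq_matI) simp_all

lemma slot_sign_simps: "slot_sign None * slot_sign None = 1" "slot_sign (Some 1) * slot_sign (Some 1) = 1"
    "slot_sign (Some (- 1)) * slot_sign (Some (- 1)) = 1"
  by (simp_all add: slot_sign_def)

lemma minus_one_square: "(- 1) * (- 1) = (1 :: complex)" by simp

lemma two_sizes_big: "3 * d \<le> p \<Longrightarrow> 3 * d \<le> q \<Longrightarrow> 3 * d \<le> two_sizes p q i"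
  "3 * d \<le> p \<Longrightarrow> i < 1 \<Longrightarrow> 3 * d \<le> two_sizes p q i"
  by (simp_all add: two_sizes_def)

text \<open>The orthogonal form identifies all matrices with all two-tensors: no symmetry in the
  slots, symmetric pairs.\<close>

lemma dim_GL_R:
  assumes "3 * d \<le> n"
  shows "mat_poly.dim (invariants n (GL n) (O_grp n) d) = fun_vs.dim (Phi d 1 None 1 (Some 1) False)"
proof -
  interpret e: encoding KO 1 "two_sizes n 0" n 1 False "rho_flat n" "\<lambda>_. 1" None
    by (rule encoding_flat) (simp_all add: slot_sign_def)
  have B: "e.form_of (1\<^sub>m n)"
    unfolding e.form_of_def by (intro conjI ballI one_carrier_mat flat_form) auto
  have K: "O_grp n = {g \<in> carrier_mat n n. off_zero n n g \<and> g * 1\<^sub>m n * transpose_mat g = 1\<^sub>m n}"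
    unfolding O_grp_eq by (rule isometries_off_zero[OF one_carrier_mat one_square]) simp
  note F = e.form_K[OF refl _ B flat_colours[where nC = 1 and q = 0] K]
  have "mat_poly.dim (invariants n (GL n) (O_grp n) d) = fun_vs.dim (Phi d 1 None 1 (flip_sign KO) False)"
  proof (rule e.dim_invariants_encoding)
    show "Lie n (GL n) = e.VV" unfolding Lie_GL by (rule e.VV_one_block[symmetric]) (rule refl)+
  qed (rule F(1) F(2) two_sizes_big(2)[OF assms]; (assumption | simp))+
  then show ?thesis by (simp only: flip_sign.simps)
qed

text \<open>The symplectic form identifies all matrices with all two-tensors: no symmetry in the
  slots, alternating pairs.\<close>

lemma dim_GL_H:
  assumes "3 * d \<le> n"
  shows "mat_poly.dim (invariants (2 * n) (GL (2 * n))
     {g \<in> GL (2 * n). - (J_mat n * transpose_mat (mat_inv g) * J_mat n) = g} d) =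
   fun_vs.dim (Phi d 1 None 1 (Some (- 1)) False)" (is "mat_poly.dim (invariants _ _ ?K d) = _")
proof -
  interpret e: encoding KSp 1 "two_sizes n 0" "2 * n" 1 False "rho_halves n" pol_sign None
    by (rule encoding_halves[OF _ unit_sign_pol slot_sign_simps(1)]) simp_all
  have B: "e.form_of (J_mat n)"
    unfolding e.form_of_def by (intro conjI ballI J_mat_carrier J_form)
  have K: "?K = {g \<in> carrier_mat (2 * n) (2 * n). off_zero (2 * n) (2 * n) g \<and> g * J_mat n * transpose_mat g = J_mat n}"
    unfolding GL_H_group_eq by (simp only: off_zero_all simp_thms)
  note F = e.form_K[OF refl _ B halves_colours(2) K]
  have "mat_poly.dim (invariants (2 * n) (GL (2 * n)) ?K d) = fun_vs.dim (Phi d 1 None 1 (flip_sign KSp) False)"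
  proof (rule e.dim_invariants_encoding)
    show "Lie (2 * n) (GL (2 * n)) = e.VV" unfolding Lie_GL by (rule e.VV_one_block[symmetric]) (rule refl)+
  qed (rule F(1) F(2) two_sizes_big(2)[OF assms]; (assumption | simp))+
  then show ?thesis by (simp only: flip_sign.simps)
qed

text \<open>Under \<open>K\<close> the standard representation of \<open>G\<close> is V + V*, so
  rows carry both polarities and \<open>par\<close> is false. The Lie algebra is the exterior
  square, and a pair joins a vector to a covector, so it has no flip sign.\<close>

lemma dim_SO_star:
  assumes "3 * d \<le> m"
  shows "mat_poly.dim (invariants (2 * m) {g \<in> isometries (2 * m) (D_mat m). Determinant.det g = 1} (GL_dual_diag m) d) =
    fun_vs.dim (Phi d 1 (Some (- 1)) 1 None False)" (is "mat_poly.dim (invariants _ ?G _ d) = _")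
proof -
  interpret e: encoding KGL 1 "two_sizes m 0" "2 * m" 1 False "rho_halves m" "\<lambda>_. 1" "Some (- 1)"
    by (rule encoding_halves[OF _ unit_sign_one slot_sign_simps(3)]) simp_all
  have B: "e.form_of (E_mat m)"
    unfolding e.form_of_def by (intro conjI ballI E_mat_carrier E_form)
  note F = e.form_K[OF refl _ B halves_colours(1) GL_dual_diag_eq]
  have "mat_poly.dim (invariants (2 * m) ?G (GL_dual_diag m) d) = fun_vs.dim (Phi d 1 (Some (- 1)) 1 (flip_sign KGL) False)"
  proof (rule e.dim_invariants_encoding)
    have "Lie (2 * m) ?G = lie_form (2 * m) (D_mat m)"
      by (rule Lie_isometries[OF D_mat_carrier])
        (use det_nonzero_square[OF D_mat_carrier D_square] in auto)
    also have "\<dots> = e.VV"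
      by (rule e.lie_form_VV[OF refl _ refl D_mat_carrier, where b = "\<lambda>_. 1"]) (rule D_form | simp; fail)+
    finally show "Lie (2 * m) ?G = e.VV" .
  qed (rule F(1) F(2) two_sizes_big(2)[OF assms]; (assumption | simp))+
  then show ?thesis by (simp only: flip_sign.simps)
qed

text \<open>The same representation V + V*, now with its symmetric square; the signs of
  \<open>J_mat\<close> are compensated by \<open>pol_sign\<close>.\<close>

lemma dim_Sp_R:
  assumes "3 * d \<le> m"
  shows "mat_poly.dim (invariants (2 * m) (Sp_grp m) (GL_dual_diag m) d) = fun_vs.dim (Phi d 1 (Some 1) 1 None False)"
proof -
  interpret e: encoding KGL 1 "two_sizes m 0" "2 * m" 1 False "rho_halves m" "pol_sign" "Some 1"
    by (rule encoding_halves[OF _ unit_sign_pol slot_sign_simps(2)]) simp_all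
  have B: "e.form_of (E_mat m)"
    unfolding e.form_of_def by (intro conjI ballI E_mat_carrier E_form)
  note F = e.form_K[OF refl _ B halves_colours(1) GL_dual_diag_eq]
  have "mat_poly.dim (invariants (2 * m) (Sp_grp m) (GL_dual_diag m) d) = fun_vs.dim (Phi d 1 (Some 1) 1 (flip_sign KGL) False)"
  proof (rule e.dim_invariants_encoding)
    have "Lie (2 * m) (Sp_grp m) = lie_form (2 * m) (J_mat m)"
      unfolding Sp_grp_def by (rule Lie_isometries_eq[OF J_mat_carrier])
    also have "\<dots> = e.VV"
    proof (rule e.lie_form_VV[OF refl _ refl J_mat_carrier, where b = "\<lambda>x. if snd (snd x) then - 1 else 1"])
      show "J_mat m $$ (rho_halves m (0, x), rho_halves m (0, y)) =
          (if y = other_end KGL x then if snd (snd x) then - 1 else 1 else 0)" if "x \<in> e.W" "y \<in> e.W" for x y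
        unfolding J_form[OF that] by (cases x; cases y) auto
      show "- ((if snd (snd y) then - 1 else 1) * (if snd (snd (other_end KGL x)) then - 1 else 1)) =
          1 * pol_sign x * pol_sign y" for x y
        by (cases x) (simp add: pol_sign_def)
    qed simp_all
    finally show "Lie (2 * m) (Sp_grp m) = e.VV" .
  qed (rule F(1) F(2) two_sizes_big(2)[OF assms]; (assumption | simp))+
  then show ?thesis by (simp only: flip_sign.simps)
qed

text \<open>Two factors of \<open>G\<close> colour the slots, and \<open>K\<close> has one colour.
  Slots are skew and pairs symmetric.\<close>

lemma dim_O_C:
  assumes "3 * d \<le> n"
  shows "mat_poly.dim (invariants (2 * n) (block_prod (O_grp n) (O_grp n)) (diagonal (O_grp n)) d) =
    fun_vs.dim (Phi d 2 (Some (- 1)) 1 (Some 1) False)"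
proof -
  interpret e: doubled KO 1 "two_sizes n 0" n False "rho_flat n" "\<lambda>_. 1" "Some (- 1)"
    by (rule doubled.intro, rule encoding_flat) (simp_all add: slot_sign_def)
  have B: "e.one.form_of (1\<^sub>m n)"
    unfolding e.one.form_of_def by (intro conjI ballI one_carrier_mat flat_form) auto
  have K: "O_grp n = {g \<in> carrier_mat n n. off_zero n n g \<and> g * 1\<^sub>m n * transpose_mat g = 1\<^sub>m n}"
    unfolding O_grp_eq by (rule isometries_off_zero[OF one_carrier_mat one_square]) simp
  note F = e.one.form_K[OF refl _ B flat_colours[where nC = 1 and q = 0] K]
  have "mat_poly.dim (invariants (n + n) (block_prod (O_grp n) (O_grp n)) (diagonal (O_grp n)) d) =
    fun_vs.dim (Phi d 2 (Some (- 1)) 1 (flip_sign KO) False)"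
  proof (rule e.dim_invariants_doubled)
    show "O_grp n \<subseteq> carrier_mat n n" by (auto simp: O_grp_def GL_def)
    show "Lie n (O_grp n) = e.one.VV"
      unfolding O_grp_eq Lie_isometries_eq[OF one_carrier_mat] by (rule e.one.lie_form_beta[OF refl _ B refl]) simp_all
  qed (rule F(1) F(2) two_sizes_big(2)[OF assms]; (assumption | simp))+
  then show ?thesis by (simp only: flip_sign.simps mult_2)
qed

text \<open>As for the complex orthogonal group, with both signs reversed.\<close>

lemma dim_Sp_C:
  assumes "3 * d \<le> m"
  shows "mat_poly.dim (invariants (4 * m) (block_prod (Sp_grp m) (Sp_grp m)) (diagonal (Sp_grp m)) d) =
    fun_vs.dim (Phi d 2 (Some 1) 1 (Some (- 1)) False)"
proof -
  interpret e: doubled KSp 1 "two_sizes m 0" "2 * m" False "rho_halves m" pol_sign "Some 1"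
    by (rule doubled.intro, rule encoding_halves[OF _ unit_sign_pol slot_sign_simps(2)]) simp_all
  have B: "e.one.form_of (J_mat m)"
    unfolding e.one.form_of_def by (intro conjI ballI J_mat_carrier J_form)
  have K: "Sp_grp m = {g \<in> carrier_mat (2 * m) (2 * m). off_zero (2 * m) (2 * m) g \<and> g * J_mat m * transpose_mat g = J_mat m}"
    unfolding Sp_grp_def by (rule isometries_off_zero[OF J_mat_carrier J_square minus_one_square])
  note F = e.one.form_K[OF refl _ B halves_colours(2) K]
  have "mat_poly.dim (invariants (2 * m + 2 * m) (block_prod (Sp_grp m) (Sp_grp m)) (diagonal (Sp_grp m)) d) =
    fun_vs.dim (Phi d 2 (Some 1) 1 (flip_sign KSp) False)"
  proof (rule e.dim_invariants_doubled)
    show "Sp_grp m \<subseteq> carrier_mat (2 * m) (2 * m)" by (auto simp: Sp_grp_def isometries_def GL_def)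
    show "Lie (2 * m) (Sp_grp m) = e.one.VV"
      unfolding Sp_grp_def Lie_isometries_eq[OF J_mat_carrier] by (rule e.one.lie_form_beta[OF refl _ B refl]) simp_all
  qed (rule F(1) F(2) two_sizes_big(2)[OF assms]; (assumption | simp))+
  moreover have "4 * m = 2 * m + 2 * m" by simp
  ultimately show ?thesis by (simp only: flip_sign.simps)
qed

text \<open>Rows carry V and columns V*, so \<open>par\<close> holds and each pair joins a row index
  to a column index.\<close>

lemma dim_GL_C:
  assumes "3 * d \<le> n"
  shows "mat_poly.dim (invariants (2 * n) (block_prod (GL n) (GL n)) (diagonal (GL n)) d) =
    fun_vs.dim (Phi d 2 None 1 None True)"
proof -
  interpret e: doubled KGL 1 "two_sizes n 0" n True "rho_flat n" "\<lambda>_. 1" None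
    by (rule doubled.intro, rule encoding_flat) (simp_all add: slot_sign_def)
  have K: "GL n = {g \<in> GL n. off_zero n n g \<and> off_zero n n (mat_inv g)}"
    by (simp only: off_zero_all simp_thms Collect_mem_eq)
  note F = e.one.GL_K[OF refl _ flat_colours[where nC = 1 and q = 0] K]
  have "mat_poly.dim (invariants (n + n) (block_prod (GL n) (GL n)) (diagonal (GL n)) d) =
    fun_vs.dim (Phi d 2 None 1 (flip_sign KGL) True)"
  proof (rule e.dim_invariants_doubled)
    show "GL n \<subseteq> carrier_mat n n" by (auto simp: GL_def)
    show "Lie n (GL n) = e.one.VV" unfolding Lie_GL by (rule e.one.VV_one_block[symmetric]) (rule refl)+
  qed (rule F(1) F(2) two_sizes_big(2)[OF assms]; (assumption | simp))+
  then show ?thesis by (simp only: flip_sign.simps mult_2)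
qed

text \<open>One factor of \<open>G\<close> and two of \<open>K\<close>: the mirror image of the
  diagonal pair for \<open>GL\<close>.\<close>

lemma dim_U:
  assumes "3 * d \<le> p" "3 * d \<le> q"
  shows "mat_poly.dim (invariants (p + q) (GL (p + q)) (block_prod (GL p) (GL q)) d) =
    fun_vs.dim (Phi d 1 None 2 None True)"
proof -
  interpret e: encoding KGL 2 "two_sizes p q" "p + q" 1 True "rho_flat p" "\<lambda>_. 1" None
    by (rule encoding_flat) (simp_all add: slot_sign_def)
  note F = e.GL_K[OF refl _ flat_colours[where nC = 2 and q = q] block_prod_GL[OF refl]]
  have "mat_poly.dim (invariants (p + q) (GL (p + q)) (block_prod (GL p) (GL q)) d) =
    fun_vs.dim (Phi d 1 None 2 (flip_sign KGL) True)"
  proof (rule e.dim_invariants_encoding)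
    show "Lie (p + q) (GL (p + q)) = e.VV" unfolding Lie_GL by (rule e.VV_one_block[symmetric]) (rule refl)+
  qed (rule F(1) F(2) two_sizes_big(1)[OF assms]; (assumption | simp))+
  then show ?thesis by (simp only: flip_sign.simps)
qed

lemma dim_O:
  assumes "3 * d \<le> p" "3 * d \<le> q"
  shows "mat_poly.dim (invariants (p + q) (isometries (p + q) (1\<^sub>m (p + q)))
     (block_prod (isometries p (1\<^sub>m p)) (isometries q (1\<^sub>m q))) d) =
    fun_vs.dim (Phi d 1 (Some (- 1)) 2 (Some 1) False)"
proof -
  interpret e: encoding KO 2 "two_sizes p q" "p + q" 1 False "rho_flat p" "\<lambda>_. 1" "Some (- 1)"
    by (rule encoding_flat) (simp_all add: slot_sign_def)
  have B: "e.form_of (1\<^sub>m (p + q))"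
    unfolding e.form_of_def by (intro conjI ballI one_carrier_mat flat_form) auto
  note K = block_prod_isometries[OF one_carrier_mat one_square one_carrier_mat one_square _ refl, of p q, unfolded diag2_one]
  note F = e.form_K[OF refl _ B flat_colours[where nC = 2 and q = q] K]
  have "mat_poly.dim (invariants (p + q) (isometries (p + q) (1\<^sub>m (p + q)))
     (block_prod (isometries p (1\<^sub>m p)) (isometries q (1\<^sub>m q))) d) =
    fun_vs.dim (Phi d 1 (Some (- 1)) 2 (flip_sign KO) False)"
  proof (rule e.dim_invariants_encoding)
    show "Lie (p + q) (isometries (p + q) (1\<^sub>m (p + q))) = e.VV"
      unfolding Lie_isometries_eq[OF one_carrier_mat] by (rule e.lie_form_beta[OF refl _ B refl]) simp_all
  qed (rule F(1) F(2) two_sizes_big(1)[OF assms]; (assumption | simp))+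
  then show ?thesis by (simp only: flip_sign.simps)
qed

text \<open>The cut at \<open>2 * p\<close> is even, so no index is separated from its
  partner.\<close>

lemma C_mat_diag2: "diag2 (C_mat p) (C_mat q) = C_mat (p + q)"
proof (rule eq_matI)
  note d = diag2_carrier[OF C_mat_carrier C_mat_carrier, of p q]
  show "dim_row (diag2 (C_mat p) (C_mat q)) = dim_row (C_mat (p + q))" "dim_col (diag2 (C_mat p) (C_mat q)) = dim_col (C_mat (p + q))"
    using carrier_matD[OF d] carrier_matD[OF C_mat_carrier[of "p + q"]] by simp_all
  fix i j assume "i < dim_row (C_mat (p + q))" "j < dim_col (C_mat (p + q))"
  then have ij: "i < 2 * p + 2 * q" "j < 2 * p + 2 * q" "i < 2 * (p + q)" "j < 2 * (p + q)"
    using carrier_matD[OF C_mat_carrier[of "p + q"]] by simp_all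
  define \<sigma> where "\<sigma> = (\<lambda>i :: nat. if even i then i + 1 else i - 1)"
  have e: "C_mat k $$ (i, j) = (if j = \<sigma> i then if even i then 1 else - 1 else 0)" if "i < 2 * k" "j < 2 * k" for i j k
    unfolding \<sigma>_def by (rule C_entry[OF that])
  have s: "\<sigma> i < 2 * p \<longleftrightarrow> i < 2 * p" unfolding \<sigma>_def by (cases "even i") (auto elim!: evenE oddE)
  have s2: "\<sigma> (i - 2 * p) = \<sigma> i - 2 * p" "even (i - 2 * p) = even i" if "2 * p \<le> i"
    unfolding \<sigma>_def using that by auto
  have s3: "2 * p \<le> \<sigma> i" if "2 * p \<le> i" using s that by simp
  show "diag2 (C_mat p) (C_mat q) $$ (i, j) = C_mat (p + q) $$ (i, j)"
    unfolding diag2_entry[OF C_mat_carrier C_mat_carrier ij(1,2)] e[OF ij(3,4)]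
  proof (cases "i < 2 * p")
    case True
    then show "(if i < 2 * p \<and> j < 2 * p then C_mat p $$ (i, j)
      else if 2 * p \<le> i \<and> 2 * p \<le> j then C_mat q $$ (i - 2 * p, j - 2 * p) else 0) =
      (if j = \<sigma> i then if even i then 1 else - 1 else 0)"
      using s by (auto simp: e)
  next
    case False
    then have g: "2 * p \<le> i" by simp
    have l: "i - 2 * p < 2 * q" "2 * p \<le> j \<Longrightarrow> j - 2 * p < 2 * q" using ij g by linarith+
    have t: "j - 2 * p = \<sigma> i - 2 * p \<longleftrightarrow> j = \<sigma> i" if "2 * p \<le> j" using that s3[OF g] by linarith
    show "(if i < 2 * p \<and> j < 2 * p then C_mat p $$ (i, j)
      else if 2 * p \<le> i \<and> 2 * p \<le> j then C_mat q $$ (i - 2 * p, j - 2 * p) else 0) =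
      (if j = \<sigma> i then if even i then 1 else - 1 else 0)"
    proof (cases "2 * p \<le> j")
      case True
      show ?thesis using False g True e[OF l(1) l(2)[OF True]] unfolding s2[OF g] t[OF True] by simp
    next
      case j: False
      then have "j \<noteq> \<sigma> i" using s3[OF g] by auto
      then show ?thesis using False j by simp
    qed
  qed
qed

lemma dim_Sp:
  assumes "3 * d \<le> p" "3 * d \<le> q"
  shows "mat_poly.dim (invariants (2 * (p + q)) (isometries (2 * (p + q)) (C_mat (p + q)))
     (block_prod (isometries (2 * p) (C_mat p)) (isometries (2 * q) (C_mat q))) d) =
    fun_vs.dim (Phi d 1 (Some 1) 2 (Some (- 1)) False)"
proof -
  interpret e: encoding KSp 2 "two_sizes p q" "2 * (p + q)" 1 False "rho_pairs p" pol_sign "Some 1"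
    by (rule encoding_pairs)
  have B: "e.form_of (C_mat (p + q))"
    unfolding e.form_of_def by (intro conjI ballI C_mat_carrier C_form)
  note K = block_prod_isometries[OF C_mat_carrier C_square C_mat_carrier C_square minus_one_square distrib_left, of p q, unfolded C_mat_diag2]
  note F = e.form_K[OF refl _ B pairs_colours K]
  have "mat_poly.dim (invariants (2 * (p + q)) (isometries (2 * (p + q)) (C_mat (p + q)))
     (block_prod (isometries (2 * p) (C_mat p)) (isometries (2 * q) (C_mat q))) d) =
    fun_vs.dim (Phi d 1 (Some 1) 2 (flip_sign KSp) False)"
  proof (rule e.dim_invariants_encoding)
    show "Lie (2 * (p + q)) (isometries (2 * (p + q)) (C_mat (p + q))) = e.VV"
      unfolding Lie_isometries_eq[OF C_mat_carrier] by (rule e.lie_form_beta[OF refl _ B refl]) simp_all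
  qed (rule F(1) F(2) two_sizes_big(1)[OF assms]; (assumption | simp))+
  then show ?thesis by (simp only: flip_sign.simps)
qed

section \<open>Passage to the stable limit\<close>

lemma stable_limit_eventually:
  assumes F: "F \<noteq> bot" and e: "\<And>d. eventually (\<lambda>i. fps_nth (H i) d = c d) F"
  shows "stable_limit_exists F H" "stable_limit F H = Abs_fps c"
proof -
  have t: "((\<lambda>i. fps_nth (H i) d) \<longlongrightarrow> c d) F" for d by (rule tendsto_eventually[OF e])
  then show "stable_limit_exists F H" unfolding stable_limit_exists_def by blast
  show "stable_limit F H = Abs_fps c"
    unfolding stable_limit_def tendsto_Lim[OF F t] ..
qed

text \<open>Limits are unique only along a proper filter; points with p = q witness that this one is
  proper.\<close>

lemma min_at_top_neq_bot: "min_at_top \<noteq> bot"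
  unfolding min_at_top_def
proof (rule filtercomap_neq_bot)
  fix P :: "nat \<Rightarrow> bool" assume "eventually P at_top"
  then obtain m where "P m" by (auto simp: eventually_at_top_linorder)
  then have "P (case (m, m) of (p, q) \<Rightarrow> min p q)" by simp
  then show "\<exists>x. P (case x of (p, q) \<Rightarrow> min p q)" by blast
qed

text \<open>Each coefficient is constant from \<open>3 * d\<close> on, so the limit is reached and
  not only approached.\<close>

lemma stable_limit_at_top:
  assumes "\<And>d n. 3 * d \<le> n \<Longrightarrow> mat_poly.dim (invariants (N n) (G n) (K n) d) = c d"
    and H: "\<And>n. H n = hilbert_series (N n) (G n) (K n)"
  shows "stable_limit_exists at_top H \<and> stable_limit at_top H = Abs_fps (\<lambda>d. real (c d))"
proof -
  have "eventually (\<lambda>n. fps_nth (H n) d = real (c d)) at_top" for d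
    using eventually_ge_at_top[of "3 * d"] by eventually_elim (simp add: H hilbert_series_def assms(1))
  from stable_limit_eventually[OF _ this]
  show ?thesis by simp
qed

lemma stable_limit_min_at_top:
  assumes "\<And>d p q. 3 * d \<le> p \<Longrightarrow> 3 * d \<le> q \<Longrightarrow> mat_poly.dim (invariants (N p q) (G p q) (K p q) d) = c d"
    and H: "H = (\<lambda>(p, q). hilbert_series (N p q) (G p q) (K p q))"
  shows "stable_limit_exists min_at_top H \<and> stable_limit min_at_top H = Abs_fps (\<lambda>d. real (c d))"
proof -
  have "eventually (\<lambda>i. fps_nth (H i) d = real (c d)) min_at_top" for d
    unfolding min_at_top_def eventually_filtercomap
  proof (intro exI[of _ "\<lambda>m. 3 * d \<le> m"] conjI allI impI)
    fix i :: "nat \<times> nat" assume "3 * d \<le> (case i of (p, q) \<Rightarrow> min p q)"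
    then show "fps_nth (H i) d = real (c d)" by (cases i) (simp add: H hilbert_series_def assms(1))
  qed (rule eventually_ge_at_top)
  from stable_limit_eventually[OF min_at_top_neq_bot this]
  show ?thesis by simp
qed

theorem mainTheorem3:
  shows
    "(stable_limit_exists at_top HS_GL_R \<and> stable_limit_exists at_top HS_Sp_R \<and>
      stable_limit_exists at_top HS_GL_H \<and> stable_limit_exists at_top HS_SO_star \<and>
      stable_limit_exists at_top HS_O_C \<and> stable_limit_exists min_at_top HS_Sp \<and>
      stable_limit_exists at_top HS_Sp_C \<and> stable_limit_exists min_at_top HS_O \<and>
      stable_limit_exists at_top HS_GL_C \<and> stable_limit_exists min_at_top HS_U) \<and>
     (stable_limit at_top HS_GL_R = stable_limit at_top HS_Sp_R \<and>
      stable_limit at_top HS_Sp_R = stable_limit at_top HS_GL_H \<and>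
      stable_limit at_top HS_GL_H = stable_limit at_top HS_SO_star) \<and>
     (stable_limit at_top HS_O_C = stable_limit min_at_top HS_Sp \<and>
      stable_limit min_at_top HS_Sp = stable_limit at_top HS_Sp_C \<and>
      stable_limit at_top HS_Sp_C = stable_limit min_at_top HS_O) \<and>
     stable_limit at_top HS_GL_C = stable_limit min_at_top HS_U"
proof -
  \<comment> \<open>One representative for each chain of equalities: \<open>A\<close> belongs to
    GL(n,R), \<open>B\<close> to Sp(p,q) and \<open>C\<close> to U(p,q).\<close>
  define A where "A = (\<lambda>d. fun_vs.dim (Phi d 1 None 1 (Some 1) False))"
  define B where "B = (\<lambda>d. fun_vs.dim (Phi d 1 (Some 1) 2 (Some (- 1)) False))"
  define C where "C = (\<lambda>d. fun_vs.dim (Phi d 1 None 2 None True))"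
  \<comment> \<open>The twist links GL(n,R) with GL(n,H); transposing these two gives Sp(m,R) and
    SO*(2m) respectively.\<close>
  have A: "fun_vs.dim (Phi d 1 None 1 (Some (- 1)) False) = A d" "fun_vs.dim (Phi d 1 (Some 1) 1 None False) = A d"
    "fun_vs.dim (Phi d 1 (Some (- 1)) 1 None False) = A d" for d
    using dim_Phi_twist[of d 1 None 1 "Some 1" False] dim_Phi_transp[of d 1 None 1 "Some 1" False]
      dim_Phi_transp[of d 1 None 1 "Some (- 1)" False] unfolding A_def option.map by metis+
  \<comment> \<open>The twist links Sp(p,q) with O(p,q); transposing these two gives O(n,C) and
    Sp(m,C) respectively.\<close>
  have B: "fun_vs.dim (Phi d 1 (Some (- 1)) 2 (Some 1) False) = B d" "fun_vs.dim (Phi d 2 (Some (- 1)) 1 (Some 1) False) = B d"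
    "fun_vs.dim (Phi d 2 (Some 1) 1 (Some (- 1)) False) = B d" for d
    using dim_Phi_twist[of d 1 "Some 1" 2 "Some (- 1)" False] dim_Phi_transp[of d 1 "Some 1" 2 "Some (- 1)" False]
      dim_Phi_transp[of d 1 "Some (- 1)" 2 "Some 1" False] unfolding B_def option.map minus_minus by metis+
  have C: "fun_vs.dim (Phi d 2 None 1 None True) = C d" for d
    unfolding C_def by (rule dim_Phi_transp)
  have GL_R: "stable_limit_exists at_top HS_GL_R \<and> stable_limit at_top HS_GL_R = Abs_fps (\<lambda>d. real (A d))"
    by (rule stable_limit_at_top[OF _ HS_GL_R_def]) (unfold A_def, rule dim_GL_R)
  have Sp_R: "stable_limit_exists at_top HS_Sp_R \<and> stable_limit at_top HS_Sp_R = Abs_fps (\<lambda>d. real (A d))"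
    by (rule stable_limit_at_top[OF _ HS_Sp_R_def]) (unfold A(2)[symmetric], rule dim_Sp_R)
  have GL_H: "stable_limit_exists at_top HS_GL_H \<and> stable_limit at_top HS_GL_H = Abs_fps (\<lambda>d. real (A d))"
    by (rule stable_limit_at_top[OF _ HS_GL_H_def]) (unfold A(1)[symmetric], rule dim_GL_H)
  have SO_star: "stable_limit_exists at_top HS_SO_star \<and> stable_limit at_top HS_SO_star = Abs_fps (\<lambda>d. real (A d))"
    by (rule stable_limit_at_top[OF _ HS_SO_star_def]) (unfold A(3)[symmetric], rule dim_SO_star)
  have O_C: "stable_limit_exists at_top HS_O_C \<and> stable_limit at_top HS_O_C = Abs_fps (\<lambda>d. real (B d))"
    by (rule stable_limit_at_top[OF _ HS_O_C_def]) (unfold B(2)[symmetric], rule dim_O_C)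
  have Sp_C: "stable_limit_exists at_top HS_Sp_C \<and> stable_limit at_top HS_Sp_C = Abs_fps (\<lambda>d. real (B d))"
    by (rule stable_limit_at_top[OF _ HS_Sp_C_def]) (unfold B(3)[symmetric], rule dim_Sp_C)
  have GL_C: "stable_limit_exists at_top HS_GL_C \<and> stable_limit at_top HS_GL_C = Abs_fps (\<lambda>d. real (C d))"
    by (rule stable_limit_at_top[OF _ HS_GL_C_def]) (unfold C[symmetric], rule dim_GL_C)
  have Sp: "stable_limit_exists min_at_top HS_Sp \<and> stable_limit min_at_top HS_Sp = Abs_fps (\<lambda>d. real (B d))"
    by (rule stable_limit_min_at_top[OF _ HS_Sp_def]) (unfold B_def, rule dim_Sp)
  have O: "stable_limit_exists min_at_top HS_O \<and> stable_limit min_at_top HS_O = Abs_fps (\<lambda>d. real (B d))"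
    by (rule stable_limit_min_at_top[OF _ HS_O_def]) (unfold B(1)[symmetric], rule dim_O)
  have U: "stable_limit_exists min_at_top HS_U \<and> stable_limit min_at_top HS_U = Abs_fps (\<lambda>d. real (C d))"
    by (rule stable_limit_min_at_top[OF _ HS_U_def]) (unfold C_def, rule dim_U)
  show ?thesis
    using GL_R Sp_R GL_H SO_star O_C Sp_C GL_C Sp O U by simp
qed

end
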